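(* Let $M$ be a sub-Riemannian manifold equipped with a smooth measure $\omega$, and let $H=-\Delta_\omega=-\mathrm{div}_\omega\circ\nabla$ with domain $\mathrm{Dom}(H)=C_c^\infty(M)$, as an operator on $L^2(M)=L^2(M,\omega)$. Then $\mathrm{Dom}(H^* )\subseteq W^1_{\mathrm{loc}}(M)$.
   Context: A sub-Riemannian structure on a connected smooth manifold $M$ (without boundary) is a triple $(U,\xi,(\cdot|\cdot)_q)$ where $\pi_U:U\to M$ is a Euclidean vector bundle (fibers $U_q$ with scalar product $(\cdot|\cdot)_q$ smooth in $q$), and $\xi:U\to TM$ is a vector bundle morphism (fiberwise linear, covering the identity of $M$) such that the Lie bracket generating condition holds: $\mathrm{Lie}(\xi(\Gamma(U)))|_q=T_qM$ for all $q\in M$, where $\Gamma(U)$ denotes smooth sections. Set $\mathcal D_q=\xi(U_q)\subseteq T_qM$ (its dimension may depend on $q$) and $\Gamma(\mathcal D)=\xi(\Gamma(U))$. For $v\in\mathcal D_q$, $|v|^2=\inf\{(u|u)_q: u\in U_q,\ \xi(u)=v\}$; this norm comes from a scalar product $g_q$ on $\mathcal D_q$, extended sesquilinearly to the complexification. Smooth measure means a measure with smooth positive density. The horizontal gradient $\nabla f\in\Gamma(\mathcal D)$ of a smooth function $f$ is defined by $g(\nabla f,W)=df(W)$ for all $W\in\Gamma(\mathcal D)$; locally $\nabla f=\sum_iX_i(f)X_i$, where $X_i=\xi\circ\sigma_i$ for a local orthonormal frame $\sigma_1,\dots,\sigma_m$ of $U$. $\mathrm{div}_\omega$ is the divergence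 with respect to $\omega$. $L^2(M)$ is the complex Hilbert space of square-integrable functions $u:M\to\mathbb C$ with $\langle u,v\rangle=\int_M u\bar v\,d\omega$. $L^2(\mathcal D)$ is the complex Hilbert space of sections of the complexified distribution with scalar product $\langle X,Y\rangle=\int_Mg(X,Y)\,d\omega$. $W^1(M)$ is the space of $u\in L^2(M)$ whose distributional horizontal gradient $\nabla u$ belongs to $L^2(\mathcal D)$. $W^1_{\mathrm{loc}}(M)$ is the space of functions $u:M\to\mathbb C$ whose restriction to every relatively compact domain $\Omega\subseteq M$ belongs to $W^1(\Omega)$. $H^*$ is the adjoint of $H$ in $L^2(M)$. *)

theory Defs
  imports "HOL-Analysis.Analysis"
begin

subsection \<open>Smooth functions on open subsets of a Euclidean space\<close>

primrec C_k_on :: "nat \<Rightarrow> 'e::euclidean_space set \<Rightarrow> ('e \<Rightarrow> 'b::real_normed_vector) \<Rightarrow> bool" where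
  "C_k_on 0 S f \<longleftrightarrow> continuous_on S f"
| "C_k_on (Suc k) S f \<longleftrightarrow>
     (\<forall>x\<in>S. f differentiable (at x)) \<and>
     (\<forall>v. C_k_on k S (\<lambda>x. frechet_derivative f (at x) v))"

definition smooth_on :: "'e::euclidean_space set \<Rightarrow> ('e \<Rightarrow> 'b::real_normed_vector) \<Rightarrow> bool" where
  "smooth_on S f \<longleftrightarrow> (\<forall>k. C_k_on k S f)"


subsection \<open>Smooth manifolds\<close>

text \<open>The manifold is the whole type \<open>'a\<close>; its dimension is the dimension of the model space
  \<open>'e\<close>. An atlas is a set of charts \<open>(V, \<phi>)\<close> with \<open>V\<close> open and \<open>\<phi>\<close> only relevant on \<open>V\<close>.\<close>

type_synonym ('a, 'e) chart = "'a set \<times> ('a \<Rightarrow> 'e)"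

definition smooth_fun_on ::
  "('a::topological_space, 'e::euclidean_space) chart set \<Rightarrow> 'a set \<Rightarrow>
   ('a \<Rightarrow> 'b::real_normed_vector) \<Rightarrow> bool" where
  "smooth_fun_on A S f \<longleftrightarrow> (\<forall>(V, \<phi>)\<in>A. smooth_on (\<phi> ` (V \<inter> S)) (f \<circ> inv_into V \<phi>))"

definition smooth_manifold ::
  "('a::{second_countable_topology, t2_space}, 'e::euclidean_space) chart set \<Rightarrow> bool" where
  "smooth_manifold A \<longleftrightarrow>
     (\<Union>(V, \<phi>)\<in>A. V) = UNIV \<and>
     (\<forall>(V, \<phi>)\<in>A. open V \<and> open (\<phi> ` V) \<and> homeomorphism V (\<phi> ` V) \<phi> (inv_into V \<phi>)) \<and>
     (\<forall>(V, \<phi>)\<in>A. smooth_fun_on A V \<phi>)"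

definition C_infinity ::
  "('a::topological_space, 'e::euclidean_space) chart set \<Rightarrow> ('a \<Rightarrow> 'b::real_normed_vector) set" where
  "C_infinity A = {f. smooth_fun_on A UNIV f}"

definition C_infinity_c ::
  "('a::topological_space, 'e::euclidean_space) chart set \<Rightarrow> ('a \<Rightarrow> 'b::real_normed_vector) set" where
  "C_infinity_c A = {f \<in> C_infinity A. compact (closure {q. f q \<noteq> 0})}"

text \<open>A tangent vector at \<open>q\<close> is a derivation at \<open>q\<close> of the algebra of real smooth functions.
  It is set to \<open>0\<close> on non-smooth functions, so that equality of tangent vectors is equality
  of HOL functions.\<close>

type_synonym 'a tangent = "('a \<Rightarrow> real) \<Rightarrow> real"

definition tangent_space ::
  "('a::topological_space, 'e::euclidean_space) chart set \<Rightarrow> 'a \<Rightarrow> 'a tangent set" where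
  "tangent_space A q = {v.
     (\<forall>f\<in>C_infinity A. \<forall>h\<in>C_infinity A. v (\<lambda>p. f p + h p) = v f + v h) \<and>
     (\<forall>f\<in>C_infinity A. \<forall>c. v (\<lambda>p. c * f p) = c * v f) \<and>
     (\<forall>f\<in>C_infinity A. \<forall>h\<in>C_infinity A. v (\<lambda>p. f p * h p) = v f * h q + f q * v h) \<and>
     (\<forall>f. f \<notin> C_infinity A \<longrightarrow> v f = 0)}"

type_synonym 'a vfield = "'a \<Rightarrow> 'a tangent"

definition lie_bracket :: "'a vfield \<Rightarrow> 'a vfield \<Rightarrow> 'a vfield" where
  "lie_bracket X Y = (\<lambda>q f. X q (\<lambda>p. Y p f) - Y q (\<lambda>p. X p f))"

inductive_set lie_algebra_generated :: "'a vfield set \<Rightarrow> 'a vfield set" for S where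
  base: "X \<in> S \<Longrightarrow> X \<in> lie_algebra_generated S"
| add: "X \<in> lie_algebra_generated S \<Longrightarrow> Y \<in> lie_algebra_generated S \<Longrightarrow>
    (\<lambda>q f. X q f + Y q f) \<in> lie_algebra_generated S"
| scale: "X \<in> lie_algebra_generated S \<Longrightarrow> (\<lambda>q f. c * X q f) \<in> lie_algebra_generated S"
| bracket: "X \<in> lie_algebra_generated S \<Longrightarrow> Y \<in> lie_algebra_generated S \<Longrightarrow>
    lie_bracket X Y \<in> lie_algebra_generated S"


subsection \<open>Sub-Riemannian structures\<close>

text \<open>The fibers of the bundle \<open>U\<close> are linear subspaces of one real vector space \<open>'u\<close>, of
  arbitrary dimension; this is no restriction, since any family of vector spaces
  embeds in its direct sum. The smooth structure of \<open>U\<close> is given by local trivializations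
  \<open>(V, \<tau>)\<close>, where \<open>\<tau> q\<close> identifies the fiber at \<open>q \<in> V\<close> with the model fiber \<open>'r\<close>.\<close>

record ('a, 'e, 'u, 'r) sub_riemannian =
  charts :: "('a, 'e) chart set"
  fiber :: "'a \<Rightarrow> 'u set"
  trivs :: "('a set \<times> ('a \<Rightarrow> 'u \<Rightarrow> 'r)) set"
  metric :: "'a \<Rightarrow> 'u \<Rightarrow> 'u \<Rightarrow> real"
  anchor :: "'a \<Rightarrow> 'u \<Rightarrow> 'a tangent"

definition smooth_vector_bundle ::
  "('a::topological_space, 'e::euclidean_space) chart set \<Rightarrow> ('a \<Rightarrow> 'u::real_vector set) \<Rightarrow>
   ('a set \<times> ('a \<Rightarrow> 'u \<Rightarrow> 'r::euclidean_space)) set \<Rightarrow> bool" where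
  "smooth_vector_bundle A F T \<longleftrightarrow>
     (\<forall>q. subspace (F q)) \<and>
     (\<Union>(V, \<tau>)\<in>T. V) = UNIV \<and>
     (\<forall>(V, \<tau>)\<in>T. open V \<and>
        (\<forall>q\<in>V. bij_betw (\<tau> q) (F q) UNIV \<and>
           (\<forall>u\<in>F q. \<forall>v\<in>F q. \<tau> q (u + v) = \<tau> q u + \<tau> q v) \<and>
           (\<forall>u\<in>F q. \<forall>c. \<tau> q (c *\<^sub>R u) = c *\<^sub>R \<tau> q u))) \<and>
     (\<forall>(V, \<tau>)\<in>T. \<forall>(V', \<tau>')\<in>T. \<forall>r.
        smooth_fun_on A (V \<inter> V') (\<lambda>q. \<tau>' q (inv_into (F q) (\<tau> q) r)))"

definition euclidean_bundle_metric ::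
  "('a::topological_space, 'e::euclidean_space) chart set \<Rightarrow> ('a \<Rightarrow> 'u::real_vector set) \<Rightarrow>
   ('a set \<times> ('a \<Rightarrow> 'u \<Rightarrow> 'r::euclidean_space)) set \<Rightarrow> ('a \<Rightarrow> 'u \<Rightarrow> 'u \<Rightarrow> real) \<Rightarrow> bool" where
  "euclidean_bundle_metric A F T ip \<longleftrightarrow>
     (\<forall>q. \<forall>u\<in>F q. \<forall>v\<in>F q. ip q u v = ip q v u) \<and>
     (\<forall>q. \<forall>u\<in>F q. \<forall>v\<in>F q. \<forall>w\<in>F q. ip q (u + v) w = ip q u w + ip q v w) \<and>
     (\<forall>q. \<forall>u\<in>F q. \<forall>v\<in>F q. \<forall>c. ip q (c *\<^sub>R u) v = c * ip q u v) \<and>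
     (\<forall>q. \<forall>u\<in>F q. u \<noteq> 0 \<longrightarrow> ip q u u > 0) \<and>
     (\<forall>(V, \<tau>)\<in>T. \<forall>r s. smooth_fun_on A V
        (\<lambda>q. ip q (inv_into (F q) (\<tau> q) r) (inv_into (F q) (\<tau> q) s)))"

definition bundle_morphism_to_tangent ::
  "('a::topological_space, 'e::euclidean_space) chart set \<Rightarrow> ('a \<Rightarrow> 'u::real_vector set) \<Rightarrow>
   ('a set \<times> ('a \<Rightarrow> 'u \<Rightarrow> 'r::euclidean_space)) set \<Rightarrow> ('a \<Rightarrow> 'u \<Rightarrow> 'a tangent) \<Rightarrow> bool" where
  "bundle_morphism_to_tangent A F T \<xi> \<longleftrightarrow>
     (\<forall>q. \<forall>u\<in>F q. \<xi> q u \<in> tangent_space A q) \<and>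
     (\<forall>q. \<forall>u\<in>F q. \<forall>v\<in>F q. \<forall>f. \<xi> q (u + v) f = \<xi> q u f + \<xi> q v f) \<and>
     (\<forall>q. \<forall>u\<in>F q. \<forall>c f. \<xi> q (c *\<^sub>R u) f = c * \<xi> q u f) \<and>
     (\<forall>(V, \<tau>)\<in>T. \<forall>r. \<forall>f\<in>C_infinity A.
        smooth_fun_on A V (\<lambda>q. \<xi> q (inv_into (F q) (\<tau> q) r) f))"

definition bundle_sections ::
  "('a::topological_space, 'e::euclidean_space, 'u, 'r::euclidean_space) sub_riemannian \<Rightarrow>
   ('a \<Rightarrow> 'u) set" where
  "bundle_sections M = {\<sigma>. (\<forall>q. \<sigma> q \<in> fiber M q) \<and>
     (\<forall>(V, \<tau>)\<in>trivs M. smooth_fun_on (charts M) V (\<lambda>q. \<tau> q (\<sigma> q)))}"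

definition distribution_at :: "('a, 'e, 'u, 'r) sub_riemannian \<Rightarrow> 'a \<Rightarrow> 'a tangent set" where
  "distribution_at M q = anchor M q ` fiber M q"

definition horizontal_fields ::
  "('a::topological_space, 'e::euclidean_space, 'u, 'r::euclidean_space) sub_riemannian \<Rightarrow>
   'a vfield set" where
  "horizontal_fields M = (\<lambda>\<sigma> q. anchor M q (\<sigma> q)) ` bundle_sections M"

definition sub_riemannian_manifold ::
  "('a::{second_countable_topology, t2_space}, 'e::euclidean_space, 'u::real_vector,
    'r::euclidean_space) sub_riemannian \<Rightarrow> bool" where
  "sub_riemannian_manifold M \<longleftrightarrow>
     smooth_manifold (charts M) \<and> connected (UNIV :: 'a set) \<and>
     smooth_vector_bundle (charts M) (fiber M) (trivs M) \<and>
     euclidean_bundle_metric (charts M) (fiber M) (trivs M) (metric M) \<and>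
     bundle_morphism_to_tangent (charts M) (fiber M) (trivs M) (anchor M) \<and>
     (\<forall>q. (\<lambda>X. X q) ` lie_algebra_generated (horizontal_fields M) = tangent_space (charts M) q)"

definition sr_norm_sq :: "('a, 'e, 'u, 'r) sub_riemannian \<Rightarrow> 'a \<Rightarrow> 'a tangent \<Rightarrow> real" where
  "sr_norm_sq M q v = Inf {metric M q u u | u. u \<in> fiber M q \<and> anchor M q u = v}"

text \<open>The scalar product on the distribution is recovered from its norm by polarization.\<close>

definition sr_inner ::
  "('a, 'e, 'u, 'r) sub_riemannian \<Rightarrow> 'a \<Rightarrow> 'a tangent \<Rightarrow> 'a tangent \<Rightarrow> real" where
  "sr_inner M q v w =
     (sr_norm_sq M q (\<lambda>f. v f + w f) - sr_norm_sq M q (\<lambda>f. v f - w f)) / 4"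


subsection \<open>Smooth measures, gradient, divergence and sub-Laplacian\<close>

definition smooth_measure ::
  "('a::topological_space, 'e::euclidean_space, 'u, 'r) sub_riemannian \<Rightarrow> 'a measure \<Rightarrow> bool" where
  "smooth_measure M \<omega> \<longleftrightarrow> sets \<omega> = sets borel \<and>
     (\<forall>(V, \<phi>)\<in>charts M. \<exists>\<rho>. smooth_on (\<phi> ` V) \<rho> \<and> (\<forall>x\<in>\<phi> ` V. \<rho> x > 0) \<and>
        (\<forall>B\<in>sets borel. B \<subseteq> V \<longrightarrow> emeasure \<omega> B = (\<integral>\<^sup>+x\<in>\<phi> ` B. ennreal (\<rho> x) \<partial>lborel)))"

definition horizontal_gradient ::
  "('a::topological_space, 'e::euclidean_space, 'u, 'r::euclidean_space) sub_riemannian \<Rightarrow>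
   ('a \<Rightarrow> real) \<Rightarrow> 'a vfield" where
  "horizontal_gradient M f = (THE Z. Z \<in> horizontal_fields M \<and>
     (\<forall>W\<in>horizontal_fields M. \<forall>q. sr_inner M q (Z q) (W q) = W q f))"

text \<open>The divergence of \<open>X\<close> is the smooth function \<open>h\<close> such that the Lie derivative of \<open>\<omega>\<close>
  along \<open>X\<close> is \<open>h \<omega>\<close>, the Lie derivative of a measure being
  \<open>f \<mapsto> - \<integral> X f d\<omega>\<close> on test functions.\<close>

definition divergence ::
  "('a::topological_space, 'e::euclidean_space, 'u, 'r) sub_riemannian \<Rightarrow> 'a measure \<Rightarrow>
   'a vfield \<Rightarrow> 'a \<Rightarrow> real" where
  "divergence M \<omega> X = (THE h. h \<in> C_infinity (charts M) \<and>
     (\<forall>f\<in>C_infinity_c (charts M). (\<integral>q. f q * h q \<partial>\<omega>) = - (\<integral>q. X q f \<partial>\<omega>)))"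

definition sub_laplacian ::
  "('a::topological_space, 'e::euclidean_space, 'u, 'r::euclidean_space) sub_riemannian \<Rightarrow>
   'a measure \<Rightarrow> ('a \<Rightarrow> complex) \<Rightarrow> 'a \<Rightarrow> complex" where
  "sub_laplacian M \<omega> u = (\<lambda>q.
     Complex (divergence M \<omega> (horizontal_gradient M (\<lambda>p. Re (u p))) q)
             (divergence M \<omega> (horizontal_gradient M (\<lambda>p. Im (u p))) q))"


subsection \<open>Square-integrable functions and adjoints\<close>

text \<open>Elements of \<open>L\<^sup>2\<close> are represented by functions; all notions below are invariant under
  change on a null set.\<close>

definition L2 :: "'a measure \<Rightarrow> ('a \<Rightarrow> complex) set" where
  "L2 \<mu> = {u \<in> borel_measurable \<mu>. integrable \<mu> (\<lambda>q. (cmod (u q))\<^sup>2)}"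

definition L2_inner :: "'a measure \<Rightarrow> ('a \<Rightarrow> complex) \<Rightarrow> ('a \<Rightarrow> complex) \<Rightarrow> complex" where
  "L2_inner \<mu> u v = (\<integral>q. u q * cnj (v q) \<partial>\<mu>)"

definition adjoint_domain ::
  "'a measure \<Rightarrow> ('a \<Rightarrow> complex) set \<Rightarrow> (('a \<Rightarrow> complex) \<Rightarrow> 'a \<Rightarrow> complex) \<Rightarrow> ('a \<Rightarrow> complex) set" where
  "adjoint_domain \<mu> Dom T =
     {v \<in> L2 \<mu>. \<exists>w\<in>L2 \<mu>. \<forall>u\<in>Dom. L2_inner \<mu> (T u) v = L2_inner \<mu> u w}"


subsection \<open>Horizontal Sobolev spaces\<close>

text \<open>A vector of the complexified tangent space is a complex-valued functional whose real and
  imaginary parts are tangent vectors.\<close>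

type_synonym 'a ctangent = "('a \<Rightarrow> real) \<Rightarrow> complex"

definition distribution_complex_at ::
  "('a, 'e, 'u, 'r) sub_riemannian \<Rightarrow> 'a \<Rightarrow> 'a ctangent set" where
  "distribution_complex_at M q =
     {z. (\<lambda>f. Re (z f)) \<in> distribution_at M q \<and> (\<lambda>f. Im (z f)) \<in> distribution_at M q}"

definition sr_inner_complex ::
  "('a, 'e, 'u, 'r) sub_riemannian \<Rightarrow> 'a \<Rightarrow> 'a ctangent \<Rightarrow> 'a ctangent \<Rightarrow> complex" where
  "sr_inner_complex M q z w = Complex
     (sr_inner M q (\<lambda>f. Re (z f)) (\<lambda>f. Re (w f)) + sr_inner M q (\<lambda>f. Im (z f)) (\<lambda>f. Im (w f)))
     (sr_inner M q (\<lambda>f. Im (z f)) (\<lambda>f. Re (w f)) - sr_inner M q (\<lambda>f. Re (z f)) (\<lambda>f. Im (w f)))"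

text \<open>Sections over an open set \<open>\<Omega>\<close>; a section \<open>Z\<close> of the tangent bundle is measurable iff
  \<open>Z f\<close> is measurable for every smooth \<open>f\<close>.\<close>

definition L2_sections ::
  "('a::topological_space, 'e::euclidean_space, 'u, 'r) sub_riemannian \<Rightarrow> 'a measure \<Rightarrow> 'a set \<Rightarrow>
   ('a \<Rightarrow> 'a ctangent) set" where
  "L2_sections M \<omega> \<Omega> = {Z.
     (\<forall>q\<in>\<Omega>. Z q \<in> distribution_complex_at M q) \<and>
     (\<forall>f\<in>C_infinity (charts M). (\<lambda>q. Z q f) \<in> borel_measurable (restrict_space \<omega> \<Omega>)) \<and>
     integrable (restrict_space \<omega> \<Omega>) (\<lambda>q. sr_inner_complex M q (Z q) (Z q))}"

text \<open>The identity \<open>g(\<nabla>u, W) = W u\<close> in the sense of distributions on \<open>\<Omega>\<close>. Real test fields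
  suffice by sesquilinearity, and horizontal fields on \<open>\<Omega>\<close> with compact support extend
  by zero to the manifold.\<close>

definition weak_horizontal_gradient ::
  "('a::topological_space, 'e::euclidean_space, 'u, 'r::euclidean_space) sub_riemannian \<Rightarrow>
   'a measure \<Rightarrow> 'a set \<Rightarrow> ('a \<Rightarrow> complex) \<Rightarrow> ('a \<Rightarrow> 'a ctangent) \<Rightarrow> bool" where
  "weak_horizontal_gradient M \<omega> \<Omega> u Z \<longleftrightarrow>
     (\<forall>W\<in>horizontal_fields M.
        compact (closure {q. W q \<noteq> (\<lambda>f. 0)}) \<and> closure {q. W q \<noteq> (\<lambda>f. 0)} \<subseteq> \<Omega> \<longrightarrow>
        (\<integral>q. sr_inner_complex M q (Z q) (\<lambda>f. complex_of_real (W q f)) \<partial>restrict_space \<omega> \<Omega>) =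
        - (\<integral>q. u q * complex_of_real (divergence M \<omega> W q) \<partial>restrict_space \<omega> \<Omega>))"

definition W1 ::
  "('a::topological_space, 'e::euclidean_space, 'u, 'r::euclidean_space) sub_riemannian \<Rightarrow>
   'a measure \<Rightarrow> 'a set \<Rightarrow> ('a \<Rightarrow> complex) set" where
  "W1 M \<omega> \<Omega> = {u \<in> L2 (restrict_space \<omega> \<Omega>).
     \<exists>Z\<in>L2_sections M \<omega> \<Omega>. weak_horizontal_gradient M \<omega> \<Omega> u Z}"

definition W1_loc ::
  "('a::topological_space, 'e::euclidean_space, 'u, 'r::euclidean_space) sub_riemannian \<Rightarrow>
   'a measure \<Rightarrow> ('a \<Rightarrow> complex) set" where
  "W1_loc M \<omega> = {u. \<forall>\<Omega>. open \<Omega> \<and> connected \<Omega> \<and> compact (closure \<Omega>) \<longrightarrow> u \<in> W1 M \<omega> \<Omega>}"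

end

theory Submission
  imports Defs
begin

text \<open>
  Let \<open>v\<close> lie in the domain of the adjoint, so that \<open>\<Delta> v = w\<close> weakly with \<open>v\<close> and \<open>w\<close> square
  integrable. The horizontal gradient of \<open>v\<close> is locally square integrable because the
  sub-Laplacian is a second order operator in divergence form, \<open>\<Delta> = \<Sum> \<partial>\<^sub>a (A\<^sub>a\<^sub>b \<partial>\<^sub>b)\<close> with a smooth
  symmetric matrix \<open>A \<ge> 0\<close>, and semidefiniteness of \<open>A\<close> is what an energy estimate rests on.

  Formally one would test the equation with \<open>\<kappa>\<^sup>2 v\<close> for a cut-off function \<open>\<kappa>\<close>. Since \<open>v\<close> has no
  derivatives, one tests with \<open>\<kappa> J J (\<kappa> v)\<close> instead, where \<open>J\<close> is convolution with an even
  mollifier of small radius. Commuting \<open>J\<close> with the operator produces an error which, after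
  symmetrisation, is a double commutator \<open>[J, [J, \<Delta>]]\<close>; a second difference of the coefficients
  gains two powers of the radius, which compensates the two derivatives that fall on the
  mollifier. Hence the energies \<open>\<integral> A \<nabla>(J \<kappa> v) \<cdot> \<nabla>(J \<kappa> v)\<close> are bounded as the radius tends to zero
  (\<open>double_commutator_bound\<close>, \<open>local_energy_bound\<close>). With a partition of unity this gives smooth
  compactly supported functions on \<open>M\<close> with bounded horizontal energy that converge, tested
  against smooth functions, to a function \<open>g\<close> equal to \<open>v\<close> on a given compact set
  (\<open>weak_solution_approximable\<close>).

  It remains to pass to the limit in the gradients. Convex combinations of the approximations of
  almost minimal energy form a Cauchy sequence in energy, by the parallelogram identity
  (\<open>energy_Cauchy_sequence\<close>). Along a fast sequence the gradients, lifted to the fibres of the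
  Euclidean bundle, converge pointwise almost everywhere, and by Fatou's lemma also in the mean
  (\<open>weak_gradient_exists\<close>). The divergence identity for smooth functions passes to the limit, so
  the limit is the distributional horizontal gradient of \<open>g\<close>, hence of \<open>v\<close> on the given set.

  The fibres carry the analysis: the scalar product on the distribution is read off from fibre
  vectors orthogonal to the kernel of the anchor (\<open>sr_inner_minimal\<close>), and \<open>\<nabla> f\<close> is the image of
  the vector representing \<open>u \<mapsto> \<xi> u f\<close> (\<open>horizontal_gradient_eq\<close>), which depends smoothly on the
  base point even where the rank of the distribution jumps.
\<close>

section \<open>Calculus of smooth functions\<close>

abbreviation dirderiv :: "'e::euclidean_space \<Rightarrow> ('e \<Rightarrow> 'b::real_normed_vector) \<Rightarrow> 'e \<Rightarrow> 'b"
  where "dirderiv v f \<equiv> (\<lambda>x. frechet_derivative f (at x) v)"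

lemma C_k_on_subset: "C_k_on k S f \<Longrightarrow> T \<subseteq> S \<Longrightarrow> C_k_on k T f"
  by (induction k arbitrary: f) (auto intro: continuous_on_subset)

lemma C_k_on_SucD: "C_k_on (Suc k) S f \<Longrightarrow> C_k_on k S f"
proof (induction k arbitrary: f)
  case 0
  then show ?case
    by (auto intro!: continuous_at_imp_continuous_on differentiable_imp_continuous_within)
next
  case (Suc k)
  show ?case
    unfolding C_k_on.simps(2)[of k]
  proof (intro conjI allI)
    show "\<forall>x\<in>S. f differentiable (at x)" using Suc.prems by auto
    fix v
    have "C_k_on (Suc k) S (dirderiv v f)" using Suc.prems unfolding C_k_on.simps(2)[of "Suc k"] by blast
    then show "C_k_on k S (dirderiv v f)" by (rule Suc.IH)
  qed
qed

lemma C_k_on_cong: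
  assumes "open S" "\<And>x. x \<in> S \<Longrightarrow> f x = g x" "C_k_on k S f"
  shows "C_k_on k S g"
  using assms(2,3)
proof (induction k arbitrary: f g)
  case 0
  then show ?case by (auto intro: continuous_on_eq)
next
  case (Suc k)
  have fr: "frechet_derivative f (at x) = frechet_derivative g (at x)" if "x \<in> S" for x
    using frechet_derivative_transform_within_open[of f x S g] Suc.prems that assms(1) by auto
  have "C_k_on k S (dirderiv v g)" for v
    by (rule Suc.IH[of "dirderiv v f"]) (use fr Suc.prems in auto)
  moreover have "g differentiable (at x)" if "x \<in> S" for x
  proof -
    have "f differentiable (at x)" using Suc.prems that by auto
    then show ?thesis
      unfolding differentiable_def
      by (meson Suc.prems(1) assms(1) has_derivative_transform_within_open that)
  qed
  ultimately show ?case by auto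
qed

lemma C_k_on_local:
  assumes "\<And>x. x \<in> S \<Longrightarrow> \<exists>T. open T \<and> x \<in> T \<and> C_k_on k T f"
  shows "C_k_on k S f"
  using assms
proof (induction k arbitrary: f)
  case 0
  then show ?case
    by (metis C_k_on.simps(1) continuous_at_imp_continuous_on continuous_on_eq_continuous_at)
next
  case (Suc k)
  have "f differentiable (at x)" if "x \<in> S" for x
    using Suc.prems[OF that] by auto
  moreover have "C_k_on k S (dirderiv v f)" for v
    by (rule Suc.IH) (use Suc.prems in fastforce)
  ultimately show ?case by auto
qed

lemma C_k_on_SucI:
  assumes "open S" "\<And>x. x \<in> S \<Longrightarrow> (f has_derivative f' x) (at x)" "\<And>v. C_k_on k S (\<lambda>x. f' x v)"
  shows "C_k_on (Suc k) S f"
proof -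
  have fr: "frechet_derivative f (at x) = f' x" if "x \<in> S" for x
    using assms(2)[OF that] frechet_derivative_at by metis
  have "C_k_on k S (dirderiv v f)" for v
    by (rule C_k_on_cong[OF assms(1) _ assms(3)[of v]]) (use fr in auto)
  then show ?thesis
    using assms(2) unfolding C_k_on.simps differentiable_def by blast
qed

lemma C_k_on_has_derivative:
  assumes "C_k_on (Suc k) S f" "x \<in> S"
  shows "(f has_derivative frechet_derivative f (at x)) (at x)"
  using assms frechet_derivative_works by auto

lemma C_k_on_const: "open S \<Longrightarrow> C_k_on k S (\<lambda>x. c)"
  by (induction k arbitrary: c) auto

lemma C_k_on_bounded_linear_compose:
  assumes "open S" "bounded_linear L" "C_k_on k S f"
  shows "C_k_on k S (\<lambda>x. L (f x))"
  using assms(3)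
proof (induction k arbitrary: f)
  case 0
  then show ?case using assms(2) by (auto intro: bounded_linear.continuous_on)
next
  case (Suc k)
  show ?case
  proof (rule C_k_on_SucI[OF assms(1), where f'="\<lambda>x v. L (frechet_derivative f (at x) v)"])
    show "((\<lambda>x. L (f x)) has_derivative (\<lambda>v. L (frechet_derivative f (at x) v))) (at x)"
      if "x \<in> S" for x
      using bounded_linear.has_derivative[OF assms(2) C_k_on_has_derivative[OF Suc.prems that]] .
    show "C_k_on k S (\<lambda>x. L (frechet_derivative f (at x) v))" for v
      by (rule Suc.IH) (use Suc.prems in auto)
  qed
qed

lemma C_k_on_linear:
  assumes "open S" "bounded_linear L"
  shows "C_k_on k S L"
proof (cases k)
  case 0
  then show ?thesis using assms(2)
    by (auto intro!: bounded_linear.continuous_on[OF assms(2)] continuous_on_id)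
next
  case (Suc j)
  show ?thesis unfolding Suc
    by (rule C_k_on_SucI[OF assms(1), where f'="\<lambda>_. L"])
       (auto intro: bounded_linear_imp_has_derivative[OF assms(2)] C_k_on_const[OF assms(1)])
qed

lemma C_k_on_add:
  assumes "open S" "C_k_on k S f" "C_k_on k S g"
  shows "C_k_on k S (\<lambda>x. f x + g x)"
  using assms(2,3)
proof (induction k arbitrary: f g)
  case 0
  then show ?case by (auto intro: continuous_on_add)
next
  case (Suc k)
  show ?case
  proof (rule C_k_on_SucI[OF assms(1),
        where f'="\<lambda>x v. frechet_derivative f (at x) v + frechet_derivative g (at x) v"])
    show "((\<lambda>x. f x + g x) has_derivative
      (\<lambda>v. frechet_derivative f (at x) v + frechet_derivative g (at x) v)) (at x)" if "x \<in> S" for x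
      using C_k_on_has_derivative[OF Suc.prems(1) that] C_k_on_has_derivative[OF Suc.prems(2) that]
      by (rule has_derivative_add)
    show "C_k_on k S (\<lambda>x. frechet_derivative f (at x) v + frechet_derivative g (at x) v)" for v
      by (rule Suc.IH) (use Suc.prems in auto)
  qed
qed

lemma C_k_on_bilinear:
  assumes "open S" "bounded_bilinear B" "C_k_on k S f" "C_k_on k S g"
  shows "C_k_on k S (\<lambda>x. B (f x) (g x))"
  using assms(3,4)
proof (induction k arbitrary: f g)
  case 0
  then show ?case using assms(2) by (auto intro: bounded_bilinear.continuous_on)
next
  case (Suc k)
  show ?case
  proof (rule C_k_on_SucI[OF assms(1),
        where f'="\<lambda>x v. B (f x) (frechet_derivative g (at x) v) + B (frechet_derivative f (at x) v) (g x)"])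
    show "((\<lambda>x. B (f x) (g x)) has_derivative
      (\<lambda>v. B (f x) (frechet_derivative g (at x) v) + B (frechet_derivative f (at x) v) (g x))) (at x)"
      if "x \<in> S" for x
      using bounded_bilinear.FDERIV[OF assms(2) C_k_on_has_derivative[OF Suc.prems(1) that]
          C_k_on_has_derivative[OF Suc.prems(2) that]] .
    have *: "C_k_on k S f" "C_k_on k S g" using Suc.prems C_k_on_SucD by blast+
    show "C_k_on k S (\<lambda>x. B (f x) (frechet_derivative g (at x) v) + B (frechet_derivative f (at x) v) (g x))" for v
      by (intro C_k_on_add[OF assms(1)] Suc.IH) (use Suc.prems * in auto)
  qed
qed

lemma C_k_on_sum:
  assumes "open S" "\<And>i. i \<in> I \<Longrightarrow> C_k_on k S (f i)"
  shows "C_k_on k S (\<lambda>x. \<Sum>i\<in>I. f i x)"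
  using assms(2)
proof (induction I rule: infinite_finite_induct)
  case (insert i I)
  then show ?case by (auto intro!: C_k_on_add[OF assms(1)])
qed (auto intro: C_k_on_const[OF assms(1)])

lemma has_derivative_expand_Basis:
  assumes "(f has_derivative f') F"
  shows "f' v = (\<Sum>b\<in>Basis. (v \<bullet> b) *\<^sub>R f' (b::'e::euclidean_space))"
proof -
  interpret bounded_linear f' using assms by (rule has_derivative_bounded_linear)
  have "f' v = f' (\<Sum>b\<in>Basis. (v \<bullet> b) *\<^sub>R b)" by (simp add: euclidean_representation)
  then show ?thesis by (simp add: sum scaleR)
qed

lemma C_k_on_compose:
  fixes f :: "'e::euclidean_space \<Rightarrow> 'f::euclidean_space"
  assumes "open S" "open T" "f ` S \<subseteq> T" "C_k_on k S f" "C_k_on k T h"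
  shows "C_k_on k S (\<lambda>x. h (f x))"
  using assms(4,5)
proof (induction k arbitrary: h)
  case 0
  then show ?case using assms(3) by (auto intro: continuous_on_compose2)
next
  case (Suc k)
  show ?case
  proof (rule C_k_on_SucI[OF assms(1),
        where f'="\<lambda>x v. \<Sum>b\<in>Basis. (frechet_derivative f (at x) v \<bullet> b) *\<^sub>R frechet_derivative h (at (f x)) b"])
    fix x assume x: "x \<in> S"
    then have h: "(h has_derivative frechet_derivative h (at (f x))) (at (f x))"
      using C_k_on_has_derivative[OF Suc.prems(2)] assms(3) by auto
    have eq: "(\<lambda>v. \<Sum>b\<in>Basis. (frechet_derivative f (at x) v \<bullet> b) *\<^sub>R frechet_derivative h (at (f x)) b)
      = (\<lambda>v. frechet_derivative h (at (f x)) (frechet_derivative f (at x) v))"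
      using has_derivative_expand_Basis[OF h] by metis
    show "((\<lambda>x. h (f x)) has_derivative (\<lambda>v. \<Sum>b\<in>Basis. (frechet_derivative f (at x) v \<bullet> b) *\<^sub>R
         frechet_derivative h (at (f x)) b)) (at x)"
      unfolding eq
      using diff_chain_at[OF C_k_on_has_derivative[OF Suc.prems(1) x] h] by (simp add: o_def)
  next
    fix v
    have f: "C_k_on k S f" using Suc.prems C_k_on_SucD by blast
    have fv: "C_k_on k S (dirderiv v f)" using Suc.prems by auto
    show "C_k_on k S (\<lambda>x. \<Sum>b\<in>Basis. (frechet_derivative f (at x) v \<bullet> b) *\<^sub>R frechet_derivative h (at (f x)) b)"
    proof (intro C_k_on_sum[OF assms(1)] C_k_on_bilinear[OF assms(1) bounded_bilinear_scaleR])
      fix b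
      show "C_k_on k S (\<lambda>x. frechet_derivative f (at x) v \<bullet> b)"
        by (rule C_k_on_bounded_linear_compose[OF assms(1) bounded_linear_inner_left fv])
      show "C_k_on k S (\<lambda>x. frechet_derivative h (at (f x)) b)"
        by (rule Suc.IH[OF f]) (use Suc.prems in auto)
    qed
  qed
qed

lemma smooth_on_subset: "smooth_on S f \<Longrightarrow> T \<subseteq> S \<Longrightarrow> smooth_on T f"
  unfolding smooth_on_def using C_k_on_subset by blast

lemma smooth_on_cong: "open S \<Longrightarrow> (\<And>x. x \<in> S \<Longrightarrow> f x = g x) \<Longrightarrow> smooth_on S f \<Longrightarrow> smooth_on S g"
  unfolding smooth_on_def using C_k_on_cong by blast

lemma smooth_on_local:
  assumes "\<And>x. x \<in> S \<Longrightarrow> \<exists>T. open T \<and> x \<in> T \<and> smooth_on T f"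
  shows "smooth_on S f"
  unfolding smooth_on_def
  by (intro allI C_k_on_local) (use assms in \<open>unfold smooth_on_def, blast\<close>)

lemma smooth_on_const[intro, simp]: "open S \<Longrightarrow> smooth_on S (\<lambda>x. c)"
  by (simp add: smooth_on_def C_k_on_const)

lemma smooth_on_add: "open S \<Longrightarrow> smooth_on S f \<Longrightarrow> smooth_on S g \<Longrightarrow> smooth_on S (\<lambda>x. f x + g x)"
  by (simp add: smooth_on_def C_k_on_add)

lemma smooth_on_bounded_linear_compose:
  "open S \<Longrightarrow> bounded_linear L \<Longrightarrow> smooth_on S f \<Longrightarrow> smooth_on S (\<lambda>x. L (f x))"
  by (simp add: smooth_on_def C_k_on_bounded_linear_compose)

lemma smooth_on_linear: "open S \<Longrightarrow> bounded_linear L \<Longrightarrow> smooth_on S L"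
  by (simp add: smooth_on_def C_k_on_linear)

lemma smooth_on_ident: "open S \<Longrightarrow> smooth_on S (\<lambda>x. x)"
  by (rule smooth_on_linear) (auto intro: bounded_linear_ident)

lemma smooth_on_mult:
  fixes f g :: "'e::euclidean_space \<Rightarrow> 'b::real_normed_algebra"
  shows "open S \<Longrightarrow> smooth_on S f \<Longrightarrow> smooth_on S g \<Longrightarrow> smooth_on S (\<lambda>x. f x * g x)"
  by (simp add: smooth_on_def C_k_on_bilinear[OF _ bounded_bilinear_mult])

lemma smooth_on_scaleR:
  "open S \<Longrightarrow> smooth_on S f \<Longrightarrow> smooth_on S g \<Longrightarrow> smooth_on S (\<lambda>x. f x *\<^sub>R g x)"
  by (simp add: smooth_on_def C_k_on_bilinear[OF _ bounded_bilinear_scaleR])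

lemma smooth_on_inner:
  "open S \<Longrightarrow> smooth_on S f \<Longrightarrow> smooth_on S g \<Longrightarrow> smooth_on S (\<lambda>x. f x \<bullet> g x)"
  by (simp add: smooth_on_def C_k_on_bilinear[OF _ bounded_bilinear_inner])

lemma smooth_on_uminus: "open S \<Longrightarrow> smooth_on S f \<Longrightarrow> smooth_on S (\<lambda>x. - f x)"
  by (rule smooth_on_bounded_linear_compose[OF _ bounded_linear_minus[OF bounded_linear_ident]])

lemma smooth_on_diff: "open S \<Longrightarrow> smooth_on S f \<Longrightarrow> smooth_on S g \<Longrightarrow> smooth_on S (\<lambda>x. f x - g x)"
  using smooth_on_add[of S f "\<lambda>x. - g x"] smooth_on_uminus[of S g] by simp

lemma smooth_on_sum:
  "open S \<Longrightarrow> (\<And>i. i \<in> I \<Longrightarrow> smooth_on S (f i)) \<Longrightarrow> smooth_on S (\<lambda>x. \<Sum>i\<in>I. f i x)"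
  by (simp add: smooth_on_def C_k_on_sum)

lemma smooth_on_compose:
  fixes f :: "'e::euclidean_space \<Rightarrow> 'f::euclidean_space"
  shows "open S \<Longrightarrow> open T \<Longrightarrow> f ` S \<subseteq> T \<Longrightarrow> smooth_on S f \<Longrightarrow> smooth_on T h \<Longrightarrow> smooth_on S (\<lambda>x. h (f x))"
  unfolding smooth_on_def using C_k_on_compose by blast

lemma smooth_on_dirderiv: "smooth_on S f \<Longrightarrow> smooth_on S (dirderiv v f)"
  unfolding smooth_on_def using C_k_on.simps(2) by blast

lemma smooth_on_has_derivative:
  "smooth_on S f \<Longrightarrow> x \<in> S \<Longrightarrow> (f has_derivative frechet_derivative f (at x)) (at x)"
  unfolding smooth_on_def using C_k_on_has_derivative by blast

lemma smooth_on_continuous_on: "smooth_on S f \<Longrightarrow> continuous_on S f"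
  unfolding smooth_on_def using C_k_on.simps(1) by blast

lemma smooth_on_inverse:
  fixes f :: "'e::euclidean_space \<Rightarrow> real"
  assumes "open S" "smooth_on S f" "\<And>x. x \<in> S \<Longrightarrow> f x > 0"
  shows "smooth_on S (\<lambda>x. inverse (f x))"
proof -
  have "C_k_on k {0<..} (inverse :: real \<Rightarrow> real)" for k
  proof (induction k)
    case 0
    then show ?case by (auto intro!: continuous_intros)
  next
    case (Suc k)
    show ?case
    proof (rule C_k_on_SucI[where f'="\<lambda>x v. - (inverse x * v * inverse x)"])
      show "C_k_on k {0<..} (\<lambda>x. - (inverse x * v * inverse x))" for v :: real
        by (intro C_k_on_bounded_linear_compose[OF _ bounded_linear_minus[OF bounded_linear_ident]]
             C_k_on_bilinear[OF _ bounded_bilinear_mult] C_k_on_const Suc) auto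
    qed (auto intro!: has_derivative_inverse')
  qed
  then have "smooth_on {0<..} (inverse :: real \<Rightarrow> real)" by (simp add: smooth_on_def)
  from smooth_on_compose[OF assms(1) _ _ assms(2) this] assms(3) show ?thesis by auto
qed

lemma smooth_on_sqrt:
  fixes f :: "'e::euclidean_space \<Rightarrow> real"
  assumes "open S" "smooth_on S f" "\<And>x. x \<in> S \<Longrightarrow> f x > 0"
  shows "smooth_on S (\<lambda>x. sqrt (f x))"
proof -
  have inv: "C_k_on k {0<..} (inverse :: real \<Rightarrow> real)" for k
    using smooth_on_inverse[OF _ smooth_on_ident, of "{0::real<..}"]
    unfolding smooth_on_def by simp
  have "C_k_on k {0<..} sqrt" for k
  proof (induction k)
    case 0
    then show ?case by (auto intro!: continuous_intros)
  next
    case (Suc k)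
    show ?case
    proof (rule C_k_on_SucI[where f'="\<lambda>x v. v * (inverse (sqrt x) * (1/2))"])
      show "C_k_on k {0<..} (\<lambda>x. v * (inverse (sqrt x) * (1/2)))" for v :: real
        by (intro C_k_on_bilinear[OF _ bounded_bilinear_mult] C_k_on_const
             C_k_on_compose[OF _ _ _ Suc inv]) auto
      show "(sqrt has_derivative (\<lambda>v. v * (inverse (sqrt x) * (1/2)))) (at x)"
        if "x \<in> {0<..}" for x
      proof -
        from that have "0 < x" by simp
        from DERIV_real_sqrt[OF this] show ?thesis
          unfolding has_field_derivative_def
          by (rule has_derivative_eq_rhs) (auto simp: fun_eq_iff field_simps)
      qed
    qed auto
  qed
  then have "smooth_on {0<..} sqrt" by (simp add: smooth_on_def)
  from smooth_on_compose[OF assms(1) _ _ assms(2) this] assms(3) show ?thesis by auto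
qed

subsection \<open>Bump functions\<close>

text \<open>Up to sign and binomial combination these are the derivatives of \<open>exp (- 1/x)\<close>; the family
  is closed under differentiation, which gives smoothness at the origin for all orders at once.\<close>

definition flat :: "nat \<Rightarrow> real \<Rightarrow> real" where
  "flat n x = (if x > 0 then inverse x ^ n * exp (- inverse x) else 0)"

lemma flat_tendsto_0: "(flat n \<longlongrightarrow> 0) (at 0)"
proof -
  have "((\<lambda>y::real. y ^ n / exp y) \<longlongrightarrow> 0) at_top" by (rule tendsto_power_div_exp_0)
  then have "((\<lambda>x. inverse x ^ n / exp (inverse x)) \<longlongrightarrow> 0) (at_right (0::real))"
    by (rule filterlim_compose[OF _ filterlim_inverse_at_top_right])
  then have 1: "(flat n \<longlongrightarrow> 0) (at_right 0)"
    by (rule Lim_transform_eventually) (auto simp: eventually_at_filter flat_def exp_minus field_simps)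
  have 2: "(flat n \<longlongrightarrow> 0) (at_left 0)"
    by (rule Lim_transform_eventually[of "\<lambda>_. 0"]) (auto simp: eventually_at_filter flat_def)
  show ?thesis using 1 2 filterlim_split_at by blast
qed

lemma flat_has_derivative:
  "(flat n has_real_derivative (flat (n + 2) x - real n * flat (n + 1) x)) (at x)"
proof (cases "x = 0")
  case True
  have "((\<lambda>h. (flat n (0 + h) - flat n 0) / h) \<longlongrightarrow> 0) (at 0)"
  proof (rule Lim_transform_eventually[OF flat_tendsto_0[of "n+1"]])
    show "\<forall>\<^sub>F h in at 0. flat (n + 1) h = (flat n (0 + h) - flat n 0) / h"
      by (auto simp: flat_def eventually_at_filter field_simps)
  qed
  then show ?thesis using True by (simp add: DERIV_def flat_def)
next
  case False
  show ?thesis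
  proof (cases "x > 0")
    case True
    have "((\<lambda>x. inverse x ^ n * exp (- inverse x)) has_real_derivative
       (flat (n + 2) x - real n * flat (n + 1) x)) (at x)"
    proof -
      have "real n * inverse x ^ (n - 1) * (inverse x * inverse x) = real n * inverse x ^ (n + 1)"
        by (cases n) simp_all
      then have eq: "flat (n + 2) x - real n * flat (n + 1) x =
        real n * inverse x ^ (n - 1) * (- (inverse x * inverse x)) * exp (- inverse x)
        + inverse x ^ n * (exp (- inverse x) * (inverse x * inverse x))"
        using True by (simp add: flat_def algebra_simps)
      show ?thesis
        unfolding eq using True by (auto intro!: derivative_eq_intros simp: algebra_simps)
    qed
    then show ?thesis
      by (rule has_field_derivative_transform_within_open[of _ _ _ "{0<..}"])
         (use True in \<open>auto simp: flat_def\<close>)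
  next
    case F: False
    have "((\<lambda>x::real. 0::real) has_real_derivative 0) (at x)" by simp
    then have "(flat n has_real_derivative 0) (at x)"
      by (rule has_field_derivative_transform_within_open[of _ _ _ "{..<0}"])
         (use False F in \<open>auto simp: flat_def\<close>)
    then show ?thesis using F by (simp add: flat_def)
  qed
qed

lemma smooth_on_flat: "smooth_on UNIV (flat n)"
proof -
  have "C_k_on k UNIV (flat n)" for k n
  proof (induction k arbitrary: n)
    case 0
    then show ?case
      using flat_has_derivative DERIV_isCont by (force simp: continuous_on_eq_continuous_at)
  next
    case (Suc k)
    show ?case
    proof (rule C_k_on_SucI[where f'="\<lambda>x v. (flat (n + 2) x + (- real n) * flat (n + 1) x) * v"])
      show "C_k_on k UNIV (\<lambda>x. (flat (n + 2) x + (- real n) * flat (n + 1) x) * v)" for v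
        by (intro C_k_on_bilinear[OF _ bounded_bilinear_mult] C_k_on_const C_k_on_add Suc) auto
      show "(flat n has_derivative (\<lambda>v. (flat (n + 2) x + (- real n) * flat (n + 1) x) * v)) (at x)" for x
        using flat_has_derivative[of n x] by (simp add: has_field_derivative_def)
    qed auto
  qed
  then show ?thesis by (simp add: smooth_on_def)
qed

definition ball_bump :: "real \<Rightarrow> 'e::euclidean_space \<Rightarrow> real" where
  "ball_bump r x = flat 0 (r\<^sup>2 - x \<bullet> x)"

lemma smooth_on_ball_bump: "smooth_on UNIV (ball_bump r)"
  unfolding ball_bump_def
  by (intro smooth_on_compose[OF _ _ _ _ smooth_on_flat] smooth_on_diff smooth_on_inner smooth_on_ident) auto

lemma ball_bump_nonneg: "0 \<le> ball_bump r x"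
  by (simp add: ball_bump_def flat_def)

lemma ball_bump_pos_iff: "0 < r \<Longrightarrow> 0 < ball_bump r x \<longleftrightarrow> norm x < r"
  by (simp add: ball_bump_def flat_def dot_square_norm abs_less_iff) (smt (verit) norm_ge_zero power2_less_imp_less power_strict_mono pos2)

lemma ball_bump_minus: "ball_bump r (- x) = ball_bump r x"
  by (simp add: ball_bump_def)

text \<open>A smooth step from \<open>0\<close> on the negative half line to \<open>1\<close> beyond \<open>1\<close>.\<close>

definition smooth_step :: "real \<Rightarrow> real" where
  "smooth_step t = flat 0 t / (flat 0 t + flat 0 (1 - t))"

lemma smooth_on_smooth_step: "smooth_on UNIV smooth_step"
proof -
  have "smooth_on UNIV (\<lambda>t. flat 0 t * inverse (flat 0 t + flat 0 (1 - t)))"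
    by (intro smooth_on_mult smooth_on_inverse smooth_on_add smooth_on_flat
        smooth_on_compose[OF _ _ _ _ smooth_on_flat] smooth_on_diff smooth_on_ident)
       (auto simp: flat_def add_pos_pos)
  moreover have "smooth_step = (\<lambda>t. flat 0 t * inverse (flat 0 t + flat 0 (1 - t)))"
    by (auto simp: smooth_step_def divide_inverse)
  ultimately show ?thesis by simp
qed

lemma smooth_step_0: "t \<le> 0 \<Longrightarrow> smooth_step t = 0"
  and smooth_step_1: "1 \<le> t \<Longrightarrow> smooth_step t = 1"
  and smooth_step_bounds: "0 \<le> smooth_step t" "smooth_step t \<le> 1"
  by (auto simp: smooth_step_def flat_def divide_simps add_pos_pos not_less intro: add_nonneg_nonneg)

definition plateau :: "real \<Rightarrow> 'e::euclidean_space \<Rightarrow> real" where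
  "plateau r x = smooth_step (2 - (x \<bullet> x) / r\<^sup>2)"

lemma smooth_on_plateau: "smooth_on UNIV (plateau r)"
proof -
  have "smooth_on UNIV (\<lambda>x::'a. smooth_step (2 - (x \<bullet> x) * inverse (r\<^sup>2)))"
    by (intro smooth_on_compose[OF _ _ _ _ smooth_on_smooth_step] smooth_on_diff smooth_on_mult
      smooth_on_inner smooth_on_ident) auto
  then show ?thesis by (simp add: plateau_def[abs_def] divide_inverse)
qed

lemma plateau_bounds: "0 \<le> plateau r x" "plateau r x \<le> 1"
  by (auto simp: plateau_def smooth_step_bounds)

lemma plateau_eq_1: "0 < r \<Longrightarrow> norm x \<le> r \<Longrightarrow> plateau r x = 1"
  unfolding plateau_def
  by (rule smooth_step_1) (auto simp: dot_square_norm divide_simps power_mono)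

lemma plateau_eq_0: "0 < r \<Longrightarrow> 2 * r \<le> norm x \<Longrightarrow> plateau r x = 0"
  unfolding plateau_def
proof (rule smooth_step_0)
  assume "0 < r" "2 * r \<le> norm x"
  then have "(2 * r)\<^sup>2 \<le> (norm x)\<^sup>2" by (intro power_mono) auto
  with \<open>0 < r\<close> show "2 - (x \<bullet> x) / r\<^sup>2 \<le> 0"
    by (auto simp: dot_square_norm divide_simps power2_eq_square) (smt (verit) mult_nonneg_nonneg)
qed

section \<open>Compactly supported smooth functions on a Euclidean space\<close>

definition test_fun :: "('e::euclidean_space \<Rightarrow> real) \<Rightarrow> bool" where
  "test_fun f \<longleftrightarrow> smooth_on UNIV f \<and> bounded {x. f x \<noteq> 0}"

lemma dirderiv_eq_0:
  assumes "open S" "\<And>x. x \<in> S \<Longrightarrow> f x = 0" "x \<in> S"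
  shows "frechet_derivative f (at x) v = 0"
proof -
  have "(f has_derivative (\<lambda>_. 0)) (at x)"
    by (rule has_derivative_transform_within_open[of "\<lambda>_. 0" _ _ _ S]) (use assms in auto)
  then show ?thesis using frechet_derivative_at by metis
qed

lemma test_fun_radius:
  assumes "bounded {x. f x \<noteq> (0::real)}"
  obtains R where "R > 0" "\<And>x. norm x \<ge> R \<Longrightarrow> f x = 0"
proof -
  from assms obtain B where B: "\<And>x. f x \<noteq> 0 \<Longrightarrow> norm x \<le> B" by (auto simp: bounded_iff)
  show thesis
  proof (rule that[of "max 1 (B + 1)"])
    show "f x = 0" if "max 1 (B + 1) \<le> norm x" for x
      using B[of x] that by (cases "f x = 0") auto
  qed simp
qed

lemma test_fun_dirderiv: "test_fun f \<Longrightarrow> test_fun (dirderiv v f)"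
proof -
  assume f: "test_fun f"
  then obtain R where R: "R > 0" "\<And>x. norm x \<ge> R \<Longrightarrow> f x = 0"
    unfolding test_fun_def using test_fun_radius by metis
  have "dirderiv v f x = 0" if "norm x > R" for x
  proof (rule dirderiv_eq_0[of "{x. R < norm x}"])
    show "open {x::'a. R < norm x}" by (intro open_Collect_less continuous_intros)
  qed (use R(2) that in auto)
  then have "bounded {x. dirderiv v f x \<noteq> 0}"
    using not_less by (intro boundedI[of _ R]) blast
  then show ?thesis using f by (auto simp: test_fun_def smooth_on_dirderiv)
qed

lemma test_fun_mult: "test_fun f \<Longrightarrow> smooth_on UNIV g \<Longrightarrow> test_fun (\<lambda>x. f x * g x)"
  unfolding test_fun_def
proof (elim conjE, intro conjI)
  show "smooth_on UNIV (\<lambda>x. f x * g x)" if "smooth_on UNIV f" "smooth_on UNIV g"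
    using that by (intro smooth_on_mult) auto
  show "bounded {x. f x * g x \<noteq> 0}" if "bounded {x. f x \<noteq> 0}"
    using that by (rule bounded_subset) auto
qed

lemma test_fun_add: "test_fun f \<Longrightarrow> test_fun g \<Longrightarrow> test_fun (\<lambda>x. f x + g x)"
proof -
  assume *: "test_fun f" "test_fun g"
  have "{x. f x + g x \<noteq> 0} \<subseteq> {x. f x \<noteq> 0} \<union> {x. g x \<noteq> 0}" by auto
  moreover have "bounded ({x. f x \<noteq> 0} \<union> {x. g x \<noteq> 0})" using * by (simp add: test_fun_def)
  ultimately have "bounded {x. f x + g x \<noteq> 0}" by (metis bounded_subset)
  then show ?thesis using * by (simp add: test_fun_def smooth_on_add)
qed

lemma test_fun_sum: "(\<And>i. i \<in> I \<Longrightarrow> test_fun (f i)) \<Longrightarrow> test_fun (\<lambda>x. \<Sum>i\<in>I. f i x)"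
proof (induction I rule: infinite_finite_induct)
  case (insert i I)
  then show ?case by (simp add: test_fun_add)
qed (simp_all add: test_fun_def)

lemma test_fun_continuous: "test_fun f \<Longrightarrow> continuous_on S f"
  by (rule continuous_on_subset[of UNIV]) (simp_all add: test_fun_def smooth_on_continuous_on)

lemma test_fun_measurable: "test_fun f \<Longrightarrow> f \<in> borel_measurable borel"
  by (intro borel_measurable_continuous_onI test_fun_continuous)

lemma continuous_bounded_support_bounded:
  fixes f :: "'e::euclidean_space \<Rightarrow> real"
  assumes "continuous_on UNIV f" "bounded {x. f x \<noteq> 0}"
  obtains C where "C \<ge> 0" "\<And>x. \<bar>f x\<bar> \<le> C"
proof -
  from assms obtain R where R: "R > 0" "\<And>x. norm x \<ge> R \<Longrightarrow> f x = 0"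
    using test_fun_radius by metis
  have "bounded (f ` cball 0 R)"
    by (intro compact_imp_bounded compact_continuous_image continuous_on_subset[OF assms(1)]) auto
  then obtain C where "\<forall>x\<in>f ` cball 0 R. norm x \<le> C" unfolding bounded_iff by blast
  then have C: "\<bar>f x\<bar> \<le> C" if "norm x \<le> R" for x using that by simp
  show thesis
  proof (rule that[of "max 0 C"])
    fix x show "\<bar>f x\<bar> \<le> max 0 C"
      using C[of x] R(2)[of x] by (cases "norm x \<le> R") simp_all
  qed auto
qed

lemma test_fun_bounded:
  assumes "test_fun f" obtains C where "C \<ge> 0" "\<And>x. \<bar>f x\<bar> \<le> C"
  using assms continuous_bounded_support_bounded smooth_on_continuous_on unfolding test_fun_def by metis

lemma test_fun_has_derivative: "test_fun f \<Longrightarrow> (f has_derivative frechet_derivative f (at x)) (at x)"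
  unfolding test_fun_def by (rule smooth_on_has_derivative[of UNIV]) auto

lemma onorm_Basis_bound:
  fixes g :: "'e::euclidean_space \<Rightarrow> real"
  assumes "bounded_linear g" "\<And>b. b \<in> Basis \<Longrightarrow> \<bar>g b\<bar> \<le> C b"
  shows "onorm g \<le> (\<Sum>b\<in>Basis. C b)"
proof (rule onorm_bound)
  show "0 \<le> sum C Basis"
  proof (intro sum_nonneg)
    show "0 \<le> C b" if "b \<in> Basis" for b using assms(2)[OF that] by linarith
  qed
  fix v
  have "g v = (\<Sum>b\<in>Basis. (v \<bullet> b) * g b)"
    using has_derivative_expand_Basis[OF bounded_linear_imp_has_derivative[OF assms(1)], where v=v] by simp
  also have "\<bar>\<dots>\<bar> \<le> (\<Sum>b\<in>Basis. norm v * C b)"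
    by (intro order_trans[OF sum_abs] sum_mono) (simp add: abs_mult mult_mono assms(2) Basis_le_norm)
  finally show "norm (g v) \<le> sum C Basis * norm v" by (simp add: sum_distrib_left mult.commute)
qed

lemma bounded_linear_frechet: "test_fun f \<Longrightarrow> bounded_linear (frechet_derivative f (at x))"
  by (rule has_derivative_bounded_linear[OF test_fun_has_derivative])

lemma test_fun_Lipschitz:
  assumes "test_fun f" obtains L where "L \<ge> 0" "\<And>x y. \<bar>f x - f y\<bar> \<le> L * norm (x - y)"
proof -
  have "\<exists>C. C \<ge> 0 \<and> (\<forall>x. \<bar>dirderiv b f x\<bar> \<le> C)" for b
    using test_fun_bounded[OF test_fun_dirderiv[OF assms]] by metis
  then obtain C where C: "\<And>b. C b \<ge> 0" "\<And>b x. \<bar>dirderiv b f x\<bar> \<le> C b" by metis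
  have "norm (f x - f y) \<le> (\<Sum>b\<in>Basis. C b) * norm (x - y)" for x y
  proof (rule differentiable_bound[where S=UNIV and f'="\<lambda>x. frechet_derivative f (at x)"])
    show "onorm (frechet_derivative f (at x)) \<le> sum C Basis" for x
      by (rule onorm_Basis_bound[OF bounded_linear_frechet[OF assms] C(2)])
  qed (use test_fun_has_derivative[OF assms] in simp_all)
  then show thesis by (intro that[of "\<Sum>b\<in>Basis. C b"] sum_nonneg C(1)) simp
qed

lemma test_fun_derivative_Lipschitz:
  assumes "test_fun f"
  obtains L where "L \<ge> 0" "\<And>x y. onorm (\<lambda>v. frechet_derivative f (at x) v - frechet_derivative f (at y) v) \<le> L * norm (x - y)"
proof -
  have "\<exists>C. C \<ge> 0 \<and> (\<forall>x y. \<bar>dirderiv b f x - dirderiv b f y\<bar> \<le> C * norm (x - y))" for b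
    using test_fun_Lipschitz[OF test_fun_dirderiv[OF assms]] by metis
  then obtain C where C: "\<And>b. C b \<ge> 0" "\<And>b x y. \<bar>dirderiv b f x - dirderiv b f y\<bar> \<le> C b * norm (x - y)" by metis
  have "onorm (\<lambda>v. frechet_derivative f (at x) v - frechet_derivative f (at y) v) \<le> (\<Sum>b\<in>Basis. C b * norm (x - y))" for x y
    by (intro onorm_Basis_bound bounded_linear_sub bounded_linear_frechet[OF assms] C)
  then show thesis by (intro that[of "\<Sum>b\<in>Basis. C b"] sum_nonneg C(1)) (simp add: sum_distrib_right)
qed

lemma test_fun_Taylor:
  fixes f :: "'e::euclidean_space \<Rightarrow> real"
  assumes "test_fun f"
  obtains C where "C \<ge> 0" "\<And>x h. \<bar>f (x + h) - f x - frechet_derivative f (at x) h\<bar> \<le> C * (norm h)\<^sup>2"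
proof -
  obtain L where L: "L \<ge> 0" "\<And>x y. onorm (\<lambda>v. frechet_derivative f (at x) v - frechet_derivative f (at y) v) \<le> L * norm (x - y)"
    using test_fun_derivative_Lipschitz[OF assms] by metis
  have "norm ((f (x + h) - frechet_derivative f (at x) h) - (f (x + 0) - frechet_derivative f (at x) 0)) \<le> (L * norm h) * norm (h - 0)" for x h
  proof (rule differentiable_bound[where S="cball 0 (norm h)" and f="\<lambda>h. f (x + h) - frechet_derivative f (at x) h"
        and f'="\<lambda>z v. frechet_derivative f (at (x + z)) v - frechet_derivative f (at x) v"])
    fix z :: 'e assume z: "z \<in> cball 0 (norm h)"
    have "((\<lambda>h. f (x + h)) has_derivative frechet_derivative f (at (x + z))) (at z within cball 0 (norm h))"
      by (rule has_derivative_compose[of "\<lambda>h. x + h" "\<lambda>v. v", OF _ test_fun_has_derivative[OF assms]])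
        (auto intro!: derivative_eq_intros)
    then show "((\<lambda>h. f (x + h) - frechet_derivative f (at x) h) has_derivative
         (\<lambda>v. frechet_derivative f (at (x + z)) v - frechet_derivative f (at x) v)) (at z within cball 0 (norm h))"
      by (intro has_derivative_diff bounded_linear_imp_has_derivative bounded_linear_frechet[OF assms])
    show "onorm (\<lambda>v. frechet_derivative f (at (x + z)) v - frechet_derivative f (at x) v) \<le> L * norm h"
      using L(2)[of "x + z" x] z L(1) by (auto intro: order_trans mult_left_mono)
  qed auto
  moreover have "frechet_derivative f (at x) 0 = 0" for x
    using bounded_linear_frechet[OF assms] by (rule linear_simps)
  ultimately show thesis
    by (intro that[OF L(1)]) (simp add: algebra_simps power2_eq_square)
qed

text \<open>The increment of \<open>f\<close> along one side of the parallelogram has a derivative bounded by the length of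
  this side; the mean value inequality along the other side gives the second factor.\<close>

lemma test_fun_parallelogram:
  assumes "test_fun f"
  obtains C where "C \<ge> 0" "\<And>x y z. \<bar>f z + f (x + y - z) - f x - f y\<bar> \<le> C * norm (z - x) * norm (z - y)"
proof -
  obtain L where L: "L \<ge> 0" "\<And>x y. onorm (\<lambda>v. frechet_derivative f (at x) v - frechet_derivative f (at y) v) \<le> L * norm (x - y)"
    using test_fun_derivative_Lipschitz[OF assms] by metis
  have "norm ((f (x - (z - y)) - f (x + (z - x) - (z - y))) - (f (x - 0) - f (x + (z - x) - 0))) \<le> (L * norm (z - x)) * norm ((z - y) - 0)" for x y z
  proof (rule differentiable_bound[where S=UNIV and f="\<lambda>h. f (x - h) - f (x + (z - x) - h)"
        and f'="\<lambda>h v. frechet_derivative f (at (x - h)) (- v) - frechet_derivative f (at (x + (z - x) - h)) (- v)"])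
    fix h
    have *: "((\<lambda>h. f (p - h)) has_derivative (\<lambda>v. frechet_derivative f (at (p - h)) (- v))) (at h)" for p
      by (rule has_derivative_compose[of "\<lambda>h. p - h" "\<lambda>v. - v", OF _ test_fun_has_derivative[OF assms]])
        (auto intro!: derivative_eq_intros)
    show "((\<lambda>h. f (x - h) - f (x + (z - x) - h)) has_derivative
       (\<lambda>v. frechet_derivative f (at (x - h)) (- v) - frechet_derivative f (at (x + (z - x) - h)) (- v))) (at h within UNIV)"
      by (intro has_derivative_diff) (use *[of x] *[of "x + (z - x)"] in auto)
    have "onorm (\<lambda>v. frechet_derivative f (at (x - h)) (- v) - frechet_derivative f (at (x + (z - x) - h)) (- v))
      = onorm (\<lambda>v. - (frechet_derivative f (at (x - h)) v - frechet_derivative f (at (x + (z - x) - h)) v))"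
      by (intro arg_cong[of _ _ onorm] ext)
         (simp add: linear_simps[OF bounded_linear_frechet[OF assms]])
    also have "\<dots> \<le> L * norm (x - h - (x + (z - x) - h))"
      unfolding onorm_neg by (rule L(2))
    finally show "onorm (\<lambda>v. frechet_derivative f (at (x - h)) (- v) - frechet_derivative f (at (x + (z - x) - h)) (- v)) \<le> L * norm (z - x)"
      by (simp add: norm_minus_commute)
  qed auto
  then show thesis
    by (intro that[OF L(1)]) (simp add: algebra_simps abs_minus_commute)
qed

section \<open>Integral operators with bounded kernels\<close>

text \<open>Square-integrable functions with bounded support; as they are also integrable, all
  integrals against bounded kernels below converge absolutely.\<close>

definition compact_L2 :: "('e::euclidean_space \<Rightarrow> real) \<Rightarrow> bool" where
  "compact_L2 f \<longleftrightarrow> f \<in> borel_measurable borel \<and> integrable lborel (\<lambda>x. (f x)\<^sup>2) \<and> bounded {x. f x \<noteq> 0}"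

lemma compact_L2_measurable: "compact_L2 f \<Longrightarrow> f \<in> borel_measurable borel"
  by (simp add: compact_L2_def)

lemma integrable_indicator_ball:
  "integrable lborel (indicator (ball c r) :: 'e::euclidean_space \<Rightarrow> real)"
  by (rule integrable_real_indicator) (simp, rule emeasure_lborel_ball_finite)

lemma integrable_bounded_support:
  fixes f :: "'e::euclidean_space \<Rightarrow> real"
  assumes [measurable]: "f \<in> borel_measurable borel" and "\<And>x. \<bar>f x\<bar> \<le> C" "bounded {x. f x \<noteq> 0}"
  shows "integrable lborel f"
proof -
  obtain R where R: "R > 0" "\<And>x. norm x \<ge> R \<Longrightarrow> f x = 0" using assms(3) test_fun_radius by metis
  have "integrable lborel (\<lambda>x. C * indicator (ball 0 R) x :: real)"
    by (intro integrable_mult_right integrable_indicator_ball)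
  then show ?thesis
    by (rule Bochner_Integration.integrable_bound)
       (use R assms(2) in \<open>auto simp: indicator_def not_less intro!: order_trans[OF _ abs_ge_self]\<close>)
qed

lemma compact_L2_integrable: "compact_L2 f \<Longrightarrow> integrable lborel f"
proof -
  assume f: "compact_L2 f"
  then have [measurable]: "f \<in> borel_measurable borel" by (rule compact_L2_measurable)
  obtain R where R: "R > 0" "\<And>x. norm x \<ge> R \<Longrightarrow> f x = 0"
    using f test_fun_radius unfolding compact_L2_def by metis
  have "integrable lborel (\<lambda>x. indicator (ball 0 R) x + (f x)\<^sup>2 :: real)"
    using f unfolding compact_L2_def
    by (intro Bochner_Integration.integrable_add integrable_indicator_ball) auto
  then show ?thesis
  proof (rule Bochner_Integration.integrable_bound)
    have "norm (f x) \<le> norm (indicator (ball 0 R) x + (f x)\<^sup>2 :: real)" for x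
    proof (cases "norm x < R")
      case True
      have "\<bar>f x\<bar> \<le> 1 + \<bar>f x\<bar>\<^sup>2" using zero_le_power2[of "\<bar>f x\<bar> - 1"] by (simp add: power2_eq_square algebra_simps)
      then show ?thesis using True by (auto simp: indicator_def)
    qed (use R in auto)
    then show "AE x in lborel. norm (f x) \<le> norm (indicator (ball 0 R) x + (f x)\<^sup>2 :: real)" by simp
  qed simp
qed

lemma compact_L2_bounded_mult:
  assumes "compact_L2 f" and [measurable]: "k \<in> borel_measurable borel" and k: "\<And>x. \<bar>k x\<bar> \<le> (C::real)"
  shows "compact_L2 (\<lambda>x. k x * f x)"
proof -
  have [measurable]: "f \<in> borel_measurable borel" using assms(1) by (rule compact_L2_measurable)
  have "integrable lborel (\<lambda>x. (k x * f x)\<^sup>2)"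
  proof (rule Bochner_Integration.integrable_bound)
    show "integrable lborel (\<lambda>x. C\<^sup>2 * (f x)\<^sup>2)" using assms(1) by (simp add: compact_L2_def)
    have "(k x)\<^sup>2 \<le> C\<^sup>2" for x using power_mono[OF k[of x], of 2] by simp
    then show "AE x in lborel. norm ((k x * f x)\<^sup>2) \<le> norm (C\<^sup>2 * (f x)\<^sup>2)"
      by (simp add: power_mult_distrib mult_right_mono)
  qed simp
  moreover have "bounded {x. k x * f x \<noteq> 0}"
    using assms(1) by (auto simp: compact_L2_def intro: bounded_subset)
  ultimately show ?thesis by (simp add: compact_L2_def)
qed

lemma compact_L2_test_fun: "test_fun f \<Longrightarrow> compact_L2 f"
proof -
  assume f: "test_fun f"
  obtain C where "C \<ge> 0" and C: "\<And>x. \<bar>f x\<bar> \<le> C" using test_fun_bounded[OF f] by metis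
  have [measurable]: "f \<in> borel_measurable borel" using f by (rule test_fun_measurable)
  have "integrable lborel (\<lambda>x. (f x)\<^sup>2)"
  proof (rule integrable_bounded_support[where C="C\<^sup>2"])
    show "\<bar>(f x)\<^sup>2\<bar> \<le> C\<^sup>2" for x using power_mono[OF C[of x], of 2] by simp
  qed (use f in \<open>simp_all add: test_fun_def\<close>)
  then show ?thesis using f by (simp add: compact_L2_def test_fun_def)
qed

lemma integrable_product_kernel:
  fixes k :: "'e::euclidean_space \<Rightarrow> 'e \<Rightarrow> real"
  assumes f: "integrable lborel f" and g: "integrable lborel g"
    and [measurable]: "(\<lambda>(x, y). k x y) \<in> borel_measurable (borel \<Otimes>\<^sub>M borel)"
    and k: "\<And>x y. \<bar>k x y\<bar> \<le> (C::real)"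
  shows "integrable (lborel \<Otimes>\<^sub>M lborel) (\<lambda>(x, y). f x * (k x y * g y))"
proof -
  have [measurable]: "f \<in> borel_measurable borel" "g \<in> borel_measurable borel"
    using f g by (auto dest: borel_measurable_integrable)
  have fg: "integrable (lborel \<Otimes>\<^sub>M lborel) (\<lambda>(x, y). f x * g y)"
  proof (rule lborel_pair.Fubini_integrable)
    show "integrable lborel (\<lambda>x. \<integral>y. norm (case (x, y) of (x, y) \<Rightarrow> f x * g y) \<partial>lborel)"
      using f g by (simp add: abs_mult)
    show "AE x in lborel. integrable lborel (\<lambda>y. case (x, y) of (x, y) \<Rightarrow> f x * g y)"
      using g by simp
  qed simp
  then have "integrable (lborel \<Otimes>\<^sub>M lborel) (\<lambda>p. C * (case p of (x, y) \<Rightarrow> f x * g y))" by simp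
  then show ?thesis
  proof (rule Bochner_Integration.integrable_bound)
    have "\<bar>k x y\<bar> * (\<bar>f x\<bar> * \<bar>g y\<bar>) \<le> \<bar>C\<bar> * (\<bar>f x\<bar> * \<bar>g y\<bar>)" for x y
      by (intro mult_right_mono) (use k[of x y] in auto)
    then show "AE p in lborel \<Otimes>\<^sub>M lborel. norm (case p of (x, y) \<Rightarrow> f x * (k x y * g y))
       \<le> norm (C * (case p of (x, y) \<Rightarrow> f x * g y))"
      by (auto simp: abs_mult mult_ac split: prod.splits)
  qed simp
qed

lemma kernel_Fubini:
  fixes k :: "'e::euclidean_space \<Rightarrow> 'e \<Rightarrow> real"
  assumes "integrable lborel f" "integrable lborel g"
    "(\<lambda>(x, y). k x y) \<in> borel_measurable (borel \<Otimes>\<^sub>M borel)" "\<And>x y. \<bar>k x y\<bar> \<le> C"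
  shows "(\<integral>x. f x * (\<integral>y. k x y * g y \<partial>lborel) \<partial>lborel) = (\<integral>y. (\<integral>x. f x * k x y \<partial>lborel) * g y \<partial>lborel)"
proof -
  have "integrable (lborel \<Otimes>\<^sub>M lborel) (\<lambda>(x, y). f x * (k x y * g y))"
    by (rule integrable_product_kernel) (use assms in auto)
  then have "(\<integral>y. (\<integral>x. f x * (k x y * g y) \<partial>lborel) \<partial>lborel) = (\<integral>x. (\<integral>y. f x * (k x y * g y) \<partial>lborel) \<partial>lborel)"
    by (rule lborel_pair.Fubini_integral)
  then show ?thesis by (simp add: mult.assoc[symmetric]) (simp add: mult.assoc)
qed

lemma lborel_integral_reflect:
  fixes f :: "'e::euclidean_space \<Rightarrow> real"
  assumes [measurable]: "f \<in> borel_measurable borel"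
  shows "(\<integral>z. f (t - z) \<partial>lborel) = (\<integral>z. f z \<partial>lborel)"
    and "integrable lborel (\<lambda>z. f (t - z)) \<longleftrightarrow> integrable lborel f"
proof -
  have "(lborel :: 'e measure) = density (distr lborel borel (\<lambda>x. t + (-1) *\<^sub>R x)) (\<lambda>_. ennreal (\<bar>-1\<bar> ^ DIM('e)))"
    by (rule lborel_affine) simp
  also have "\<dots> = distr lborel borel (\<lambda>x. t - x)" by (simp add: density_1)
  finally have *: "(lborel :: 'e measure) = distr lborel borel (\<lambda>x. t - x)" .
  show "(\<integral>z. f (t - z) \<partial>lborel) = (\<integral>z. f z \<partial>lborel)"
    by (subst (2) *) (simp add: integral_distr)
  show "integrable lborel (\<lambda>z. f (t - z)) \<longleftrightarrow> integrable lborel f"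
    by (subst (2) *) (simp add: integrable_distr_eq)
qed

definition ball_vol :: "'e::euclidean_space itself \<Rightarrow> real \<Rightarrow> real" where
  "ball_vol _ r = unit_ball_vol (real DIM('e)) * r ^ DIM('e)"

lemma integral_ball_indicator:
  assumes "r \<ge> 0"
  shows "integrable lborel (\<lambda>y. indicator (ball x r) (y::'e::euclidean_space) :: real)"
    "(\<integral>y. indicator (ball x r) (y::'e) \<partial>lborel) = ball_vol TYPE('e) r"
    "integrable lborel (\<lambda>y. indicator (ball y r) (x::'e::euclidean_space) :: real)"
    "(\<integral>y. indicator (ball y r) (x::'e) \<partial>lborel) = ball_vol TYPE('e) r"
proof -
  show 1: "integrable lborel (\<lambda>y. indicator (ball x r) (y::'e) :: real)"
    using integrable_indicator_ball[of x r] by simp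
  show 2: "(\<integral>y. indicator (ball x r) (y::'e) \<partial>lborel) = ball_vol TYPE('e) r"
    using content_ball[OF assms, of x] by (simp add: ball_vol_def)
  have *: "(\<lambda>y. indicator (ball y r) x :: real) = indicator (ball x r)"
    by (auto simp: indicator_def dist_commute fun_eq_iff)
  show "integrable lborel (\<lambda>y. indicator (ball y r) (x::'e::euclidean_space) :: real)"
    "(\<integral>y. indicator (ball y r) (x::'e) \<partial>lborel) = ball_vol TYPE('e) r"
    unfolding * using 1 2 by auto
qed

lemma ball_vol_nonneg: "r \<ge> 0 \<Longrightarrow> ball_vol T r \<ge> 0"
  by (simp add: ball_vol_def)

text \<open>Schur's test. The arithmetic-geometric mean inequality replaces Cauchy--Schwarz.\<close>

lemma Schur_test:
  fixes k :: "'e::euclidean_space \<Rightarrow> 'e \<Rightarrow> real"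
  assumes f: "compact_L2 f" and g: "compact_L2 g" and r: "r \<ge> 0"
    and k[measurable]: "(\<lambda>(x, y). k x y) \<in> borel_measurable (borel \<Otimes>\<^sub>M borel)"
    and kC: "\<And>x y. \<bar>k x y\<bar> \<le> C" and k0: "\<And>x y. norm (x - y) \<ge> r \<Longrightarrow> k x y = 0"
  shows "\<bar>\<integral>x. f x * (\<integral>y. k x y * g y \<partial>lborel) \<partial>lborel\<bar>
    \<le> C * ball_vol TYPE('e) r * ((\<integral>x. (f x)\<^sup>2 \<partial>lborel) + (\<integral>x. (g x)\<^sup>2 \<partial>lborel)) / 2"
proof -
  have [measurable]: "f \<in> borel_measurable borel" "g \<in> borel_measurable borel" using f g compact_L2_measurable by blast+
  have C: "C \<ge> 0" using kC[of 0 0] by auto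
  let ?B = "\<lambda>x y::'e. indicator (ball x r) y :: real"
  have fi: "integrable lborel (\<lambda>x. (f x)\<^sup>2)" and gi: "integrable lborel (\<lambda>x. (g x)\<^sup>2)"
    using f g by (auto simp: compact_L2_def)
  have content: "measure lborel (ball (x::'e) r) = ball_vol TYPE('e) r" for x
    using content_ball[OF r, of x] by (simp add: ball_vol_def)
  have B_alt: "?B x y = (if norm (x - y) < r then 1 else 0)" for x y by (auto simp: indicator_def dist_norm)
  have Bm[measurable]: "(\<lambda>(x, y). ?B x y) \<in> borel_measurable (borel \<Otimes>\<^sub>M borel)"
    unfolding B_alt by measurable
  have I1: "integrable (lborel \<Otimes>\<^sub>M lborel) (\<lambda>(x, y). (f x)\<^sup>2 * ?B x y)"
  proof (rule lborel_pair.Fubini_integrable)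
    show "integrable lborel (\<lambda>x. \<integral>y. norm (case (x, y) of (x, y) \<Rightarrow> (f x)\<^sup>2 * ?B x y) \<partial>lborel)"
      using fi by (simp add: abs_mult integral_ball_indicator[OF r] content)
    show "AE x in lborel. integrable lborel (\<lambda>y. case (x, y) of (x, y) \<Rightarrow> (f x)\<^sup>2 * ?B x y)"
      by (simp add: integrable_indicator_ball)
  qed simp
  have I2': "integrable (lborel \<Otimes>\<^sub>M lborel) (\<lambda>(y, x). (g y)\<^sup>2 * ?B x y)"
  proof (rule lborel_pair.Fubini_integrable)
    show "integrable lborel (\<lambda>y. \<integral>x. norm (case (y, x) of (y, x) \<Rightarrow> (g y)\<^sup>2 * ?B x y) \<partial>lborel)"
      using gi by (simp add: abs_mult integral_ball_indicator[OF r] content)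
    show "AE y in lborel. integrable lborel (\<lambda>x. case (y, x) of (y, x) \<Rightarrow> (g y)\<^sup>2 * ?B x y)"
      by (simp add: integral_ball_indicator(3)[OF r])
  qed simp
  have I2: "integrable (lborel \<Otimes>\<^sub>M lborel) (\<lambda>(x, y). (g y)\<^sup>2 * ?B x y)"
    using lborel_pair.integrable_product_swap[OF I2'] by (simp add: case_prod_beta)
  let ?F = "\<lambda>(x, y). f x * (k x y * g y)"
  let ?G = "\<lambda>p. C / 2 * ((case p of (x, y) \<Rightarrow> (f x)\<^sup>2 * ?B x y) + (case p of (x, y) \<Rightarrow> (g y)\<^sup>2 * ?B x y))"
  have IG: "integrable (lborel \<Otimes>\<^sub>M lborel) ?G"
    by (rule integrable_mult_right[OF Bochner_Integration.integrable_add[OF I1 I2]])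
  have IF: "integrable (lborel \<Otimes>\<^sub>M lborel) ?F"
    by (rule integrable_product_kernel[where C=C]) (use f g kC compact_L2_integrable in auto)
  have le: "\<bar>?F p\<bar> \<le> ?G p" for p
  proof -
    obtain x y where p: "p = (x, y)" by force
    show ?thesis
    proof (cases "norm (x - y) < r")
      case True
      have "\<bar>f x\<bar> * \<bar>g y\<bar> \<le> ((f x)\<^sup>2 + (g y)\<^sup>2) / 2"
        using zero_le_power2[of "\<bar>f x\<bar> - \<bar>g y\<bar>"] by (simp add: power2_eq_square algebra_simps)
      moreover have "\<bar>k x y\<bar> * (\<bar>f x\<bar> * \<bar>g y\<bar>) \<le> C * (\<bar>f x\<bar> * \<bar>g y\<bar>)"
        by (intro mult_right_mono kC) auto
      ultimately have "\<bar>k x y\<bar> * (\<bar>f x\<bar> * \<bar>g y\<bar>) \<le> C * (((f x)\<^sup>2 + (g y)\<^sup>2) / 2)"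
        using C by (meson mult_left_mono order_trans)
      then show ?thesis using True by (simp add: p B_alt abs_mult mult_ac del: indicator_simps)
    qed (use k0[of x y] C in \<open>simp add: p B_alt\<close>)
  qed
  have "(\<integral>x. f x * (\<integral>y. k x y * g y \<partial>lborel) \<partial>lborel) = (\<integral>x. (\<integral>y. f x * (k x y * g y) \<partial>lborel) \<partial>lborel)"
    by simp
  also have "\<dots> = integral\<^sup>L (lborel \<Otimes>\<^sub>M lborel) ?F" by (rule lborel_pair.integral_fst[OF IF])
  also have "\<bar>\<dots>\<bar> \<le> integral\<^sup>L (lborel \<Otimes>\<^sub>M lborel) ?G"
    by (intro integral_abs_bound_integral IF IG le)
  also have "\<dots> = C / 2 * ((\<integral>(x, y). (f x)\<^sup>2 * ?B x y \<partial>(lborel \<Otimes>\<^sub>M lborel)) + (\<integral>(x, y). (g y)\<^sup>2 * ?B x y \<partial>(lborel \<Otimes>\<^sub>M lborel)))"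
    unfolding integral_mult_right_zero by (subst Bochner_Integration.integral_add[OF I1 I2]) simp
  also have "(\<integral>(x, y). (f x)\<^sup>2 * ?B x y \<partial>(lborel \<Otimes>\<^sub>M lborel)) = ball_vol TYPE('e) r * (\<integral>x. (f x)\<^sup>2 \<partial>lborel)"
    using lborel_pair.integral_fst[OF I1] by (simp add: integral_ball_indicator[OF r] content mult.commute)
  also have "(\<integral>(x, y). (g y)\<^sup>2 * ?B x y \<partial>(lborel \<Otimes>\<^sub>M lborel)) = ball_vol TYPE('e) r * (\<integral>x. (g x)\<^sup>2 \<partial>lborel)"
    using lborel_pair.integral_snd[OF I2] by (simp add: integral_ball_indicator[OF r] content mult.commute)
  finally show ?thesis by (simp add: algebra_simps)
qed

section \<open>Convolution\<close>

definition conv :: "('e::euclidean_space \<Rightarrow> real) \<Rightarrow> ('e \<Rightarrow> real) \<Rightarrow> 'e \<Rightarrow> real" where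
  "conv k v z = (\<integral>x. k (z - x) * v x \<partial>lborel)"

lemma conv_commute:
  assumes [measurable]: "k \<in> borel_measurable borel" "v \<in> borel_measurable borel"
  shows "conv k v z = conv v k z"
  unfolding conv_def
  using lborel_integral_reflect(1)[of "\<lambda>x. k (z - x) * v x" z] by (simp add: mult.commute)

lemma integrable_conv_integrand:
  assumes "test_fun k" "integrable lborel v"
  shows "integrable lborel (\<lambda>x. k (z - x) * v x)"
proof -
  obtain C where "C \<ge> 0" and C: "\<And>x. \<bar>k x\<bar> \<le> C" using test_fun_bounded[OF assms(1)] by metis
  have [measurable]: "k \<in> borel_measurable borel" "v \<in> borel_measurable borel"
    using assms test_fun_measurable borel_measurable_integrable by auto
  have "integrable lborel (\<lambda>x. C * v x)" using assms by simp
  then show ?thesis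
    by (rule Bochner_Integration.integrable_bound)
      (use C \<open>C \<ge> 0\<close> in \<open>auto simp: abs_mult intro!: mult_right_mono\<close>)
qed

lemma conv_has_derivative:
  assumes k: "test_fun k" and v: "integrable lborel v"
  shows "(conv k v has_derivative (\<lambda>h. \<Sum>b\<in>Basis. (h \<bullet> b) * conv (dirderiv b k) v z)) (at z)"
proof -
  obtain C where C: "C \<ge> 0" "\<And>x h. \<bar>k (x + h) - k x - frechet_derivative k (at x) h\<bar> \<le> C * (norm h)\<^sup>2"
    using test_fun_Taylor[OF k] by metis
  have i: "integrable lborel (\<lambda>x. k (y - x) * v x)" "integrable lborel (\<lambda>x. dirderiv b k (y - x) * v x)" for y b
    using integrable_conv_integrand k v test_fun_dirderiv by blast+
  have expand: "frechet_derivative k (at x) h = (\<Sum>b\<in>Basis. (h \<bullet> b) * dirderiv b k x)" for x h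
    using has_derivative_expand_Basis[OF test_fun_has_derivative[OF k], of x h] by simp
  show ?thesis
  proof (rule has_derivativeI_sandwich[of 1, where H="\<lambda>y. C * (\<integral>x. \<bar>v x\<bar> \<partial>lborel) * norm (y - z)"])
    show "bounded_linear (\<lambda>h. \<Sum>b\<in>Basis. (h \<bullet> b) * conv (dirderiv b k) v z)"
      by (intro bounded_linear_sum bounded_linear_mult_left[THEN bounded_linear_compose] bounded_linear_inner_left)
    show "((\<lambda>y. C * (\<integral>x. \<bar>v x\<bar> \<partial>lborel) * norm (y - z)) \<longlongrightarrow> 0) (at z within UNIV)"
      by (auto intro!: tendsto_eq_intros)
    fix y assume "y \<noteq> z"
    let ?D = "\<lambda>x. k (y - x) * v x - k (z - x) * v x - (\<Sum>b\<in>Basis. ((y - z) \<bullet> b) * (dirderiv b k (z - x) * v x))"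
    have pw: "\<bar>?D x\<bar> \<le> C * (norm (y - z))\<^sup>2 * \<bar>v x\<bar>" for x
    proof -
      have "?D x = (k (y - x) - k (z - x) - frechet_derivative k (at (z - x)) (y - z)) * v x"
        unfolding expand[of "z - x" "y - z"] by (simp add: left_diff_distrib sum_distrib_right mult.assoc)
      moreover have "\<bar>k (y - x) - k (z - x) - frechet_derivative k (at (z - x)) (y - z)\<bar> \<le> C * (norm (y - z))\<^sup>2"
        using C(2)[of "z - x" "y - z"] by simp
      ultimately show ?thesis by (simp add: abs_mult mult_right_mono)
    qed
    have "conv k v y - conv k v z - (\<Sum>b\<in>Basis. ((y - z) \<bullet> b) * conv (dirderiv b k) v z) = (\<integral>x. ?D x \<partial>lborel)"
      unfolding conv_def by (simp add: i)
    also have "norm \<dots> \<le> (\<integral>x. C * (norm (y - z))\<^sup>2 * \<bar>v x\<bar> \<partial>lborel)"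
    proof (rule Bochner_Integration.integral_norm_bound_integral)
      show "integrable lborel ?D" by (simp add: i)
    qed (use v pw in simp_all)
    finally show "norm (conv k v y - conv k v z - (\<Sum>b\<in>Basis. ((y - z) \<bullet> b) * conv (dirderiv b k) v z)) / norm (y - z)
       \<le> C * (\<integral>x. \<bar>v x\<bar> \<partial>lborel) * norm (y - z)"
      using \<open>y \<noteq> z\<close> by (simp add: divide_simps power2_eq_square mult_ac)
  qed auto
qed

lemma dirderiv_conv:
  assumes k: "test_fun k" and v: "integrable lborel v"
  shows "dirderiv b (conv k v) z = conv (dirderiv b k) v z"
proof -
  have "dirderiv b (conv k v) z = (\<Sum>c\<in>Basis. (b \<bullet> c) * conv (dirderiv c k) v z)"
    unfolding frechet_derivative_at[OF conv_has_derivative[OF k v], symmetric] ..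
  also have "\<dots> = (\<integral>x. (\<Sum>c\<in>Basis. (b \<bullet> c) * (dirderiv c k (z - x) * v x)) \<partial>lborel)"
    unfolding conv_def
    by (simp add: integral_sum integrable_conv_integrand[OF test_fun_dirderiv[OF k] v])
  also have "\<dots> = conv (dirderiv b k) v z"
    unfolding conv_def
    unfolding has_derivative_expand_Basis[OF test_fun_has_derivative[OF k], of _ b]
    by (simp add: sum_distrib_right mult.assoc)
  finally show ?thesis .
qed

lemma smooth_on_conv:
  assumes "test_fun k" "integrable lborel v"
  shows "smooth_on UNIV (conv k v)"
proof -
  have "C_k_on n UNIV (conv k v)" if "test_fun k" for n k
    using that
  proof (induction n arbitrary: k)
    case 0
    then show ?case
      by (auto intro!: continuous_at_imp_continuous_on has_derivative_continuous conv_has_derivative assms)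
  next
    case (Suc n)
    show ?case
    proof (rule C_k_on_SucI[OF _ conv_has_derivative[OF Suc.prems assms(2)]])
      fix h show "C_k_on n UNIV (\<lambda>x. \<Sum>b\<in>Basis. (h \<bullet> b) * conv (dirderiv b k) v x)"
        by (intro C_k_on_sum C_k_on_bilinear[OF _ bounded_bilinear_mult] C_k_on_const Suc test_fun_dirderiv) auto
    qed auto
  qed
  then show ?thesis using assms by (simp add: smooth_on_def)
qed

lemma conv_eq_0:
  assumes "\<And>x. norm x \<ge> r \<Longrightarrow> k x = 0" "\<And>x. v x \<noteq> 0 \<Longrightarrow> norm (z - x) \<ge> r"
  shows "conv k v z = 0"
proof -
  have "k (z - x) * v x = 0" for x using assms by (cases "v x = 0") auto
  then have "(\<lambda>x. k (z - x) * v x) = (\<lambda>_. 0)" by (rule ext)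
  then show ?thesis by (simp add: conv_def)
qed

lemma test_fun_conv:
  assumes k: "test_fun k" and v: "compact_L2 v"
  shows "test_fun (conv k v)"
proof -
  obtain R1 where R1: "R1 > 0" "\<And>x. norm x \<ge> R1 \<Longrightarrow> k x = 0"
    using k test_fun_radius unfolding test_fun_def by metis
  obtain R2 where R2: "R2 > 0" "\<And>x. norm x \<ge> R2 \<Longrightarrow> v x = 0"
    using v test_fun_radius unfolding compact_L2_def by metis
  have "conv k v z = 0" if "norm z \<ge> R1 + R2" for z
  proof (rule conv_eq_0[OF R1(2)])
    fix x assume "v x \<noteq> 0"
    then have "norm x < R2" using R2 by (meson not_less)
    then show "R1 \<le> norm (z - x)" using that norm_triangle_ineq2[of z x] by linarith
  qed
  then have "bounded {x. conv k v x \<noteq> 0}"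
    by (intro boundedI[of _ "R1 + R2"]) (use linear in blast)
  then show ?thesis using smooth_on_conv[OF k compact_L2_integrable[OF v]] by (simp add: test_fun_def)
qed

lemma dirderiv_conv':
  assumes "test_fun j" "test_fun g"
  shows "dirderiv b (conv j g) z = conv j (dirderiv b g) z"
proof -
  have [measurable]: "j \<in> borel_measurable borel" "g \<in> borel_measurable borel"
    "dirderiv b g \<in> borel_measurable borel"
    using assms test_fun_dirderiv[of g b] test_fun_measurable by auto
  have "conv j g = conv g j" by (intro ext conv_commute) auto
  then have "dirderiv b (conv j g) z = conv (dirderiv b g) j z"
    using dirderiv_conv[OF assms(2) compact_L2_integrable[OF compact_L2_test_fun[OF assms(1)]]] by simp
  also have "\<dots> = conv j (dirderiv b g) z" by (intro conv_commute) auto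
  finally show ?thesis .
qed

lemma integral_conv_square_le:
  fixes j :: "'e::euclidean_space \<Rightarrow> real"
  assumes j: "test_fun j" and jr: "\<And>x. norm x \<ge> r \<Longrightarrow> j x = 0" and r: "r > 0"
    and jc: "\<And>x. \<bar>j x\<bar> \<le> c" and v: "compact_L2 v"
  shows "(\<integral>x. (conv j v x)\<^sup>2 \<partial>lborel) \<le> (c * ball_vol TYPE('e) r)\<^sup>2 * (\<integral>x. (v x)\<^sup>2 \<partial>lborel)"
proof -
  define m where "m = c * ball_vol TYPE('e) r"
  have [measurable]: "j \<in> borel_measurable borel" "v \<in> borel_measurable borel" using j v test_fun_measurable compact_L2_measurable by auto
  have c: "c \<ge> 0" using jc[of 0] by auto
  let ?g = "conv j v"
  have g: "compact_L2 ?g" by (intro compact_L2_test_fun test_fun_conv j v)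
  show ?thesis
  proof (cases "m = 0")
    case True
    moreover have "ball_vol TYPE('e) r > 0" unfolding ball_vol_def
      by (intro mult_pos_pos unit_ball_vol_pos) (use r in auto)
    ultimately have "c = 0" by (simp add: m_def)
    then have "j x = 0" for x using jc[of x] by auto
    then show ?thesis by (simp add: conv_def)
  next
    case False
    then have m: "m > 0" using ball_vol_nonneg[of r "TYPE('e)"] r c by (simp add: m_def less_eq_real_def)
    let ?s = "sqrt m"
    have s: "?s > 0" "?s\<^sup>2 = m" using m by auto
    have f1: "compact_L2 (\<lambda>x. inverse ?s * ?g x)" "compact_L2 (\<lambda>x. ?s * v x)"
      by (rule compact_L2_bounded_mult[OF g, where C="inverse ?s"], use s in auto)
         (rule compact_L2_bounded_mult[OF v, where C="?s"], use s in auto)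
    have "\<bar>\<integral>x. (inverse ?s * ?g x) * (\<integral>y. j (x - y) * (?s * v y) \<partial>lborel) \<partial>lborel\<bar>
      \<le> c * ball_vol TYPE('e) r * ((\<integral>x. (inverse ?s * ?g x)\<^sup>2 \<partial>lborel) + (\<integral>x. (?s * v x)\<^sup>2 \<partial>lborel)) / 2"
      by (rule Schur_test[OF f1]) (use r jr jc in auto)
    also have "(\<integral>x. (inverse ?s * ?g x) * (\<integral>y. j (x - y) * (?s * v y) \<partial>lborel) \<partial>lborel) = (\<integral>x. (?g x)\<^sup>2 \<partial>lborel)"
    proof (rule Bochner_Integration.integral_cong[OF refl])
      fix x
      have "(\<integral>y. j (x - y) * (?s * v y) \<partial>lborel) = (\<integral>y. ?s * (j (x - y) * v y) \<partial>lborel)" by (simp add: mult_ac)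
      also have "\<dots> = ?s * ?g x" by (simp add: conv_def)
      finally show "(inverse ?s * ?g x) * (\<integral>y. j (x - y) * (?s * v y) \<partial>lborel) = (?g x)\<^sup>2"
        using s m by (simp add: power2_eq_square)
    qed
    finally have "(\<integral>x. (?g x)\<^sup>2 \<partial>lborel) \<le> m * (inverse m * (\<integral>x. (?g x)\<^sup>2 \<partial>lborel) + m * (\<integral>x. (v x)\<^sup>2 \<partial>lborel)) / 2"
      using m by (simp add: m_def[symmetric] power_mult_distrib power_inverse)
    moreover have "m * (inverse m * X + m * Y) = X + m\<^sup>2 * Y" for X Y
      using m by (simp add: field_simps power2_eq_square)
    ultimately have "(\<integral>x. (?g x)\<^sup>2 \<partial>lborel) \<le> ((\<integral>x. (?g x)\<^sup>2 \<partial>lborel) + m\<^sup>2 * (\<integral>x. (v x)\<^sup>2 \<partial>lborel)) / 2"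
      by (simp only:)
    moreover have "X \<le> Z" if "X \<le> (X + Z) / 2" for X Z :: real using that by simp
    ultimately show ?thesis unfolding m_def[symmetric] by blast
  qed
qed

section \<open>The double commutator estimate\<close>

lemma dirderiv_mult:
  assumes "test_fun f" "test_fun g"
  shows "frechet_derivative (\<lambda>x. f x * g x) (at x) a
    = frechet_derivative f (at x) a * g x + f x * frechet_derivative g (at x) a"
proof -
  have "((\<lambda>x. f x * g x) has_derivative
     (\<lambda>h. f x * frechet_derivative g (at x) h + frechet_derivative f (at x) h * g x)) (at x)"
    by (intro has_derivative_mult test_fun_has_derivative assms)
  from frechet_derivative_at[OF this] show ?thesis by (metis add.commute)
qed

lemma dirderiv_even:
  assumes "test_fun j" "\<And>x. j (- x) = j x"
  shows "frechet_derivative j (at (- x)) a = - frechet_derivative j (at x) a"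
proof -
  have "((\<lambda>x. j (- x)) has_derivative (\<lambda>v. frechet_derivative j (at (- x)) (- v))) (at x)"
    by (rule has_derivative_compose[of uminus uminus, OF _ test_fun_has_derivative[OF assms(1)]])
      (auto intro!: derivative_eq_intros)
  then have "(j has_derivative (\<lambda>v. frechet_derivative j (at (- x)) (- v))) (at x)"
    unfolding assms(2) .
  from frechet_derivative_at[OF this] have "frechet_derivative j (at x) a = frechet_derivative j (at (- x)) (- a)"
    by metis
  also have "\<dots> = - frechet_derivative j (at (- x)) a"
    by (rule linear_simps(4)[OF bounded_linear_frechet[OF assms(1)]])
  finally show ?thesis by simp
qed

definition bounded_kernel :: "('e::euclidean_space \<Rightarrow> 'e \<Rightarrow> real) \<Rightarrow> bool" where
  "bounded_kernel k \<longleftrightarrow> (\<lambda>(x, y). k x y) \<in> borel_measurable (borel \<Otimes>\<^sub>M borel) \<and> (\<exists>C. \<forall>x y. \<bar>k x y\<bar> \<le> C)"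

definition kernel_form :: "('e::euclidean_space \<Rightarrow> real) \<Rightarrow> ('e \<Rightarrow> 'e \<Rightarrow> real) \<Rightarrow> ('e \<Rightarrow> real) \<Rightarrow> real" where
  "kernel_form f k g = (\<integral>x. f x * (\<integral>y. k x y * g y \<partial>lborel) \<partial>lborel)"

lemma bounded_kernel_section:
  assumes k: "bounded_kernel k" and g: "integrable lborel g"
  shows "integrable lborel (\<lambda>y. k x y * g y)"
proof -
  obtain C where C: "\<And>x y. \<bar>k x y\<bar> \<le> C" using k by (auto simp: bounded_kernel_def)
  have [measurable]: "(\<lambda>(x, y). k x y) \<in> borel_measurable (borel \<Otimes>\<^sub>M borel)" "g \<in> borel_measurable borel"
    using k g borel_measurable_integrable by (auto simp: bounded_kernel_def)
  have "integrable lborel (\<lambda>y. C * g y)" using g by simp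
  then show ?thesis
  proof (rule Bochner_Integration.integrable_bound)
    have "\<bar>k x y\<bar> * \<bar>g y\<bar> \<le> \<bar>C\<bar> * \<bar>g y\<bar>" for y
      by (rule mult_right_mono) (use C[of x y] in auto)
    then show "AE y in lborel. norm (k x y * g y) \<le> norm (C * g y)" by (simp add: abs_mult)
  qed measurable
qed

lemma kernel_form_integrable:
  assumes k: "bounded_kernel k" and "integrable lborel f" "integrable lborel g"
  shows "integrable lborel (\<lambda>x. f x * (\<integral>y. k x y * g y \<partial>lborel))"
proof -
  obtain C where C: "\<And>x y. \<bar>k x y\<bar> \<le> C" using k by (auto simp: bounded_kernel_def)
  have "integrable (lborel \<Otimes>\<^sub>M lborel) (\<lambda>(x, y). f x * (k x y * g y))"
    by (rule integrable_product_kernel[where C=C]) (use assms C in \<open>auto simp: bounded_kernel_def\<close>)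
  from lborel_pair.integrable_fst[OF this] show ?thesis by simp
qed

lemma kernel_form_swap:
  assumes k: "bounded_kernel k" and "integrable lborel f" "integrable lborel g"
  shows "kernel_form f k g = kernel_form g (\<lambda>y x. k x y) f"
proof -
  obtain C where C: "\<And>x y. \<bar>k x y\<bar> \<le> C" using k by (auto simp: bounded_kernel_def)
  have m: "(\<lambda>(x, y). k x y) \<in> borel_measurable (borel \<Otimes>\<^sub>M borel)" using k by (simp add: bounded_kernel_def)
  show ?thesis
    unfolding kernel_form_def kernel_Fubini[OF assms(2,3) m C] by (simp add: mult.commute)
qed

lemma bounded_kernel_add:
  assumes "bounded_kernel k" "bounded_kernel l"
  shows "bounded_kernel (\<lambda>x y. k x y + l x y)"
proof -
  from assms obtain C D where C: "\<And>x y. \<bar>k x y\<bar> \<le> C" "\<And>x y. \<bar>l x y\<bar> \<le> D"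
    by (auto simp: bounded_kernel_def)
  have "\<bar>k x y + l x y\<bar> \<le> C + D" for x y using C[of x y] by linarith
  moreover have [measurable]: "(\<lambda>(x, y). k x y) \<in> borel_measurable (borel \<Otimes>\<^sub>M borel)"
    "(\<lambda>(x, y). l x y) \<in> borel_measurable (borel \<Otimes>\<^sub>M borel)" using assms by (auto simp: bounded_kernel_def)
  have "(\<lambda>(x, y). k x y + l x y) \<in> borel_measurable (borel \<Otimes>\<^sub>M borel)" by measurable
  ultimately show ?thesis unfolding bounded_kernel_def by blast
qed

lemma kernel_form_add:
  assumes k: "bounded_kernel k" "bounded_kernel l" and fg: "integrable lborel f" "integrable lborel g"
  shows "kernel_form f k g + kernel_form f l g = kernel_form f (\<lambda>x y. k x y + l x y) g"
  unfolding kernel_form_def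
  by (simp add: distrib_right distrib_left bounded_kernel_section kernel_form_integrable k fg)

lemma bounded_kernel_swap: "bounded_kernel k \<Longrightarrow> bounded_kernel (\<lambda>x y. k y x)"
proof -
  assume k: "bounded_kernel k"
  then have "(\<lambda>(x, y). k x y) \<in> borel_measurable (borel \<Otimes>\<^sub>M borel)" by (simp add: bounded_kernel_def)
  from measurable_pair_swap[OF this] have "(\<lambda>(x, y). k y x) \<in> borel_measurable (borel \<Otimes>\<^sub>M borel)"
    by (simp add: case_prod_beta)
  with k show ?thesis by (auto simp: bounded_kernel_def)
qed

lemma bounded_kernel_translate:
  assumes "test_fun l" shows "bounded_kernel (\<lambda>z y. l (z - y))"
proof -
  have [measurable]: "l \<in> borel_measurable borel" by (rule test_fun_measurable[OF assms])
  have "(\<lambda>(z, y). l (z - y)) \<in> borel_measurable (borel \<Otimes>\<^sub>M borel)" by measurable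
  moreover obtain C where "\<And>x. \<bar>l x\<bar> \<le> C" using test_fun_bounded[OF assms] by metis
  ultimately show ?thesis unfolding bounded_kernel_def by blast
qed

lemma kernel_form_conv:
  assumes k: "bounded_kernel k" and ki: "\<And>x. integrable lborel (k x)" and l: "test_fun l"
    and v: "integrable lborel v"
  shows "kernel_form f k (conv l v) = kernel_form f (\<lambda>x y. \<integral>z. k x z * l (z - y) \<partial>lborel) v"
proof -
  obtain C where C: "\<And>z y. \<bar>l (z - y)\<bar> \<le> C" and m: "(\<lambda>(z, y). l (z - y)) \<in> borel_measurable (borel \<Otimes>\<^sub>M borel)"
    using bounded_kernel_translate[OF l] by (auto simp: bounded_kernel_def)
  show ?thesis
    unfolding kernel_form_def conv_def by (subst kernel_Fubini[OF ki v m C]) simp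
qed

text \<open>Both terms are quadratic forms in \<open>v\<close> with kernels supported in \<open>\<bar>x - y\<bar> \<le> 2 r\<close>, and their
  sum is unchanged when the kernel is symmetrised in \<open>x\<close> and \<open>y\<close>. As \<open>j\<close> is even, the
  reflection \<open>z \<mapsto> x + y - z\<close> exchanges the two factors under the integral over \<open>z\<close>. After both
  symmetrisations \<open>\<alpha>\<close> appears only in its second difference and \<open>dirderiv a \<alpha>\<close> only in its first
  difference, which are of order \<open>r\<^sup>2\<close> and \<open>r\<close>. For \<open>c0\<close> of order \<open>1 / vol\<close> and \<open>c1\<close> of order
  \<open>1 / (r vol)\<close>, as for mollifiers, the bound is therefore independent of \<open>r\<close>.\<close>

lemma double_commutator_bound:
  fixes j :: "'e::euclidean_space \<Rightarrow> real"
  assumes \<alpha>: "test_fun \<alpha>" and j: "test_fun j" and even: "\<And>x. j (- x) = j x"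
    and supp: "\<And>x. norm x \<ge> r \<Longrightarrow> j x = 0" and r: "r > 0"
    and c0: "\<And>x. \<bar>j x\<bar> \<le> c0" and c1: "\<And>x. \<bar>dirderiv a j x\<bar> \<le> c1" "\<And>x. \<bar>dirderiv b j x\<bar> \<le> c1"
    and v: "compact_L2 v"
    and K: "\<And>x y z. \<bar>\<alpha> z + \<alpha> (x + y - z) - \<alpha> x - \<alpha> y\<bar> \<le> K * norm (z - x) * norm (z - y)" "K \<ge> 0"
    and L: "\<And>x y. \<bar>dirderiv a \<alpha> x - dirderiv a \<alpha> y\<bar> \<le> L * norm (x - y)" "L \<ge> 0"
  shows "\<bar>(\<integral>z. \<alpha> z * dirderiv a (conv j v) z * dirderiv b (conv j v) z \<partial>lborel)
      + (\<integral>x. v x * dirderiv a (\<lambda>x. \<alpha> x * dirderiv b (conv j (conv j v)) x) x \<partial>lborel)\<bar>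
    \<le> (K * r\<^sup>2 * c1\<^sup>2 + 2 * r * L * c0 * c1) * ball_vol TYPE('e) r * ball_vol TYPE('e) (2 * r) * (\<integral>x. (v x)\<^sup>2 \<partial>lborel)"
proof -
  define ja jb where "ja = dirderiv a j" and "jb = dirderiv b j"
  define g where "g = conv j v"
  define gb where "gb = dirderiv b g"
  define \<alpha>a where "\<alpha>a = dirderiv a \<alpha>"
  have tf: "test_fun ja" "test_fun jb" "test_fun g" "test_fun gb" "test_fun \<alpha>a"
    using j v \<alpha> by (auto simp: ja_def jb_def g_def gb_def \<alpha>a_def intro!: test_fun_dirderiv test_fun_conv)
  note [measurable] = tf[THEN test_fun_measurable] test_fun_measurable[OF \<alpha>] test_fun_measurable[OF j]
    compact_L2_measurable[OF v]
  have vi: "integrable lborel v" by (rule compact_L2_integrable[OF v])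
  have gbi: "integrable lborel gb" by (rule compact_L2_integrable[OF compact_L2_test_fun[OF tf(4)]])
  have gb_conv: "gb = conv jb v"
    unfolding gb_def g_def jb_def by (rule ext, rule dirderiv_conv[OF j vi])
  have ga: "dirderiv a g z = conv ja v z" for z
    unfolding g_def ja_def by (rule dirderiv_conv[OF j vi])
  have supp': "ja x = 0" "jb x = 0" if "norm x \<ge> r" for x
  proof -
    have "dirderiv u j x = 0" for u
    proof (cases "norm x = r")
      case False
      then have "r < norm x" using that by simp
      then show ?thesis
        by (intro dirderiv_eq_0[of "{x. r < norm x}"]) (auto intro!: open_Collect_less continuous_intros supp)
    next
      case True
      \<comment> \<open>on the sphere itself the derivative vanishes by continuity from outside\<close>
      have "continuous_on UNIV (dirderiv u j)"
        by (rule test_fun_continuous[OF test_fun_dirderiv[OF j]])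
      then have "isCont (dirderiv u j) x" by (simp add: continuous_on_eq_continuous_at)
      moreover have "(\<lambda>n. x + (1 / real (Suc n)) *\<^sub>R x) \<longlonglongrightarrow> x + 0 *\<^sub>R x"
        by (intro tendsto_intros LIMSEQ_Suc[OF lim_1_over_n])
      ultimately have "(\<lambda>n. dirderiv u j (x + (1 / real (Suc n)) *\<^sub>R x)) \<longlonglongrightarrow> dirderiv u j x"
        by (intro isCont_tendsto_compose[of x "dirderiv u j"]) simp_all
      moreover have "dirderiv u j (x + (1 / real (Suc n)) *\<^sub>R x) = 0" for n
      proof (rule dirderiv_eq_0[of "{x. r < norm x}"])
        have "x + (1 / real (Suc n)) *\<^sub>R x = (1 + 1 / real (Suc n)) *\<^sub>R x" by (simp add: algebra_simps)
        then have "norm (x + (1 / real (Suc n)) *\<^sub>R x) = (1 + 1 / real (Suc n)) * r" using True by simp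
        then show "x + (1 / real (Suc n)) *\<^sub>R x \<in> {x. r < norm x}" using r by (simp add: algebra_simps)
      qed (auto intro!: open_Collect_less continuous_intros supp)
      ultimately have "(\<lambda>n::nat. 0::real) \<longlonglongrightarrow> dirderiv u j x" by simp
      then show ?thesis using LIMSEQ_unique tendsto_const by blast
    qed
    then show "ja x = 0" "jb x = 0" by (simp_all add: ja_def jb_def)
  qed
  have odd: "ja (- x) = - ja x" "jb (- x) = - jb x" for x
    unfolding ja_def jb_def by (rule dirderiv_even[OF j even])+
  have ref: "j (x - z) = j (z - x)" "ja (x - z) = - ja (z - x)" "jb (x - z) = - jb (z - x)" for x z
    using even[of "z - x"] odd[of "z - x"] by simp_all
  obtain A A' where A: "\<And>x. \<bar>\<alpha> x\<bar> \<le> A" "\<And>x. \<bar>\<alpha>a x\<bar> \<le> A'"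
    using test_fun_bounded[OF \<alpha>] test_fun_bounded[OF tf(5)] by metis
  have c: "c0 \<ge> 0" "c1 \<ge> 0" using c0[of 0] c1[of 0] by auto
  have A0: "A \<ge> 0" "A' \<ge> 0" using A[of 0] by auto
  have cj: "\<bar>ja x\<bar> \<le> c1" "\<bar>jb x\<bar> \<le> c1" for x using c1 by (auto simp: ja_def jb_def)

  define k1 where "k1 = (\<lambda>x z. \<alpha>a x * j (z - x) - \<alpha> x * ja (z - x))"
  define k2 where "k2 = (\<lambda>x z. \<alpha> z * ja (z - x))"
  define m where "m = (\<lambda>x z. k2 x z + k1 x z)"
  have bk1: "bounded_kernel k1"
    unfolding bounded_kernel_def
  proof
    show "(\<lambda>(x, y). k1 x y) \<in> borel_measurable (borel \<Otimes>\<^sub>M borel)" unfolding k1_def by measurable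
    have "\<bar>k1 x z\<bar> \<le> A' * c0 + A * c1" for x z
    proof -
      have "\<bar>k1 x z\<bar> \<le> \<bar>\<alpha>a x\<bar> * \<bar>j (z - x)\<bar> + \<bar>\<alpha> x\<bar> * \<bar>ja (z - x)\<bar>"
        unfolding k1_def by (metis abs_mult abs_triangle_ineq4)
      also have "\<dots> \<le> A' * c0 + A * c1" by (intro add_mono mult_mono A c0 cj A0) auto
      finally show ?thesis .
    qed
    then show "\<exists>C. \<forall>x y. \<bar>k1 x y\<bar> \<le> C" by blast
  qed
  have bk2: "bounded_kernel k2"
    unfolding bounded_kernel_def
  proof
    show "(\<lambda>(x, y). k2 x y) \<in> borel_measurable (borel \<Otimes>\<^sub>M borel)" unfolding k2_def by measurable
    have "\<bar>k2 x z\<bar> \<le> A * c1" for x z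
      unfolding k2_def abs_mult by (intro mult_mono A cj A0) auto
    then show "\<exists>C. \<forall>x y. \<bar>k2 x y\<bar> \<le> C" by blast
  qed
  have bm: "bounded_kernel m" unfolding m_def by (rule bounded_kernel_add[OF bk2 bk1])
  have m_eq: "m x z = (\<alpha> z - \<alpha> x) * ja (z - x) + \<alpha>a x * j (z - x)" for x z
    by (simp add: m_def k1_def k2_def algebra_simps)
  obtain D where D: "\<And>x y. \<bar>m x y\<bar> \<le> D" using bm by (auto simp: bounded_kernel_def)
  have mi: "integrable lborel (m x)" for x
  proof (rule integrable_bounded_support)
    show "m x \<in> borel_measurable borel" unfolding m_def k1_def k2_def by measurable
    show "\<bar>m x z\<bar> \<le> D" for z by (rule D)
    have "z \<in> ball x r" if "m x z \<noteq> 0" for z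
      using that supp[of "z - x"] supp'[of "z - x"] unfolding m_eq by (force simp: dist_norm norm_minus_commute)
    then show "bounded {z. m x z \<noteq> 0}" by (intro bounded_subset[OF bounded_ball[of x r]]) auto
  qed

  define n where "n = (\<lambda>x y. \<integral>z. m x z * jb (z - y) \<partial>lborel)"
  have jbm: "integrable lborel (\<lambda>z. m x z * jb (z - y))" for x y
  proof (rule Bochner_Integration.integrable_bound)
    show "integrable lborel (\<lambda>z. c1 * m x z)" using mi by simp
    have "\<bar>jb (z - y)\<bar> * \<bar>m x z\<bar> \<le> c1 * \<bar>m x z\<bar>" for z by (rule mult_right_mono) (auto simp: cj)
    then show "AE z in lborel. norm (m x z * jb (z - y)) \<le> norm (c1 * m x z)"
      using c by (simp add: abs_mult mult.commute)
    show "(\<lambda>z. m x z * jb (z - y)) \<in> borel_measurable lborel" unfolding m_def k1_def k2_def by measurable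
  qed
  define H where "H = (\<lambda>x y z. (\<alpha> z + \<alpha> (x + y - z) - \<alpha> x - \<alpha> y) * (ja (z - x) * jb (z - y))
      + (\<alpha>a x - \<alpha>a y) * (j (z - x) * jb (z - y)))"
  have nn: "n x y + n y x = (\<integral>z. H x y z \<partial>lborel)" for x y
  proof -
    have "n y x = (\<integral>z. m y (x + y - z) * jb (x + y - z - x) \<partial>lborel)"
      unfolding n_def
      using lborel_integral_reflect(1)[OF borel_measurable_integrable[OF jbm[of y x], simplified], of "x + y"] by simp
    moreover have "integrable lborel (\<lambda>z. m y (x + y - z) * jb (x + y - z - x))"
      using lborel_integral_reflect(2)[OF borel_measurable_integrable[OF jbm[of y x], simplified], of "x + y"] jbm by simp
    ultimately have "n x y + n y x = (\<integral>z. m x z * jb (z - y) + m y (x + y - z) * jb (x + y - z - x) \<partial>lborel)"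
      unfolding n_def by (simp add: jbm)
    also have "(\<lambda>z. m x z * jb (z - y) + m y (x + y - z) * jb (x + y - z - x)) = H x y"
    proof
      fix z
      have e: "x + y - z - x = y - z" "x + y - z - y = x - z" by simp_all
      show "m x z * jb (z - y) + m y (x + y - z) * jb (x + y - z - x) = H x y z"
        unfolding m_eq H_def e ref(1)[of x z] ref(2)[of x z] ref(3)[of y z] by (simp add: algebra_simps)
    qed
    finally show ?thesis .
  qed
  define N where "N = K * r\<^sup>2 * c1\<^sup>2 + 2 * r * L * c0 * c1"
  have N0: "N \<ge> 0" unfolding N_def using K L r c by auto
  have H_bound: "\<bar>H x y z\<bar> \<le> N * indicator (ball x r) z" for x y z
  proof (cases "norm (z - x) < r \<and> norm (z - y) < r")
    case True
    have "\<bar>\<alpha> z + \<alpha> (x + y - z) - \<alpha> x - \<alpha> y\<bar> \<le> K * r * r"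
      by (rule order_trans[OF K(1)]) (use True K(2) r in \<open>intro mult_mono; simp\<close>)
    then have 1: "\<bar>(\<alpha> z + \<alpha> (x + y - z) - \<alpha> x - \<alpha> y) * (ja (z - x) * jb (z - y))\<bar> \<le> (K * r * r) * (c1 * c1)"
      unfolding abs_mult by (intro mult_mono cj) (use K r c in auto)
    have "norm (x - y) \<le> norm (z - x) + norm (z - y)"
      using norm_triangle_ineq4[of "z - y" "z - x"] by (simp add: algebra_simps)
    then have "norm (x - y) \<le> 2 * r" using True by linarith
    then have "\<bar>\<alpha>a x - \<alpha>a y\<bar> \<le> L * (2 * r)"
      unfolding \<alpha>a_def by (intro order_trans[OF L(1)] mult_left_mono L(2))
    then have 2: "\<bar>(\<alpha>a x - \<alpha>a y) * (j (z - x) * jb (z - y))\<bar> \<le> (L * (2 * r)) * (c0 * c1)"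
      unfolding abs_mult by (intro mult_mono cj c0) (use L r c in auto)
    have "\<bar>H x y z\<bar> \<le> (K * r * r) * (c1 * c1) + (L * (2 * r)) * (c0 * c1)"
      unfolding H_def by (rule order_trans[OF abs_triangle_ineq add_mono[OF 1 2]])
    also have "\<dots> = N" by (simp add: N_def power2_eq_square)
    finally show ?thesis using True by (simp add: dist_norm norm_minus_commute)
  next
    case False
    then have "H x y z = 0"
      using supp[of "z - x"] supp'[of "z - x"] supp'[of "z - y"] unfolding H_def by (force simp: not_less)
    then show ?thesis using N0 by simp
  qed
  have bn: "\<bar>n x y + n y x\<bar> \<le> N * ball_vol TYPE('e) r" for x y
  proof -
    have "\<bar>\<integral>z. H x y z \<partial>lborel\<bar> \<le> (\<integral>z. N * indicator (ball x r) z \<partial>lborel)"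
    proof (rule integral_abs_bound_integral)
      show "integrable lborel (\<lambda>z. N * indicator (ball x r) z :: real)"
        by (intro integrable_mult_right integrable_indicator_ball)
      then show "integrable lborel (H x y)"
        by (rule Bochner_Integration.integrable_bound)
          (use H_bound[of x y] N0 in \<open>auto simp: H_def abs_mult\<close>)
    qed (use H_bound in auto)
    also have "\<dots> = N * ball_vol TYPE('e) r"
      using r by (simp only: integral_mult_right_zero integral_ball_indicator)
    finally show ?thesis unfolding nn .
  qed
  have n0: "n x y + n y x = 0" if "norm (x - y) \<ge> 2 * r" for x y
  proof -
    have "H x y z = 0" for z
    proof -
      have "norm (x - y) \<le> norm (z - x) + norm (z - y)"
        using norm_triangle_ineq4[of "z - y" "z - x"] by (simp add: algebra_simps)
      then have "norm (z - x) \<ge> r \<or> norm (z - y) \<ge> r" using that by linarith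
      then show ?thesis using supp[of "z - x"] supp'[of "z - x"] supp'[of "z - y"] unfolding H_def by force
    qed
    then have "H x y = (\<lambda>_. 0)" by (rule ext)
    then show ?thesis unfolding nn by simp
  qed
  have bkn: "bounded_kernel n"
    unfolding bounded_kernel_def
  proof
    show "(\<lambda>(x, y). n x y) \<in> borel_measurable (borel \<Otimes>\<^sub>M borel)"
      unfolding n_def m_def k1_def k2_def by measurable
    have D0: "D \<ge> 0" using D[of 0 0] by auto
    have "\<bar>n x y\<bar> \<le> D * c1 * ball_vol TYPE('e) r" for x y
    proof -
      have "\<bar>\<integral>z. m x z * jb (z - y) \<partial>lborel\<bar> \<le> (\<integral>z. D * c1 * indicator (ball x r) z \<partial>lborel)"
      proof (rule integral_abs_bound_integral[OF jbm])
        show "integrable lborel (\<lambda>z. D * c1 * indicator (ball x r) z :: real)"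
          by (intro integrable_mult_right integrable_indicator_ball)
        fix z
        show "\<bar>m x z * jb (z - y)\<bar> \<le> D * c1 * indicator (ball x r) z"
        proof (cases "norm (z - x) < r")
          case True
          then show ?thesis using mult_mono[OF D[of x z] cj(2)[of "z - y"] D0]
            by (simp add: abs_mult dist_norm norm_minus_commute)
        next
          case False
          then have "m x z = 0" unfolding m_eq using supp[of "z - x"] supp'[of "z - x"] by simp
          then show ?thesis using D0 c by simp
        qed
      qed
      also have "\<dots> = D * c1 * ball_vol TYPE('e) r"
        using r by (simp only: integral_mult_right_zero integral_ball_indicator)
      finally show ?thesis unfolding n_def .
    qed
    then show "\<exists>C. \<forall>x y. \<bar>n x y\<bar> \<le> C" by blast
  qed

  have "(\<integral>z. \<alpha> z * dirderiv a g z * gb z \<partial>lborel) = (\<integral>z. (\<integral>x. v x * k2 x z \<partial>lborel) * gb z \<partial>lborel)"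
  proof (rule Bochner_Integration.integral_cong[OF refl])
    fix z
    have "(\<integral>x. v x * k2 x z \<partial>lborel) = (\<integral>x. \<alpha> z * (ja (z - x) * v x) \<partial>lborel)"
      by (simp add: k2_def mult_ac)
    also have "\<dots> = \<alpha> z * dirderiv a g z" by (simp add: ga conv_def)
    finally show "\<alpha> z * dirderiv a g z * gb z = (\<integral>x. v x * k2 x z \<partial>lborel) * gb z" by simp
  qed
  also have "\<dots> = kernel_form v k2 gb"
    unfolding kernel_form_def
    by (subst kernel_Fubini[OF vi gbi, where C="A * c1"])
      (use bk2 in \<open>simp_all add: bounded_kernel_def\<close>, simp add: k2_def abs_mult mult_mono A cj A0)
  finally have Q: "(\<integral>z. \<alpha> z * dirderiv a g z * gb z \<partial>lborel) = kernel_form v k2 gb" .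
  have \<psi>b: "dirderiv b (conv j g) x = conv j gb x" for x
    unfolding gb_def by (rule dirderiv_conv'[OF j tf(3)])
  have "dirderiv a (\<lambda>x. \<alpha> x * dirderiv b (conv j g) x) x = (\<integral>z. k1 x z * gb z \<partial>lborel)" for x
  proof -
    have "dirderiv a (\<lambda>x. \<alpha> x * dirderiv b (conv j g) x) x = \<alpha>a x * conv j gb x + \<alpha> x * conv ja gb x"
      unfolding \<psi>b \<alpha>a_def ja_def dirderiv_conv[OF j gbi, symmetric]
      by (rule dirderiv_mult[OF \<alpha> test_fun_conv[OF j compact_L2_test_fun[OF tf(4)]]])
    also have "\<dots> = (\<integral>z. \<alpha>a x * (j (x - z) * gb z) + \<alpha> x * (ja (x - z) * gb z) \<partial>lborel)"
      unfolding conv_def using integrable_conv_integrand[OF j gbi] integrable_conv_integrand[OF tf(1) gbi] by simp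
    also have "\<dots> = (\<integral>z. k1 x z * gb z \<partial>lborel)"
      by (simp add: k1_def ref(1)[of x] ref(2)[of x] algebra_simps)
    finally show ?thesis .
  qed
  then have B: "(\<integral>x. v x * dirderiv a (\<lambda>x. \<alpha> x * dirderiv b (conv j g) x) x \<partial>lborel) = kernel_form v k1 gb"
    by (simp add: kernel_form_def)
  have "kernel_form v k2 gb + kernel_form v k1 gb = kernel_form v m gb"
    unfolding m_def by (rule kernel_form_add[OF bk2 bk1 vi gbi])
  also have "\<dots> = kernel_form v n v"
    unfolding gb_conv n_def by (rule kernel_form_conv[OF bm mi tf(2) vi])
  finally have S: "kernel_form v k2 gb + kernel_form v k1 gb = kernel_form v n v" .
  have "2 * kernel_form v n v = kernel_form v n v + kernel_form v (\<lambda>x y. n y x) v"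
    using kernel_form_swap[OF bkn vi vi] by simp
  also have "\<dots> = kernel_form v (\<lambda>x y. n x y + n y x) v"
    by (rule kernel_form_add[OF bkn bounded_kernel_swap[OF bkn] vi vi])
  finally have "2 * \<bar>kernel_form v n v\<bar> = \<bar>kernel_form v (\<lambda>x y. n x y + n y x) v\<bar>" by simp
  also have "\<dots> \<le> (N * ball_vol TYPE('e) r) * ball_vol TYPE('e) (2 * r) * ((\<integral>x. (v x)\<^sup>2 \<partial>lborel) + (\<integral>x. (v x)\<^sup>2 \<partial>lborel)) / 2"
    unfolding kernel_form_def
  proof (rule Schur_test[OF v v])
    show "(\<lambda>(x, y). n x y + n y x) \<in> borel_measurable (borel \<Otimes>\<^sub>M borel)"
      using bounded_kernel_add[OF bkn bounded_kernel_swap[OF bkn]] by (simp add: bounded_kernel_def)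
  qed (use r bn n0 in auto)
  finally have "2 * \<bar>kernel_form v n v\<bar> \<le> N * ball_vol TYPE('e) r * ball_vol TYPE('e) (2 * r) * (\<integral>x. (v x)\<^sup>2 \<partial>lborel)" by simp
  then have "\<bar>kernel_form v k2 gb + kernel_form v k1 gb\<bar> \<le> N * ball_vol TYPE('e) r * ball_vol TYPE('e) (2 * r) * (\<integral>x. (v x)\<^sup>2 \<partial>lborel)"
    unfolding S by linarith
  moreover have "dirderiv b g z = gb z" for z by (simp add: gb_def)
  ultimately show ?thesis using Q B unfolding g_def[symmetric] N_def[symmetric] by simp
qed

section \<open>Mollifiers\<close>

definition mollifier :: "real \<Rightarrow> ('e::euclidean_space \<Rightarrow> real) \<Rightarrow> bool" where
  "mollifier r j \<longleftrightarrow> test_fun j \<and> (\<forall>x. j (- x) = j x) \<and> (\<forall>x. 0 \<le> j x) \<and> (\<forall>x. norm x \<ge> r \<longrightarrow> j x = 0)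
     \<and> (\<integral>x. j x \<partial>lborel) = 1"

text \<open>A normalised bump \<open>\<eta>\<close> is rescaled to radius \<open>r\<close>; the constant is uniform in \<open>r\<close>, and one derivative costs
  one factor \<open>1 / r\<close>.\<close>

lemma mollifier_exists:
  obtains C where "C \<ge> 0" "\<And>r. r > 0 \<Longrightarrow> \<exists>j :: 'e::euclidean_space \<Rightarrow> real. mollifier r j
    \<and> (\<forall>x. \<bar>j x\<bar> * ball_vol TYPE('e) r \<le> C) \<and> (\<forall>b\<in>Basis. \<forall>x. \<bar>dirderiv b j x\<bar> * (r * ball_vol TYPE('e) r) \<le> C)"
proof -
  define \<eta> :: "'e \<Rightarrow> real" where "\<eta> = ball_bump 1"
  have \<eta>0: "\<eta> x = 0" if "norm x \<ge> 1" for x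
    using ball_bump_pos_iff[of 1 x] ball_bump_nonneg[of 1 x] that unfolding \<eta>_def by linarith
  have "{x. \<eta> x \<noteq> 0} \<subseteq> ball 0 1" by (auto, meson \<eta>0 not_less)
  then have t\<eta>: "test_fun \<eta>"
    unfolding test_fun_def using bounded_subset[OF bounded_ball] by (auto simp: \<eta>_def smooth_on_ball_bump)
  have "\<exists>C. C \<ge> 0 \<and> (\<forall>x. \<bar>dirderiv b \<eta> x\<bar> \<le> C)" for b
    using test_fun_bounded[OF test_fun_dirderiv[OF t\<eta>]] by metis
  then obtain D where D: "\<And>b. D b \<ge> 0" "\<And>b x. \<bar>dirderiv b \<eta> x\<bar> \<le> D b" by metis
  define E where "E = (\<Sum>b\<in>Basis. D b)"
  have E: "E \<ge> 0" "\<And>b x. b \<in> Basis \<Longrightarrow> \<bar>dirderiv b \<eta> x\<bar> \<le> E"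
    unfolding E_def using D(1) by (auto intro!: sum_nonneg order_trans[OF D(2)] member_le_sum)
  define c where "c = flat 0 (3/4) / 2 ^ DIM('e)"
  have c: "c > 0" by (simp add: c_def flat_def)
  have main: "\<exists>j :: 'e \<Rightarrow> real. mollifier r j
    \<and> (\<forall>x. \<bar>j x\<bar> * ball_vol TYPE('e) r \<le> (1 + E) / c) \<and> (\<forall>b\<in>Basis. \<forall>x. \<bar>dirderiv b j x\<bar> * (r * ball_vol TYPE('e) r) \<le> (1 + E) / c)"
    if r: "r > 0" for r
  proof -
    define h where "h = (\<lambda>x. \<eta> (inverse r *\<^sub>R x))"
    have hd: "(h has_derivative (\<lambda>v. inverse r * frechet_derivative \<eta> (at (inverse r *\<^sub>R x)) v)) (at x)" for x
    proof -
      have "(h has_derivative (\<lambda>v. frechet_derivative \<eta> (at (inverse r *\<^sub>R x)) (inverse r *\<^sub>R v))) (at x)"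
        unfolding h_def
        by (rule has_derivative_compose[of "\<lambda>x. inverse r *\<^sub>R x" "\<lambda>x. inverse r *\<^sub>R x", OF _ test_fun_has_derivative[OF t\<eta>]])
          (auto intro!: derivative_eq_intros)
      then show ?thesis using linear_simps(5)[OF bounded_linear_frechet[OF t\<eta>]] by simp
    qed
    have h0: "h x = 0" if "norm x \<ge> r" for x
      unfolding h_def by (rule \<eta>0) (use that r in \<open>simp add: field_simps\<close>)
    have th: "test_fun h"
      unfolding test_fun_def
    proof
      show "smooth_on UNIV h" unfolding h_def
        by (rule smooth_on_compose[of UNIV UNIV]) (use t\<eta> in \<open>auto simp: test_fun_def intro!: smooth_on_linear bounded_linear_scaleR_right\<close>)
      show "bounded {x. h x \<noteq> 0}"
        by (rule bounded_subset[OF bounded_ball[of 0 r]]) (auto, meson h0 not_less)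
    qed
    have hi: "integrable lborel h" by (rule compact_L2_integrable[OF compact_L2_test_fun[OF th]])
    have h_nn: "h x \<ge> 0" for x by (simp add: h_def \<eta>_def ball_bump_nonneg)
    have h1: "h x \<le> 1" for x by (simp add: h_def \<eta>_def ball_bump_def flat_def)
    have V: "ball_vol TYPE('e) r > 0" unfolding ball_vol_def
      by (intro mult_pos_pos unit_ball_vol_pos) (use r in auto)
    have hlow: "flat 0 (3/4) * indicator (ball 0 (r/2)) x \<le> h x" for x
    proof (cases "norm x < r / 2")
      case True
      have "(inverse r *\<^sub>R x) \<bullet> (inverse r *\<^sub>R x) = (norm x / r)\<^sup>2"
        using r by (simp add: dot_square_norm power_divide divide_inverse power2_eq_square)
      also have "\<dots> \<le> (1/2)\<^sup>2" by (intro power_mono) (use True r in \<open>auto simp: field_simps\<close>)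
      finally have le: "3/4 \<le> 1 - (inverse r *\<^sub>R x) \<bullet> (inverse r *\<^sub>R x)" by (simp add: power2_eq_square)
      have mono: "flat 0 s \<le> flat 0 t" if "3/4 \<le> s" "s \<le> t" for s t
        using that by (auto simp: flat_def field_simps)
      show ?thesis using mono[OF _ le] True by (simp add: h_def \<eta>_def ball_bump_def)
    qed (use h_nn in \<open>auto simp: indicator_def\<close>)
    define I where "I = (\<integral>x. h x \<partial>lborel)"
    have "ball_vol TYPE('e) (r/2) = ball_vol TYPE('e) r / 2 ^ DIM('e)"
      by (simp add: ball_vol_def power_divide)
    then have "c * ball_vol TYPE('e) r = (\<integral>x. flat 0 (3/4) * indicator (ball 0 (r/2)) (x::'e) \<partial>lborel)"
      using integral_ball_indicator(2)[of "r/2" "0::'e"] r by (simp only: integral_mult_right_zero) (simp add: c_def)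
    also have "\<dots> \<le> I" unfolding I_def
      by (intro integral_mono hi hlow integrable_mult_right integrable_indicator_ball)
    finally have I: "c * ball_vol TYPE('e) r \<le> I" .
    then have I0: "I > 0" using c V by (meson less_le_trans mult_pos_pos)
    define j where "j = (\<lambda>x. h x * inverse I)"
    have tj: "test_fun j" unfolding j_def by (rule test_fun_mult[OF th]) auto
    have VI: "inverse I * ball_vol TYPE('e) r \<le> inverse c"
      using I I0 c by (simp add: field_simps)
    have "mollifier r j"
      unfolding mollifier_def
    proof (intro conjI allI impI)
      show "(\<integral>x. j x \<partial>lborel) = 1" using I0 by (simp add: j_def I_def)
    qed (use tj h0 h_nn I0 in \<open>auto simp: j_def h_def \<eta>_def ball_bump_minus\<close>)
    moreover have "\<bar>j x\<bar> * ball_vol TYPE('e) r \<le> (1 + E) / c" for x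
    proof -
      have "\<bar>j x\<bar> * ball_vol TYPE('e) r = h x * (inverse I * ball_vol TYPE('e) r)"
        using h_nn I0 by (simp add: j_def abs_mult)
      also have "\<dots> \<le> 1 * inverse c" by (intro mult_mono h1 VI) (use V I0 in auto)
      also have "\<dots> \<le> (1 + E) / c" using c E by (simp add: field_simps)
      finally show ?thesis .
    qed
    moreover have "\<bar>dirderiv b j x\<bar> * (r * ball_vol TYPE('e) r) \<le> (1 + E) / c" if b: "b \<in> Basis" for b x
    proof -
      have "(j has_derivative (\<lambda>v. inverse r * frechet_derivative \<eta> (at (inverse r *\<^sub>R x)) v * inverse I)) (at x)"
        unfolding j_def by (rule has_derivative_mult_left[OF hd])
      from frechet_derivative_at[OF this]
      have "dirderiv b j x = inverse r * frechet_derivative \<eta> (at (inverse r *\<^sub>R x)) b * inverse I" by metis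
      then have "\<bar>dirderiv b j x\<bar> * (r * ball_vol TYPE('e) r) = \<bar>frechet_derivative \<eta> (at (inverse r *\<^sub>R x)) b\<bar> * (inverse I * ball_vol TYPE('e) r)"
        using r I0 by (simp add: abs_mult)
      also have "\<dots> \<le> E * inverse c" by (intro mult_mono E VI b) (use V I0 E in auto)
      also have "\<dots> \<le> (1 + E) / c" using c E by (simp add: field_simps)
      finally show ?thesis .
    qed
    ultimately show ?thesis by blast
  qed
  show thesis by (rule that[of "(1 + E) / c"]) (use main c E in auto)
qed

section \<open>Local energy estimate for weak solutions\<close>

text \<open>The scale-invariant bounds on a mollifier of radius \<open>r\<close> and its first derivatives that make
  Schur's test uniform in \<open>r\<close>.\<close>

definition mollifier_bound :: "real \<Rightarrow> real \<Rightarrow> ('e::euclidean_space \<Rightarrow> real) \<Rightarrow> bool" where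
  "mollifier_bound C r j \<longleftrightarrow> (\<forall>x. \<bar>j x\<bar> * ball_vol TYPE('e) r \<le> C) \<and>
     (\<forall>b\<in>Basis. \<forall>x. \<bar>dirderiv b j x\<bar> * (r * ball_vol TYPE('e) r) \<le> C)"

lemma ball_vol_pos: "r > 0 \<Longrightarrow> ball_vol TYPE('e::euclidean_space) r > 0"
  unfolding ball_vol_def by (intro mult_pos_pos unit_ball_vol_pos) auto

lemma mollifier_dirderiv_support:
  assumes "mollifier r j" "norm x > r"
  shows "dirderiv b j x = 0"
  by (rule dirderiv_eq_0[of "{x. r < norm x}"])
    (use assms in \<open>auto simp: mollifier_def intro!: open_Collect_less continuous_intros\<close>)

lemma Schur_test_conv:
  fixes j :: "'e::euclidean_space \<Rightarrow> real"
  assumes j: "mollifier r j" "mollifier_bound C r j" and r: "r > 0"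
    and f: "compact_L2 f" and g: "compact_L2 g"
  shows "\<bar>\<integral>x. f x * conv j g x \<partial>lborel\<bar> \<le> C * ((\<integral>x. (f x)\<^sup>2 \<partial>lborel) + (\<integral>x. (g x)\<^sup>2 \<partial>lborel)) / 2"
proof -
  note V = ball_vol_pos[OF r, where 'e='e]
  have tj: "test_fun j" using j by (simp add: mollifier_def)
  have [measurable]: "j \<in> borel_measurable borel" by (rule test_fun_measurable[OF tj])
  have "\<bar>\<integral>x. f x * (\<integral>y. j (x - y) * g y \<partial>lborel) \<partial>lborel\<bar>
    \<le> C / ball_vol TYPE('e) r * ball_vol TYPE('e) r * ((\<integral>x. (f x)\<^sup>2 \<partial>lborel) + (\<integral>x. (g x)\<^sup>2 \<partial>lborel)) / 2"
  proof (rule Schur_test[OF f g])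
    show "\<bar>j (x - y)\<bar> \<le> C / ball_vol TYPE('e) r" for x y
      using j V by (simp add: mollifier_bound_def pos_le_divide_eq)
  qed (use j r in \<open>auto simp: mollifier_def\<close>)
  then show ?thesis using V by (simp add: conv_def)
qed

lemma integral_mollify_square_le:
  fixes j :: "'e::euclidean_space \<Rightarrow> real"
  assumes j: "mollifier r j" "mollifier_bound C r j" and r: "r > 0" and v: "compact_L2 v"
  shows "(\<integral>x. (conv j v x)\<^sup>2 \<partial>lborel) \<le> C\<^sup>2 * (\<integral>x. (v x)\<^sup>2 \<partial>lborel)"
proof -
  note V = ball_vol_pos[OF r, where 'e='e]
  have "(\<integral>x. (conv j v x)\<^sup>2 \<partial>lborel) \<le> (C / ball_vol TYPE('e) r * ball_vol TYPE('e) r)\<^sup>2 * (\<integral>x. (v x)\<^sup>2 \<partial>lborel)"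
  proof (rule integral_conv_square_le[OF _ _ r _ v])
    show "\<bar>j x\<bar> \<le> C / ball_vol TYPE('e) r" for x
      using j V by (simp add: mollifier_bound_def pos_le_divide_eq)
  qed (use j in \<open>auto simp: mollifier_def\<close>)
  then show ?thesis using V by simp
qed

text \<open>The kernel \<open>dirderiv b j\<close> vanishes only outside the closed ball of radius \<open>r\<close>, so the
  estimate is applied with radius \<open>2 r\<close>, which accounts for the factor \<open>2 ^ DIM('e)\<close>.\<close>

lemma integral_mollify_dirderiv_square_le:
  fixes j :: "'e::euclidean_space \<Rightarrow> real"
  assumes j: "mollifier r j" "mollifier_bound C r j" and r: "r > 0" and v: "compact_L2 v" and b: "b \<in> Basis"
  shows "r\<^sup>2 * (\<integral>x. (dirderiv b (conv j v) x)\<^sup>2 \<partial>lborel) \<le> (2 ^ DIM('e) * C)\<^sup>2 * (\<integral>x. (v x)\<^sup>2 \<partial>lborel)"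
proof -
  note V = ball_vol_pos[OF r, where 'e='e]
  have tj: "test_fun j" using j by (simp add: mollifier_def)
  have V2: "ball_vol TYPE('e) (2 * r) = 2 ^ DIM('e) * ball_vol TYPE('e) r"
    by (simp add: ball_vol_def power_mult_distrib)
  have "(\<integral>x. (conv (dirderiv b j) v x)\<^sup>2 \<partial>lborel)
      \<le> (C / (r * ball_vol TYPE('e) r) * ball_vol TYPE('e) (2 * r))\<^sup>2 * (\<integral>x. (v x)\<^sup>2 \<partial>lborel)"
  proof (rule integral_conv_square_le[OF test_fun_dirderiv[OF tj] _ _ _ v])
    show "\<bar>dirderiv b j x\<bar> \<le> C / (r * ball_vol TYPE('e) r)" for x
      using j V r b by (simp add: mollifier_bound_def pos_le_divide_eq)
    show "dirderiv b j x = 0" if "2 * r \<le> norm x" for x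
      by (rule mollifier_dirderiv_support[OF j(1)]) (use that r in linarith)
  qed (use r in auto)
  also have "C / (r * ball_vol TYPE('e) r) * ball_vol TYPE('e) (2 * r) = (2 ^ DIM('e) * C) / r"
    unfolding V2 using V r by (simp add: field_simps)
  finally have "r\<^sup>2 * (\<integral>x. (conv (dirderiv b j) v x)\<^sup>2 \<partial>lborel) \<le> r\<^sup>2 * (((2 ^ DIM('e) * C) / r)\<^sup>2 * (\<integral>x. (v x)\<^sup>2 \<partial>lborel))"
    by (intro mult_left_mono) auto
  also have "\<dots> = (2 ^ DIM('e) * C)\<^sup>2 * (\<integral>x. (v x)\<^sup>2 \<partial>lborel)"
    using r by (simp add: power_divide)
  finally show ?thesis
    unfolding dirderiv_conv[OF tj compact_L2_integrable[OF v], abs_def] .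
qed

lemma double_commutator_bound_mollifier:
  fixes \<alpha> :: "'e::euclidean_space \<Rightarrow> real"
  assumes \<alpha>: "test_fun \<alpha>" and v: "compact_L2 v" and ab: "a \<in> Basis" "b \<in> Basis"
  obtains D where "\<And>r j. 0 < r \<Longrightarrow> mollifier r j \<Longrightarrow> mollifier_bound C r j \<Longrightarrow>
    (\<integral>z. \<alpha> z * dirderiv a (conv j v) z * dirderiv b (conv j v) z \<partial>lborel)
      + (\<integral>x. v x * dirderiv a (\<lambda>x. \<alpha> x * dirderiv b (conv j (conv j v)) x) x \<partial>lborel) \<le> D"
proof -
  obtain K where K: "K \<ge> 0" "\<And>x y z. \<bar>\<alpha> z + \<alpha> (x + y - z) - \<alpha> x - \<alpha> y\<bar> \<le> K * norm (z - x) * norm (z - y)"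
    using test_fun_parallelogram[OF \<alpha>] by metis
  obtain L where L: "L \<ge> 0" "\<And>x y. \<bar>dirderiv a \<alpha> x - dirderiv a \<alpha> y\<bar> \<le> L * norm (x - y)"
    using test_fun_Lipschitz[OF test_fun_dirderiv[OF \<alpha>]] by metis
  show thesis
  proof (rule that)
    fix r and j :: "'e \<Rightarrow> real"
    assume r: "0 < r" and j: "mollifier r j" "mollifier_bound C r j"
    note V = ball_vol_pos[OF r, where 'e='e]
    let ?V = "ball_vol TYPE('e) r"
    have V2: "ball_vol TYPE('e) (2 * r) = 2 ^ DIM('e) * ?V"
      by (simp add: ball_vol_def power_mult_distrib)
    have "\<bar>(\<integral>z. \<alpha> z * dirderiv a (conv j v) z * dirderiv b (conv j v) z \<partial>lborel)
      + (\<integral>x. v x * dirderiv a (\<lambda>x. \<alpha> x * dirderiv b (conv j (conv j v)) x) x \<partial>lborel)\<bar>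
      \<le> (K * r\<^sup>2 * (C / (r * ?V))\<^sup>2 + 2 * r * L * (C / ?V) * (C / (r * ?V))) * ?V * ball_vol TYPE('e) (2 * r) * (\<integral>x. (v x)\<^sup>2 \<partial>lborel)"
    proof (rule double_commutator_bound[OF \<alpha> _ _ _ r _ _ _ v K(2) K(1) L(2) L(1)])
      show "\<bar>j x\<bar> \<le> C / ?V" "\<bar>dirderiv a j x\<bar> \<le> C / (r * ?V)" "\<bar>dirderiv b j x\<bar> \<le> C / (r * ?V)" for x
        using j V r ab by (simp_all add: mollifier_bound_def pos_le_divide_eq)
    qed (use j in \<open>auto simp: mollifier_def\<close>)
    also have "(K * r\<^sup>2 * (C / (r * ?V))\<^sup>2 + 2 * r * L * (C / ?V) * (C / (r * ?V))) * ?V * ball_vol TYPE('e) (2 * r)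
      = (K + 2 * L) * C\<^sup>2 * 2 ^ DIM('e)"
      unfolding V2 using V r by (simp add: field_simps power2_eq_square)
    finally show "(\<integral>z. \<alpha> z * dirderiv a (conv j v) z * dirderiv b (conv j v) z \<partial>lborel)
      + (\<integral>x. v x * dirderiv a (\<lambda>x. \<alpha> x * dirderiv b (conv j (conv j v)) x) x \<partial>lborel)
      \<le> (K + 2 * L) * C\<^sup>2 * 2 ^ DIM('e) * (\<integral>x. (v x)\<^sup>2 \<partial>lborel)" by linarith
  qed
qed

text \<open>The multiplication by \<open>c\<close> is moved past one mollification. The commutator has the kernel
  \<open>(c x - c z) * j (x - z)\<close>, of order \<open>r\<close> in the operator norm, while the remaining derivative of
  \<open>conv j v\<close> is of order \<open>1 / r\<close>.\<close>

lemma commutator_mult_bound: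
  fixes c :: "'e::euclidean_space \<Rightarrow> real"
  assumes c: "test_fun c" and u: "compact_L2 u" and v: "compact_L2 v" and b: "b \<in> Basis"
  obtains D where "\<And>r j. 0 < r \<Longrightarrow> mollifier r j \<Longrightarrow> mollifier_bound C r j \<Longrightarrow>
    \<bar>(\<integral>x. u x * c x * dirderiv b (conv j (conv j v)) x \<partial>lborel)
      - (\<integral>x. conv j u x * (c x * dirderiv b (conv j v) x) \<partial>lborel)\<bar> \<le> D"
proof -
  obtain L where L: "L \<ge> 0" "\<And>x y. \<bar>c x - c y\<bar> \<le> L * norm (x - y)"
    using test_fun_Lipschitz[OF c] by metis
  show thesis
  proof (rule that)
    fix r and j :: "'e \<Rightarrow> real"
    assume r: "0 < r" and j: "mollifier r j" "mollifier_bound C r j"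
    note V = ball_vol_pos[OF r, where 'e='e]
    let ?V = "ball_vol TYPE('e) r"
    have tj: "test_fun j" and even: "\<And>x. j (- x) = j x" using j by (auto simp: mollifier_def)
    define gb where "gb = dirderiv b (conv j v)"
    have tgb: "test_fun gb" unfolding gb_def by (intro test_fun_dirderiv test_fun_conv tj v)
    note [measurable] = test_fun_measurable[OF tgb] test_fun_measurable[OF c] test_fun_measurable[OF tj]
      compact_L2_measurable[OF u]
    have ui: "integrable lborel u" and gbi: "integrable lborel gb"
      using u tgb compact_L2_integrable compact_L2_test_fun by auto
    obtain Cc where Cc: "Cc \<ge> 0" "\<And>x. \<bar>c x\<bar> \<le> Cc" using test_fun_bounded[OF c] by metis
    have jV: "\<bar>j x\<bar> \<le> C / ?V" for x
      using j V by (simp add: mollifier_bound_def pos_le_divide_eq)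
    define k1 where "k1 = (\<lambda>x z. j (x - z) * c z)"
    define k2 where "k2 = (\<lambda>x z. (c x - c z) * j (x - z))"
    have k2_bound: "\<bar>k2 x z\<bar> \<le> L * r * (C / ?V)" for x z
    proof (cases "norm (x - z) < r")
      case True
      have "\<bar>c x - c z\<bar> \<le> L * r"
        by (rule order_trans[OF L(2)]) (use True L(1) in \<open>intro mult_left_mono; simp\<close>)
      then show ?thesis unfolding k2_def abs_mult by (rule mult_mono[OF _ jV]) (use L r in auto)
    next
      case False
      moreover have "0 \<le> L * r * (C / ?V)"
        by (intro mult_nonneg_nonneg) (use r L(1) order_trans[OF abs_ge_zero jV] in auto)
      ultimately show ?thesis using j by (simp add: k2_def mollifier_def)
    qed
    have bk1: "bounded_kernel k1"
      unfolding bounded_kernel_def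
    proof
      show "(\<lambda>(x, y). k1 x y) \<in> borel_measurable (borel \<Otimes>\<^sub>M borel)" unfolding k1_def by measurable
      have "\<bar>k1 x z\<bar> \<le> C / ?V * Cc" for x z
        unfolding k1_def abs_mult by (rule mult_mono[OF jV Cc(2)]) (use order_trans[OF abs_ge_zero jV] in auto)
      then show "\<exists>C. \<forall>x y. \<bar>k1 x y\<bar> \<le> C" by blast
    qed
    have mk2: "(\<lambda>(x, y). k2 x y) \<in> borel_measurable (borel \<Otimes>\<^sub>M borel)" unfolding k2_def by measurable
    have bk2: "bounded_kernel k2"
      unfolding bounded_kernel_def using mk2 k2_bound by blast
    have "(\<integral>x. u x * c x * dirderiv b (conv j (conv j v)) x \<partial>lborel) = kernel_form u (\<lambda>x z. k1 x z + k2 x z) gb"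
    proof -
      have "dirderiv b (conv j (conv j v)) x = conv j gb x" for x
        unfolding gb_def by (rule dirderiv_conv'[OF tj test_fun_conv[OF tj v]])
      moreover have "c x * conv j gb x = (\<integral>z. (k1 x z + k2 x z) * gb z \<partial>lborel)" for x
      proof -
        have "(\<integral>z. (k1 x z + k2 x z) * gb z \<partial>lborel) = (\<integral>z. c x * (j (x - z) * gb z) \<partial>lborel)"
          by (rule Bochner_Integration.integral_cong) (simp_all add: k1_def k2_def algebra_simps)
        then show ?thesis by (simp add: conv_def)
      qed
      ultimately show ?thesis by (simp add: kernel_form_def mult.assoc)
    qed
    also have "\<dots> = kernel_form u k1 gb + kernel_form u k2 gb"
      by (rule kernel_form_add[OF bk1 bk2 ui gbi, symmetric])
    also have "kernel_form u k1 gb = kernel_form gb (\<lambda>z x. k1 x z) u"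
      by (rule kernel_form_swap[OF bk1 ui gbi])
    also have "\<dots> = (\<integral>x. conv j u x * (c x * gb x) \<partial>lborel)"
      unfolding kernel_form_def
    proof (rule Bochner_Integration.integral_cong[OF refl])
      fix z
      have "(\<integral>x. k1 x z * u x \<partial>lborel) = (\<integral>x. c z * (j (z - x) * u x) \<partial>lborel)"
        using even[of "z - x" for x] by (simp add: k1_def mult_ac)
      then show "gb z * (\<integral>x. k1 x z * u x \<partial>lborel) = conv j u z * (c z * gb z)" by (simp add: conv_def)
    qed
    finally have eq: "(\<integral>x. u x * c x * dirderiv b (conv j (conv j v)) x \<partial>lborel)
      - (\<integral>x. conv j u x * (c x * gb x) \<partial>lborel) = kernel_form u k2 gb" by simp
    have rgb: "compact_L2 (\<lambda>x. r * gb x)"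
      by (rule compact_L2_bounded_mult[OF compact_L2_test_fun[OF tgb], where C=r]) (use r in auto)
    have "kernel_form u k2 gb = (\<integral>x. u x * (\<integral>y. (k2 x y / r) * (r * gb y) \<partial>lborel) \<partial>lborel)"
      using r by (simp add: kernel_form_def)
    also have "\<bar>\<dots>\<bar> \<le> (L * (C / ?V)) * ?V * ((\<integral>x. (u x)\<^sup>2 \<partial>lborel) + (\<integral>x. (r * gb x)\<^sup>2 \<partial>lborel)) / 2"
    proof (rule Schur_test[OF u rgb])
      show "(\<lambda>(x, y). k2 x y / r) \<in> borel_measurable (borel \<Otimes>\<^sub>M borel)"
        unfolding k2_def by measurable
      show "\<bar>k2 x y / r\<bar> \<le> L * (C / ?V)" for x y using k2_bound[of x y] r by (simp add: field_simps)
      show "k2 x y / r = 0" if "r \<le> norm (x - y)" for x y using that j by (simp add: k2_def mollifier_def)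
    qed (use r in auto)
    also have "\<dots> = L * C * ((\<integral>x. (u x)\<^sup>2 \<partial>lborel) + r\<^sup>2 * (\<integral>x. (gb x)\<^sup>2 \<partial>lborel)) / 2"
      using V by (simp add: power_mult_distrib)
    also have "\<dots> \<le> L * C * ((\<integral>x. (u x)\<^sup>2 \<partial>lborel) + (2 ^ DIM('e) * C)\<^sup>2 * (\<integral>x. (v x)\<^sup>2 \<partial>lborel)) / 2"
    proof -
      have "C \<ge> 0" using jV[of 0] V order_trans[OF abs_ge_zero jV[of 0]] by (simp add: zero_le_divide_iff)
      then show ?thesis
        using integral_mollify_dirderiv_square_le[OF j r v b] L(1) unfolding gb_def
        by (intro divide_right_mono mult_left_mono add_left_mono) auto
    qed
    finally show "\<bar>(\<integral>x. u x * c x * dirderiv b (conv j (conv j v)) x \<partial>lborel)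
      - (\<integral>x. conv j u x * (c x * dirderiv b (conv j v) x) \<partial>lborel)\<bar>
      \<le> L * C * ((\<integral>x. (u x)\<^sup>2 \<partial>lborel) + (2 ^ DIM('e) * C)\<^sup>2 * (\<integral>x. (v x)\<^sup>2 \<partial>lborel)) / 2"
      unfolding eq[unfolded gb_def] unfolding gb_def .
  qed
qed

definition quad :: "('e::euclidean_space \<Rightarrow> 'e \<Rightarrow> 'e \<Rightarrow> real) \<Rightarrow> 'e \<Rightarrow> ('e \<Rightarrow> real) \<Rightarrow> ('e \<Rightarrow> real) \<Rightarrow> real" where
  "quad A x p q = (\<Sum>a\<in>Basis. \<Sum>b\<in>Basis. A a b x * p a * q b)"

lemma quad_sym:
  assumes "\<And>a b. a \<in> Basis \<Longrightarrow> b \<in> Basis \<Longrightarrow> A a b x = A b a x"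
  shows "quad A x p q = quad A x q p"
  unfolding quad_def by (subst sum.swap) (auto intro!: sum.cong simp: assms)

text \<open>Cauchy--Schwarz for the semidefinite form \<open>A x\<close>, in the additive form obtained from the
  nonnegativity at \<open>2 s p \<plusminus> q\<close>.\<close>

lemma quad_Young:
  assumes sym: "\<And>a b. a \<in> Basis \<Longrightarrow> b \<in> Basis \<Longrightarrow> A a b x = A b a x"
    and pos: "\<And>p. 0 \<le> quad A x p p"
  shows "2 * \<bar>s * quad A x p q\<bar> \<le> 2 * s\<^sup>2 * quad A x p p + quad A x q q / 2"
proof -
  have expand: "quad A x (\<lambda>a. t * p a + q a) (\<lambda>a. t * p a + q a) = t\<^sup>2 * quad A x p p + 2 * t * quad A x p q + quad A x q q" for t
  proof -
    have "quad A x (\<lambda>a. t * p a + q a) (\<lambda>a. t * p a + q a)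
      = t\<^sup>2 * quad A x p p + t * quad A x p q + t * quad A x q p + quad A x q q"
      unfolding quad_def by (simp add: sum_distrib_left sum.distrib[symmetric] algebra_simps power2_eq_square)
    then show ?thesis using quad_sym[of A x q p, OF sym] by simp
  qed
  have "0 \<le> 4 * s\<^sup>2 * quad A x p p + 4 * (s * quad A x p q) + quad A x q q"
    using pos[of "\<lambda>a. (2 * s) * p a + q a"] unfolding expand by (simp add: power_mult_distrib)
  moreover have "0 \<le> 4 * s\<^sup>2 * quad A x p p - 4 * (s * quad A x p q) + quad A x q q"
    using pos[of "\<lambda>a. (- 2 * s) * p a + q a"] unfolding expand by (simp add: power_mult_distrib)
  ultimately show ?thesis by (simp add: abs_if)
qed

definition energy :: "('e::euclidean_space \<Rightarrow> 'e \<Rightarrow> 'e \<Rightarrow> real) \<Rightarrow> ('e \<Rightarrow> real) \<Rightarrow> 'e \<Rightarrow> real" where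
  "energy A f x = quad A x (\<lambda>a. dirderiv a f x) (\<lambda>a. dirderiv a f x)"

definition div_form_op :: "('e::euclidean_space \<Rightarrow> 'e \<Rightarrow> 'e \<Rightarrow> real) \<Rightarrow> ('e \<Rightarrow> real) \<Rightarrow> 'e \<Rightarrow> real" where
  "div_form_op A f x = (\<Sum>a\<in>Basis. \<Sum>b\<in>Basis. dirderiv a (\<lambda>x. A a b x * dirderiv b f x) x)"

lemma compact_L2_mult_integrable:
  assumes u: "compact_L2 u" and g: "test_fun g" shows "integrable lborel (\<lambda>x. u x * g x)"
proof -
  obtain C where "\<And>x. \<bar>g x\<bar> \<le> C" using test_fun_bounded[OF g] by metis
  then have "compact_L2 (\<lambda>x. g x * u x)"
    by (intro compact_L2_bounded_mult[OF u] test_fun_measurable g)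
  from compact_L2_integrable[OF this] show ?thesis by (simp add: mult.commute)
qed

lemma compact_L2_mult:
  assumes u: "compact_L2 u" and g: "test_fun g" shows "compact_L2 (\<lambda>x. g x * u x)"
proof -
  obtain C where "\<And>x. \<bar>g x\<bar> \<le> C" using test_fun_bounded[OF g] by metis
  then show ?thesis by (intro compact_L2_bounded_mult[OF u] test_fun_measurable g)
qed

lemma integrable_test_fun: "test_fun g \<Longrightarrow> integrable lborel g"
  by (intro compact_L2_integrable compact_L2_test_fun)

lemma test_fun_mult': "test_fun f \<Longrightarrow> test_fun g \<Longrightarrow> test_fun (\<lambda>x. f x * g x)"
  by (rule test_fun_mult) (simp_all add: test_fun_def)

lemma dirderiv_add:
  assumes "test_fun f" "test_fun g"
  shows "dirderiv a (\<lambda>x. f x + g x) x = dirderiv a f x + dirderiv a g x"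
proof -
  have "((\<lambda>x. f x + g x) has_derivative (\<lambda>h. frechet_derivative f (at x) h + frechet_derivative g (at x) h)) (at x)"
    by (intro has_derivative_add test_fun_has_derivative assms)
  from frechet_derivative_at[OF this] show ?thesis by metis
qed

text \<open>The equation is tested with \<open>\<psi> = J J (\<kappa> u)\<close>. Up to the double commutator, the energy of
  \<open>g = J (\<kappa> u)\<close> is \<open>- \<integral> \<kappa> u \<partial>\<^sub>a (A\<^sub>a\<^sub>b \<partial>\<^sub>b \<psi>)\<close>, and the Leibniz rule moves \<open>\<kappa>\<close> inside the operator. This
  leaves the right hand side \<open>F\<close>, a term of order zero, and a term of first order in \<open>\<psi>\<close>. The last
  one is \<open>\<integral> (J u) A \<nabla>\<kappa> \<cdot> \<nabla>g\<close> up to a bounded commutator, and Young's inequality for the form \<open>A\<close>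
  absorbs half of the energy.\<close>

theorem local_energy_bound:
  fixes A :: "'e::euclidean_space \<Rightarrow> 'e \<Rightarrow> 'e \<Rightarrow> real"
  assumes A: "\<And>a b. a \<in> Basis \<Longrightarrow> b \<in> Basis \<Longrightarrow> test_fun (A a b)"
    and sym: "\<And>a b x. a \<in> Basis \<Longrightarrow> b \<in> Basis \<Longrightarrow> A a b x = A b a x"
    and pos: "\<And>x p. 0 \<le> quad A x p p"
    and \<kappa>: "test_fun \<kappa>" and u: "compact_L2 u" and F: "compact_L2 F"
    and eq: "\<And>\<psi>. test_fun \<psi> \<Longrightarrow>
      (\<integral>x. u x * div_form_op A (\<lambda>x. \<kappa> x * \<psi> x) x \<partial>lborel) = (\<integral>x. F x * (\<kappa> x * \<psi> x) \<partial>lborel)"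
  obtains E where "\<And>r j. 0 < r \<Longrightarrow> mollifier r j \<Longrightarrow> mollifier_bound C r j \<Longrightarrow>
    (\<integral>x. energy A (conv j (\<lambda>x. \<kappa> x * u x)) x \<partial>lborel) \<le> E"
proof -
  define v where "v = (\<lambda>x. \<kappa> x * u x)"
  have v: "compact_L2 v" unfolding v_def by (rule compact_L2_mult[OF u \<kappa>])
  define c where "c = (\<lambda>b x. \<Sum>a\<in>Basis. A a b x * dirderiv a \<kappa> x)"
  define w where "w = (\<lambda>x. \<Sum>a\<in>Basis. \<Sum>b\<in>Basis. dirderiv a (\<lambda>x. A a b x * dirderiv b \<kappa> x) x)"
  have tc: "test_fun (c b)" if "b \<in> Basis" for b
    unfolding c_def by (intro test_fun_sum test_fun_mult' A test_fun_dirderiv \<kappa> that)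
  have tw: "test_fun w"
    unfolding w_def by (intro test_fun_sum test_fun_dirderiv test_fun_mult' A \<kappa>)
  have "\<forall>a b. \<exists>D. a \<in> Basis \<longrightarrow> b \<in> Basis \<longrightarrow> (\<forall>r j. 0 < r \<longrightarrow> mollifier r j \<longrightarrow> mollifier_bound C r j \<longrightarrow>
    (\<integral>z. A a b z * dirderiv a (conv j v) z * dirderiv b (conv j v) z \<partial>lborel)
      + (\<integral>x. v x * dirderiv a (\<lambda>x. A a b x * dirderiv b (conv j (conv j v)) x) x \<partial>lborel) \<le> D)"
  proof (intro allI)
    fix a b :: 'e
    show "\<exists>D. a \<in> Basis \<longrightarrow> b \<in> Basis \<longrightarrow> (\<forall>r j. 0 < r \<longrightarrow> mollifier r j \<longrightarrow> mollifier_bound C r j \<longrightarrow>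
    (\<integral>z. A a b z * dirderiv a (conv j v) z * dirderiv b (conv j v) z \<partial>lborel)
      + (\<integral>x. v x * dirderiv a (\<lambda>x. A a b x * dirderiv b (conv j (conv j v)) x) x \<partial>lborel) \<le> D)"
    proof (cases "a \<in> Basis \<and> b \<in> Basis")
      case True
      then have ab: "a \<in> Basis" "b \<in> Basis" by auto
      show ?thesis
        by (rule double_commutator_bound_mollifier[OF A[OF ab] v ab, where C=C]) blast
    qed blast
  qed
  then obtain D where D: "\<And>a b r j. a \<in> Basis \<Longrightarrow> b \<in> Basis \<Longrightarrow> 0 < r \<Longrightarrow> mollifier r j \<Longrightarrow> mollifier_bound C r j \<Longrightarrow>
    (\<integral>z. A a b z * dirderiv a (conv j v) z * dirderiv b (conv j v) z \<partial>lborel)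
      + (\<integral>x. v x * dirderiv a (\<lambda>x. A a b x * dirderiv b (conv j (conv j v)) x) x \<partial>lborel) \<le> D a b"
    unfolding choice_iff by blast
  have "\<forall>b. \<exists>G. b \<in> Basis \<longrightarrow> (\<forall>r j. 0 < r \<longrightarrow> mollifier r j \<longrightarrow> mollifier_bound C r j \<longrightarrow>
    \<bar>(\<integral>x. u x * c b x * dirderiv b (conv j (conv j v)) x \<partial>lborel)
      - (\<integral>x. conv j u x * (c b x * dirderiv b (conv j v) x) \<partial>lborel)\<bar> \<le> G)"
  proof
    fix b :: 'e
    show "\<exists>G. b \<in> Basis \<longrightarrow> (\<forall>r j. 0 < r \<longrightarrow> mollifier r j \<longrightarrow> mollifier_bound C r j \<longrightarrow>
    \<bar>(\<integral>x. u x * c b x * dirderiv b (conv j (conv j v)) x \<partial>lborel)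
      - (\<integral>x. conv j u x * (c b x * dirderiv b (conv j v) x) \<partial>lborel)\<bar> \<le> G)"
    proof (cases "b \<in> Basis")
      case True
      show ?thesis by (rule commutator_mult_bound[OF tc[OF True] u v True, where C=C]) blast
    qed blast
  qed
  then obtain G where G: "\<And>b r j. b \<in> Basis \<Longrightarrow> 0 < r \<Longrightarrow> mollifier r j \<Longrightarrow> mollifier_bound C r j \<Longrightarrow>
    \<bar>(\<integral>x. u x * c b x * dirderiv b (conv j (conv j v)) x \<partial>lborel)
      - (\<integral>x. conv j u x * (c b x * dirderiv b (conv j v) x) \<partial>lborel)\<bar> \<le> G b"
    unfolding choice_iff by blast
  define q\<kappa> where "q\<kappa> = energy A \<kappa>"
  have tq\<kappa>: "test_fun q\<kappa>"
    unfolding q\<kappa>_def energy_def quad_def by (intro test_fun_sum test_fun_mult' A test_fun_dirderiv \<kappa>)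
  obtain M where M: "M \<ge> 0" "\<And>x. \<bar>q\<kappa> x\<bar> \<le> M" using test_fun_bounded[OF tq\<kappa>] by metis
  define I where "I = (\<lambda>f::'e \<Rightarrow> real. \<integral>x. (f x)\<^sup>2 \<partial>lborel)"
  define F\<kappa> uw where "F\<kappa> = (\<lambda>x. \<kappa> x * F x)" and "uw = (\<lambda>x. w x * u x)"
  have F\<kappa>: "compact_L2 F\<kappa>" and uw: "compact_L2 uw"
    unfolding F\<kappa>_def uw_def by (rule compact_L2_mult[OF F \<kappa>], rule compact_L2_mult[OF u tw])
  define E where "E = C * (I F\<kappa> + C\<^sup>2 * I v) / 2 + C * (I uw + C\<^sup>2 * I v) / 2
    + 2 * (\<Sum>b\<in>Basis. G b) + 2 * M * (C\<^sup>2 * I u) + (\<Sum>a\<in>Basis. \<Sum>b\<in>Basis. D a b)"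
  show thesis
  proof (rule that)
    fix r and j :: "'e \<Rightarrow> real"
    assume r: "0 < r" and j: "mollifier r j" "mollifier_bound C r j"
    have tj: "test_fun j" using j by (simp add: mollifier_def)
    define g \<psi> where "g = conv j v" and "\<psi> = conv j g"
    have tg: "test_fun g" unfolding g_def by (rule test_fun_conv[OF tj v])
    have g: "compact_L2 g" by (rule compact_L2_test_fun[OF tg])
    have t\<psi>: "test_fun \<psi>" unfolding \<psi>_def by (rule test_fun_conv[OF tj g])
    have C0: "C \<ge> 0"
    proof -
      have "0 \<le> \<bar>j 0\<bar> * ball_vol TYPE('e) r" using ball_vol_pos[OF r, where 'e='e] by simp
      also have "\<dots> \<le> C" using j(2) by (simp add: mollifier_bound_def)
      finally show ?thesis .
    qed
    define Q where "Q = (\<integral>x. energy A g x \<partial>lborel)"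
    have tij: "test_fun (\<lambda>x. A a b x * dirderiv a g x * dirderiv b g x)" if "a \<in> Basis" "b \<in> Basis" for a b
      by (intro test_fun_mult' A test_fun_dirderiv tg that)
    have Q_sum: "Q = (\<Sum>a\<in>Basis. \<Sum>b\<in>Basis. \<integral>x. A a b x * dirderiv a g x * dirderiv b g x \<partial>lborel)"
      unfolding Q_def energy_def quad_def
      by (simp add: integrable_test_fun[OF tij] integral_sum)
    have Qint: "integrable lborel (energy A g)"
      unfolding energy_def quad_def[abs_def]
      by (intro Bochner_Integration.integrable_sum integrable_test_fun tij)

    have leib: "\<kappa> x * dirderiv a (\<lambda>x. A a b x * dirderiv b \<psi> x) x
      = dirderiv a (\<lambda>x. A a b x * dirderiv b (\<lambda>x. \<kappa> x * \<psi> x) x) x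
        - dirderiv a (\<lambda>x. A a b x * dirderiv b \<kappa> x) x * \<psi> x
        - A a b x * dirderiv b \<kappa> x * dirderiv a \<psi> x - A a b x * dirderiv a \<kappa> x * dirderiv b \<psi> x"
      if ab: "a \<in> Basis" "b \<in> Basis" for a b x
    proof -
      note t = A[OF ab] \<kappa> t\<psi> test_fun_dirderiv test_fun_mult'
      have "(\<lambda>x. A a b x * dirderiv b (\<lambda>x. \<kappa> x * \<psi> x) x)
        = (\<lambda>x. (A a b x * dirderiv b \<kappa> x) * \<psi> x + \<kappa> x * (A a b x * dirderiv b \<psi> x))"
        by (rule ext) (simp add: dirderiv_mult[OF \<kappa> t\<psi>] algebra_simps)
      then have "dirderiv a (\<lambda>x. A a b x * dirderiv b (\<lambda>x. \<kappa> x * \<psi> x) x) x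
        = dirderiv a (\<lambda>x. (A a b x * dirderiv b \<kappa> x) * \<psi> x) x + dirderiv a (\<lambda>x. \<kappa> x * (A a b x * dirderiv b \<psi> x)) x"
        by (simp only:) (rule dirderiv_add; intro t)
      also have "dirderiv a (\<lambda>x. (A a b x * dirderiv b \<kappa> x) * \<psi> x) x
        = dirderiv a (\<lambda>x. A a b x * dirderiv b \<kappa> x) x * \<psi> x + A a b x * dirderiv b \<kappa> x * dirderiv a \<psi> x"
        by (rule dirderiv_mult; intro t)
      also have "dirderiv a (\<lambda>x. \<kappa> x * (A a b x * dirderiv b \<psi> x)) x
        = dirderiv a \<kappa> x * (A a b x * dirderiv b \<psi> x) + \<kappa> x * dirderiv a (\<lambda>x. A a b x * dirderiv b \<psi> x) x"
        by (rule dirderiv_mult; intro t)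
      finally show ?thesis by simp
    qed
    have ti: "integrable lborel (\<lambda>x. u x * dirderiv a (\<lambda>x. A a b x * dirderiv b (\<lambda>x. \<kappa> x * \<psi> x) x) x)"
      "integrable lborel (\<lambda>x. u x * (dirderiv a (\<lambda>x. A a b x * dirderiv b \<kappa> x) x * \<psi> x))"
      "integrable lborel (\<lambda>x. u x * (A a b x * dirderiv b \<kappa> x * dirderiv a \<psi> x))"
      "integrable lborel (\<lambda>x. u x * (A a b x * dirderiv a \<kappa> x * dirderiv b \<psi> x))"
      if "a \<in> Basis" "b \<in> Basis" for a b
      by (intro compact_L2_mult_integrable[OF u] test_fun_dirderiv test_fun_mult' A \<kappa> t\<psi> that)+
    have vint: "(\<integral>x. v x * dirderiv a (\<lambda>x. A a b x * dirderiv b \<psi> x) x \<partial>lborel)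
      = (\<integral>x. u x * dirderiv a (\<lambda>x. A a b x * dirderiv b (\<lambda>x. \<kappa> x * \<psi> x) x) x \<partial>lborel)
       - (\<integral>x. u x * (dirderiv a (\<lambda>x. A a b x * dirderiv b \<kappa> x) x * \<psi> x) \<partial>lborel)
       - (\<integral>x. u x * (A a b x * dirderiv b \<kappa> x * dirderiv a \<psi> x) \<partial>lborel)
       - (\<integral>x. u x * (A a b x * dirderiv a \<kappa> x * dirderiv b \<psi> x) \<partial>lborel)"
      if ab: "a \<in> Basis" "b \<in> Basis" for a b
    proof -
      have "v x * dirderiv a (\<lambda>x. A a b x * dirderiv b \<psi> x) x
        = u x * dirderiv a (\<lambda>x. A a b x * dirderiv b (\<lambda>x. \<kappa> x * \<psi> x) x) x
        - u x * (dirderiv a (\<lambda>x. A a b x * dirderiv b \<kappa> x) x * \<psi> x)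
        - u x * (A a b x * dirderiv b \<kappa> x * dirderiv a \<psi> x) - u x * (A a b x * dirderiv a \<kappa> x * dirderiv b \<psi> x)" for x
      proof -
        have "v x * dirderiv a (\<lambda>x. A a b x * dirderiv b \<psi> x) x = u x * (\<kappa> x * dirderiv a (\<lambda>x. A a b x * dirderiv b \<psi> x) x)"
          by (simp add: v_def)
        also note leib[OF ab]
        finally show ?thesis by (simp only: right_diff_distrib)
      qed
      then show ?thesis by (simp only: Bochner_Integration.integral_diff Bochner_Integration.integrable_diff ti[OF ab])
    qed
    define S1 where "S1 = (\<integral>x. u x * div_form_op A (\<lambda>x. \<kappa> x * \<psi> x) x \<partial>lborel)"
    define S2 where "S2 = (\<integral>x. u x * (w x * \<psi> x) \<partial>lborel)"
    define S3 where "S3 = (\<Sum>b\<in>Basis. \<integral>x. u x * c b x * dirderiv b \<psi> x \<partial>lborel)"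
    have S1: "(\<Sum>a\<in>Basis. \<Sum>b\<in>Basis. \<integral>x. u x * dirderiv a (\<lambda>x. A a b x * dirderiv b (\<lambda>x. \<kappa> x * \<psi> x) x) x \<partial>lborel) = S1"
      unfolding S1_def div_form_op_def by (simp add: sum_distrib_left integral_sum ti)
    have S2: "(\<Sum>a\<in>Basis. \<Sum>b\<in>Basis. \<integral>x. u x * (dirderiv a (\<lambda>x. A a b x * dirderiv b \<kappa> x) x * \<psi> x) \<partial>lborel) = S2"
      unfolding S2_def w_def by (simp add: sum_distrib_left sum_distrib_right integral_sum ti)
    have S3a: "(\<Sum>a\<in>Basis. \<Sum>b\<in>Basis. \<integral>x. u x * (A a b x * dirderiv a \<kappa> x * dirderiv b \<psi> x) \<partial>lborel) = S3"
    proof -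
      have "S3 = (\<Sum>b\<in>Basis. \<integral>x. (\<Sum>a\<in>Basis. u x * (A a b x * dirderiv a \<kappa> x * dirderiv b \<psi> x)) \<partial>lborel)"
        unfolding S3_def c_def by (simp add: sum_distrib_left sum_distrib_right mult_ac)
      also have "\<dots> = (\<Sum>b\<in>Basis. \<Sum>a\<in>Basis. \<integral>x. u x * (A a b x * dirderiv a \<kappa> x * dirderiv b \<psi> x) \<partial>lborel)"
        by (intro sum.cong refl Bochner_Integration.integral_sum ti)
      finally show ?thesis by (subst sum.swap) simp
    qed
    have S3b: "(\<Sum>a\<in>Basis. \<Sum>b\<in>Basis. \<integral>x. u x * (A a b x * dirderiv b \<kappa> x * dirderiv a \<psi> x) \<partial>lborel) = S3"
      unfolding S3a[symmetric] by (subst sum.swap) (auto intro!: sum.cong simp: sym)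
    have sumv: "(\<Sum>a\<in>Basis. \<Sum>b\<in>Basis. \<integral>x. v x * dirderiv a (\<lambda>x. A a b x * dirderiv b \<psi> x) x \<partial>lborel) = S1 - S2 - 2 * S3"
      by (simp add: vint sum_subtractf S1 S2 S3a S3b)
    have "Q + (S1 - S2 - 2 * S3) \<le> (\<Sum>a\<in>Basis. \<Sum>b\<in>Basis. D a b)"
      unfolding Q_sum sumv[symmetric] sum.distrib[symmetric]
      by (intro sum_mono) (use D r j in \<open>simp add: g_def \<psi>_def\<close>)
    then have Qle: "Q \<le> \<bar>S1\<bar> + \<bar>S2\<bar> + 2 * S3 + (\<Sum>a\<in>Basis. \<Sum>b\<in>Basis. D a b)" by linarith

    have Ig: "I g \<le> C\<^sup>2 * I v" unfolding I_def g_def by (rule integral_mollify_square_le[OF j r v])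
    have "S1 = (\<integral>x. F\<kappa> x * conv j g x \<partial>lborel)"
      unfolding S1_def eq[OF t\<psi>] unfolding F\<kappa>_def \<psi>_def by (simp add: mult_ac)
    then have "\<bar>S1\<bar> \<le> C * (I F\<kappa> + I g) / 2"
      unfolding I_def using Schur_test_conv[OF j r F\<kappa> g] by simp
    also have "\<dots> \<le> C * (I F\<kappa> + C\<^sup>2 * I v) / 2"
      using Ig C0 by (intro divide_right_mono mult_left_mono add_left_mono) auto
    finally have b1: "\<bar>S1\<bar> \<le> C * (I F\<kappa> + C\<^sup>2 * I v) / 2" .
    have "S2 = (\<integral>x. uw x * conv j g x \<partial>lborel)"
      unfolding S2_def uw_def \<psi>_def by (simp add: mult_ac)
    then have "\<bar>S2\<bar> \<le> C * (I uw + I g) / 2"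
      unfolding I_def using Schur_test_conv[OF j r uw g] by simp
    also have "\<dots> \<le> C * (I uw + C\<^sup>2 * I v) / 2"
      using Ig C0 by (intro divide_right_mono mult_left_mono add_left_mono) auto
    finally have b2: "\<bar>S2\<bar> \<le> C * (I uw + C\<^sup>2 * I v) / 2" .

    define U where "U = conv j u"
    have tU: "test_fun U" unfolding U_def by (rule test_fun_conv[OF tj u])
    have tUi: "test_fun (\<lambda>x. U x * (c b x * dirderiv b g x))" if "b \<in> Basis" for b
      by (intro test_fun_mult' tU tc test_fun_dirderiv tg that)
    have "S3 \<le> (\<Sum>b\<in>Basis. (\<integral>x. U x * (c b x * dirderiv b g x) \<partial>lborel) + G b)"
      unfolding S3_def
    proof (rule sum_mono)
      fix b :: 'e assume b: "b \<in> Basis"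
      show "(\<integral>x. u x * c b x * dirderiv b \<psi> x \<partial>lborel) \<le> (\<integral>x. U x * (c b x * dirderiv b g x) \<partial>lborel) + G b"
        using G[OF b r j] unfolding \<psi>_def g_def U_def by linarith
    qed
    also have "\<dots> = (\<integral>x. U x * quad A x (\<lambda>a. dirderiv a \<kappa> x) (\<lambda>a. dirderiv a g x) \<partial>lborel) + (\<Sum>b\<in>Basis. G b)"
    proof -
      have "(\<integral>x. U x * quad A x (\<lambda>a. dirderiv a \<kappa> x) (\<lambda>a. dirderiv a g x) \<partial>lborel)
        = (\<integral>x. (\<Sum>b\<in>Basis. U x * (c b x * dirderiv b g x)) \<partial>lborel)"
        unfolding quad_def c_def
        by (subst sum.swap) (simp add: sum_distrib_left sum_distrib_right mult_ac)
      also have "\<dots> = (\<Sum>b\<in>Basis. \<integral>x. U x * (c b x * dirderiv b g x) \<partial>lborel)"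
        by (intro Bochner_Integration.integral_sum integrable_test_fun tUi)
      finally show ?thesis by (simp add: sum.distrib)
    qed
    finally have "2 * S3 \<le> (\<integral>x. 2 * (U x * quad A x (\<lambda>a. dirderiv a \<kappa> x) (\<lambda>a. dirderiv a g x)) \<partial>lborel) + 2 * (\<Sum>b\<in>Basis. G b)"
      by simp
    also have "(\<integral>x. 2 * (U x * quad A x (\<lambda>a. dirderiv a \<kappa> x) (\<lambda>a. dirderiv a g x)) \<partial>lborel)
      \<le> (\<integral>x. 2 * M * (U x)\<^sup>2 + energy A g x / 2 \<partial>lborel)"
    proof (rule integral_mono)
      have "test_fun (\<lambda>x. U x * quad A x (\<lambda>a. dirderiv a \<kappa> x) (\<lambda>a. dirderiv a g x))"
        unfolding quad_def by (intro test_fun_mult' test_fun_sum tU A test_fun_dirderiv \<kappa> tg)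
      from integrable_test_fun[OF this]
      show "integrable lborel (\<lambda>x. 2 * (U x * quad A x (\<lambda>a. dirderiv a \<kappa> x) (\<lambda>a. dirderiv a g x)))" by simp
      show "integrable lborel (\<lambda>x. 2 * M * (U x)\<^sup>2 + energy A g x / 2)"
        using Qint compact_L2_test_fun[OF tU] by (simp add: compact_L2_def)
      fix x
      have "2 * (U x * quad A x (\<lambda>a. dirderiv a \<kappa> x) (\<lambda>a. dirderiv a g x))
        \<le> 2 * \<bar>U x * quad A x (\<lambda>a. dirderiv a \<kappa> x) (\<lambda>a. dirderiv a g x)\<bar>" by simp
      also have "\<dots> \<le> 2 * (U x)\<^sup>2 * q\<kappa> x + energy A g x / 2"
        unfolding q\<kappa>_def energy_def by (rule quad_Young[OF sym pos])
      also have "2 * (U x)\<^sup>2 * q\<kappa> x \<le> 2 * (U x)\<^sup>2 * M"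
        by (rule mult_left_mono) (use M(2)[of x] in auto)
      finally show "2 * (U x * quad A x (\<lambda>a. dirderiv a \<kappa> x) (\<lambda>a. dirderiv a g x)) \<le> 2 * M * (U x)\<^sup>2 + energy A g x / 2"
        by (simp add: mult_ac)
    qed
    also have "(\<integral>x. 2 * M * (U x)\<^sup>2 + energy A g x / 2 \<partial>lborel) = 2 * M * I U + Q / 2"
      using Qint compact_L2_test_fun[OF tU] by (simp add: compact_L2_def I_def Q_def)
    also have "2 * M * I U \<le> 2 * M * (C\<^sup>2 * I u)"
      unfolding I_def U_def by (intro mult_left_mono integral_mollify_square_le[OF j r u]) (use M in auto)
    finally have b3: "2 * S3 \<le> 2 * M * (C\<^sup>2 * I u) + Q / 2 + 2 * (\<Sum>b\<in>Basis. G b)" by simp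
    have "q \<le> 2 * (x + y + w + z + d)"
      if "q \<le> a + b + c + d" "a \<le> x" "b \<le> y" "c \<le> z + q / 2 + w" for a b c d q w x y z :: real
      using that by simp
    from this[OF Qle b1 b2 b3] have "Q \<le> 2 * E" unfolding E_def .
    then show "(\<integral>x. energy A (conv j (\<lambda>x. \<kappa> x * u x)) x \<partial>lborel) \<le> 2 * E"
      by (simp add: Q_def g_def v_def)
  qed
qed

text \<open>Convolution with the even kernel moves to the Lipschitz function \<open>h\<close>, which it changes by
  at most \<open>L * r\<close>.\<close>

lemma mollifier_pairing:
  fixes j :: "'e::euclidean_space \<Rightarrow> real"
  assumes j: "mollifier r j" and r: "r > 0" and v: "integrable lborel v" and h: "test_fun h"
    and L: "\<And>x y. \<bar>h x - h y\<bar> \<le> L * norm (x - y)" "L \<ge> 0"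
  shows "\<bar>(\<integral>x. conv j v x * h x \<partial>lborel) - (\<integral>x. v x * h x \<partial>lborel)\<bar> \<le> L * r * (\<integral>x. \<bar>v x\<bar> \<partial>lborel)"
proof -
  have tj: "test_fun j" and even: "\<And>x. j (- x) = j x" and nn: "\<And>x. 0 \<le> j x" and j0: "\<And>x. norm x \<ge> r \<Longrightarrow> j x = 0"
    and j1: "(\<integral>x. j x \<partial>lborel) = 1" using j by (auto simp: mollifier_def)
  note [measurable] = test_fun_measurable[OF tj] test_fun_measurable[OF h]
  have ji: "integrable lborel j" and hi: "integrable lborel h" by (intro integrable_test_fun tj h)+
  obtain C where C: "\<And>z y. \<bar>j (z - y)\<bar> \<le> C" and m: "(\<lambda>(z, y). j (z - y)) \<in> borel_measurable (borel \<Otimes>\<^sub>M borel)"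
    using bounded_kernel_translate[OF tj] by (auto simp: bounded_kernel_def)
  obtain Ch where Ch: "\<And>x. \<bar>h x\<bar> \<le> Ch" using test_fun_bounded[OF h] by metis
  have "(\<integral>x. conv j v x * h x \<partial>lborel) = (\<integral>x. h x * (\<integral>y. j (x - y) * v y \<partial>lborel) \<partial>lborel)"
    by (simp add: conv_def mult.commute)
  also have "\<dots> = (\<integral>y. (\<integral>x. h x * j (x - y) \<partial>lborel) * v y \<partial>lborel)"
    by (rule kernel_Fubini[OF hi v m C])
  also have "\<dots> = (\<integral>y. v y * conv j h y \<partial>lborel)"
  proof (rule Bochner_Integration.integral_cong[OF refl])
    fix y
    have "j (x - y) = j (y - x)" for x using even[of "y - x"] by simp
    then show "(\<integral>x. h x * j (x - y) \<partial>lborel) * v y = v y * conv j h y" by (simp add: conv_def mult.commute)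
  qed
  finally have 1: "(\<integral>x. conv j v x * h x \<partial>lborel) = (\<integral>y. v y * conv j h y \<partial>lborel)" .
  have shift: "(\<integral>y. j (x - y) \<partial>lborel) = 1" "integrable lborel (\<lambda>y. j (x - y))" for x
    using lborel_integral_reflect[of j x] j1 ji by auto
  have diff: "\<bar>conv j h x - h x\<bar> \<le> L * r" for x
  proof -
    have "conv j h x - h x = (\<integral>y. j (x - y) * h y \<partial>lborel) - (\<integral>y. j (x - y) * h x \<partial>lborel)"
      by (simp add: conv_def shift)
    also have "\<dots> = (\<integral>y. j (x - y) * (h y - h x) \<partial>lborel)"
      using integrable_conv_integrand[OF tj hi] shift(2) by (simp add: right_diff_distrib)
    also have "\<bar>\<dots>\<bar> \<le> (\<integral>y. j (x - y) * (L * r) \<partial>lborel)"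
    proof (rule integral_abs_bound_integral)
      show "integrable lborel (\<lambda>y. j (x - y) * (h y - h x))"
        using integrable_conv_integrand[OF tj hi] shift(2) by (simp add: right_diff_distrib)
      show "integrable lborel (\<lambda>y. j (x - y) * (L * r))" using shift(2) by simp
      fix y
      show "\<bar>j (x - y) * (h y - h x)\<bar> \<le> j (x - y) * (L * r)"
      proof (cases "norm (x - y) < r")
        case True
        have "\<bar>h y - h x\<bar> \<le> L * r"
          by (rule order_trans[OF L(1)]) (use True L(2) in \<open>intro mult_left_mono; simp add: norm_minus_commute\<close>)
        then show ?thesis using nn[of "x - y"] by (simp add: abs_mult mult_left_mono)
      qed (use j0 in simp)
    qed
    also have "\<dots> = L * r" by (simp add: shift)
    finally show ?thesis .
  qed
  have i: "integrable lborel (\<lambda>x. v x * conv j h x)" "integrable lborel (\<lambda>x. v x * h x)"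
  proof -
    have "integrable lborel (\<lambda>x. v x * k x)" if k: "test_fun k" for k
    proof -
      obtain D where D: "\<And>x. \<bar>k x\<bar> \<le> D" using test_fun_bounded[OF k] by metis
      have [measurable]: "k \<in> borel_measurable borel" by (rule test_fun_measurable[OF k])
      have "integrable lborel (\<lambda>x. D * v x)" using v by simp
      then show ?thesis
      proof (rule Bochner_Integration.integrable_bound)
        have "\<bar>k x\<bar> * \<bar>v x\<bar> \<le> \<bar>D\<bar> * \<bar>v x\<bar>" for x by (rule mult_right_mono) (use D[of x] in auto)
        then show "AE x in lborel. norm (v x * k x) \<le> norm (D * v x)" by (simp add: abs_mult mult.commute)
      qed (use v in measurable)
    qed
    then show "integrable lborel (\<lambda>x. v x * conv j h x)" "integrable lborel (\<lambda>x. v x * h x)"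
      using h test_fun_conv[OF tj compact_L2_test_fun[OF h]] by auto
  qed
  have "(\<integral>x. conv j v x * h x \<partial>lborel) - (\<integral>x. v x * h x \<partial>lborel) = (\<integral>x. v x * (conv j h x - h x) \<partial>lborel)"
    unfolding 1 using i by (simp add: right_diff_distrib)
  also have "\<bar>\<dots>\<bar> \<le> (\<integral>x. L * r * \<bar>v x\<bar> \<partial>lborel)"
  proof (rule integral_abs_bound_integral)
    show "integrable lborel (\<lambda>x. v x * (conv j h x - h x))" using i by (simp add: right_diff_distrib)
    show "\<bar>v x * (conv j h x - h x)\<bar> \<le> L * r * \<bar>v x\<bar>" for x
      unfolding abs_mult by (subst mult.commute) (intro mult_right_mono diff abs_ge_zero)
  qed (use v in simp)
  finally show ?thesis by simp
qed

section \<open>Hadamard's lemma\<close>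

lemma continuous_on_segment:
  fixes F :: "'e::euclidean_space \<Rightarrow> real"
  assumes "test_fun F"
  shows "continuous_on {0..1::real} (\<lambda>t. t ^ m * F (x0 + t *\<^sub>R (x - x0)))"
  by (intro continuous_intros continuous_on_compose2[OF test_fun_continuous[OF assms, of UNIV]]) auto

definition segment_mean :: "nat \<Rightarrow> 'e::euclidean_space \<Rightarrow> ('e \<Rightarrow> real) \<Rightarrow> 'e \<Rightarrow> real" where
  "segment_mean m x0 F x = integral {0..1} (\<lambda>t. t ^ m * F (x0 + t *\<^sub>R (x - x0)))"

lemma segment_mean_has_derivative:
  fixes F :: "'e::euclidean_space \<Rightarrow> real"
  assumes F: "test_fun F"
  shows "(segment_mean m x0 F has_derivative (\<lambda>h. \<Sum>b\<in>Basis. (h \<bullet> b) * segment_mean (Suc m) x0 (dirderiv b F) x)) (at x)"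
proof -
  obtain C where C: "C \<ge> 0" "\<And>x h. \<bar>F (x + h) - F x - frechet_derivative F (at x) h\<bar> \<le> C * (norm h)\<^sup>2"
    using test_fun_Taylor[OF F] by metis
  have i: "(\<lambda>t. t ^ m * F (x0 + t *\<^sub>R (x - x0))) integrable_on {0..1}" for m x
    by (intro integrable_continuous_real continuous_on_segment F)
  have i': "(\<lambda>t. t ^ m * dirderiv b F (x0 + t *\<^sub>R (x - x0))) integrable_on {0..1}" for m b x
    by (intro integrable_continuous_real continuous_on_segment test_fun_dirderiv F)
  show ?thesis
  proof (rule has_derivativeI_sandwich[of 1, where H="\<lambda>y. C * norm (y - x)"])
    show "bounded_linear (\<lambda>h. \<Sum>b\<in>Basis. (h \<bullet> b) * segment_mean (Suc m) x0 (dirderiv b F) x)"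
      by (intro bounded_linear_sum bounded_linear_mult_left[THEN bounded_linear_compose] bounded_linear_inner_left)
    show "((\<lambda>y. C * norm (y - x)) \<longlongrightarrow> 0) (at x within UNIV)"
      by (auto intro!: tendsto_eq_intros)
    fix y assume "y \<noteq> x"
    let ?D = "\<lambda>t. t ^ m * F (x0 + t *\<^sub>R (y - x0)) - t ^ m * F (x0 + t *\<^sub>R (x - x0))
       - (\<Sum>b\<in>Basis. ((y - x) \<bullet> b) * (t ^ Suc m * dirderiv b F (x0 + t *\<^sub>R (x - x0))))"
    have pw: "norm (?D t) \<le> C * (norm (y - x))\<^sup>2" if t: "t \<in> {0..1}" for t
    proof -
      let ?p = "x0 + t *\<^sub>R (x - x0)"
      have "frechet_derivative F (at ?p) (t *\<^sub>R (y - x)) = t * frechet_derivative F (at ?p) (y - x)"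
        using linear_simps(5)[OF bounded_linear_frechet[OF F]] by simp
      also have "frechet_derivative F (at ?p) (y - x) = (\<Sum>b\<in>Basis. ((y - x) \<bullet> b) * dirderiv b F ?p)"
        using has_derivative_expand_Basis[OF test_fun_has_derivative[OF F], of ?p "y - x"] by simp
      finally have "?D t = t ^ m * (F (?p + t *\<^sub>R (y - x)) - F ?p - frechet_derivative F (at ?p) (t *\<^sub>R (y - x)))"
        by (simp add: algebra_simps sum_distrib_left)
      also have "norm \<dots> \<le> 1 * (C * (norm (t *\<^sub>R (y - x)))\<^sup>2)"
        unfolding norm_mult
      proof (rule mult_mono)
        show "norm (t ^ m) \<le> 1" using t by (simp add: power_le_one)
        show "norm (F (?p + t *\<^sub>R (y - x)) - F ?p - frechet_derivative F (at ?p) (t *\<^sub>R (y - x))) \<le> C * (norm (t *\<^sub>R (y - x)))\<^sup>2"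
          using C(2)[of ?p "t *\<^sub>R (y - x)"] by simp
      qed (use C(1) in auto)
      also have "\<dots> \<le> C * (norm (y - x))\<^sup>2"
        using t C(1) by (auto intro!: mult_left_mono power_mono mult_left_le_one_le)
      finally show ?thesis .
    qed
    have isum: "(\<lambda>t. \<Sum>b\<in>Basis. ((y - x) \<bullet> b) * (t ^ Suc m * dirderiv b F (x0 + t *\<^sub>R (x - x0)))) integrable_on {0..1}"
      by (intro integrable_sum integrable_on_mult_right i') auto
    have "integral {0..1} ?D = segment_mean m x0 F y - segment_mean m x0 F x
       - integral {0..1} (\<lambda>t. \<Sum>b\<in>Basis. ((y - x) \<bullet> b) * (t ^ Suc m * dirderiv b F (x0 + t *\<^sub>R (x - x0))))"
      unfolding segment_mean_def
      by (simp only: Henstock_Kurzweil_Integration.integral_diff integrable_diff i isum)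
    also have "integral {0..1} (\<lambda>t. \<Sum>b\<in>Basis. ((y - x) \<bullet> b) * (t ^ Suc m * dirderiv b F (x0 + t *\<^sub>R (x - x0))))
      = (\<Sum>b\<in>Basis. ((y - x) \<bullet> b) * segment_mean (Suc m) x0 (dirderiv b F) x)"
      unfolding segment_mean_def
      by (subst Henstock_Kurzweil_Integration.integral_sum)
        (auto intro!: integrable_on_mult_right i' sum.cong Henstock_Kurzweil_Integration.integral_mult_right simp del: power_Suc)
    finally have "segment_mean m x0 F y - segment_mean m x0 F x
       - (\<Sum>b\<in>Basis. ((y - x) \<bullet> b) * segment_mean (Suc m) x0 (dirderiv b F) x) = integral {0..1} ?D" by simp
    also have "norm \<dots> \<le> (C * (norm (y - x))\<^sup>2) * (1 - 0)"
    proof (rule integral_bound)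
      show "continuous_on {0..1} ?D"
        by (intro continuous_on_diff continuous_on_sum continuous_on_mult_left continuous_on_segment test_fun_dirderiv F)
    qed (use pw in auto)
    finally show "norm (segment_mean m x0 F y - segment_mean m x0 F x
       - (\<Sum>b\<in>Basis. ((y - x) \<bullet> b) * segment_mean (Suc m) x0 (dirderiv b F) x)) / norm (y - x) \<le> C * norm (y - x)"
      using \<open>y \<noteq> x\<close> by (simp add: divide_simps power2_eq_square mult_ac)
  qed auto
qed

lemma smooth_on_segment_mean:
  assumes "test_fun F" shows "smooth_on UNIV (segment_mean m x0 F)"
proof -
  have "C_k_on n UNIV (segment_mean m x0 F)" if "test_fun F" for n m F
    using that
  proof (induction n arbitrary: m F)
    case 0
    then show ?case
      by (auto intro!: continuous_at_imp_continuous_on has_derivative_continuous segment_mean_has_derivative)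
  next
    case (Suc n)
    show ?case
    proof (rule C_k_on_SucI[OF _ segment_mean_has_derivative[OF Suc.prems]])
      fix h show "C_k_on n UNIV (\<lambda>x. \<Sum>b\<in>Basis. (h \<bullet> b) * segment_mean (Suc m) x0 (dirderiv b F) x)"
        by (intro C_k_on_sum C_k_on_bilinear[OF _ bounded_bilinear_mult] C_k_on_const Suc test_fun_dirderiv) auto
    qed auto
  qed
  then show ?thesis using assms by (simp add: smooth_on_def)
qed

text \<open>The coefficient \<open>G b\<close> is the mean of \<open>dirderiv b F\<close> over the segment from \<open>x0\<close> to \<open>x\<close>.\<close>

lemma Hadamard:
  fixes F :: "'e::euclidean_space \<Rightarrow> real"
  assumes F: "test_fun F"
  obtains G where "\<And>b. smooth_on UNIV (G b)" "\<And>x. F x = F x0 + (\<Sum>b\<in>Basis. ((x - x0) \<bullet> b) * G b x)"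
    "\<And>b. G b x0 = dirderiv b F x0"
proof (rule that)
  let ?G = "\<lambda>b. segment_mean 0 x0 (dirderiv b F)"
  show "smooth_on UNIV (?G b)" for b by (intro smooth_on_segment_mean test_fun_dirderiv F)
  show "?G b x0 = dirderiv b F x0" for b by (simp add: segment_mean_def)
  fix x
  have i: "(\<lambda>t. dirderiv b F (x0 + t *\<^sub>R (x - x0))) integrable_on {0..1}" for b
    using integrable_continuous_real[OF continuous_on_segment[OF test_fun_dirderiv[OF F], where m=0]] by simp
  have "((\<lambda>t. frechet_derivative F (at (x0 + t *\<^sub>R (x - x0))) (x - x0)) has_integral
      F (x0 + 1 *\<^sub>R (x - x0)) - F (x0 + 0 *\<^sub>R (x - x0))) {0..1}"
  proof (rule fundamental_theorem_of_calculus)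
    fix t :: real assume "t \<in> {0..1}"
    have "((\<lambda>t. F (x0 + t *\<^sub>R (x - x0))) has_derivative (\<lambda>s. frechet_derivative F (at (x0 + t *\<^sub>R (x - x0))) (s *\<^sub>R (x - x0)))) (at t within {0..1})"
      by (rule has_derivative_compose[of "\<lambda>t. x0 + t *\<^sub>R (x - x0)" "\<lambda>s. s *\<^sub>R (x - x0)", OF _ test_fun_has_derivative[OF F]])
        (auto intro!: derivative_eq_intros)
    then show "((\<lambda>t. F (x0 + t *\<^sub>R (x - x0))) has_vector_derivative frechet_derivative F (at (x0 + t *\<^sub>R (x - x0))) (x - x0)) (at t within {0..1})"
      unfolding has_vector_derivative_def using linear_simps(5)[OF bounded_linear_frechet[OF F]] by simp
  qed simp
  then have "F x - F x0 = integral {0..1} (\<lambda>t. frechet_derivative F (at (x0 + t *\<^sub>R (x - x0))) (x - x0))"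
    by (simp add: integral_unique)
  also have "\<dots> = integral {0..1} (\<lambda>t. \<Sum>b\<in>Basis. ((x - x0) \<bullet> b) * dirderiv b F (x0 + t *\<^sub>R (x - x0)))"
    using has_derivative_expand_Basis[OF test_fun_has_derivative[OF F], of _ "x - x0"] by simp
  also have "\<dots> = (\<Sum>b\<in>Basis. ((x - x0) \<bullet> b) * ?G b x)"
    unfolding segment_mean_def
    by (subst Henstock_Kurzweil_Integration.integral_sum) (auto intro!: integrable_on_mult_right i)
  finally show "F x = F x0 + (\<Sum>b\<in>Basis. ((x - x0) \<bullet> b) * ?G b x)" by simp
qed

section \<open>Smooth functions on a manifold\<close>

locale manifold =
  fixes A :: "('a::{second_countable_topology, t2_space}, 'e::euclidean_space) chart set"
  assumes manifold: "smooth_manifold A"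
begin

lemma chart_at: obtains V \<phi> where "(V, \<phi>) \<in> A" "q \<in> V"
proof -
  have "(\<Union>(V, \<phi>)\<in>A. V) = UNIV" using manifold by (simp add: smooth_manifold_def)
  then have "q \<in> (\<Union>(V, \<phi>)\<in>A. V)" by simp
  then show thesis using that by blast
qed

lemma chart_props:
  assumes "(V, \<phi>) \<in> A"
  shows "open V" "open (\<phi> ` V)" "continuous_on V \<phi>" "continuous_on (\<phi> ` V) (inv_into V \<phi>)" "inj_on \<phi> V"
proof -
  have *: "open V" "open (\<phi> ` V)" "homeomorphism V (\<phi> ` V) \<phi> (inv_into V \<phi>)"
  proof -
    have "\<forall>(V, \<phi>)\<in>A. open V \<and> open (\<phi> ` V) \<and> homeomorphism V (\<phi> ` V) \<phi> (inv_into V \<phi>)"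
      using manifold by (simp add: smooth_manifold_def)
    from bspec[OF this assms] show "open V" "open (\<phi> ` V)" "homeomorphism V (\<phi> ` V) \<phi> (inv_into V \<phi>)"
      by simp_all
  qed
  then show "open V" "open (\<phi> ` V)" "continuous_on V \<phi>" "continuous_on (\<phi> ` V) (inv_into V \<phi>)"
    by (auto simp: homeomorphism_def)
  show "inj_on \<phi> V" using *(3) unfolding homeomorphism_def by (metis inj_onI)
qed

lemma chart_inv: "(V, \<phi>) \<in> A \<Longrightarrow> q \<in> V \<Longrightarrow> inv_into V \<phi> (\<phi> q) = q"
  by (simp add: chart_props(5))

lemma chart_open_image:
  assumes "(V, \<phi>) \<in> A" "open S" shows "open (\<phi> ` (V \<inter> S))"
proof -
  have "open (\<phi> ` V \<inter> inv_into V \<phi> -` S)"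
    using chart_props[OF assms(1)] assms(2) by (intro continuous_open_preimage) auto
  moreover have "\<phi> ` (V \<inter> S) = \<phi> ` V \<inter> inv_into V \<phi> -` S"
    using chart_inv[OF assms(1)] by auto
  ultimately show ?thesis by simp
qed

lemma chart_open_preimage:
  assumes "(V, \<phi>) \<in> A" "open S" shows "open (V \<inter> \<phi> -` S)"
  using chart_props[OF assms(1)] assms(2) by (intro continuous_open_preimage) auto

lemma smooth_transition:
  "(V, \<phi>) \<in> A \<Longrightarrow> (V', \<phi>') \<in> A \<Longrightarrow> smooth_on (\<phi>' ` (V' \<inter> V)) (\<phi> \<circ> inv_into V' \<phi>')"
proof -
  assume c: "(V, \<phi>) \<in> A" and c': "(V', \<phi>') \<in> A"
  have "\<forall>(V, \<phi>)\<in>A. smooth_fun_on A V \<phi>" using manifold by (simp add: smooth_manifold_def)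
  from bspec[OF this c] have "smooth_fun_on A V \<phi>" by simp
  then have "\<forall>(V', \<phi>')\<in>A. smooth_on (\<phi>' ` (V' \<inter> V)) (\<phi> \<circ> inv_into V' \<phi>')" by (simp add: smooth_fun_on_def)
  from bspec[OF this c'] show ?thesis by simp
qed

lemma smooth_fun_onD: "smooth_fun_on A S f \<Longrightarrow> (V, \<phi>) \<in> A \<Longrightarrow> smooth_on (\<phi> ` (V \<inter> S)) (f \<circ> inv_into V \<phi>)"
  unfolding smooth_fun_on_def by (drule (1) bspec) simp

lemma smooth_fun_onI: "(\<And>V \<phi>. (V, \<phi>) \<in> A \<Longrightarrow> smooth_on (\<phi> ` (V \<inter> S)) (f \<circ> inv_into V \<phi>)) \<Longrightarrow> smooth_fun_on A S f"
  unfolding smooth_fun_on_def by auto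

lemma smooth_fun_on_subset: "smooth_fun_on A S f \<Longrightarrow> T \<subseteq> S \<Longrightarrow> smooth_fun_on A T f"
  by (rule smooth_fun_onI) (erule (1) smooth_on_subset[OF smooth_fun_onD], blast)

lemma smooth_fun_on_cong:
  assumes "open S" "\<And>q. q \<in> S \<Longrightarrow> f q = g q" "smooth_fun_on A S f"
  shows "smooth_fun_on A S g"
proof (rule smooth_fun_onI)
  fix V \<phi> assume c: "(V, \<phi>) \<in> A"
  show "smooth_on (\<phi> ` (V \<inter> S)) (g \<circ> inv_into V \<phi>)"
    by (rule smooth_on_cong[OF chart_open_image[OF c assms(1)] _ smooth_fun_onD[OF assms(3) c]])
      (use assms(2) chart_inv[OF c] in auto)
qed

lemma smooth_fun_on_local:
  assumes "\<And>q. q \<in> S \<Longrightarrow> \<exists>T. open T \<and> q \<in> T \<and> smooth_fun_on A T f"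
  shows "smooth_fun_on A S f"
proof (rule smooth_fun_onI, rule smooth_on_local)
  fix V \<phi> x assume c: "(V, \<phi>) \<in> A" and "x \<in> \<phi> ` (V \<inter> S)"
  then obtain q where q: "q \<in> V" "q \<in> S" "x = \<phi> q" by auto
  then obtain T where T: "open T" "q \<in> T" "smooth_fun_on A T f" using assms by blast
  show "\<exists>T. open T \<and> x \<in> T \<and> smooth_on T (f \<circ> inv_into V \<phi>)"
  proof (intro exI conjI)
    show "open (\<phi> ` (V \<inter> T))" by (rule chart_open_image[OF c T(1)])
    show "x \<in> \<phi> ` (V \<inter> T)" using q T by blast
    show "smooth_on (\<phi> ` (V \<inter> T)) (f \<circ> inv_into V \<phi>)" by (rule smooth_fun_onD[OF T(3) c])
  qed
qed

lemma smooth_fun_on_single_chart: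
  assumes c: "(V, \<phi>) \<in> A" and S: "open S" "S \<subseteq> V" and f: "smooth_on (\<phi> ` S) (f \<circ> inv_into V \<phi>)"
  shows "smooth_fun_on A S f"
proof (rule smooth_fun_onI)
  fix V' \<phi>' assume c': "(V', \<phi>') \<in> A"
  have o: "open (\<phi>' ` (V' \<inter> S))" "open (\<phi> ` S)"
    using chart_open_image[OF c' S(1)] chart_open_image[OF c S(1)] unfolding Int_absorb1[OF S(2)] .
  show "smooth_on (\<phi>' ` (V' \<inter> S)) (f \<circ> inv_into V' \<phi>')"
  proof (rule smooth_on_cong[OF o(1)])
    show "smooth_on (\<phi>' ` (V' \<inter> S)) (\<lambda>x. (f \<circ> inv_into V \<phi>) ((\<phi> \<circ> inv_into V' \<phi>') x))"
    proof (rule smooth_on_compose[OF o _ _ f])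
      show "(\<phi> \<circ> inv_into V' \<phi>') ` \<phi>' ` (V' \<inter> S) \<subseteq> \<phi> ` S"
        by (force simp: chart_inv[OF c'])
      show "smooth_on (\<phi>' ` (V' \<inter> S)) (\<phi> \<circ> inv_into V' \<phi>')"
        by (rule smooth_on_subset[OF smooth_transition[OF c c']]) (use S in auto)
    qed
    fix x assume "x \<in> \<phi>' ` (V' \<inter> S)"
    then obtain q where q: "q \<in> V'" "q \<in> S" "x = \<phi>' q" by blast
    then have "q \<in> V" using S by blast
    then show "(f \<circ> inv_into V \<phi>) ((\<phi> \<circ> inv_into V' \<phi>') x) = (f \<circ> inv_into V' \<phi>') x"
      using q by (simp add: chart_inv[OF c] chart_inv[OF c'])
  qed
qed

lemma smooth_fun_on_const: "open S \<Longrightarrow> smooth_fun_on A S (\<lambda>_. c)"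
proof (rule smooth_fun_onI)
  fix V \<phi> assume "(V, \<phi>) \<in> A" "open S"
  then show "smooth_on (\<phi> ` (V \<inter> S)) ((\<lambda>_. c) \<circ> inv_into V \<phi>)"
    by (simp add: o_def chart_open_image)
qed

lemma smooth_fun_on_add:
  "open S \<Longrightarrow> smooth_fun_on A S f \<Longrightarrow> smooth_fun_on A S g \<Longrightarrow> smooth_fun_on A S (\<lambda>q. f q + g q)"
proof (rule smooth_fun_onI)
  fix V \<phi> assume c: "(V, \<phi>) \<in> A" and a: "open S" "smooth_fun_on A S f" "smooth_fun_on A S g"
  show "smooth_on (\<phi> ` (V \<inter> S)) ((\<lambda>q. f q + g q) \<circ> inv_into V \<phi>)"
    using smooth_on_add[OF chart_open_image[OF c a(1)] smooth_fun_onD[OF a(2) c] smooth_fun_onD[OF a(3) c]]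
    by (simp add: o_def)
qed

lemma smooth_fun_on_mult:
  fixes f g :: "'a \<Rightarrow> real"
  shows "open S \<Longrightarrow> smooth_fun_on A S f \<Longrightarrow> smooth_fun_on A S g \<Longrightarrow> smooth_fun_on A S (\<lambda>q. f q * g q)"
proof (rule smooth_fun_onI)
  fix V \<phi> assume c: "(V, \<phi>) \<in> A" and a: "open S" "smooth_fun_on A S f" "smooth_fun_on A S g"
  show "smooth_on (\<phi> ` (V \<inter> S)) ((\<lambda>q. f q * g q) \<circ> inv_into V \<phi>)"
    using smooth_on_mult[OF chart_open_image[OF c a(1)] smooth_fun_onD[OF a(2) c] smooth_fun_onD[OF a(3) c]]
    by (simp add: o_def)
qed

lemma smooth_fun_on_scaleR:
  "open S \<Longrightarrow> smooth_fun_on A S f \<Longrightarrow> smooth_fun_on A S g \<Longrightarrow> smooth_fun_on A S (\<lambda>q. f q *\<^sub>R g q)"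
proof (rule smooth_fun_onI)
  fix V \<phi> assume c: "(V, \<phi>) \<in> A" and a: "open S" "smooth_fun_on A S f" "smooth_fun_on A S g"
  show "smooth_on (\<phi> ` (V \<inter> S)) ((\<lambda>q. f q *\<^sub>R g q) \<circ> inv_into V \<phi>)"
    using smooth_on_scaleR[OF chart_open_image[OF c a(1)] smooth_fun_onD[OF a(2) c] smooth_fun_onD[OF a(3) c]]
    by (simp add: o_def)
qed

lemma smooth_fun_on_bounded_linear:
  "open S \<Longrightarrow> bounded_linear L \<Longrightarrow> smooth_fun_on A S f \<Longrightarrow> smooth_fun_on A S (\<lambda>q. L (f q))"
proof (rule smooth_fun_onI)
  fix V \<phi> assume c: "(V, \<phi>) \<in> A" and a: "open S" "bounded_linear L" "smooth_fun_on A S f"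
  show "smooth_on (\<phi> ` (V \<inter> S)) ((\<lambda>q. L (f q)) \<circ> inv_into V \<phi>)"
    using smooth_on_bounded_linear_compose[OF chart_open_image[OF c a(1)] a(2) smooth_fun_onD[OF a(3) c]]
    by (simp add: o_def)
qed

lemma smooth_fun_on_inverse:
  fixes f :: "'a \<Rightarrow> real"
  assumes "open S" "smooth_fun_on A S f" "\<And>q. q \<in> S \<Longrightarrow> f q > 0"
  shows "smooth_fun_on A S (\<lambda>q. inverse (f q))"
proof (rule smooth_fun_onI)
  fix V \<phi> assume c: "(V, \<phi>) \<in> A"
  show "smooth_on (\<phi> ` (V \<inter> S)) ((\<lambda>q. inverse (f q)) \<circ> inv_into V \<phi>)"
  proof -
    have "0 < (f \<circ> inv_into V \<phi>) x" if "x \<in> \<phi> ` (V \<inter> S)" for x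
      using that assms(3) chart_inv[OF c] by auto
    from smooth_on_inverse[OF chart_open_image[OF c assms(1)] smooth_fun_onD[OF assms(2) c] this]
    show ?thesis by (simp add: o_def)
  qed
qed

lemma smooth_fun_on_sqrt:
  fixes f :: "'a \<Rightarrow> real"
  assumes "open S" "smooth_fun_on A S f" "\<And>q. q \<in> S \<Longrightarrow> f q > 0"
  shows "smooth_fun_on A S (\<lambda>q. sqrt (f q))"
proof (rule smooth_fun_onI)
  fix V \<phi> assume c: "(V, \<phi>) \<in> A"
  show "smooth_on (\<phi> ` (V \<inter> S)) ((\<lambda>q. sqrt (f q)) \<circ> inv_into V \<phi>)"
  proof -
    have "0 < (f \<circ> inv_into V \<phi>) x" if "x \<in> \<phi> ` (V \<inter> S)" for x
      using that assms(3) chart_inv[OF c] by auto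
    from smooth_on_sqrt[OF chart_open_image[OF c assms(1)] smooth_fun_onD[OF assms(2) c] this]
    show ?thesis by (simp add: o_def)
  qed
qed

lemma smooth_fun_on_uminus: "open S \<Longrightarrow> smooth_fun_on A S f \<Longrightarrow> smooth_fun_on A S (\<lambda>q. - f q)"
  by (rule smooth_fun_on_bounded_linear[OF _ bounded_linear_minus[OF bounded_linear_ident]])

lemma smooth_fun_on_sum:
  "open S \<Longrightarrow> (\<And>i. i \<in> I \<Longrightarrow> smooth_fun_on A S (f i)) \<Longrightarrow> smooth_fun_on A S (\<lambda>q. \<Sum>i\<in>I. f i q)"
proof (induction I rule: infinite_finite_induct)
  case (insert i I)
  then show ?case by (simp add: smooth_fun_on_add)
qed (auto intro: smooth_fun_on_const)

lemma smooth_fun_on_continuous: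
  assumes "open S" "smooth_fun_on A S f" shows "continuous_on S f"
proof -
  have "isCont f q" if q: "q \<in> S" for q
  proof -
    obtain V \<phi> where c: "(V, \<phi>) \<in> A" "q \<in> V" by (rule chart_at)
    have "continuous_on (V \<inter> S) (\<lambda>q. (f \<circ> inv_into V \<phi>) (\<phi> q))"
      by (rule continuous_on_compose2[OF smooth_on_continuous_on[OF smooth_fun_onD[OF assms(2) c(1)]]])
        (use continuous_on_subset[OF chart_props(3)[OF c(1)], of "V \<inter> S"] in auto)
    then have "continuous_on (V \<inter> S) f"
      by (rule continuous_on_eq) (use chart_inv[OF c(1)] in auto)
    moreover have "open (V \<inter> S)" by (intro open_Int chart_props(1)[OF c(1)] assms(1))
    ultimately show ?thesis using q c(2) continuous_on_eq_continuous_at[of "V \<inter> S" f] by blast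
  qed
  then show ?thesis by (intro continuous_at_imp_continuous_on ballI)
qed

lemma C_infinity_iff: "f \<in> C_infinity A \<longleftrightarrow> smooth_fun_on A UNIV f" by (simp add: C_infinity_def)

lemma C_infinity_smooth_fun_on: "f \<in> C_infinity A \<Longrightarrow> smooth_fun_on A S f"
  unfolding C_infinity_iff by (erule smooth_fun_on_subset) simp

lemma C_infinity_const: "(\<lambda>_. c) \<in> C_infinity A"
  unfolding C_infinity_iff by (rule smooth_fun_on_const[OF open_UNIV])

lemma C_infinity_add: "f \<in> C_infinity A \<Longrightarrow> g \<in> C_infinity A \<Longrightarrow> (\<lambda>q. f q + g q) \<in> C_infinity A"
  unfolding C_infinity_iff by (rule smooth_fun_on_add[OF open_UNIV])

lemma C_infinity_mult:
  fixes f g :: "'a \<Rightarrow> real"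
  shows "f \<in> C_infinity A \<Longrightarrow> g \<in> C_infinity A \<Longrightarrow> (\<lambda>q. f q * g q) \<in> C_infinity A"
  unfolding C_infinity_iff by (rule smooth_fun_on_mult[OF open_UNIV])

lemma C_infinity_cmult:
  fixes f :: "'a \<Rightarrow> real"
  shows "f \<in> C_infinity A \<Longrightarrow> (\<lambda>q. c * f q) \<in> C_infinity A"
  by (rule C_infinity_mult[OF C_infinity_const])

lemma C_infinity_diff:
  fixes f g :: "'a \<Rightarrow> real"
  shows "f \<in> C_infinity A \<Longrightarrow> g \<in> C_infinity A \<Longrightarrow> (\<lambda>q. f q - g q) \<in> C_infinity A"
proof -
  assume "f \<in> C_infinity A" "g \<in> C_infinity A"
  then have "(\<lambda>q. f q + - 1 * g q) \<in> C_infinity A" by (intro C_infinity_add C_infinity_cmult)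
  then show ?thesis by simp
qed

lemma C_infinity_sum: "(\<And>i. i \<in> I \<Longrightarrow> f i \<in> C_infinity A) \<Longrightarrow> (\<lambda>q. \<Sum>i\<in>I. f i q) \<in> C_infinity A"
  unfolding C_infinity_iff by (rule smooth_fun_on_sum[OF open_UNIV])

lemma C_infinity_continuous: "f \<in> C_infinity A \<Longrightarrow> continuous_on UNIV f"
  unfolding C_infinity_iff by (rule smooth_fun_on_continuous[OF open_UNIV])

lemma C_infinity_zero_extension:
  assumes "open S" "smooth_fun_on A S f" "closed K" "K \<subseteq> S" "\<And>q. q \<notin> K \<Longrightarrow> f q = 0"
  shows "f \<in> C_infinity A"
  unfolding C_infinity_iff
proof (rule smooth_fun_on_local)
  fix q
  show "\<exists>T. open T \<and> q \<in> T \<and> smooth_fun_on A T f"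
  proof (cases "q \<in> K")
    case True
    then show ?thesis by (intro exI[of _ S] conjI assms(1,2)) (use assms(4) in blast)
  next
    case False
    have "open (- K)" using assms(3) by (rule open_Compl)
    moreover have "smooth_fun_on A (- K) f"
      by (rule smooth_fun_on_cong[OF \<open>open (- K)\<close> _ smooth_fun_on_const[OF \<open>open (- K)\<close>, of 0]])
        (simp add: assms(5))
    ultimately show ?thesis using False by (intro exI[of _ "- K"]) simp
  qed
qed

text \<open>Phrased with a compact set instead of the closure of the support, so that products, sums
  and restrictions are immediate.\<close>

definition support_in :: "('a \<Rightarrow> real) \<Rightarrow> 'a set \<Rightarrow> bool" where
  "support_in f N \<longleftrightarrow> (\<exists>K. compact K \<and> K \<subseteq> N \<and> (\<forall>q. q \<notin> K \<longrightarrow> f q = 0))"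

lemma support_in_compact_closure:
  assumes "support_in f N" shows "compact (closure {q. f q \<noteq> 0})" "closure {q. f q \<noteq> 0} \<subseteq> N"
proof -
  obtain K where K: "compact K" "K \<subseteq> N" "\<And>q. q \<notin> K \<Longrightarrow> f q = 0" using assms unfolding support_in_def by blast
  have "closure {q. f q \<noteq> 0} \<subseteq> K"
    by (rule closure_minimal) (use K in \<open>auto intro: compact_imp_closed\<close>)
  moreover have "K \<inter> closure {q. f q \<noteq> 0} = closure {q. f q \<noteq> 0}" using calculation by auto
  then show "compact (closure {q. f q \<noteq> 0})" using compact_Int_closed[OF K(1) closed_closure] by metis
  ultimately show "closure {q. f q \<noteq> 0} \<subseteq> N" using K by auto
qed

lemma C_infinity_c_iff: "f \<in> C_infinity_c A \<longleftrightarrow> f \<in> C_infinity A \<and> support_in f UNIV"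
proof
  assume f: "f \<in> C_infinity_c A"
  have "f q = 0" if "q \<notin> closure {q. f q \<noteq> 0}" for q
    using that closure_subset[of "{q. f q \<noteq> 0}"] by auto
  moreover have "compact (closure {q. f q \<noteq> 0})" using f by (simp add: C_infinity_c_def)
  ultimately have "support_in f UNIV"
    unfolding support_in_def by blast
  then show "f \<in> C_infinity A \<and> support_in f UNIV" using f by (simp add: C_infinity_c_def)
qed (auto simp: C_infinity_c_def support_in_compact_closure)

lemma support_in_mono: "support_in f N \<Longrightarrow> N \<subseteq> N' \<Longrightarrow> support_in f N'"
  unfolding support_in_def by (elim exE conjE, intro exI conjI) (assumption, rule order_trans)

lemma support_in_weaker:
  assumes "support_in f N" "\<And>q. f q = 0 \<Longrightarrow> g q = 0" shows "support_in g N"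
proof -
  obtain K where K: "compact K" "K \<subseteq> N" "\<And>q. q \<notin> K \<Longrightarrow> f q = 0" using assms(1) unfolding support_in_def by blast
  then have "\<And>q. q \<notin> K \<Longrightarrow> g q = 0" using assms(2) by blast
  then show ?thesis unfolding support_in_def using K by blast
qed

lemma support_in_mult: "support_in f N \<Longrightarrow> support_in (\<lambda>q. f q * g q) N"
  by (erule support_in_weaker) simp

lemma support_in_add: "support_in f N \<Longrightarrow> support_in g N \<Longrightarrow> support_in (\<lambda>q. f q + g q) N"
proof -
  assume "support_in f N" "support_in g N"
  then obtain K L where K: "compact K" "K \<subseteq> N" "\<And>q. q \<notin> K \<Longrightarrow> f q = 0"
    and L: "compact L" "L \<subseteq> N" "\<And>q. q \<notin> L \<Longrightarrow> g q = 0" unfolding support_in_def by blast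
  show ?thesis unfolding support_in_def
    by (rule exI[of _ "K \<union> L"]) (use K L in auto)
qed

lemma support_in_zero: "support_in (\<lambda>_. 0) N"
  unfolding support_in_def by (rule exI[of _ "{}"]) auto

lemma support_in_sum: "(\<And>i. i \<in> I \<Longrightarrow> support_in (f i) N) \<Longrightarrow> support_in (\<lambda>q. \<Sum>i\<in>I. f i q) N"
proof (induction I rule: infinite_finite_induct)
  case (insert i I)
  then show ?case by (simp add: support_in_add)
qed (simp_all add: support_in_zero)

end

context manifold
begin

definition pull :: "'a set \<Rightarrow> ('a \<Rightarrow> 'e) \<Rightarrow> ('e \<Rightarrow> real) \<Rightarrow> 'a \<Rightarrow> real" where
  "pull V \<phi> F q = (if q \<in> V then F (\<phi> q) else 0)"

definition push :: "'a set \<Rightarrow> ('a \<Rightarrow> 'e) \<Rightarrow> ('a \<Rightarrow> real) \<Rightarrow> 'e \<Rightarrow> real" where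
  "push V \<phi> f x = (if x \<in> \<phi> ` V then f (inv_into V \<phi> x) else 0)"

lemma compact_chart_preimage:
  assumes c: "(V, \<phi>) \<in> A" and K: "compact K" "K \<subseteq> \<phi> ` V"
  shows "compact (inv_into V \<phi> ` K)" "inv_into V \<phi> ` K \<subseteq> V"
proof -
  show "compact (inv_into V \<phi> ` K)"
    by (rule compact_continuous_image[OF continuous_on_subset[OF chart_props(4)[OF c] K(2)] K(1)])
  show "inv_into V \<phi> ` K \<subseteq> V"
  proof
    fix q assume "q \<in> inv_into V \<phi> ` K"
    then obtain x where "x \<in> K" "q = inv_into V \<phi> x" by blast
    then show "q \<in> V" using K(2) inv_into_into[of x \<phi> V] by blast
  qed
qed

lemma pull_C_infinity:
  assumes c: "(V, \<phi>) \<in> A" and F: "smooth_on (\<phi> ` V) F" and K: "compact K" "K \<subseteq> \<phi> ` V"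
    and F0: "\<And>x. x \<in> \<phi> ` V \<Longrightarrow> x \<notin> K \<Longrightarrow> F x = 0"
  shows "pull V \<phi> F \<in> C_infinity A" "support_in (pull V \<phi> F) V"
proof -
  let ?K = "inv_into V \<phi> ` K"
  note K' = compact_chart_preimage[OF c K]
  have z: "pull V \<phi> F q = 0" if "q \<notin> ?K" for q
  proof (cases "q \<in> V")
    case True
    have "\<phi> q \<notin> K" using that chart_inv[OF c True] by (metis imageI)
    then show ?thesis using True F0 by (simp add: pull_def)
  qed (simp add: pull_def)
  have "smooth_on (\<phi> ` V) (pull V \<phi> F \<circ> inv_into V \<phi>)"
    by (rule smooth_on_cong[OF chart_props(2)[OF c] _ F]) (auto simp: pull_def chart_inv[OF c])
  then have "smooth_fun_on A V (pull V \<phi> F)"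
    by (intro smooth_fun_on_single_chart[OF c chart_props(1)[OF c]]) auto
  then show "pull V \<phi> F \<in> C_infinity A"
    by (rule C_infinity_zero_extension[OF chart_props(1)[OF c] _ compact_imp_closed[OF K'(1)] K'(2) z])
  show "support_in (pull V \<phi> F) V"
    unfolding support_in_def by (intro exI[of _ ?K] conjI K' allI impI z)
qed

lemma push_test_fun:
  assumes c: "(V, \<phi>) \<in> A" and f: "smooth_fun_on A V f" and s: "support_in f V"
  shows "test_fun (push V \<phi> f)"
proof -
  obtain K where K: "compact K" "K \<subseteq> V" "\<And>q. q \<notin> K \<Longrightarrow> f q = 0" using s unfolding support_in_def by blast
  have cK: "compact (\<phi> ` K)"
    by (rule compact_continuous_image[OF continuous_on_subset[OF chart_props(3)[OF c] K(2)] K(1)])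
  have z: "push V \<phi> f x = 0" if "x \<notin> \<phi> ` K" for x
  proof (cases "x \<in> \<phi> ` V")
    case True
    then obtain q where q: "q \<in> V" "x = \<phi> q" by auto
    then have "q \<notin> K" using that by auto
    then show ?thesis using q K chart_inv[OF c] by (simp add: push_def)
  qed (simp add: push_def)
  have "smooth_on UNIV (push V \<phi> f)"
  proof (rule smooth_on_local)
    fix x
    show "\<exists>T. open T \<and> x \<in> T \<and> smooth_on T (push V \<phi> f)"
    proof (cases "x \<in> \<phi> ` K")
      case True
      have "smooth_on (\<phi> ` V) (f \<circ> inv_into V \<phi>)" using smooth_fun_onD[OF f c] by simp
      then have "smooth_on (\<phi> ` V) (push V \<phi> f)"
        by (rule smooth_on_cong[OF chart_props(2)[OF c], rotated]) (auto simp: push_def)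
      then show ?thesis by (intro exI[of _ "\<phi> ` V"] conjI chart_props(2)[OF c]) (use True K(2) in blast)
    next
      case False
      have o: "open (- \<phi> ` K)" using cK compact_imp_closed by blast
      have "smooth_on (- \<phi> ` K) (push V \<phi> f)"
        by (rule smooth_on_cong[OF o _ smooth_on_const[OF o, of 0]]) (use z in auto)
      then show ?thesis by (intro exI[of _ "- \<phi> ` K"] conjI o) (simp_all add: False)
    qed
  qed
  moreover have "bounded {x. push V \<phi> f x \<noteq> 0}"
    by (rule bounded_subset[OF compact_imp_bounded[OF cK]]) (use z in auto)
  ultimately show ?thesis by (simp add: test_fun_def)
qed

lemma push_support:
  assumes c: "(V, \<phi>) \<in> A" and s: "support_in f V"
  obtains K where "compact K" "K \<subseteq> \<phi> ` V" "\<forall>x. x \<notin> K \<longrightarrow> push V \<phi> f x = 0"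
proof -
  obtain K where K: "compact K" "K \<subseteq> V" "\<And>q. q \<notin> K \<Longrightarrow> f q = 0" using s unfolding support_in_def by blast
  show thesis
  proof (rule that[of "\<phi> ` K"])
    show "compact (\<phi> ` K)"
      by (rule compact_continuous_image[OF continuous_on_subset[OF chart_props(3)[OF c] K(2)] K(1)])
    show "\<forall>x. x \<notin> \<phi> ` K \<longrightarrow> push V \<phi> f x = 0"
    proof (intro allI impI)
     fix x assume that: "x \<notin> \<phi> ` K"
     show "push V \<phi> f x = 0"
     proof (cases "x \<in> \<phi> ` V")
      case True
      then obtain q where q: "q \<in> V" "x = \<phi> q" by auto
      then have "q \<notin> K" using that by auto
      then show ?thesis using q K chart_inv[OF c] by (simp add: push_def)
     qed (simp add: push_def)
    qed
  qed (use K in auto)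
qed

lemma bump_exists:
  assumes "open N" "q \<in> N"
  obtains \<kappa> W where "\<kappa> \<in> C_infinity A" "support_in \<kappa> N" "\<And>p. 0 \<le> \<kappa> p" "\<And>p. \<kappa> p \<le> 1"
    "open W" "q \<in> W" "\<And>p. p \<in> W \<Longrightarrow> \<kappa> p = 1"
proof -
  obtain V \<phi> where c: "(V, \<phi>) \<in> A" "q \<in> V" by (rule chart_at)
  have "open (\<phi> ` (V \<inter> N))" by (rule chart_open_image[OF c(1) assms(1)])
  moreover have "\<phi> q \<in> \<phi> ` (V \<inter> N)" using c assms by auto
  ultimately obtain e where e: "e > 0" "cball (\<phi> q) e \<subseteq> \<phi> ` (V \<inter> N)" using open_contains_cball by blast
  define r where "r = e / 2"
  have r: "r > 0" "2 * r = e" using e by (auto simp: r_def)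
  define F where "F = (\<lambda>x. plateau r (x - \<phi> q))"
  have F: "smooth_on UNIV F"
    unfolding F_def
    by (rule smooth_on_compose[OF _ _ _ _ smooth_on_plateau])
      (auto intro!: smooth_on_diff smooth_on_ident)
  have F0: "F x = 0" if "x \<notin> cball (\<phi> q) e" for x
    unfolding F_def by (rule plateau_eq_0[OF r(1)]) (use that r in \<open>simp add: dist_norm norm_minus_commute\<close>)
  have sub: "cball (\<phi> q) e \<subseteq> \<phi> ` V" using e by auto
  have sF: "smooth_on (\<phi> ` V) F" by (rule smooth_on_subset[OF F]) auto
  note p = pull_C_infinity[OF c(1) sF compact_cball sub F0]
  show thesis
  proof (rule that[of "pull V \<phi> F" "V \<inter> \<phi> -` ball (\<phi> q) r"])
    show "pull V \<phi> F \<in> C_infinity A" by (rule p)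
    show "support_in (pull V \<phi> F) N"
      unfolding support_in_def
    proof (intro exI conjI allI impI)
      show "compact (inv_into V \<phi> ` cball (\<phi> q) e)" by (rule compact_chart_preimage[OF c(1) compact_cball sub])
      show "inv_into V \<phi> ` cball (\<phi> q) e \<subseteq> N"
      proof
        fix p assume "p \<in> inv_into V \<phi> ` cball (\<phi> q) e"
        then obtain x where "x \<in> cball (\<phi> q) e" "p = inv_into V \<phi> x" by auto
        moreover from this e obtain p' where "p' \<in> V \<inter> N" "x = \<phi> p'" by auto
        ultimately show "p \<in> N" using chart_inv[OF c(1)] by auto
      qed
      fix p assume p: "p \<notin> inv_into V \<phi> ` cball (\<phi> q) e"
      show "pull V \<phi> F p = 0"
      proof (cases "p \<in> V")
        case True
        then have "\<phi> p \<notin> cball (\<phi> q) e" using p chart_inv[OF c(1) True] by (metis imageI)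
        then show ?thesis using True F0 by (simp add: pull_def)
      qed (simp add: pull_def)
    qed
    show "0 \<le> pull V \<phi> F p" "pull V \<phi> F p \<le> 1" for p
      by (auto simp: pull_def F_def plateau_bounds)
    show "open (V \<inter> \<phi> -` ball (\<phi> q) r)" by (rule chart_open_preimage[OF c(1)]) auto
    show "q \<in> V \<inter> \<phi> -` ball (\<phi> q) r" using c r by auto
    show "pull V \<phi> F p = 1" if "p \<in> V \<inter> \<phi> -` ball (\<phi> q) r" for p
      using that r by (auto simp: pull_def F_def dist_norm norm_minus_commute intro!: plateau_eq_1)
  qed
qed

text \<open>The products \<open>b\<^sub>i (1 - b\<^sub>j) \<cdots>\<close> of bump functions avoid any division by a sum.\<close>

lemma partition_of_unity:
  assumes K: "compact K" and N: "\<And>q. q \<in> K \<Longrightarrow> \<exists>N. P N \<and> open N \<and> q \<in> N"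
  obtains n :: nat and c where "\<forall>i<n. c i \<in> C_infinity A"
    "\<forall>i<n. \<exists>N. P N \<and> support_in (c i) N" "\<forall>q\<in>K. (\<Sum>i<n. c i q) = 1"
proof -
  define \<W> where "\<W> = {W. open W \<and> (\<exists>b N. b \<in> C_infinity A \<and> P N \<and> support_in b N \<and> (\<forall>q\<in>W. b q = 1))}"
  have "K \<subseteq> \<Union>\<W>"
  proof
    fix q assume "q \<in> K"
    then obtain N where N': "P N" "open N" "q \<in> N" using N by blast
    obtain \<kappa> W where k: "\<kappa> \<in> C_infinity A" "support_in \<kappa> N" "open W" "q \<in> W" "\<And>p. p \<in> W \<Longrightarrow> \<kappa> p = 1"
      using bump_exists[OF N'(2,3)] by metis
    then have "W \<in> \<W>" unfolding \<W>_def using N'(1) by blast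
    with k show "q \<in> \<Union>\<W>" by blast
  qed
  moreover have "\<And>W. W \<in> \<W> \<Longrightarrow> open W" by (auto simp: \<W>_def)
  ultimately obtain \<F> where F: "\<F> \<subseteq> \<W>" "finite \<F>" "K \<subseteq> \<Union>\<F>"
    using K by (meson compactE)
  have "\<exists>n c. (\<forall>i<n. c i \<in> C_infinity A) \<and> (\<forall>i<n. \<exists>N. P N \<and> support_in (c i) N) \<and> (\<forall>q\<in>\<Union>\<F>. (\<Sum>i<(n::nat). c i q) = 1)"
    using F(2,1)
  proof (induction \<F> rule: finite_induct)
    case empty
    show ?case by (rule exI[of _ 0]) auto
  next
    case (insert W \<F>)
    then obtain n c where c: "\<forall>i<n. c i \<in> C_infinity A" "\<forall>i<n. \<exists>N. P N \<and> support_in (c i) N"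
      "\<forall>q\<in>\<Union>\<F>. (\<Sum>i<(n::nat). c i q) = 1" by auto
    from insert.prems obtain b N where b: "b \<in> C_infinity A" "P N" "support_in b N" "\<forall>q\<in>W. b q = 1"
      unfolding \<W>_def by auto
    define c' where "c' = (\<lambda>i q. if i = n then b q else c i q * (1 - b q))"
    show ?case
    proof (rule exI[of _ "Suc n"], rule exI[of _ c'], intro conjI allI impI ballI)
      fix i assume i: "i < Suc n"
      have sm: "(\<lambda>q. 1 - b q) \<in> C_infinity A" by (rule C_infinity_diff[OF C_infinity_const b(1)])
      show "c' i \<in> C_infinity A"
        using i b c C_infinity_mult[OF _ sm, of "c i"] by (cases "i = n") (auto simp: c'_def)
      show "\<exists>N. P N \<and> support_in (c' i) N"
      proof (cases "i = n")
        case True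
        then show ?thesis using b by (auto simp: c'_def)
      next
        case False
        then have "i < n" using i by simp
        then obtain N where "P N" "support_in (c i) N" using c(2) by blast
        then show ?thesis using support_in_mult[of "c i" N "\<lambda>q. 1 - b q"] False by (auto simp: c'_def)
      qed
    next
      fix q assume "q \<in> \<Union>(insert W \<F>)"
      then consider "q \<in> W" | "q \<in> \<Union>\<F>" by auto
      moreover have "(\<Sum>i<Suc n. c' i q) = (\<Sum>i<n. c i q) * (1 - b q) + b q"
        by (simp add: c'_def sum_distrib_right)
      ultimately show "(\<Sum>i<Suc n. c' i q) = 1" using b(4) c(3) by cases auto
    qed
  qed
  then obtain n :: nat and c where nc: "\<forall>i<n. c i \<in> C_infinity A" "\<forall>i<n. \<exists>N. P N \<and> support_in (c i) N"
    "\<forall>q\<in>\<Union>\<F>. (\<Sum>i<n. c i q) = 1" by (elim exE conjE)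
  show thesis by (rule that[OF nc(1,2)]) (use nc(3) F(3) in blast)
qed

section \<open>Tangent vectors in coordinates\<close>

lemma tangentD:
  assumes "v \<in> tangent_space A q"
  shows "f \<in> C_infinity A \<Longrightarrow> h \<in> C_infinity A \<Longrightarrow> v (\<lambda>p. f p + h p) = v f + v h"
    "f \<in> C_infinity A \<Longrightarrow> v (\<lambda>p. c * f p) = c * v f"
    "f \<in> C_infinity A \<Longrightarrow> h \<in> C_infinity A \<Longrightarrow> v (\<lambda>p. f p * h p) = v f * h q + f q * v h"
    "f \<notin> C_infinity A \<Longrightarrow> v f = 0"
  using assms unfolding tangent_space_def by blast+

lemma tangent_const: "v \<in> tangent_space A q \<Longrightarrow> v (\<lambda>_. c) = 0"
proof -
  assume v: "v \<in> tangent_space A q"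
  have "v (\<lambda>_. 1) = v (\<lambda>_. 1) + v (\<lambda>_. 1)"
    using tangentD(3)[OF v C_infinity_const[of 1] C_infinity_const[of 1]] by (simp only: mult_1 mult_1_right)
  then have z: "v (\<lambda>_. 1) = 0" by linarith
  have "v (\<lambda>_. c) = c * v (\<lambda>_. 1)"
    using tangentD(2)[OF v C_infinity_const[of 1], of c] by (simp only: mult_1_right)
  then show ?thesis by (simp only: z mult_zero_right)
qed

lemma tangent_sum:
  assumes "v \<in> tangent_space A q" "\<And>i. i \<in> I \<Longrightarrow> f i \<in> C_infinity A" "finite I"
  shows "v (\<lambda>p. \<Sum>i\<in>I. f i p) = (\<Sum>i\<in>I. v (f i))"
  using assms(3,2)
proof (induction I)
  case (insert i I)
  then have "v (\<lambda>p. f i p + (\<Sum>i\<in>I. f i p)) = v (f i) + v (\<lambda>p. \<Sum>i\<in>I. f i p)"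
    by (intro tangentD(1)[OF assms(1)] C_infinity_sum) auto
  then show ?case using insert by simp
qed (simp add: tangent_const[OF assms(1)])

lemma cutoff_coordinate_C_infinity:
  fixes G :: "'e \<Rightarrow> real"
  assumes c: "(V, \<phi>) \<in> A" and \<kappa>: "\<kappa> \<in> C_infinity A" "support_in \<kappa> V" and G: "smooth_on UNIV G"
  shows "(\<lambda>p. \<kappa> p * G (\<phi> p)) \<in> C_infinity A"
proof -
  obtain K where K: "compact K" "K \<subseteq> V" "\<And>q. q \<notin> K \<Longrightarrow> \<kappa> q = 0" using \<kappa>(2) unfolding support_in_def by blast
  have "smooth_on (\<phi> ` V) ((\<lambda>p. G (\<phi> p)) \<circ> inv_into V \<phi>)"
    by (rule smooth_on_cong[OF chart_props(2)[OF c] _ smooth_on_subset[OF G]]) (use chart_inv[OF c] in auto)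
  then have "smooth_fun_on A V (\<lambda>p. G (\<phi> p))"
    by (intro smooth_fun_on_single_chart[OF c chart_props(1)[OF c]]) auto
  then have "smooth_fun_on A V (\<lambda>p. \<kappa> p * G (\<phi> p))"
    by (rule smooth_fun_on_mult[OF chart_props(1)[OF c] C_infinity_smooth_fun_on[OF \<kappa>(1)]])
  then show ?thesis
    by (rule C_infinity_zero_extension[OF chart_props(1)[OF c] _ compact_imp_closed[OF K(1)] K(2)]) (simp add: K(3))
qed

lemma chart_has_derivative:
  assumes c: "(V, \<phi>) \<in> A" and q: "q \<in> V" and f: "f \<in> C_infinity A"
  shows "((f \<circ> inv_into V \<phi>) has_derivative frechet_derivative (f \<circ> inv_into V \<phi>) (at (\<phi> q))) (at (\<phi> q))"
proof (rule smooth_on_has_derivative)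
  show "smooth_on (\<phi> ` (V \<inter> UNIV)) (f \<circ> inv_into V \<phi>)"
    using f unfolding C_infinity_iff by (rule smooth_fun_onD[OF _ c])
qed (use q in auto)

text \<open>A derivation annihilates constants and is local, so that after cutting off in the chart
  Hadamard's lemma at \<open>\<phi> q\<close> reduces its value on \<open>f\<close> to the values on the cut-off coordinates.\<close>

lemma tangent_coordinates:
  assumes c: "(V, \<phi>) \<in> A" and q: "q \<in> V" and v: "v \<in> tangent_space A q"
  shows "\<exists>e. \<forall>f\<in>C_infinity A. v f = frechet_derivative (f \<circ> inv_into V \<phi>) (at (\<phi> q)) e"
proof -
  let ?x0 = "\<phi> q"
  obtain \<kappa> W where \<kappa>: "\<kappa> \<in> C_infinity A" "support_in \<kappa> V" and W: "open W" "q \<in> W" "\<And>p. p \<in> W \<Longrightarrow> \<kappa> p = 1"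
    using bump_exists[OF chart_props(1)[OF c] q] by metis
  obtain KK where KK: "\<And>q. q \<notin> V \<Longrightarrow> \<kappa> q = 0" using \<kappa>(2) unfolding support_in_def by blast
  have \<kappa>q: "\<kappa> q = 1" using W by simp
  define h where "h = (\<lambda>b p. \<kappa> p * ((\<phi> p - ?x0) \<bullet> b))"
  have h: "h b \<in> C_infinity A" for b
    unfolding h_def
    by (rule cutoff_coordinate_C_infinity[OF c \<kappa>, of "\<lambda>x. (x - ?x0) \<bullet> b"]) (auto intro!: smooth_on_inner smooth_on_diff smooth_on_ident)
  define e where "e = (\<Sum>b\<in>Basis. v (h b) *\<^sub>R b)"
  have "v f = frechet_derivative (f \<circ> inv_into V \<phi>) (at ?x0) e" if f: "f \<in> C_infinity A" for f
  proof -
    define f0 where "f0 = (\<lambda>p. f p + (- f q))"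
    have f0: "f0 \<in> C_infinity A" unfolding f0_def by (rule C_infinity_add[OF f C_infinity_const])
    have vf0: "v f0 = v f"
      unfolding f0_def using tangentD(1)[OF v f C_infinity_const[of "- f q"]] tangent_const[OF v] by simp
    define F where "F = push V \<phi> (\<lambda>p. \<kappa> p * f0 p)"
    have F: "test_fun F"
      unfolding F_def
      by (rule push_test_fun[OF c C_infinity_smooth_fun_on[OF C_infinity_mult[OF \<kappa>(1) f0]] support_in_mult[OF \<kappa>(2)]])
    have F_at: "F (\<phi> p) = \<kappa> p * f0 p" if "p \<in> V" for p
      using that chart_inv[OF c] by (simp add: F_def push_def)
    obtain G where G: "\<And>b. smooth_on UNIV (G b)" "\<And>x. F x = F ?x0 + (\<Sum>b\<in>Basis. ((x - ?x0) \<bullet> b) * G b x)"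
      "\<And>b. G b ?x0 = dirderiv b F ?x0" using Hadamard[OF F, of ?x0] by metis
    have F0: "F ?x0 = 0" using F_at[OF q] by (simp add: f0_def)
    have gG: "(\<lambda>p. \<kappa> p * G b (\<phi> p)) \<in> C_infinity A" for b by (rule cutoff_coordinate_C_infinity[OF c \<kappa> G(1)])
    have eq: "(\<lambda>p. (\<kappa> p * \<kappa> p * \<kappa> p) * f0 p) = (\<lambda>p. \<Sum>b\<in>Basis. h b p * (\<kappa> p * G b (\<phi> p)))"
    proof
      fix p
      show "(\<kappa> p * \<kappa> p * \<kappa> p) * f0 p = (\<Sum>b\<in>Basis. h b p * (\<kappa> p * G b (\<phi> p)))"
      proof (cases "p \<in> V")
        case True
        have "\<kappa> p * f0 p = (\<Sum>b\<in>Basis. ((\<phi> p - ?x0) \<bullet> b) * G b (\<phi> p))"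
          using F_at[OF True] G(2)[of "\<phi> p"] F0 by simp
        then have "(\<kappa> p * \<kappa> p) * (\<kappa> p * f0 p) = (\<Sum>b\<in>Basis. (\<kappa> p * \<kappa> p) * (((\<phi> p - ?x0) \<bullet> b) * G b (\<phi> p)))"
          by (simp only: sum_distrib_left)
        then show ?thesis by (simp add: h_def mult_ac)
      qed (simp add: KK h_def)
    qed
    have k3: "(\<lambda>p. \<kappa> p * \<kappa> p * \<kappa> p) \<in> C_infinity A" by (intro C_infinity_mult \<kappa>)
    have "v f0 = v (\<lambda>p. (\<kappa> p * \<kappa> p * \<kappa> p) * f0 p)"
      using tangentD(3)[OF v k3 f0] \<kappa>q by (simp add: f0_def)
    also have "\<dots> = (\<Sum>b\<in>Basis. v (\<lambda>p. h b p * (\<kappa> p * G b (\<phi> p))))"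
      unfolding eq by (rule tangent_sum[OF v]) (auto intro!: C_infinity_mult[OF h gG])
    also have "\<dots> = (\<Sum>b\<in>Basis. v (h b) * dirderiv b F ?x0)"
    proof (rule sum.cong[OF refl])
      fix b :: 'e
      have "h b q = 0" by (simp add: h_def)
      then show "v (\<lambda>p. h b p * (\<kappa> p * G b (\<phi> p))) = v (h b) * dirderiv b F ?x0"
        using tangentD(3)[OF v h gG, of b b] \<kappa>q G(3) by simp
    qed
    also have "frechet_derivative F (at ?x0) = frechet_derivative (f \<circ> inv_into V \<phi>) (at ?x0)"
    proof -
      have "((\<lambda>x. (f \<circ> inv_into V \<phi>) x + (- f q)) has_derivative (\<lambda>w. frechet_derivative (f \<circ> inv_into V \<phi>) (at ?x0) w + 0)) (at ?x0)"
        by (intro has_derivative_add chart_has_derivative[OF c q f] has_derivative_const)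
      then have "(F has_derivative (\<lambda>w. frechet_derivative (f \<circ> inv_into V \<phi>) (at ?x0) w + 0)) (at ?x0)"
      proof (rule has_derivative_transform_within_open)
        show "open (\<phi> ` (V \<inter> W))" by (rule chart_open_image[OF c W(1)])
        show "?x0 \<in> \<phi> ` (V \<inter> W)" using q W by auto
        fix x assume "x \<in> \<phi> ` (V \<inter> W)"
        then obtain p where "p \<in> V" "p \<in> W" "x = \<phi> p" by auto
        then show "(f \<circ> inv_into V \<phi>) x + (- f q) = F x"
          using F_at W(3) chart_inv[OF c] by (simp add: f0_def)
      qed
      from frechet_derivative_at[OF this] show ?thesis by simp
    qed
    finally have "v f = (\<Sum>b\<in>Basis. v (h b) * frechet_derivative (f \<circ> inv_into V \<phi>) (at ?x0) b)"
      using vf0 by simp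
    also have "\<dots> = frechet_derivative (f \<circ> inv_into V \<phi>) (at ?x0) e"
    proof -
      have "linear (frechet_derivative (f \<circ> inv_into V \<phi>) (at ?x0))"
        using chart_has_derivative[OF c q f] has_derivative_linear by blast
      then show ?thesis by (simp add: e_def linear_sum linear_scale)
    qed
    finally show ?thesis .
  qed
  then show ?thesis by blast
qed

definition tcomp :: "'a set \<Rightarrow> ('a \<Rightarrow> 'e) \<Rightarrow> 'a \<Rightarrow> 'a tangent \<Rightarrow> 'e" where
  "tcomp V \<phi> q v = (SOME e. \<forall>f\<in>C_infinity A. v f = frechet_derivative (f \<circ> inv_into V \<phi>) (at (\<phi> q)) e)"

lemma tcomp:
  assumes "(V, \<phi>) \<in> A" "q \<in> V" "v \<in> tangent_space A q" "f \<in> C_infinity A"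
  shows "v f = frechet_derivative (f \<circ> inv_into V \<phi>) (at (\<phi> q)) (tcomp V \<phi> q v)"
  using someI_ex[OF tangent_coordinates[OF assms(1-3)]] assms(4) unfolding tcomp_def by blast

lemma tcomp_inner:
  assumes c: "(V, \<phi>) \<in> A" and q: "q \<in> V" and v: "v \<in> tangent_space A q"
    and \<kappa>: "\<kappa> \<in> C_infinity A" "support_in \<kappa> V" and W: "open W" "q \<in> W" "\<And>p. p \<in> W \<Longrightarrow> \<kappa> p = 1"
  shows "v (\<lambda>p. \<kappa> p * (\<phi> p \<bullet> b)) = tcomp V \<phi> q v \<bullet> b"
proof -
  let ?f = "\<lambda>p. \<kappa> p * (\<phi> p \<bullet> b)"
  have f: "?f \<in> C_infinity A"
    by (rule cutoff_coordinate_C_infinity[OF c \<kappa>, of "\<lambda>x. x \<bullet> b"]) (auto intro!: smooth_on_inner smooth_on_ident)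
  have "((\<lambda>x. x \<bullet> b) has_derivative (\<lambda>x. x \<bullet> b)) (at (\<phi> q))"
    by (auto intro!: derivative_eq_intros)
  then have "((?f \<circ> inv_into V \<phi>) has_derivative (\<lambda>x. x \<bullet> b)) (at (\<phi> q))"
  proof (rule has_derivative_transform_within_open)
    show "open (\<phi> ` (V \<inter> W))" by (rule chart_open_image[OF c W(1)])
  qed (use q W chart_inv[OF c] in auto)
  from frechet_derivative_at[OF this] tcomp[OF c q v f] show ?thesis by metis
qed

lemma tcomp_smooth:
  assumes c: "(V, \<phi>) \<in> A" and S: "open S" "S \<subseteq> V"
    and X: "\<And>q. q \<in> S \<Longrightarrow> X q \<in> tangent_space A q"
    and Xf: "\<And>f. f \<in> C_infinity A \<Longrightarrow> smooth_fun_on A S (\<lambda>q. X q f)"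
  shows "smooth_on (\<phi> ` S) (\<lambda>x. tcomp V \<phi> (inv_into V \<phi> x) (X (inv_into V \<phi> x)))"
proof (rule smooth_on_local)
  fix x assume "x \<in> \<phi> ` S"
  then obtain q where q: "q \<in> S" "x = \<phi> q" by auto
  then have qV: "q \<in> V" using S by auto
  obtain \<kappa> W where \<kappa>: "\<kappa> \<in> C_infinity A" "support_in \<kappa> V" and W: "open W" "q \<in> W" "\<And>p. p \<in> W \<Longrightarrow> \<kappa> p = 1"
    using bump_exists[OF chart_props(1)[OF c] qV] by metis
  let ?T = "\<phi> ` (V \<inter> (S \<inter> W))"
  have T: "open ?T" by (rule chart_open_image[OF c]) (use S W in auto)
  let ?f = "\<lambda>b p. \<kappa> p * (\<phi> p \<bullet> b)"
  have f: "?f b \<in> C_infinity A" for b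
    by (rule cutoff_coordinate_C_infinity[OF c \<kappa>, of "\<lambda>x. x \<bullet> b"]) (auto intro!: smooth_on_inner smooth_on_ident)
  have "smooth_on ?T (\<lambda>x. \<Sum>b\<in>Basis. ((\<lambda>q. X q (?f b)) \<circ> inv_into V \<phi>) x *\<^sub>R b)"
  proof (intro smooth_on_sum smooth_on_scaleR T smooth_on_const)
    fix b
    have "smooth_fun_on A (S \<inter> W) (\<lambda>q. X q (?f b))" by (rule smooth_fun_on_subset[OF Xf[OF f]]) auto
    from smooth_fun_onD[OF this c] show "smooth_on ?T ((\<lambda>q. X q (?f b)) \<circ> inv_into V \<phi>)" .
  qed
  then have "smooth_on ?T (\<lambda>x. tcomp V \<phi> (inv_into V \<phi> x) (X (inv_into V \<phi> x)))"
  proof (rule smooth_on_cong[OF T, rotated])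
    fix x assume "x \<in> ?T"
    then obtain p where p: "p \<in> V" "p \<in> S" "p \<in> W" "x = \<phi> p" by auto
    have "X p (?f b) = tcomp V \<phi> p (X p) \<bullet> b" for b
      by (rule tcomp_inner[OF c p(1) X[OF p(2)] \<kappa> W(1) p(3) W(3)])
    then show "(\<Sum>b\<in>Basis. ((\<lambda>q. X q (?f b)) \<circ> inv_into V \<phi>) x *\<^sub>R b) = tcomp V \<phi> (inv_into V \<phi> x) (X (inv_into V \<phi> x))"
      using p chart_inv[OF c] by (simp add: euclidean_representation)
  qed
  then show "\<exists>T. open T \<and> x \<in> T \<and> smooth_on T (\<lambda>x. tcomp V \<phi> (inv_into V \<phi> x) (X (inv_into V \<phi> x)))"
    using T q qV W by blast
qed

end

section \<open>Integration by parts\<close>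

text \<open>Extension by zero: a function that is smooth only on an open set may be multiplied by a test
  function supported in that set.\<close>

lemma test_fun_mult_local:
  fixes F G :: "'e::euclidean_space \<Rightarrow> real"
  assumes F: "test_fun F" and K: "compact K" "K \<subseteq> S" "\<forall>x. x \<notin> K \<longrightarrow> F x = 0" and S: "open S" and G: "smooth_on S G"
  shows "test_fun (\<lambda>x. F x * G x)"
    and "x \<in> S \<Longrightarrow> dirderiv b (\<lambda>x. F x * G x) x = dirderiv b F x * G x + F x * dirderiv b G x"
    and "x \<notin> S \<Longrightarrow> dirderiv b (\<lambda>x. F x * G x) x = 0"
proof -
  have o: "open (- K)" using compact_imp_closed[OF K(1)] by (rule open_Compl)
  have z: "smooth_on (- K) (\<lambda>x. F x * G x)"
    by (rule smooth_on_cong[OF o _ smooth_on_const[OF o, of 0]]) (simp add: K(3))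
  have s: "smooth_on S (\<lambda>x. F x * G x)"
  proof (rule smooth_on_mult[OF S _ G])
    show "smooth_on S F" by (rule smooth_on_subset[of UNIV]) (use F in \<open>simp_all add: test_fun_def\<close>)
  qed
  have "smooth_on UNIV (\<lambda>x. F x * G x)"
  proof (rule smooth_on_local)
    fix x
    show "\<exists>T. open T \<and> x \<in> T \<and> smooth_on T (\<lambda>x. F x * G x)"
    proof (cases "x \<in> K")
      case True
      then show ?thesis by (intro exI[of _ S] conjI S s) (use K in blast)
    next
      case False
      then show ?thesis by (intro exI[of _ "- K"] conjI o z) simp
    qed
  qed
  moreover have "bounded {x. F x * G x \<noteq> 0}"
    by (rule bounded_subset[of "{x. F x \<noteq> 0}"]) (use F in \<open>auto simp: test_fun_def\<close>)
  ultimately show "test_fun (\<lambda>x. F x * G x)" by (simp add: test_fun_def)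
  show "dirderiv b (\<lambda>x. F x * G x) x = dirderiv b F x * G x + F x * dirderiv b G x" if x: "x \<in> S"
  proof -
    have "((\<lambda>x. F x * G x) has_derivative
       (\<lambda>h. F x * frechet_derivative G (at x) h + frechet_derivative F (at x) h * G x)) (at x)"
      by (intro has_derivative_mult test_fun_has_derivative[OF F] smooth_on_has_derivative[OF G x])
    from frechet_derivative_at[OF this] show ?thesis by (metis add.commute)
  qed
  show "dirderiv b (\<lambda>x. F x * G x) x = 0" if "x \<notin> S"
    by (rule dirderiv_eq_0[OF o]) (use that K in auto)
qed

text \<open>The convolution of a test function with the indicator of a large ball is constant near the
  origin, where its value is the integral.\<close>

lemma integral_dirderiv_eq_0:
  fixes F :: "'e::euclidean_space \<Rightarrow> real"
  assumes F: "test_fun F"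
  shows "(\<integral>x. dirderiv b F x \<partial>lborel) = 0"
proof -
  obtain R where R: "R > 0" "\<And>x. norm x \<ge> R \<Longrightarrow> F x = 0" using F test_fun_radius unfolding test_fun_def by metis
  obtain R' where R': "R' > 0" "\<And>x. norm x \<ge> R' \<Longrightarrow> dirderiv b F x = 0"
    using test_fun_dirderiv[OF F, of b] test_fun_radius unfolding test_fun_def by metis
  define B where "B = ball (0::'e) (R + R' + 1)"
  define v where "v = (indicator B :: 'e \<Rightarrow> real)"
  have v: "integrable lborel v" unfolding v_def B_def by (rule integrable_indicator_ball)
  have near: "conv k v z = (\<integral>x. k x \<partial>lborel)" if k: "test_fun k" and z: "norm z < 1"
    and k0: "\<And>x. norm x \<ge> R + R' \<Longrightarrow> k x = 0" for k z
  proof -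
    have "conv k v z = (\<integral>x. k (z - x) \<partial>lborel)"
      unfolding conv_def
    proof (rule Bochner_Integration.integral_cong[OF refl])
      fix x
      show "k (z - x) * v x = k (z - x)"
      proof (cases "x \<in> B")
        case False
        then have "norm x \<ge> R + R' + 1" by (simp add: B_def)
        moreover have "norm x \<le> norm z + norm (z - x)" using norm_triangle_ineq4[of z "z - x"] by simp
        ultimately have "k (z - x) = 0" using z by (intro k0) linarith
        then show ?thesis by simp
      qed (simp add: v_def)
    qed
    also have "\<dots> = (\<integral>x. k x \<partial>lborel)" by (rule lborel_integral_reflect(1)[OF test_fun_measurable[OF k]])
    finally show ?thesis .
  qed
  have "(conv F v has_derivative (\<lambda>_. 0)) (at 0)"
  proof (rule has_derivative_transform_within_open[OF _ open_ball, of "\<lambda>_. \<integral>x. F x \<partial>lborel" _ 0 UNIV 0 1])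
    show "(\<integral>x. F x \<partial>lborel) = conv F v z" if "z \<in> ball 0 1" for z
      by (rule near[OF F, symmetric]) (use that R R' in auto)
  qed auto
  then have "dirderiv b (conv F v) 0 = 0" using frechet_derivative_at by metis
  then have "conv (dirderiv b F) v 0 = 0" using dirderiv_conv[OF F v] by simp
  moreover have "conv (dirderiv b F) v 0 = (\<integral>x. dirderiv b F x \<partial>lborel)"
    by (rule near[OF test_fun_dirderiv[OF F]]) (use R R' in auto)
  ultimately show ?thesis by simp
qed

section \<open>Smooth measures\<close>

locale measured_manifold = manifold A for A :: "('a::{second_countable_topology, t2_space}, 'e::euclidean_space) chart set" +
  fixes \<omega> :: "'a measure"
  assumes sets_\<omega>: "sets \<omega> = sets borel"
    and density: "\<And>V \<phi>. (V, \<phi>) \<in> A \<Longrightarrow> \<exists>\<rho>. smooth_on (\<phi> ` V) \<rho> \<and> (\<forall>x\<in>\<phi> ` V. \<rho> x > 0) \<and>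
        (\<forall>B\<in>sets borel. B \<subseteq> V \<longrightarrow> emeasure \<omega> B = (\<integral>\<^sup>+x\<in>\<phi> ` B. ennreal (\<rho> x) \<partial>lborel))"
begin

definition rho :: "'a set \<Rightarrow> ('a \<Rightarrow> 'e) \<Rightarrow> 'e \<Rightarrow> real" where
  "rho V \<phi> = (SOME \<rho>. smooth_on (\<phi> ` V) \<rho> \<and> (\<forall>x\<in>\<phi> ` V. \<rho> x > 0) \<and>
        (\<forall>B\<in>sets borel. B \<subseteq> V \<longrightarrow> emeasure \<omega> B = (\<integral>\<^sup>+x\<in>\<phi> ` B. ennreal (\<rho> x) \<partial>lborel)))"

lemma rho:
  assumes "(V, \<phi>) \<in> A"
  shows "smooth_on (\<phi> ` V) (rho V \<phi>)" "\<And>x. x \<in> \<phi> ` V \<Longrightarrow> rho V \<phi> x > 0"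
    "\<And>B. B \<in> sets borel \<Longrightarrow> B \<subseteq> V \<Longrightarrow> emeasure \<omega> B = (\<integral>\<^sup>+x\<in>\<phi> ` B. ennreal (rho V \<phi> x) \<partial>lborel)"
proof -
  note * = someI_ex[OF density[OF assms], folded rho_def]
  show "smooth_on (\<phi> ` V) (rho V \<phi>)" using * by (rule conjunct1)
  show "\<And>x. x \<in> \<phi> ` V \<Longrightarrow> rho V \<phi> x > 0" using * by (elim conjE) (erule bspec)
  show "\<And>B. B \<in> sets borel \<Longrightarrow> B \<subseteq> V \<Longrightarrow> emeasure \<omega> B = (\<integral>\<^sup>+x\<in>\<phi> ` B. ennreal (rho V \<phi> x) \<partial>lborel)"
    using * by (elim conjE) (drule (1) bspec, erule (1) mp)
qed

lemma measurable_\<omega>: "f \<in> borel_measurable \<omega> \<longleftrightarrow> f \<in> borel_measurable borel"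
  by (rule arg_cong[where f="\<lambda>S. f \<in> S"]) (rule measurable_cong_sets[OF sets_\<omega> refl])

lemma C_infinity_measurable: "f \<in> C_infinity A \<Longrightarrow> (f :: 'a \<Rightarrow> real) \<in> borel_measurable \<omega>"
  unfolding measurable_\<omega> by (intro borel_measurable_continuous_onI C_infinity_continuous)

text \<open>Change of variables: the part of \<open>\<omega>\<close> in a chart is the image of a weighted Lebesgue measure
  under the inverse chart.\<close>

lemma chart_measure:
  assumes c: "(V, \<phi>) \<in> A"
  defines "T \<equiv> (\<lambda>x. if x \<in> \<phi> ` V then inv_into V \<phi> x else (SOME q. True))"
  shows "T \<in> borel_measurable borel"
    and "density \<omega> (\<lambda>q. ennreal (indicator V q)) =
      distr (density lborel (\<lambda>x. ennreal (indicator (\<phi> ` V) x * rho V \<phi> x))) borel T"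
proof -
  have oV: "open V" and oI: "open (\<phi> ` V)" by (rule chart_props[OF c])+
  show Tm[measurable]: "T \<in> borel_measurable borel"
    unfolding T_def
  proof (rule borel_measurable_continuous_on_if)
    show "\<phi> ` V \<in> sets borel" using oI by simp
    show "continuous_on (\<phi> ` V) (inv_into V \<phi>)" by (rule chart_props(4)[OF c])
  qed (rule continuous_on_const)
  have rm[measurable]: "(\<lambda>x. indicator (\<phi> ` V) x * rho V \<phi> x) \<in> borel_measurable borel"
    using borel_measurable_continuous_on_indicator[of "\<phi> ` V" "rho V \<phi>"] oI
      smooth_on_continuous_on[OF rho(1)[OF c]] by simp
  have Vm[measurable]: "V \<in> sets borel" using oV by simp
  note sets_\<omega>[measurable_cong]
  show "density \<omega> (\<lambda>q. ennreal (indicator V q)) =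
      distr (density lborel (\<lambda>x. ennreal (indicator (\<phi> ` V) x * rho V \<phi> x))) borel T"
  proof (rule measure_eqI)
    show "sets (density \<omega> (\<lambda>q. ennreal (indicator V q))) =
      sets (distr (density lborel (\<lambda>x. ennreal (indicator (\<phi> ` V) x * rho V \<phi> x))) borel T)"
      by (simp add: sets_\<omega>)
    fix B assume "B \<in> sets (density \<omega> (\<lambda>q. ennreal (indicator V q)))"
    then have B[measurable]: "B \<in> sets borel" by (simp add: sets_\<omega>)
    have "emeasure (density \<omega> (\<lambda>q. ennreal (indicator V q))) B = (\<integral>\<^sup>+q. ennreal (indicator V q) * indicator B q \<partial>\<omega>)"
      by (rule emeasure_density) (auto simp: sets_\<omega>)
    also have "\<dots> = (\<integral>\<^sup>+q. indicator (V \<inter> B) q \<partial>\<omega>)"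
      by (rule nn_integral_cong) (auto simp: indicator_def)
    also have "\<dots> = emeasure \<omega> (V \<inter> B)" by (rule nn_integral_indicator) (simp add: sets_\<omega>)
    also have "\<dots> = (\<integral>\<^sup>+x\<in>\<phi> ` (V \<inter> B). ennreal (rho V \<phi> x) \<partial>lborel)" by (rule rho(3)[OF c]) auto
    also have "\<dots> = (\<integral>\<^sup>+x. ennreal (indicator (\<phi> ` V) x * rho V \<phi> x) * indicator (T -` B) x \<partial>lborel)"
    proof (rule nn_integral_cong)
      fix x
      show "ennreal (rho V \<phi> x) * indicator (\<phi> ` (V \<inter> B)) x = ennreal (indicator (\<phi> ` V) x * rho V \<phi> x) * indicator (T -` B) x"
      proof (cases "x \<in> \<phi> ` V")
        case True
        then obtain q where q: "q \<in> V" "x = \<phi> q" by blast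
        have "x \<in> \<phi> ` (V \<inter> B) \<longleftrightarrow> q \<in> B"
          using q inj_onD[OF chart_props(5)[OF c]] by blast
        moreover have "x \<in> T -` B \<longleftrightarrow> q \<in> B" using True q chart_inv[OF c q(1)] by (simp add: T_def)
        ultimately show ?thesis using True by (simp add: indicator_def)
      next
        case False
        then have "x \<notin> \<phi> ` (V \<inter> B)" by blast
        then show ?thesis using False by simp
      qed
    qed
    also have "\<dots> = emeasure (density lborel (\<lambda>x. ennreal (indicator (\<phi> ` V) x * rho V \<phi> x))) (T -` B)"
      using measurable_sets[OF Tm B] by (subst emeasure_density) auto
    also have "\<dots> = emeasure (distr (density lborel (\<lambda>x. ennreal (indicator (\<phi> ` V) x * rho V \<phi> x))) borel T) B"
      by (subst emeasure_distr) auto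
    finally show "emeasure (density \<omega> (\<lambda>q. ennreal (indicator V q))) B =
      emeasure (distr (density lborel (\<lambda>x. ennreal (indicator (\<phi> ` V) x * rho V \<phi> x))) borel T) B" .
  qed
qed

lemma chart_integral:
  assumes c: "(V, \<phi>) \<in> A" and g: "g \<in> borel_measurable borel" and g0: "\<forall>q. q \<notin> V \<longrightarrow> g q = (0::real)"
  shows "integrable \<omega> g \<longleftrightarrow> integrable lborel (\<lambda>x. push V \<phi> g x * rho V \<phi> x)"
    and "(\<integral>q. g q \<partial>\<omega>) = (\<integral>x. push V \<phi> g x * rho V \<phi> x \<partial>lborel)"
    and "push V \<phi> g \<in> borel_measurable borel"
proof -
  define T where "T = (\<lambda>x. if x \<in> \<phi> ` V then inv_into V \<phi> x else (SOME q. True))"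
  have T[measurable]: "T \<in> borel_measurable borel" unfolding T_def by (rule chart_measure(1)[OF c])
  note cm = chart_measure(2)[OF c, folded T_def]
  have oV: "open V" and oI: "open (\<phi> ` V)" by (rule chart_props[OF c])+
  have g\<omega>: "g \<in> borel_measurable \<omega>" using g by (simp add: measurable_\<omega>)
  note g[measurable]
  have Vm: "V \<in> sets \<omega>" using oV by (simp add: sets_\<omega>)
  have im: "(indicator V :: 'a \<Rightarrow> real) \<in> borel_measurable \<omega>" using Vm by (rule borel_measurable_indicator)
  have rm[measurable]: "(\<lambda>x. indicator (\<phi> ` V) x * rho V \<phi> x) \<in> borel_measurable borel"
    using borel_measurable_continuous_on_indicator[of "\<phi> ` V" "rho V \<phi>"] oI
      smooth_on_continuous_on[OF rho(1)[OF c]] by simp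
  have nn: "0 \<le> indicator (\<phi> ` V) x * rho V \<phi> x" for x
    using rho(2)[OF c, of x] by (cases "x \<in> \<phi> ` V") (simp_all add: less_imp_le)
  have gV: "(\<lambda>q. indicator V q *\<^sub>R g q) = g"
    by (rule ext) (use g0 in \<open>auto simp: indicator_def\<close>)
  have e: "(\<lambda>x. (indicator (\<phi> ` V) x * rho V \<phi> x) *\<^sub>R g (T x)) = (\<lambda>x. push V \<phi> g x * rho V \<phi> x)"
    by (rule ext) (simp add: push_def T_def indicator_def)
  have p: "push V \<phi> g = (\<lambda>x. indicator (\<phi> ` V) x * g (T x))"
    by (rule ext) (simp add: push_def T_def indicator_def)
  have [measurable]: "\<phi> ` V \<in> sets borel" using oI by simp
  show "push V \<phi> g \<in> borel_measurable borel" unfolding p by measurable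
  have "integrable \<omega> g \<longleftrightarrow> integrable (density \<omega> (\<lambda>q. ennreal (indicator V q))) g"
    by (subst integrable_density[OF g\<omega> im]) (simp_all only: gV, simp)
  also have "\<dots> \<longleftrightarrow> integrable (density lborel (\<lambda>x. ennreal (indicator (\<phi> ` V) x * rho V \<phi> x))) (\<lambda>x. g (T x))"
    unfolding cm by (rule integrable_distr_eq) auto
  also have "\<dots> \<longleftrightarrow> integrable lborel (\<lambda>x. push V \<phi> g x * rho V \<phi> x)"
    by (subst integrable_density) (use nn in \<open>simp_all add: e[unfolded real_scaleR_def]\<close>)
  finally show "integrable \<omega> g \<longleftrightarrow> integrable lborel (\<lambda>x. push V \<phi> g x * rho V \<phi> x)" .
  have "(\<integral>q. g q \<partial>\<omega>) = integral\<^sup>L (density \<omega> (\<lambda>q. ennreal (indicator V q))) g"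
    by (subst integral_density[OF g\<omega> im]) (simp_all only: gV, simp)
  also have "\<dots> = (\<integral>x. g (T x) \<partial>density lborel (\<lambda>x. ennreal (indicator (\<phi> ` V) x * rho V \<phi> x)))"
    unfolding cm by (rule integral_distr) auto
  also have "\<dots> = (\<integral>x. push V \<phi> g x * rho V \<phi> x \<partial>lborel)"
    by (subst integral_density) (use nn in \<open>simp_all add: e[unfolded real_scaleR_def]\<close>)
  finally show "(\<integral>q. g q \<partial>\<omega>) = (\<integral>x. push V \<phi> g x * rho V \<phi> x \<partial>lborel)" .
qed

lemma push_rho_test_fun:
  assumes c: "(V, \<phi>) \<in> A" and f: "f \<in> C_infinity A" "support_in f V" and G: "smooth_on (\<phi> ` V) G"
  shows "test_fun (\<lambda>x. push V \<phi> f x * G x)"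
proof -
  obtain K where "compact K" "K \<subseteq> \<phi> ` V" "\<forall>x. x \<notin> K \<longrightarrow> push V \<phi> f x = 0" by (rule push_support[OF c f(2)])
  then show ?thesis
    by (rule test_fun_mult_local(1)[OF push_test_fun[OF c C_infinity_smooth_fun_on[OF f(1)] f(2)] _ _ _ chart_props(2)[OF c] G])
qed

lemma support_in_eq_0: "support_in f V \<Longrightarrow> \<forall>q. q \<notin> V \<longrightarrow> f q = 0"
  unfolding support_in_def by blast

lemma chart_integral_smooth:
  assumes c: "(V, \<phi>) \<in> A" and f: "f \<in> C_infinity A" "support_in f V"
  shows "integrable \<omega> f" "(\<integral>q. f q \<partial>\<omega>) = (\<integral>x. push V \<phi> f x * rho V \<phi> x \<partial>lborel)"
proof -
  have m: "f \<in> borel_measurable borel" using C_infinity_measurable[OF f(1)] by (simp add: measurable_\<omega>)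
  note ci = chart_integral[OF c m support_in_eq_0[OF f(2)]]
  show "integrable \<omega> f"
    by (rule ci(1)[THEN iffD2, OF integrable_test_fun[OF push_rho_test_fun[OF c f rho(1)[OF c]]]])
  show "(\<integral>q. f q \<partial>\<omega>) = (\<integral>x. push V \<phi> f x * rho V \<phi> x \<partial>lborel)" by (rule ci(2))
qed

lemma chart_partition:
  assumes f: "f \<in> C_infinity A" "support_in f UNIV"
  obtains n :: nat and c where "\<forall>i<n. c i \<in> C_infinity A"
    "\<forall>i<n. \<exists>V \<phi>. (V, \<phi>) \<in> A \<and> support_in (c i) V" "\<forall>q. f q = (\<Sum>i<n. c i q * f q)"
proof -
  obtain K where K: "compact K" "\<And>q. q \<notin> K \<Longrightarrow> f q = 0" using f(2) unfolding support_in_def by blast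
  have cover: "\<exists>N. (\<exists>\<phi>. (N, \<phi>) \<in> A) \<and> open N \<and> q \<in> N" for q
  proof -
    obtain V \<phi> where "(V, \<phi>) \<in> A" "q \<in> V" by (rule chart_at)
    then show ?thesis using chart_props(1) by blast
  qed
  obtain n c where nc: "\<forall>i<n. c i \<in> C_infinity A"
    "\<forall>i<n. \<exists>N. (\<exists>\<phi>. (N, \<phi>) \<in> A) \<and> support_in (c i) N" "\<forall>q\<in>K. (\<Sum>i<(n::nat). c i q) = 1"
    by (rule partition_of_unity[OF K(1), of "\<lambda>N. \<exists>\<phi>. (N, \<phi>) \<in> A"]) (rule cover)
  show thesis
  proof (rule that[OF nc(1)])
    show "\<forall>i<n. \<exists>V \<phi>. (V, \<phi>) \<in> A \<and> support_in (c i) V" using nc(2) by blast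
    show "\<forall>q. f q = (\<Sum>i<n. c i q * f q)"
    proof
      fix q
      show "f q = (\<Sum>i<n. c i q * f q)"
      proof (cases "q \<in> K")
        case True
        then show ?thesis using nc(3) by (simp add: sum_distrib_right[symmetric])
      qed (simp add: K(2))
    qed
  qed
qed

lemma C_infinity_c_integrable:
  assumes f: "f \<in> C_infinity A" "support_in f UNIV"
  shows "integrable \<omega> f"
proof -
  obtain n c where nc': "\<forall>i<n. c i \<in> C_infinity A"
    "\<forall>i<n. \<exists>V \<phi>. (V, \<phi>) \<in> A \<and> support_in (c i) V" "\<forall>q. f q = (\<Sum>i<(n::nat). c i q * f q)"
    by (rule chart_partition[OF f])
  note nc = nc'[rule_format]
  have "integrable \<omega> (\<lambda>q. c i q * f q)" if i: "i < n" for i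
  proof -
    obtain V \<phi> where c: "(V, \<phi>) \<in> A" and s: "support_in (c i) V" using nc(2)[OF i] by blast
    show ?thesis by (rule chart_integral_smooth(1)[OF c C_infinity_mult[OF nc(1)[OF i] f(1)] support_in_mult[OF s]])
  qed
  then have "integrable \<omega> (\<lambda>q. \<Sum>i<n. c i q * f q)" by (intro Bochner_Integration.integrable_sum) auto
  then show ?thesis by (simp only: nc(3)[symmetric])
qed

lemma integral_eq_0_imp_eq_0:
  assumes f: "f \<in> C_infinity A" "support_in f UNIV" and nn: "\<And>q. 0 \<le> f q" and I: "(\<integral>q. f q \<partial>\<omega>) = 0"
  shows "f q = 0"
proof (rule ccontr)
  assume "f q \<noteq> 0"
  then have fq: "f q > 0" using nn[of q] by simp
  obtain V \<phi> where c: "(V, \<phi>) \<in> A" "q \<in> V" by (rule chart_at)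
  obtain \<kappa> W where \<kappa>: "\<kappa> \<in> C_infinity A" "support_in \<kappa> V" "\<And>p. 0 \<le> \<kappa> p" "\<And>p. \<kappa> p \<le> 1" "q \<in> W" "\<And>p. p \<in> W \<Longrightarrow> \<kappa> p = 1"
    using bump_exists[OF chart_props(1)[OF c(1)] c(2)] by metis
  let ?g = "\<lambda>q. \<kappa> q * f q"
  have g: "?g \<in> C_infinity A" "support_in ?g V"
    by (rule C_infinity_mult[OF \<kappa>(1) f(1)], rule support_in_mult[OF \<kappa>(2)])
  have "(\<integral>q. ?g q \<partial>\<omega>) \<le> (\<integral>q. f q \<partial>\<omega>)"
    by (rule integral_mono[OF chart_integral_smooth(1)[OF c(1) g] C_infinity_c_integrable[OF f]])
      (simp add: \<kappa> nn mult_left_le_one_le)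
  then have le: "(\<integral>q. ?g q \<partial>\<omega>) \<le> 0" using I by simp
  define F where "F = (\<lambda>x. push V \<phi> ?g x * rho V \<phi> x)"
  have F: "test_fun F" unfolding F_def by (rule push_rho_test_fun[OF c(1) g rho(1)[OF c(1)]])
  have Fnn: "0 \<le> F x" for x
    using rho(2)[OF c(1), of x] \<kappa>(3) nn by (simp add: F_def push_def less_imp_le)
  have F0: "F (\<phi> q) > 0"
    using c(2) chart_inv[OF c] \<kappa>(5,6) fq rho(2)[OF c(1), of "\<phi> q"] by (simp add: F_def push_def)
  have "isCont F (\<phi> q)" using test_fun_continuous[OF F, of UNIV] by (simp add: continuous_on_eq_continuous_at)
  then obtain d where d: "d > 0" "\<And>x. dist x (\<phi> q) < d \<Longrightarrow> dist (F x) (F (\<phi> q)) < F (\<phi> q) / 2"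
    unfolding continuous_at_eps_delta using F0 by (metis half_gt_zero)
  have "F (\<phi> q) / 2 * ball_vol TYPE('e) d = (\<integral>x. F (\<phi> q) / 2 * indicator (ball (\<phi> q) d) x \<partial>lborel)"
    using d(1) by (simp only: integral_mult_right_zero integral_ball_indicator)
  also have "\<dots> \<le> (\<integral>x. F x \<partial>lborel)"
  proof (rule integral_mono[OF _ integrable_test_fun[OF F]])
    show "integrable lborel (\<lambda>x. F (\<phi> q) / 2 * indicator (ball (\<phi> q) d) x)"
      by (intro integrable_mult_right integrable_indicator_ball)
    fix x
    show "F (\<phi> q) / 2 * indicator (ball (\<phi> q) d) x \<le> F x"
    proof (cases "x \<in> ball (\<phi> q) d")
      case True
      then have "dist x (\<phi> q) < d" by (simp add: dist_commute)
      from d(2)[OF this] have "F (\<phi> q) / 2 \<le> F x" by (simp add: dist_real_def abs_if split: if_splits)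
      then show ?thesis using True by simp
    qed (simp add: Fnn)
  qed
  also have "\<dots> \<le> 0" using le chart_integral_smooth(2)[OF c(1) g] by (simp add: F_def)
  finally show False using F0 ball_vol_pos[OF d(1), where 'e='e] by (simp add: mult_le_0_iff)
qed

lemma fundamental_lemma:
  fixes h k :: "'a \<Rightarrow> real"
  assumes N: "open N" and h: "smooth_fun_on A N h" "smooth_fun_on A N k"
    and eq: "\<And>f. f \<in> C_infinity A \<Longrightarrow> support_in f N \<Longrightarrow> (\<integral>q. f q * h q \<partial>\<omega>) = (\<integral>q. f q * k q \<partial>\<omega>)"
    and q: "q \<in> N"
  shows "h q = k q"
proof -
  obtain \<kappa> W where \<kappa>: "\<kappa> \<in> C_infinity A" "support_in \<kappa> N" "q \<in> W" "\<And>p. p \<in> W \<Longrightarrow> \<kappa> p = 1"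
    using bump_exists[OF N q] by metis
  obtain K where K: "compact K" "K \<subseteq> N" "\<And>q. q \<notin> K \<Longrightarrow> \<kappa> q = 0" using \<kappa>(2) unfolding support_in_def by blast
  have ext: "(\<lambda>q. \<kappa> q * g q) \<in> C_infinity A" if "smooth_fun_on A N g" for g
  proof (rule C_infinity_zero_extension[OF N _ compact_imp_closed[OF K(1)] K(2)])
    show "smooth_fun_on A N (\<lambda>q. \<kappa> q * g q)"
      by (rule smooth_fun_on_mult[OF N C_infinity_smooth_fun_on[OF \<kappa>(1)] that])
  qed (simp add: K(3))
  have d: "smooth_fun_on A N (\<lambda>q. h q + - 1 * k q)"
    by (intro smooth_fun_on_add smooth_fun_on_mult smooth_fun_on_const N h)
  let ?f = "\<lambda>q. \<kappa> q * (\<kappa> q * (h q + - 1 * k q))"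
  have f: "?f \<in> C_infinity A" "support_in ?f N"
    by (rule C_infinity_mult[OF \<kappa>(1) ext[OF d]], rule support_in_mult[OF \<kappa>(2)])
  have fi: "integrable \<omega> (\<lambda>q. ?f q * g q)" if g: "smooth_fun_on A N g" for g
  proof (rule C_infinity_c_integrable)
    have "(\<lambda>q. (\<kappa> q * (h q + - 1 * k q)) * (\<kappa> q * g q)) \<in> C_infinity A"
      by (rule C_infinity_mult[OF ext[OF d] ext[OF g]])
    then show "(\<lambda>q. ?f q * g q) \<in> C_infinity A" by (simp add: mult_ac)
    show "support_in (\<lambda>q. ?f q * g q) UNIV" by (rule support_in_mono[OF support_in_mult[OF f(2)]]) simp
  qed
  let ?s = "\<lambda>q. (\<kappa> q * (h q + - 1 * k q)) * (\<kappa> q * (h q + - 1 * k q))"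
  have "(\<integral>q. ?s q \<partial>\<omega>) = (\<integral>q. ?f q * h q - ?f q * k q \<partial>\<omega>)"
    by (rule Bochner_Integration.integral_cong) (simp_all add: algebra_simps)
  also have "\<dots> = (\<integral>q. ?f q * h q \<partial>\<omega>) - (\<integral>q. ?f q * k q \<partial>\<omega>)"
    by (rule Bochner_Integration.integral_diff[OF fi[OF h(1)] fi[OF h(2)]])
  also have "\<dots> = 0" using eq[OF f] by simp
  finally have "?s q = 0"
  proof (rule integral_eq_0_imp_eq_0[rotated 3])
    show "?s \<in> C_infinity A" by (rule C_infinity_mult[OF ext[OF d] ext[OF d]])
    show "support_in ?s UNIV"
      by (rule support_in_mono[OF support_in_weaker[OF \<kappa>(2)]]) simp_all
  qed simp
  then show ?thesis using \<kappa>(4)[OF \<kappa>(3)] by simp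
qed

section \<open>Divergence of a smooth vector field\<close>

definition smooth_field :: "'a vfield \<Rightarrow> bool" where
  "smooth_field X \<longleftrightarrow> (\<forall>q. X q \<in> tangent_space A q) \<and> (\<forall>f\<in>C_infinity A. (\<lambda>q. X q f) \<in> C_infinity A)"

lemma smooth_fieldD:
  "smooth_field X \<Longrightarrow> X q \<in> tangent_space A q"
  "smooth_field X \<Longrightarrow> f \<in> C_infinity A \<Longrightarrow> (\<lambda>q. X q f) \<in> C_infinity A"
  unfolding smooth_field_def by blast+

lemma tangent_local:
  assumes v: "v \<in> tangent_space A q" and f: "f \<in> C_infinity A" and W: "open W" "q \<in> W" "\<And>p. p \<in> W \<Longrightarrow> f p = 0"
  shows "v f = 0"
proof -
  obtain V \<phi> where c: "(V, \<phi>) \<in> A" "q \<in> V" by (rule chart_at)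
  have "frechet_derivative (f \<circ> inv_into V \<phi>) (at (\<phi> q)) u = 0" for u
  proof (rule dirderiv_eq_0[OF chart_open_image[OF c(1) W(1)]])
    show "\<phi> q \<in> \<phi> ` (V \<inter> W)" using c W by blast
    fix x assume "x \<in> \<phi> ` (V \<inter> W)"
    then obtain p where "p \<in> V" "p \<in> W" "x = \<phi> p" by blast
    then show "(f \<circ> inv_into V \<phi>) x = 0" using W(3) chart_inv[OF c(1)] by simp
  qed
  then show ?thesis using tcomp[OF c v f] by simp
qed

lemma field_support:
  assumes X: "\<And>q. X q \<in> tangent_space A q" and f: "f \<in> C_infinity A" "support_in f N"
  shows "support_in (\<lambda>q. X q f) N"
proof -
  obtain K where K: "compact K" "K \<subseteq> N" "\<And>q. q \<notin> K \<Longrightarrow> f q = 0" using f(2) unfolding support_in_def by blast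
  have "X q f = 0" if "q \<notin> K" for q
    by (rule tangent_local[OF X f(1) open_Compl[OF compact_imp_closed[OF K(1)]]]) (use that K(3) in auto)
  then show ?thesis unfolding support_in_def using K(1,2) by (intro exI[of _ K]) simp
qed

definition field_comp :: "'a set \<Rightarrow> ('a \<Rightarrow> 'e) \<Rightarrow> 'a vfield \<Rightarrow> 'e \<Rightarrow> 'e" where
  "field_comp V \<phi> X x = tcomp V \<phi> (inv_into V \<phi> x) (X (inv_into V \<phi> x))"

definition local_div :: "'a set \<Rightarrow> ('a \<Rightarrow> 'e) \<Rightarrow> 'a vfield \<Rightarrow> 'e \<Rightarrow> real" where
  "local_div V \<phi> X x = (\<Sum>b\<in>Basis. dirderiv b (\<lambda>x. rho V \<phi> x * (field_comp V \<phi> X x \<bullet> b)) x) * inverse (rho V \<phi> x)"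

lemma field_comp_smooth:
  assumes c: "(V, \<phi>) \<in> A" and X: "smooth_field X"
  shows "smooth_on (\<phi> ` V) (field_comp V \<phi> X)"
  unfolding field_comp_def[abs_def]
  by (rule tcomp_smooth[OF c chart_props(1)[OF c] order_refl smooth_fieldD(1)[OF X]])
    (rule C_infinity_smooth_fun_on[OF smooth_fieldD(2)[OF X]])

lemma flux_smooth:
  assumes c: "(V, \<phi>) \<in> A" and X: "smooth_field X"
  shows "smooth_on (\<phi> ` V) (\<lambda>x. rho V \<phi> x * (field_comp V \<phi> X x \<bullet> b))"
  by (intro smooth_on_mult smooth_on_inner rho(1)[OF c] field_comp_smooth[OF c X] chart_props(2)[OF c] smooth_on_const)

lemma local_div_smooth:
  assumes c: "(V, \<phi>) \<in> A" and X: "smooth_field X"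
  shows "smooth_fun_on A V (\<lambda>q. local_div V \<phi> X (\<phi> q))"
proof (rule smooth_fun_on_single_chart[OF c chart_props(1)[OF c] order_refl])
  have "smooth_on (\<phi> ` V) (local_div V \<phi> X)"
    unfolding local_div_def[abs_def]
    by (intro smooth_on_mult smooth_on_sum smooth_on_dirderiv flux_smooth[OF c X] smooth_on_inverse
        rho[OF c] chart_props(2)[OF c])
  then show "smooth_on (\<phi> ` V) ((\<lambda>q. local_div V \<phi> X (\<phi> q)) \<circ> inv_into V \<phi>)"
    by (rule smooth_on_cong[OF chart_props(2)[OF c], rotated]) (auto simp: chart_inv[OF c])
qed

lemma push_derivative:
  assumes c: "(V, \<phi>) \<in> A" and v: "v \<in> tangent_space A q" and q: "q \<in> V" and f: "f \<in> C_infinity A" "support_in f V"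
  shows "v f = (\<Sum>b\<in>Basis. (tcomp V \<phi> q v \<bullet> b) * dirderiv b (push V \<phi> f) (\<phi> q))"
proof -
  have F: "test_fun (push V \<phi> f)" by (rule push_test_fun[OF c C_infinity_smooth_fun_on[OF f(1)] f(2)])
  have "frechet_derivative (push V \<phi> f) (at (\<phi> q)) = frechet_derivative (f \<circ> inv_into V \<phi>) (at (\<phi> q))"
    by (rule frechet_derivative_transform_within_open[OF _ chart_props(2)[OF c]])
      (use q differentiableI[OF test_fun_has_derivative[OF F]] in \<open>auto simp: push_def\<close>)
  then have "v f = frechet_derivative (push V \<phi> f) (at (\<phi> q)) (tcomp V \<phi> q v)"
    using tcomp[OF c q v f(1)] by simp
  also have "\<dots> = (\<Sum>b\<in>Basis. (tcomp V \<phi> q v \<bullet> b) * dirderiv b (push V \<phi> f) (\<phi> q))"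
    using has_derivative_expand_Basis[OF test_fun_has_derivative[OF F, of "\<phi> q"], of "tcomp V \<phi> q v"] by simp
  finally show ?thesis .
qed

text \<open>Integration by parts in the chart, with the flux weighted by the density of \<open>\<omega>\<close>.\<close>

lemma local_div_parts:
  assumes c: "(V, \<phi>) \<in> A" and X: "smooth_field X" and f: "f \<in> C_infinity A" "support_in f V"
  shows "(\<integral>q. f q * local_div V \<phi> X (\<phi> q) \<partial>\<omega>) = - (\<integral>q. X q f \<partial>\<omega>)"
proof -
  let ?F = "push V \<phi> f"
  let ?G = "\<lambda>b x. rho V \<phi> x * (field_comp V \<phi> X x \<bullet> b)"
  have F: "test_fun ?F" by (rule push_test_fun[OF c C_infinity_smooth_fun_on[OF f(1)] f(2)])
  obtain K where K: "compact K" "K \<subseteq> \<phi> ` V" "\<forall>x. x \<notin> K \<longrightarrow> ?F x = 0" by (rule push_support[OF c f(2)])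
  note P = test_fun_mult_local[OF F K chart_props(2)[OF c] flux_smooth[OF c X]]
  have xf: "(\<lambda>q. X q f) \<in> C_infinity A" "support_in (\<lambda>q. X q f) V"
    by (rule smooth_fieldD(2)[OF X f(1)], rule field_support[OF smooth_fieldD(1)[OF X] f])
  have fd: "(\<lambda>q. f q * local_div V \<phi> X (\<phi> q)) \<in> C_infinity A" "support_in (\<lambda>q. f q * local_div V \<phi> X (\<phi> q)) V"
  proof -
    obtain L where L: "compact L" "L \<subseteq> V" "\<And>q. q \<notin> L \<Longrightarrow> f q = 0" using f(2) unfolding support_in_def by blast
    show "(\<lambda>q. f q * local_div V \<phi> X (\<phi> q)) \<in> C_infinity A"
      by (rule C_infinity_zero_extension[OF chart_props(1)[OF c] smooth_fun_on_mult[OF chart_props(1)[OF c] C_infinity_smooth_fun_on[OF f(1)] local_div_smooth[OF c X]] compact_imp_closed[OF L(1)] L(2)])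
        (simp add: L(3))
    show "support_in (\<lambda>q. f q * local_div V \<phi> X (\<phi> q)) V" by (rule support_in_mult[OF f(2)])
  qed
  have pw: "push V \<phi> (\<lambda>q. f q * local_div V \<phi> X (\<phi> q)) x * rho V \<phi> x + push V \<phi> (\<lambda>q. X q f) x * rho V \<phi> x
      = (\<Sum>b\<in>Basis. dirderiv b (\<lambda>x. ?F x * ?G b x) x)" for x
  proof (cases "x \<in> \<phi> ` V")
    case True
    then obtain q where q: "q \<in> V" "x = \<phi> q" by blast
    have r: "rho V \<phi> x > 0" by (rule rho(2)[OF c True])
    have 1: "push V \<phi> (\<lambda>q. f q * local_div V \<phi> X (\<phi> q)) x * rho V \<phi> x = ?F x * (\<Sum>b\<in>Basis. dirderiv b (?G b) x)"
      using True q r chart_inv[OF c q(1)] by (simp add: push_def local_div_def)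
    have "push V \<phi> (\<lambda>q. X q f) x = (\<Sum>b\<in>Basis. (field_comp V \<phi> X x \<bullet> b) * dirderiv b ?F x)"
      using push_derivative[OF c smooth_fieldD(1)[OF X] q(1) f] True q chart_inv[OF c q(1)]
      by (simp add: push_def[of _ _ "\<lambda>q. X q f"] field_comp_def)
    then have 2: "push V \<phi> (\<lambda>q. X q f) x * rho V \<phi> x = (\<Sum>b\<in>Basis. dirderiv b ?F x * ?G b x)"
      by (simp add: sum_distrib_left sum_distrib_right mult_ac)
    show ?thesis
      unfolding 1 2 P(2)[OF True] by (simp add: sum.distrib sum_distrib_left)
  next
    case False
    then show ?thesis by (simp add: push_def[of _ _ "\<lambda>q. X q f"] push_def[of _ _ "\<lambda>q. f q * local_div V \<phi> X (\<phi> q)"] P(3)[OF False])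
  qed
  have "(\<integral>q. f q * local_div V \<phi> X (\<phi> q) \<partial>\<omega>) + (\<integral>q. X q f \<partial>\<omega>)
    = (\<integral>x. push V \<phi> (\<lambda>q. f q * local_div V \<phi> X (\<phi> q)) x * rho V \<phi> x + push V \<phi> (\<lambda>q. X q f) x * rho V \<phi> x \<partial>lborel)"
    unfolding chart_integral_smooth(2)[OF c fd] chart_integral_smooth(2)[OF c xf]
    by (rule Bochner_Integration.integral_add[symmetric])
      (rule integrable_test_fun[OF push_rho_test_fun[OF c fd rho(1)[OF c]]],
       rule integrable_test_fun[OF push_rho_test_fun[OF c xf rho(1)[OF c]]])
  also have "\<dots> = (\<Sum>b\<in>Basis. \<integral>x. dirderiv b (\<lambda>x. ?F x * ?G b x) x \<partial>lborel)"
    unfolding pw by (rule Bochner_Integration.integral_sum) (rule integrable_test_fun[OF test_fun_dirderiv[OF P(1)]])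
  also have "\<dots> = 0" by (simp only: integral_dirderiv_eq_0[OF P(1)] sum.neutral_const)
  finally show ?thesis by simp
qed

lemma field_sum:
  assumes X: "smooth_field X" and c: "\<And>i. i < n \<Longrightarrow> c i \<in> C_infinity A" and f: "f \<in> C_infinity A"
    and s: "\<And>q. f q = (\<Sum>i<(n::nat). c i q * f q)"
  shows "X q f = (\<Sum>i<n. X q (\<lambda>q. c i q * f q))"
proof -
  have "f = (\<lambda>q. \<Sum>i<n. c i q * f q)" by (rule ext) (rule s)
  then have "X q f = X q (\<lambda>q. \<Sum>i<n. c i q * f q)" by (rule arg_cong)
  also have "\<dots> = (\<Sum>i<n. X q (\<lambda>q. c i q * f q))"
    by (rule tangent_sum[OF smooth_fieldD(1)[OF X]]) (simp_all add: C_infinity_mult c f)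
  finally show ?thesis .
qed

text \<open>The local formulas agree on overlaps of charts, because each of them is determined by its
  integrals against test functions; so they patch to one smooth function. A partition of unity
  then gives the identity for all test functions.\<close>

lemma divergence_exists:
  assumes X: "smooth_field X"
  obtains h where "h \<in> C_infinity A"
    "\<And>f. f \<in> C_infinity_c A \<Longrightarrow> (\<integral>q. f q * h q \<partial>\<omega>) = - (\<integral>q. X q f \<partial>\<omega>)"
    "\<And>V \<phi> q. (V, \<phi>) \<in> A \<Longrightarrow> q \<in> V \<Longrightarrow> h q = local_div V \<phi> X (\<phi> q)"
proof -
  define ch where "ch = (\<lambda>q. SOME c. c \<in> A \<and> q \<in> fst c)"
  have ch: "ch q \<in> A" "q \<in> fst (ch q)" for q
  proof -
    obtain V \<phi> where "(V, \<phi>) \<in> A" "q \<in> V" by (rule chart_at)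
    then have "\<exists>c. c \<in> A \<and> q \<in> fst c" by (intro exI[of _ "(V, \<phi>)"]) simp
    from someI_ex[OF this] show "ch q \<in> A" "q \<in> fst (ch q)" by (simp_all add: ch_def)
  qed
  define h where "h = (\<lambda>q. local_div (fst (ch q)) (snd (ch q)) X (snd (ch q) q))"
  have h_eq: "h q = local_div V \<phi> X (\<phi> q)" if c: "(V, \<phi>) \<in> A" and q: "q \<in> V" for V \<phi> q
  proof -
    obtain V' \<phi>' where c': "ch q = (V', \<phi>')" by (cases "ch q")
    have m: "(V', \<phi>') \<in> A" "q \<in> V'" using ch[of q] c' by simp_all
    have "local_div V' \<phi>' X (\<phi>' q) = local_div V \<phi> X (\<phi> q)"
    proof (rule fundamental_lemma[where N="V \<inter> V'" and h="\<lambda>q. local_div V' \<phi>' X (\<phi>' q)" and k="\<lambda>q. local_div V \<phi> X (\<phi> q)"])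
      show "open (V \<inter> V')" by (intro open_Int chart_props(1)[OF c] chart_props(1)[OF m(1)])
      show "smooth_fun_on A (V \<inter> V') (\<lambda>q. local_div V' \<phi>' X (\<phi>' q))"
        by (rule smooth_fun_on_subset[OF local_div_smooth[OF m(1) X]]) simp
      show "smooth_fun_on A (V \<inter> V') (\<lambda>q. local_div V \<phi> X (\<phi> q))"
        by (rule smooth_fun_on_subset[OF local_div_smooth[OF c X]]) simp
      fix f assume f: "f \<in> C_infinity A" "support_in f (V \<inter> V')"
      have "support_in f V" "support_in f V'" by (rule support_in_mono[OF f(2)], simp)+
      then show "(\<integral>q. f q * local_div V' \<phi>' X (\<phi>' q) \<partial>\<omega>) = (\<integral>q. f q * local_div V \<phi> X (\<phi> q) \<partial>\<omega>)"
        using local_div_parts[OF c X f(1)] local_div_parts[OF m(1) X f(1)] by simp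
    qed (use q m in simp)
    then show ?thesis by (simp add: h_def c')
  qed
  have h: "h \<in> C_infinity A"
    unfolding C_infinity_iff
  proof (rule smooth_fun_on_local)
    fix q
    obtain V \<phi> where c: "(V, \<phi>) \<in> A" "q \<in> V" by (rule chart_at)
    have "smooth_fun_on A V h"
      by (rule smooth_fun_on_cong[OF chart_props(1)[OF c(1)] _ local_div_smooth[OF c(1) X]]) (simp add: h_eq[OF c(1)])
    then show "\<exists>T. open T \<and> q \<in> T \<and> smooth_fun_on A T h"
      by (intro exI[of _ V] conjI chart_props(1)[OF c(1)] c(2))
  qed
  have "(\<integral>q. f q * h q \<partial>\<omega>) = - (\<integral>q. X q f \<partial>\<omega>)" if "f \<in> C_infinity_c A" for f
  proof -
    have f: "f \<in> C_infinity A" "support_in f UNIV" using that by (simp_all add: C_infinity_c_iff)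
    obtain n c where nc': "\<forall>i<n. c i \<in> C_infinity A"
      "\<forall>i<n. \<exists>V \<phi>. (V, \<phi>) \<in> A \<and> support_in (c i) V" "\<forall>q. f q = (\<Sum>i<(n::nat). c i q * f q)"
      by (rule chart_partition[OF f])
    note nc = nc'[rule_format]
    let ?g = "\<lambda>i q. c i q * f q"
    have g: "?g i \<in> C_infinity A" if "i < n" for i by (rule C_infinity_mult[OF nc(1)[OF that] f(1)])
    have part: "(\<integral>q. ?g i q * h q \<partial>\<omega>) = - (\<integral>q. X q (?g i) \<partial>\<omega>)" and i1: "integrable \<omega> (\<lambda>q. ?g i q * h q)"
      and i2: "integrable \<omega> (\<lambda>q. X q (?g i))" if i: "i < n" for i
    proof -
      obtain V \<phi> where c: "(V, \<phi>) \<in> A" and s: "support_in (c i) V" using nc(2)[OF i] by blast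
      have s': "support_in (?g i) V" by (rule support_in_mult[OF s])
      have "(\<integral>q. ?g i q * h q \<partial>\<omega>) = (\<integral>q. ?g i q * local_div V \<phi> X (\<phi> q) \<partial>\<omega>)"
      proof (rule Bochner_Integration.integral_cong[OF refl])
        fix q
        show "?g i q * h q = ?g i q * local_div V \<phi> X (\<phi> q)"
          by (cases "q \<in> V") (simp_all add: h_eq[OF c] support_in_eq_0[OF s', rule_format])
      qed
      also have "\<dots> = - (\<integral>q. X q (?g i) \<partial>\<omega>)" by (rule local_div_parts[OF c X g[OF i] s'])
      finally show "(\<integral>q. ?g i q * h q \<partial>\<omega>) = - (\<integral>q. X q (?g i) \<partial>\<omega>)" .
      show "integrable \<omega> (\<lambda>q. ?g i q * h q)"
        by (rule chart_integral_smooth(1)[OF c C_infinity_mult[OF g[OF i] h] support_in_mult[OF s']])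
      show "integrable \<omega> (\<lambda>q. X q (?g i))"
        by (rule chart_integral_smooth(1)[OF c smooth_fieldD(2)[OF X g[OF i]] field_support[OF smooth_fieldD(1)[OF X] g[OF i] s']])
    qed
    have "f q * h q = (\<Sum>i<n. ?g i q * h q)" for q
    proof -
      have "(\<Sum>i<n. ?g i q * h q) = (\<Sum>i<n. ?g i q) * h q" by (rule sum_distrib_right[symmetric])
      also have "(\<Sum>i<n. ?g i q) = f q" by (rule nc(3)[symmetric])
      finally show ?thesis by (rule sym)
    qed
    then have "(\<integral>q. f q * h q \<partial>\<omega>) = (\<integral>q. (\<Sum>i<n. ?g i q * h q) \<partial>\<omega>)" by (simp only:)
    also have "\<dots> = (\<Sum>i<n. \<integral>q. ?g i q * h q \<partial>\<omega>)"
      by (rule Bochner_Integration.integral_sum) (rule i1, simp)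
    also have "\<dots> = - (\<Sum>i<n. \<integral>q. X q (?g i) \<partial>\<omega>)" by (simp add: part sum_negf)
    also have "(\<Sum>i<n. \<integral>q. X q (?g i) \<partial>\<omega>) = (\<integral>q. (\<Sum>i<n. X q (?g i)) \<partial>\<omega>)"
      by (rule Bochner_Integration.integral_sum[symmetric]) (rule i2, simp)
    also have "\<dots> = (\<integral>q. X q f \<partial>\<omega>)"
      by (simp only: field_sum[OF X nc(1) f(1) nc(3), symmetric])
    finally show ?thesis .
  qed
  with h h_eq show thesis by (intro that)
qed

lemma divergence_unique:
  fixes h k :: "'a \<Rightarrow> real"
  assumes "h \<in> C_infinity A" "k \<in> C_infinity A"
    "\<And>f. f \<in> C_infinity_c A \<Longrightarrow> (\<integral>q. f q * h q \<partial>\<omega>) = (\<integral>q. f q * k q \<partial>\<omega>)"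
  shows "h = k"
proof
  fix q show "h q = k q"
  proof (rule fundamental_lemma[OF open_UNIV, of h k q])
    show "smooth_fun_on A UNIV h" "smooth_fun_on A UNIV k" using assms(1,2) by (simp_all only: C_infinity_iff)
    show "(\<integral>q. f q * h q \<partial>\<omega>) = (\<integral>q. f q * k q \<partial>\<omega>)" if "f \<in> C_infinity A" "support_in f UNIV" for f
      using assms(3)[of f] that by (simp only: C_infinity_c_iff simp_thms)
  qed simp
qed

end

section \<open>Fibrewise linear algebra\<close>

locale sub_riemannian_space =
  fixes M :: "('a::{second_countable_topology, t2_space}, 'e::euclidean_space,
               'u::real_vector, 'r::euclidean_space) sub_riemannian"
    and \<omega> :: "'a measure"
  assumes sub_riemannian: "sub_riemannian_manifold M"
    and smooth_measure: "smooth_measure M \<omega>"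
begin

lemma parts:
  "smooth_manifold (charts M)" "smooth_vector_bundle (charts M) (fiber M) (trivs M)"
  "euclidean_bundle_metric (charts M) (fiber M) (trivs M) (metric M)"
  "bundle_morphism_to_tangent (charts M) (fiber M) (trivs M) (anchor M)"
proof -
  note * = sub_riemannian[unfolded sub_riemannian_manifold_def]
  show "smooth_manifold (charts M)" using * by (elim conjE)
  show "smooth_vector_bundle (charts M) (fiber M) (trivs M)" using * by (elim conjE)
  show "euclidean_bundle_metric (charts M) (fiber M) (trivs M) (metric M)" using * by (elim conjE)
  show "bundle_morphism_to_tangent (charts M) (fiber M) (trivs M) (anchor M)" using * by (elim conjE)
qed

sublocale measured_manifold "charts M" \<omega>
proof
  show "smooth_manifold (charts M)" by (rule parts)
  show "sets \<omega> = sets borel" using smooth_measure unfolding smooth_measure_def by (rule conjunct1)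
  fix V \<phi> assume c: "(V, \<phi>) \<in> charts M"
  have "\<forall>(V, \<phi>)\<in>charts M. \<exists>\<rho>. smooth_on (\<phi> ` V) \<rho> \<and> (\<forall>x\<in>\<phi> ` V. \<rho> x > 0) \<and>
        (\<forall>B\<in>sets borel. B \<subseteq> V \<longrightarrow> emeasure \<omega> B = (\<integral>\<^sup>+x\<in>\<phi> ` B. ennreal (\<rho> x) \<partial>lborel))"
    using smooth_measure unfolding smooth_measure_def by (rule conjunct2)
  from bspec[OF this c] show "\<exists>\<rho>. smooth_on (\<phi> ` V) \<rho> \<and> (\<forall>x\<in>\<phi> ` V. \<rho> x > 0) \<and>
        (\<forall>B\<in>sets borel. B \<subseteq> V \<longrightarrow> emeasure \<omega> B = (\<integral>\<^sup>+x\<in>\<phi> ` B. ennreal (\<rho> x) \<partial>lborel))"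
    by (simp only: prod.case)
qed

abbreviation "A \<equiv> charts M"
abbreviation "F \<equiv> fiber M"
abbreviation "ip \<equiv> metric M"
abbreviation "\<xi> \<equiv> anchor M"

lemma fiber_subspace: "subspace (F q)"
  using parts(2) unfolding smooth_vector_bundle_def by (elim conjE) (erule spec)

lemma triv_at: obtains V \<tau> where "(V, \<tau>) \<in> trivs M" "q \<in> V"
proof -
  have "(\<Union>(V, \<tau>)\<in>trivs M. V) = UNIV" using parts(2) unfolding smooth_vector_bundle_def by (elim conjE)
  then have "q \<in> (\<Union>(V, \<tau>)\<in>trivs M. V)" by simp
  then show thesis using that by blast
qed

lemma triv:
  assumes "(V, \<tau>) \<in> trivs M"
  shows "open V" "q \<in> V \<Longrightarrow> bij_betw (\<tau> q) (F q) UNIV"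
    "q \<in> V \<Longrightarrow> u \<in> F q \<Longrightarrow> v \<in> F q \<Longrightarrow> \<tau> q (u + v) = \<tau> q u + \<tau> q v"
    "q \<in> V \<Longrightarrow> u \<in> F q \<Longrightarrow> \<tau> q (c *\<^sub>R u) = c *\<^sub>R \<tau> q u"
proof -
  have "\<forall>(V, \<tau>)\<in>trivs M. open V \<and>
        (\<forall>q\<in>V. bij_betw (\<tau> q) (F q) UNIV \<and>
           (\<forall>u\<in>F q. \<forall>v\<in>F q. \<tau> q (u + v) = \<tau> q u + \<tau> q v) \<and>
           (\<forall>u\<in>F q. \<forall>c. \<tau> q (c *\<^sub>R u) = c *\<^sub>R \<tau> q u))"
    using parts(2) unfolding smooth_vector_bundle_def by (elim conjE)
  note * = bspec[OF this assms, simplified]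
  show "open V" using * by (rule conjunct1)
  note * = bspec[OF conjunct2[OF *]]
  show "q \<in> V \<Longrightarrow> bij_betw (\<tau> q) (F q) UNIV" using * by (rule conjunct1)
  show "q \<in> V \<Longrightarrow> u \<in> F q \<Longrightarrow> v \<in> F q \<Longrightarrow> \<tau> q (u + v) = \<tau> q u + \<tau> q v" using * by simp
  show "q \<in> V \<Longrightarrow> u \<in> F q \<Longrightarrow> \<tau> q (c *\<^sub>R u) = c *\<^sub>R \<tau> q u" using * by simp
qed

definition untriv :: "('a \<Rightarrow> 'u \<Rightarrow> 'r) \<Rightarrow> 'a \<Rightarrow> 'r \<Rightarrow> 'u" where
  "untriv \<tau> q = inv_into (F q) (\<tau> q)"

lemma untriv:
  assumes t: "(V, \<tau>) \<in> trivs M" "q \<in> V"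
  shows "untriv \<tau> q r \<in> F q" "\<tau> q (untriv \<tau> q r) = r" "u \<in> F q \<Longrightarrow> untriv \<tau> q (\<tau> q u) = u"
    "linear (untriv \<tau> q)"
proof -
  note b = triv(2)[OF t]
  have r: "r \<in> \<tau> q ` F q" for r using b by (simp add: bij_betw_def)
  show in_F: "untriv \<tau> q r \<in> F q" for r unfolding untriv_def by (rule inv_into_into[OF r])
  show tu: "\<tau> q (untriv \<tau> q r) = r" for r unfolding untriv_def by (rule f_inv_into_f[OF r])
  show ut: "u \<in> F q \<Longrightarrow> untriv \<tau> q (\<tau> q u) = u" for u
    unfolding untriv_def using b by (intro inv_into_f_f) (simp_all add: bij_betw_def)
  show "linear (untriv \<tau> q)"
  proof (rule linearI)
    fix r s
    have "untriv \<tau> q (r + s) = untriv \<tau> q (\<tau> q (untriv \<tau> q r + untriv \<tau> q s))"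
      by (simp add: triv(3)[OF t in_F in_F] tu)
    also have "\<dots> = untriv \<tau> q r + untriv \<tau> q s" by (intro ut subspace_add[OF fiber_subspace] in_F)
    finally show "untriv \<tau> q (r + s) = untriv \<tau> q r + untriv \<tau> q s" .
  next
    fix c r
    have "untriv \<tau> q (c *\<^sub>R r) = untriv \<tau> q (\<tau> q (c *\<^sub>R untriv \<tau> q r))"
      by (simp add: triv(4)[OF t in_F] tu)
    also have "\<dots> = c *\<^sub>R untriv \<tau> q r" by (intro ut subspace_scale[OF fiber_subspace] in_F)
    finally show "untriv \<tau> q (c *\<^sub>R r) = c *\<^sub>R untriv \<tau> q r" .
  qed
qed

lemma ip:
  "u \<in> F q \<Longrightarrow> v \<in> F q \<Longrightarrow> ip q u v = ip q v u"
  "u \<in> F q \<Longrightarrow> v \<in> F q \<Longrightarrow> w \<in> F q \<Longrightarrow> ip q (u + v) w = ip q u w + ip q v w"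
  "u \<in> F q \<Longrightarrow> v \<in> F q \<Longrightarrow> ip q (c *\<^sub>R u) v = c * ip q u v"
  "u \<in> F q \<Longrightarrow> u \<noteq> 0 \<Longrightarrow> ip q u u > 0"
proof -
  note * = parts(3)[unfolded euclidean_bundle_metric_def]
  show "u \<in> F q \<Longrightarrow> v \<in> F q \<Longrightarrow> ip q u v = ip q v u" using * by (elim conjE) simp
  show "u \<in> F q \<Longrightarrow> v \<in> F q \<Longrightarrow> w \<in> F q \<Longrightarrow> ip q (u + v) w = ip q u w + ip q v w"
    using * by (elim conjE) simp
  show "u \<in> F q \<Longrightarrow> v \<in> F q \<Longrightarrow> ip q (c *\<^sub>R u) v = c * ip q u v" using * by (elim conjE) simp
  show "u \<in> F q \<Longrightarrow> u \<noteq> 0 \<Longrightarrow> ip q u u > 0" using * by (elim conjE) simp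
qed

lemma ip_right:
  "u \<in> F q \<Longrightarrow> v \<in> F q \<Longrightarrow> w \<in> F q \<Longrightarrow> ip q w (u + v) = ip q w u + ip q w v"
  "u \<in> F q \<Longrightarrow> v \<in> F q \<Longrightarrow> ip q v (c *\<^sub>R u) = c * ip q v u"
proof -
  assume *: "u \<in> F q" "v \<in> F q"
  show "ip q w (u + v) = ip q w u + ip q w v" if "w \<in> F q"
    using ip(2)[OF * that] ip(1)[OF that *(1)] ip(1)[OF that *(2)] ip(1)[OF that subspace_add[OF fiber_subspace *]] by simp
  show "ip q v (c *\<^sub>R u) = c * ip q v u"
    using ip(3)[OF *, of c] ip(1)[OF *] ip(1)[OF *(2) subspace_scale[OF fiber_subspace *(1)], of c] by simp
qed

lemma ip_smooth:
  "(V, \<tau>) \<in> trivs M \<Longrightarrow> smooth_fun_on A V (\<lambda>q. ip q (untriv \<tau> q r) (untriv \<tau> q s))"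
proof -
  assume t: "(V, \<tau>) \<in> trivs M"
  have "\<forall>(V, \<tau>)\<in>trivs M. \<forall>r s. smooth_fun_on A V
        (\<lambda>q. ip q (inv_into (F q) (\<tau> q) r) (inv_into (F q) (\<tau> q) s))"
    using parts(3) unfolding euclidean_bundle_metric_def by (elim conjE)
  from bspec[OF this t] show ?thesis unfolding untriv_def by simp
qed

lemma anchor:
  "u \<in> F q \<Longrightarrow> \<xi> q u \<in> tangent_space A q"
  "u \<in> F q \<Longrightarrow> v \<in> F q \<Longrightarrow> \<xi> q (u + v) f = \<xi> q u f + \<xi> q v f"
  "u \<in> F q \<Longrightarrow> \<xi> q (c *\<^sub>R u) f = c * \<xi> q u f"
proof -
  note * = parts(4)[unfolded bundle_morphism_to_tangent_def]
  show "u \<in> F q \<Longrightarrow> \<xi> q u \<in> tangent_space A q" using * by (elim conjE) simp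
  show "u \<in> F q \<Longrightarrow> v \<in> F q \<Longrightarrow> \<xi> q (u + v) f = \<xi> q u f + \<xi> q v f" using * by (elim conjE) simp
  show "u \<in> F q \<Longrightarrow> \<xi> q (c *\<^sub>R u) f = c * \<xi> q u f" using * by (elim conjE) simp
qed

lemma anchor_smooth:
  "(V, \<tau>) \<in> trivs M \<Longrightarrow> f \<in> C_infinity A \<Longrightarrow> smooth_fun_on A V (\<lambda>q. \<xi> q (untriv \<tau> q r) f)"
proof -
  assume t: "(V, \<tau>) \<in> trivs M" and f: "f \<in> C_infinity A"
  have "\<forall>(V, \<tau>)\<in>trivs M. \<forall>r. \<forall>f\<in>C_infinity A.
        smooth_fun_on A V (\<lambda>q. \<xi> q (inv_into (F q) (\<tau> q) r) f)"
    using parts(4) unfolding bundle_morphism_to_tangent_def by (elim conjE)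
  from bspec[OF this t] f show ?thesis unfolding untriv_def by simp
qed

lemma anchor_0: "\<xi> q 0 f = 0"
  using anchor(3)[OF subspace_0[OF fiber_subspace], of q 0 f] by simp

lemma anchor_diff:
  assumes "u \<in> F q" "v \<in> F q" shows "\<xi> q (u - v) f = \<xi> q u f - \<xi> q v f"
  using anchor(2)[OF assms(1) subspace_neg[OF fiber_subspace assms(2)], of f] anchor(3)[OF assms(2), of "-1" f] by simp

lemma untriv_expand:
  assumes t: "(V, \<tau>) \<in> trivs M" "q \<in> V"
  shows "\<xi> q (untriv \<tau> q r) f = (\<Sum>b\<in>Basis. (r \<bullet> b) * \<xi> q (untriv \<tau> q b) f)"
    and "ip q (untriv \<tau> q r) (untriv \<tau> q s)
      = (\<Sum>b\<in>Basis. \<Sum>c\<in>Basis. (r \<bullet> b) * (s \<bullet> c) * ip q (untriv \<tau> q b) (untriv \<tau> q c))"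
proof -
  note [simp] = untriv(1)[OF t] linear_add[OF untriv(4)[OF t]] linear_scale[OF untriv(4)[OF t]]
  have l1: "linear (\<lambda>r. \<xi> q (untriv \<tau> q r) f)"
    by (rule linearI) (simp_all add: anchor(2,3))
  have l2: "linear (\<lambda>r. ip q (untriv \<tau> q r) (untriv \<tau> q s))" for s
    by (rule linearI) (simp_all add: ip(2,3))
  have l3: "linear (\<lambda>s. ip q (untriv \<tau> q r) (untriv \<tau> q s))" for r
    by (rule linearI) (simp_all add: ip_right)
  have ex: "l r = (\<Sum>b\<in>Basis. (r \<bullet> b) * l b)" if "linear l" for l :: "'r \<Rightarrow> real" and r
  proof -
    have "l r = l (\<Sum>b\<in>Basis. (r \<bullet> b) *\<^sub>R b)" by (simp add: euclidean_representation)
    also have "\<dots> = (\<Sum>b\<in>Basis. (r \<bullet> b) * l b)" using that by (simp add: linear_sum linear_scale)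
    finally show ?thesis .
  qed
  show "\<xi> q (untriv \<tau> q r) f = (\<Sum>b\<in>Basis. (r \<bullet> b) * \<xi> q (untriv \<tau> q b) f)" by (rule ex[OF l1])
  have "ip q (untriv \<tau> q r) (untriv \<tau> q s) = (\<Sum>b\<in>Basis. (r \<bullet> b) * ip q (untriv \<tau> q b) (untriv \<tau> q s))"
    by (rule ex[OF l2])
  also have "\<dots> = (\<Sum>b\<in>Basis. (r \<bullet> b) * (\<Sum>c\<in>Basis. (s \<bullet> c) * ip q (untriv \<tau> q b) (untriv \<tau> q c)))"
    by (intro sum.cong refl arg_cong[where f="(*) _"] ex[OF l3])
  finally show "ip q (untriv \<tau> q r) (untriv \<tau> q s)
      = (\<Sum>b\<in>Basis. \<Sum>c\<in>Basis. (r \<bullet> b) * (s \<bullet> c) * ip q (untriv \<tau> q b) (untriv \<tau> q c))"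
    by (simp add: sum_distrib_left mult.assoc)
qed

lemma smooth_inner_const:
  "open S \<Longrightarrow> smooth_fun_on A S (r :: 'a \<Rightarrow> 'r) \<Longrightarrow> smooth_fun_on A S (\<lambda>q. r q \<bullet> b)"
  by (rule smooth_fun_on_bounded_linear[OF _ bounded_linear_inner_left])

lemma ip_smooth_gen:
  assumes t: "(V, \<tau>) \<in> trivs M" and r: "smooth_fun_on A V r" "smooth_fun_on A V s"
  shows "smooth_fun_on A V (\<lambda>q. ip q (untriv \<tau> q (r q)) (untriv \<tau> q (s q)))"
proof (rule smooth_fun_on_cong[OF triv(1)[OF t]])
  show "smooth_fun_on A V (\<lambda>q. \<Sum>b\<in>Basis. \<Sum>c\<in>Basis. (r q \<bullet> b) * (s q \<bullet> c) * ip q (untriv \<tau> q b) (untriv \<tau> q c))"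
    by (intro smooth_fun_on_sum smooth_fun_on_mult smooth_inner_const ip_smooth t triv(1)[OF t] r)
qed (rule untriv_expand(2)[OF t, symmetric])

lemma anchor_smooth_gen:
  assumes t: "(V, \<tau>) \<in> trivs M" and r: "smooth_fun_on A V r" and f: "f \<in> C_infinity A"
  shows "smooth_fun_on A V (\<lambda>q. \<xi> q (untriv \<tau> q (r q)) f)"
proof (rule smooth_fun_on_cong[OF triv(1)[OF t]])
  show "smooth_fun_on A V (\<lambda>q. \<Sum>b\<in>Basis. (r q \<bullet> b) * \<xi> q (untriv \<tau> q b) f)"
    by (intro smooth_fun_on_sum smooth_fun_on_mult smooth_inner_const anchor_smooth t triv(1)[OF t] r f)
qed (rule untriv_expand(1)[OF t, symmetric])

text \<open>Gram--Schmidt orthonormalisation with smooth dependence on the base point.\<close>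

lemma Gram_Schmidt_smooth:
  assumes t: "(V, \<tau>) \<in> trivs M" and B: "B \<subseteq> (Basis :: 'r set)"
  shows "\<exists>e :: 'r \<Rightarrow> 'a \<Rightarrow> 'r. \<forall>b\<in>B. smooth_fun_on A V (e b) \<and> (\<forall>q\<in>V. e b q \<in> span B \<and>
    (\<forall>c\<in>B. ip q (untriv \<tau> q (e b q)) (untriv \<tau> q (e c q)) = (if b = c then 1 else 0)))"
  using finite_subset[OF B finite_Basis] B
proof (induction B rule: finite_induct)
  case empty
  show ?case by simp
next
  case (insert b0 B)
  define G where "G = (\<lambda>q r s. ip q (untriv \<tau> q r) (untriv \<tau> q s))"
  from insert obtain e :: "'r \<Rightarrow> 'a \<Rightarrow> 'r" where e: "\<And>b. b \<in> B \<Longrightarrow> smooth_fun_on A V (e b)"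
    "\<And>b q. b \<in> B \<Longrightarrow> q \<in> V \<Longrightarrow> e b q \<in> span B"
    "\<And>b c q. b \<in> B \<Longrightarrow> c \<in> B \<Longrightarrow> q \<in> V \<Longrightarrow> G q (e b q) (e c q) = (if b = c then 1 else 0)"
    unfolding G_def by auto
  have lin: "linear (untriv \<tau> q)" if "q \<in> V" for q using untriv(4)[OF t that] .
  have inF: "untriv \<tau> q r \<in> F q" if "q \<in> V" for q r by (rule untriv(1)[OF t that])
  have Gl: "linear (\<lambda>r. G q r s)" if q: "q \<in> V" for q s
    unfolding G_def by (rule linearI) (simp_all add: linear_add[OF lin[OF q]] linear_scale[OF lin[OF q]] ip(2,3) inF[OF q])
  have Gs: "G q r s = G q s r" if q: "q \<in> V" for q r s
    unfolding G_def by (rule ip(1)[OF inF[OF q] inF[OF q]])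
  have Gpos: "G q r r > 0" if q: "q \<in> V" and r: "r \<noteq> 0" for q r
    unfolding G_def
  proof (rule ip(4)[OF inF[OF q]])
    show "untriv \<tau> q r \<noteq> 0"
    proof
      assume "untriv \<tau> q r = 0"
      then have "untriv \<tau> q r = untriv \<tau> q 0" using linear_0[OF lin[OF q]] by simp
      then have "\<tau> q (untriv \<tau> q r) = \<tau> q (untriv \<tau> q 0)" by simp
      then show False using r by (simp add: untriv(2)[OF t q])
    qed
  qed
  define w where "w = (\<lambda>q. b0 - (\<Sum>b\<in>B. G q b0 (e b q) *\<^sub>R e b q))"
  define e0 where "e0 = (\<lambda>q. inverse (sqrt (G q (w q) (w q))) *\<^sub>R w q)"
  have ms: "(\<Sum>b\<in>B. G q b0 (e b q) *\<^sub>R e b q) \<in> span B" if "q \<in> V" for q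
    by (intro span_sum span_scale e(2) that)
  have perp: "x \<bullet> b0 = 0" if "x \<in> span B" for x
    using that
  proof (induction rule: span_induct_alt)
    case (step c x y)
    then have "x \<in> Basis" "b0 \<in> Basis" "x \<noteq> b0" using insert.hyps insert.prems by auto
    then have "x \<bullet> b0 = 0" by (rule inner_not_same_Basis)
    then show ?case using step by (simp add: inner_add_left)
  qed simp
  have w0: "w q \<noteq> 0" if q: "q \<in> V" for q
  proof
    assume "w q = 0"
    then have "b0 \<in> span B" using ms[OF q] by (simp add: w_def)
    then have "b0 \<bullet> b0 = 0" by (rule perp)
    then show False using insert.prems nonzero_Basis by auto
  qed
  have Gw: "G q (w q) (w q) > 0" if "q \<in> V" for q by (rule Gpos[OF that w0[OF that]])
  have orth: "G q (w q) (e c q) = 0" if q: "q \<in> V" and c: "c \<in> B" for q c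
  proof -
    have "G q (w q) (e c q) = G q b0 (e c q) - (\<Sum>b\<in>B. G q b0 (e b q) * G q (e b q) (e c q))"
      unfolding w_def
      by (simp only: linear_diff[OF Gl[OF q]] linear_sum[OF Gl[OF q]] linear_scale[OF Gl[OF q]] real_scaleR_def)
    also have "(\<Sum>b\<in>B. G q b0 (e b q) * G q (e b q) (e c q)) = (\<Sum>b\<in>B. if b = c then G q b0 (e b q) else 0)"
      by (intro sum.cong refl) (simp add: e(3) c q)
    also have "\<dots> = G q b0 (e c q)" using insert.hyps(1) c by simp
    finally show ?thesis by simp
  qed
  have orth0: "G q (e0 q) (e c q) = 0" if q: "q \<in> V" and c: "c \<in> B" for q c
    unfolding e0_def using linear_scale[OF Gl[OF q]] orth[OF q c] by simp
  have norm0: "G q (e0 q) (e0 q) = 1" if q: "q \<in> V" for q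
  proof -
    have "G q (e0 q) (e0 q) = inverse (sqrt (G q (w q) (w q))) * (inverse (sqrt (G q (w q) (w q))) * G q (w q) (w q))"
      unfolding e0_def using linear_scale[OF Gl[OF q]] Gs[OF q] by simp
    also have "\<dots> = 1" using Gw[OF q] by (simp add: field_simps)
    finally show ?thesis .
  qed
  have oV: "open V" by (rule triv(1)[OF t])
  have sw: "smooth_fun_on A V w"
    unfolding w_def diff_conv_add_uminus G_def
    by (intro smooth_fun_on_add smooth_fun_on_const smooth_fun_on_uminus smooth_fun_on_sum smooth_fun_on_scaleR
        ip_smooth_gen[OF t] e(1) oV)
  have se: "smooth_fun_on A V e0"
    unfolding e0_def
  proof (intro smooth_fun_on_scaleR sw oV smooth_fun_on_inverse smooth_fun_on_sqrt)
    show "smooth_fun_on A V (\<lambda>q. G q (w q) (w q))" unfolding G_def by (rule ip_smooth_gen[OF t sw sw])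
    show "0 < G q (w q) (w q)" if "q \<in> V" for q by (rule Gw[OF that])
    show "0 < sqrt (G q (w q) (w q))" if "q \<in> V" for q using Gw[OF that] by simp
  qed
  have sub: "span B \<subseteq> span (insert b0 B)" by (intro span_mono) auto
  have span0: "e0 q \<in> span (insert b0 B)" if q: "q \<in> V" for q
    unfolding e0_def w_def
    by (rule span_scale, rule span_diff, rule span_base, simp, rule subsetD[OF sub ms[OF q]])
  let ?e = "\<lambda>b. if b = b0 then e0 else e b"
  have nb: "b0 \<notin> B" by (rule insert.hyps)
  show ?case
  proof (rule exI[of _ ?e], intro ballI conjI)
    fix b assume b: "b \<in> insert b0 B"
    show "smooth_fun_on A V (?e b)" using b se e(1) by auto
    fix q assume q: "q \<in> V"
    show "?e b q \<in> span (insert b0 B)" using b span0[OF q] e(2)[OF _ q] sub by auto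
    fix c assume c: "c \<in> insert b0 B"
    have "G q (?e b q) (?e c q) = (if b = c then 1 else 0)"
      using b c nb norm0[OF q] orth0[OF q] e(3)[OF _ _ q] Gs[OF q, of "e b q" "e0 q"] by auto
    then show "ip q (untriv \<tau> q (?e b q)) (untriv \<tau> q (?e c q)) = (if b = c then 1 else 0)" by (simp add: G_def)
  qed
qed

lemma orthonormal_frame:
  assumes t: "(V, \<tau>) \<in> trivs M"
  obtains e :: "'r \<Rightarrow> 'a \<Rightarrow> 'r" where "\<And>b. b \<in> Basis \<Longrightarrow> smooth_fun_on A V (e b)"
    "\<And>q r s. q \<in> V \<Longrightarrow> ip q (untriv \<tau> q (\<Sum>b\<in>Basis. (r \<bullet> b) *\<^sub>R e b q)) (untriv \<tau> q (\<Sum>b\<in>Basis. (s \<bullet> b) *\<^sub>R e b q)) = r \<bullet> s"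
    "\<And>q. q \<in> V \<Longrightarrow> (\<lambda>r. untriv \<tau> q (\<Sum>b\<in>Basis. (r \<bullet> b) *\<^sub>R e b q)) ` UNIV = F q"
    "\<And>q. q \<in> V \<Longrightarrow> linear (\<lambda>r. untriv \<tau> q (\<Sum>b\<in>Basis. (r \<bullet> b) *\<^sub>R e b q))"
proof -
  obtain e :: "'r \<Rightarrow> 'a \<Rightarrow> 'r" where e: "\<forall>b\<in>Basis. smooth_fun_on A V (e b) \<and> (\<forall>q\<in>V. e b q \<in> span Basis \<and>
    (\<forall>c\<in>Basis. ip q (untriv \<tau> q (e b q)) (untriv \<tau> q (e c q)) = (if b = c then 1 else 0)))"
    using Gram_Schmidt_smooth[OF t order_refl] by (elim exE)
  let ?m = "\<lambda>q r. \<Sum>b\<in>Basis. (r \<bullet> b) *\<^sub>R e b q"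
  have lm: "linear (?m q)" for q
    by (rule linearI) (simp_all add: inner_add_left scaleR_add_left sum.distrib scaleR_sum_right)
  have lin: "linear (untriv \<tau> q)" if "q \<in> V" for q using untriv(4)[OF t that] .
  have inF: "untriv \<tau> q r \<in> F q" if "q \<in> V" for q r by (rule untriv(1)[OF t that])
  have iso: "ip q (untriv \<tau> q (?m q r)) (untriv \<tau> q (?m q s)) = r \<bullet> s" if q: "q \<in> V" for q r s
  proof -
    let ?G = "\<lambda>r s. ip q (untriv \<tau> q r) (untriv \<tau> q s)"
    have Gl: "linear (\<lambda>r. ?G r s)" for s
      by (rule linearI) (simp_all add: linear_add[OF lin[OF q]] linear_scale[OF lin[OF q]] ip(2,3) inF[OF q])
    have Gr: "linear (\<lambda>s. ?G r s)" for r
      by (rule linearI) (simp_all add: linear_add[OF lin[OF q]] linear_scale[OF lin[OF q]] ip_right inF[OF q])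
    have "?G (?m q r) (?m q s) = (\<Sum>b\<in>Basis. (r \<bullet> b) * ?G (e b q) (?m q s))"
      by (simp only: linear_sum[OF Gl] linear_scale[OF Gl] real_scaleR_def)
    also have "\<dots> = (\<Sum>b\<in>Basis. (r \<bullet> b) * (\<Sum>c\<in>Basis. (s \<bullet> c) * ?G (e b q) (e c q)))"
      by (intro sum.cong refl arg_cong[where f="(*) _"]) (simp only: linear_sum[OF Gr] linear_scale[OF Gr] real_scaleR_def)
    also have "\<dots> = (\<Sum>b\<in>Basis. (r \<bullet> b) * (\<Sum>c\<in>Basis. if b = c then s \<bullet> c else 0))"
      by (intro sum.cong refl arg_cong[where f="(*) _"]) (use e q in simp)
    also have "\<dots> = (\<Sum>b\<in>Basis. (r \<bullet> b) * (s \<bullet> b))" by (intro sum.cong refl) simp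
    also have "\<dots> = r \<bullet> s" by (rule euclidean_inner[symmetric])
    finally show ?thesis .
  qed
  show thesis
  proof (rule that[of e])
    show "smooth_fun_on A V (e b)" if "b \<in> Basis" for b using e that by blast
    show "ip q (untriv \<tau> q (?m q r)) (untriv \<tau> q (?m q s)) = r \<bullet> s" if "q \<in> V" for q r s by (rule iso[OF that])
    show lE: "linear (\<lambda>r. untriv \<tau> q (?m q r))" if "q \<in> V" for q
      using linear_compose[OF lm lin[OF that]] by (simp add: o_def)
    show "(\<lambda>r. untriv \<tau> q (?m q r)) ` UNIV = F q" if q: "q \<in> V" for q
    proof
      show "(\<lambda>r. untriv \<tau> q (?m q r)) ` UNIV \<subseteq> F q" using inF[OF q] by blast
      have "inj (?m q)"
        unfolding linear_injective_0[OF lm]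
      proof (intro allI impI)
        fix r assume "?m q r = 0"
        then have "r \<bullet> r = ip q (untriv \<tau> q 0) (untriv \<tau> q (?m q r))" using iso[OF q, of r r] by simp
        also have "\<dots> = 0"
          using ip(3)[OF inF[OF q, of 0] inF[OF q, of "?m q r"], of 0] linear_0[OF lin[OF q]] by simp
        finally show "r = 0" by simp
      qed
      then have "surj (?m q)" using lm linear_injective_imp_surjective by blast
      show "F q \<subseteq> (\<lambda>r. untriv \<tau> q (?m q r)) ` UNIV"
      proof
        fix u assume u: "u \<in> F q"
        obtain r where "\<tau> q u = ?m q r" using \<open>surj (?m q)\<close> by (rule surjE)
        then have "u = untriv \<tau> q (?m q r)" using untriv(3)[OF t q u] by simp
        then show "u \<in> (\<lambda>r. untriv \<tau> q (?m q r)) ` UNIV" by blast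
      qed
    qed
  qed
qed

lemma fiber_isometry:
  obtains E :: "'r \<Rightarrow> 'u" where "linear E" "range E = F q" "\<forall>r s. ip q (E r) (E s) = r \<bullet> s"
proof -
  obtain V \<tau> where t: "(V, \<tau>) \<in> trivs M" "q \<in> V" by (rule triv_at)
  show thesis
  proof (rule orthonormal_frame[OF t(1)])
    fix e :: "'r \<Rightarrow> 'a \<Rightarrow> 'r"
    assume "\<And>q r s. q \<in> V \<Longrightarrow> ip q (untriv \<tau> q (\<Sum>b\<in>Basis. (r \<bullet> b) *\<^sub>R e b q)) (untriv \<tau> q (\<Sum>b\<in>Basis. (s \<bullet> b) *\<^sub>R e b q)) = r \<bullet> s"
      "\<And>q. q \<in> V \<Longrightarrow> (\<lambda>r. untriv \<tau> q (\<Sum>b\<in>Basis. (r \<bullet> b) *\<^sub>R e b q)) ` UNIV = F q"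
      "\<And>q. q \<in> V \<Longrightarrow> linear (\<lambda>r. untriv \<tau> q (\<Sum>b\<in>Basis. (r \<bullet> b) *\<^sub>R e b q))"
    then show thesis by (intro that[of "\<lambda>r. untriv \<tau> q (\<Sum>b\<in>Basis. (r \<bullet> b) *\<^sub>R e b q)"]) (simp_all add: t(2))
  qed
qed

text \<open>A fibre vector is minimal if it is orthogonal to the kernel of the anchor, that is, if it is
  the shortest lift of its image.\<close>

definition minimal :: "'a \<Rightarrow> 'u \<Rightarrow> bool" where
  "minimal q u \<longleftrightarrow> u \<in> F q \<and> (\<forall>k\<in>F q. (\<forall>f. \<xi> q k f = 0) \<longrightarrow> ip q u k = 0)"

lemma ip_nonneg: "u \<in> F q \<Longrightarrow> 0 \<le> ip q u u"
proof (cases "u = 0")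
  case True
  assume "u \<in> F q"
  then show ?thesis using ip(3)[of u q u 0] True by simp
qed (use ip(4) less_imp_le in blast)

lemma ip_square_add:
  assumes "u \<in> F q" "v \<in> F q"
  shows "ip q (u + v) (u + v) = ip q u u + 2 * ip q u v + ip q v v"
  using assms by (simp add: ip(2) ip_right subspace_add[OF fiber_subspace] ip(1)[of v q u])

lemma ip_square_diff:
  assumes u: "u \<in> F q" and v: "v \<in> F q"
  shows "ip q (u - v) (u - v) = ip q u u - 2 * ip q u v + ip q v v"
proof -
  have nF: "(-1) *\<^sub>R v \<in> F q" by (rule subspace_scale[OF fiber_subspace v])
  have e: "u - v = u + (-1) *\<^sub>R v" by simp
  show ?thesis
    unfolding e ip_square_add[OF u nF]
    by (simp only: ip(3)[OF v nF] ip_right(2)[OF v v] ip_right(2)[OF v u])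
qed

lemma minimal_diff: "minimal q u \<Longrightarrow> minimal q v \<Longrightarrow> minimal q (u - v)"
  unfolding minimal_def
proof (elim conjE, intro conjI ballI impI)
  assume u: "u \<in> F q" "v \<in> F q" and *: "\<forall>k\<in>F q. (\<forall>f. \<xi> q k f = 0) \<longrightarrow> ip q u k = 0"
    "\<forall>k\<in>F q. (\<forall>f. \<xi> q k f = 0) \<longrightarrow> ip q v k = 0"
  show "u - v \<in> F q" by (rule subspace_diff[OF fiber_subspace u])
  fix k assume k: "k \<in> F q" "\<forall>f. \<xi> q k f = 0"
  have "ip q (u + (-1) *\<^sub>R v) k = ip q u k + (-1) * ip q v k"
    using ip(2)[OF u(1) subspace_scale[OF fiber_subspace u(2)] k(1), of "-1"] ip(3)[OF u(2) k(1), of "-1"] by simp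
  then show "ip q (u - v) k = 0" using * k by simp
qed

lemma minimal_add: "minimal q u \<Longrightarrow> minimal q v \<Longrightarrow> minimal q (u + v)"
  unfolding minimal_def
proof (elim conjE, intro conjI ballI impI)
  assume u: "u \<in> F q" "v \<in> F q" and *: "\<forall>k\<in>F q. (\<forall>f. \<xi> q k f = 0) \<longrightarrow> ip q u k = 0"
    "\<forall>k\<in>F q. (\<forall>f. \<xi> q k f = 0) \<longrightarrow> ip q v k = 0"
  show "u + v \<in> F q" by (rule subspace_add[OF fiber_subspace u])
  fix k assume k: "k \<in> F q" "\<forall>f. \<xi> q k f = 0"
  show "ip q (u + v) k = 0" using ip(2)[OF u k(1)] * k by simp
qed

text \<open>The component orthogonal to the kernel of the anchor.\<close>

lemma minimal_lift:
  assumes v: "v \<in> F q"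
  obtains u where "minimal q u" "\<xi> q u = \<xi> q v"
proof -
  obtain E :: "'r \<Rightarrow> 'u" where E: "linear E" "range E = F q" "\<forall>r s. ip q (E r) (E s) = r \<bullet> s" by (rule fiber_isometry)
  have EF: "E r \<in> F q" for r using E(2) by blast
  define K where "K = {r. \<forall>f. \<xi> q (E r) f = 0}"
  have "subspace K"
    unfolding subspace_def K_def
    by (auto simp: linear_0[OF E(1)] linear_add[OF E(1)] linear_scale[OF E(1)] anchor_0 anchor(2,3) EF)
  then have sK: "span K = K" by (simp add: span_eq_iff)
  obtain r where r: "v = E r" using v E(2) by blast
  obtain y z where yz: "y \<in> span K" "\<And>w. w \<in> span K \<Longrightarrow> orthogonal z w" "r = y + z"
    using orthogonal_subspace_decomp_exists[of K r] by metis
  show thesis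
  proof (rule that[of "E z"])
    show "minimal q (E z)"
      unfolding minimal_def
    proof (intro conjI ballI impI EF)
      fix k assume k: "k \<in> F q" "\<forall>f. \<xi> q k f = 0"
      then obtain s where "k = E s" using E(2) by blast
      then show "ip q (E z) k = 0" using k(2) yz(2)[of s] E(3) unfolding sK by (simp add: K_def orthogonal_def)
    qed
    show "\<xi> q (E z) = \<xi> q v"
      using yz(1) unfolding r yz(3) sK by (intro ext) (simp add: linear_add[OF E(1)] anchor(2) EF K_def)
  qed
qed

lemma sr_norm_sq_minimal:
  assumes u: "minimal q u" shows "sr_norm_sq M q (\<xi> q u) = ip q u u"
  unfolding sr_norm_sq_def
proof (rule cInf_eq_minimum)
  have uF: "u \<in> F q" using u by (simp add: minimal_def)
  then show "ip q u u \<in> {ip q w w |w. w \<in> F q \<and> \<xi> q w = \<xi> q u}" by blast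
  fix x assume "x \<in> {ip q w w |w. w \<in> F q \<and> \<xi> q w = \<xi> q u}"
  then obtain w where w: "w \<in> F q" "\<xi> q w = \<xi> q u" "x = ip q w w" by blast
  have d: "w - u \<in> F q" by (rule subspace_diff[OF fiber_subspace w(1) uF])
  have "ip q u (w - u) = 0"
    using u d anchor_diff[OF w(1) uF] w(2) by (simp add: minimal_def)
  then have "ip q w w = ip q u u + ip q (w - u) (w - u)" using ip_square_add[OF uF d] by simp
  then show "ip q u u \<le> x" using w(3) ip_nonneg[OF d] by simp
qed

text \<open>By orthogonality the norm of \<open>\<xi> q u\<close> is attained at a minimal \<open>u\<close>, and minimal vectors form a
  linear space; polarisation then gives the scalar product. Replacing \<open>w\<close> by its minimal
  representative changes it by an element of the kernel, to which \<open>u\<close> is orthogonal.\<close>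

lemma sr_inner_minimal:
  assumes u: "minimal q u" and w: "w \<in> F q"
  shows "sr_inner M q (\<xi> q u) (\<xi> q w) = ip q u w"
proof -
  obtain z where z: "minimal q z" "\<xi> q z = \<xi> q w" by (rule minimal_lift[OF w])
  have F: "u \<in> F q" "z \<in> F q" using u z by (auto simp: minimal_def)
  have "(\<lambda>f. \<xi> q u f + \<xi> q w f) = \<xi> q (u + z)" "(\<lambda>f. \<xi> q u f - \<xi> q w f) = \<xi> q (u - z)"
    unfolding z(2)[symmetric] by (rule ext, simp add: anchor(2)[OF F] anchor_diff[OF F])+
  then have "sr_inner M q (\<xi> q u) (\<xi> q w) = (ip q (u + z) (u + z) - ip q (u - z) (u - z)) / 4"
    unfolding sr_inner_def by (simp only: sr_norm_sq_minimal[OF minimal_add[OF u z(1)]] sr_norm_sq_minimal[OF minimal_diff[OF u z(1)]])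
  also have "ip q (u - z) (u - z) = ip q u u - 2 * ip q u z + ip q z z"
    by (rule ip_square_diff[OF F])
  finally have "sr_inner M q (\<xi> q u) (\<xi> q w) = ip q u z" using ip_square_add[OF F] by simp
  also have "ip q u z = ip q u w"
  proof -
    have d: "w - z \<in> F q" by (rule subspace_diff[OF fiber_subspace w F(2)])
    have "ip q u (w - z) = 0" using u d anchor_diff[OF w F(2)] z(2) by (simp add: minimal_def)
    then show ?thesis using ip_right(1)[OF F(2) d F(1)] by simp
  qed
  finally show ?thesis .
qed

text \<open>The Riesz representative of \<open>u \<mapsto> \<xi> u f\<close>: the lift of the horizontal gradient.\<close>

lemma lift_exists: "\<exists>!u. u \<in> F q \<and> (\<forall>k\<in>F q. ip q u k = \<xi> q k f)"
proof -
  obtain E :: "'r \<Rightarrow> 'u" where E: "linear E" "range E = F q" "\<forall>r s. ip q (E r) (E s) = r \<bullet> s" by (rule fiber_isometry)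
  have EF: "E r \<in> F q" for r using E(2) by blast
  have l: "linear (\<lambda>r. \<xi> q (E r) f)"
    by (rule linearI) (simp_all add: linear_add[OF E(1)] linear_scale[OF E(1)] anchor(2,3) EF)
  define a where "a = (\<Sum>b\<in>Basis. \<xi> q (E b) f *\<^sub>R b)"
  have a: "a \<bullet> r = \<xi> q (E r) f" for r
  proof -
    have "\<xi> q (E r) f = \<xi> q (E (\<Sum>b\<in>Basis. (r \<bullet> b) *\<^sub>R b)) f" by (simp add: euclidean_representation)
    also have "\<dots> = (\<Sum>b\<in>Basis. (r \<bullet> b) * \<xi> q (E b) f)" by (simp only: linear_sum[OF l] linear_scale[OF l] real_scaleR_def)
    also have "\<dots> = (\<Sum>b\<in>Basis. \<xi> q (E b) f * (b \<bullet> r))"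
      by (intro sum.cong refl) (simp only: inner_commute[of r] mult.commute)
    also have "\<dots> = a \<bullet> r" by (simp only: a_def inner_sum_left inner_scaleR_left)
    finally show ?thesis by simp
  qed
  show ?thesis
  proof (rule ex1I[of _ "E a"], intro conjI ballI EF)
    show "ip q (E a) k = \<xi> q k f" if k: "k \<in> F q" for k
    proof -
      obtain r where "k = E r" using k E(2) by blast
      then show ?thesis using E(3) a by simp
    qed
    fix u assume u: "u \<in> F q \<and> (\<forall>k\<in>F q. ip q u k = \<xi> q k f)"
    then obtain s where s: "u = E s" using E(2) by blast
    have "s \<bullet> r = a \<bullet> r" for r using u s E(3) a EF by metis
    then have "s = a" by (metis vector_eq_rdot)
    then show "u = E a" using s by simp
  qed
qed

definition lift :: "('a \<Rightarrow> real) \<Rightarrow> 'a \<Rightarrow> 'u" where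
  "lift f q = (THE u. u \<in> F q \<and> (\<forall>k\<in>F q. ip q u k = \<xi> q k f))"

lemma lift: "lift f q \<in> F q" "k \<in> F q \<Longrightarrow> ip q (lift f q) k = \<xi> q k f"
  using theI'[OF lift_exists[of q f]] unfolding lift_def by blast+

lemma lift_unique: "u \<in> F q \<Longrightarrow> (\<And>k. k \<in> F q \<Longrightarrow> ip q u k = \<xi> q k f) \<Longrightarrow> lift f q = u"
  using lift_exists[of q f] lift(1)[of f q] lift(2)[of _ q f] by blast

lemma lift_minimal: "minimal q (lift f q)"
  unfolding minimal_def using lift by simp

lemma lift_section:
  fixes f :: "'a \<Rightarrow> real"
  assumes f: "f \<in> C_infinity A" shows "lift f \<in> bundle_sections M"
  unfolding bundle_sections_def mem_Collect_eq
proof (intro conjI allI ballI)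
  show "lift f q \<in> F q" for q by (rule lift)
  fix p assume "p \<in> trivs M"
  then obtain V \<tau> where p: "p = (V, \<tau>)" and t: "(V, \<tau>) \<in> trivs M" by (cases p) blast
  have "smooth_fun_on A V (\<lambda>q. \<tau> q (lift f q))"
  proof (rule orthonormal_frame[OF t])
    fix e :: "'r \<Rightarrow> 'a \<Rightarrow> 'r"
    assume e: "\<And>b. b \<in> Basis \<Longrightarrow> smooth_fun_on A V (e b)"
      "\<And>q r s. q \<in> V \<Longrightarrow> ip q (untriv \<tau> q (\<Sum>b\<in>Basis. (r \<bullet> b) *\<^sub>R e b q)) (untriv \<tau> q (\<Sum>b\<in>Basis. (s \<bullet> b) *\<^sub>R e b q)) = r \<bullet> s"
      "\<And>q. q \<in> V \<Longrightarrow> (\<lambda>r. untriv \<tau> q (\<Sum>b\<in>Basis. (r \<bullet> b) *\<^sub>R e b q)) ` UNIV = F q"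
      "\<And>q. q \<in> V \<Longrightarrow> linear (\<lambda>r. untriv \<tau> q (\<Sum>b\<in>Basis. (r \<bullet> b) *\<^sub>R e b q))"
    let ?a = "\<lambda>q. \<Sum>b\<in>Basis. \<xi> q (untriv \<tau> q (e b q)) f *\<^sub>R b"
    let ?E = "\<lambda>q r. untriv \<tau> q (\<Sum>b\<in>Basis. (r \<bullet> b) *\<^sub>R e b q)"
    have Eb: "?E q b = untriv \<tau> q (e b q)" if "b \<in> Basis" for q b
    proof -
      have "(\<Sum>c\<in>Basis. (b \<bullet> c) *\<^sub>R e c q) = (\<Sum>c\<in>Basis. if c = b then e c q else 0)"
        by (intro sum.cong refl) (use that in \<open>simp add: inner_Basis\<close>)
      then show ?thesis using that by simp
    qed
    have lift_eq: "lift f q = ?E q (?a q)" if q: "q \<in> V" for q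
    proof (rule lift_unique)
      show "?E q (?a q) \<in> F q" using e(3)[OF q] by blast
      fix k assume "k \<in> F q"
      then obtain r where r: "k = ?E q r" using e(3)[OF q] by blast
      have l: "linear (\<lambda>r. \<xi> q (?E q r) f)"
        by (rule linearI) (simp_all only: linear_add[OF e(4)[OF q]] linear_scale[OF e(4)[OF q]] anchor(2,3) untriv(1)[OF t q] real_scaleR_def)
      have "\<xi> q k f = \<xi> q (?E q (\<Sum>b\<in>Basis. (r \<bullet> b) *\<^sub>R b)) f" unfolding r by (simp only: euclidean_representation)
      also have "\<dots> = (\<Sum>b\<in>Basis. (r \<bullet> b) * \<xi> q (?E q b) f)"
        by (simp only: linear_sum[OF l] linear_scale[OF l] real_scaleR_def)
      also have "\<dots> = (\<Sum>b\<in>Basis. \<xi> q (untriv \<tau> q (e b q)) f * (b \<bullet> r))"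
        by (intro sum.cong refl) (simp only: Eb inner_commute[of r] mult.commute)
      also have "\<dots> = ?a q \<bullet> r" by (simp only: inner_sum_left inner_scaleR_left)
      also have "\<dots> = ip q (?E q (?a q)) k" unfolding r by (rule e(2)[OF q, symmetric])
      finally show "ip q (?E q (?a q)) k = \<xi> q k f" by simp
    qed
    show "smooth_fun_on A V (\<lambda>q. \<tau> q (lift f q))"
    proof (rule smooth_fun_on_cong[OF triv(1)[OF t]])
      show "smooth_fun_on A V (\<lambda>q. \<Sum>b\<in>Basis. \<xi> q (untriv \<tau> q (e b q)) f *\<^sub>R e b q)"
        by (intro smooth_fun_on_sum smooth_fun_on_scaleR anchor_smooth_gen[OF t _ f] e(1) triv(1)[OF t])
      show "(\<Sum>b\<in>Basis. \<xi> q (untriv \<tau> q (e b q)) f *\<^sub>R e b q) = \<tau> q (lift f q)" if q: "q \<in> V" for q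
        unfolding lift_eq[OF q] untriv(2)[OF t q] by (intro sum.cong refl) simp
    qed
  qed
  then show "case p of (V, \<tau>) \<Rightarrow> smooth_fun_on A V (\<lambda>q. \<tau> q (lift f q))" by (simp add: p)
qed

lemma section_in_fiber: "s \<in> bundle_sections M \<Longrightarrow> s q \<in> F q"
  unfolding bundle_sections_def by blast

lemma section_anchor_smooth:
  assumes s: "s \<in> bundle_sections M" shows "smooth_field (\<lambda>q. \<xi> q (s q))"
  unfolding smooth_field_def
proof (intro conjI allI ballI)
  show "\<xi> q (s q) \<in> tangent_space A q" for q by (rule anchor(1)[OF section_in_fiber[OF s]])
  fix f :: "'a \<Rightarrow> real" assume f: "f \<in> C_infinity A"
  show "(\<lambda>q. \<xi> q (s q) f) \<in> C_infinity A"
    unfolding C_infinity_iff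
  proof (rule smooth_fun_on_local)
    fix q
    obtain V \<tau> where t: "(V, \<tau>) \<in> trivs M" "q \<in> V" by (rule triv_at)
    have "\<forall>(V, \<tau>)\<in>trivs M. smooth_fun_on A V (\<lambda>q. \<tau> q (s q))" using s unfolding bundle_sections_def by blast
    from bspec[OF this t(1)] have "smooth_fun_on A V (\<lambda>q. \<tau> q (s q))" by simp
    from anchor_smooth_gen[OF t(1) this f] have "smooth_fun_on A V (\<lambda>q. \<xi> q (s q) f)"
      by (rule smooth_fun_on_cong[OF triv(1)[OF t(1)], rotated]) (simp add: untriv(3)[OF t(1)] section_in_fiber[OF s])
    then show "\<exists>T. open T \<and> q \<in> T \<and> smooth_fun_on A T (\<lambda>q. \<xi> q (s q) f)"
      by (intro exI[of _ V] conjI triv(1)[OF t(1)] t(2))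
  qed
qed

lemma horizontal_fieldE:
  assumes "W \<in> horizontal_fields M"
  obtains s where "s \<in> bundle_sections M" "W = (\<lambda>q. \<xi> q (s q))"
  using assms unfolding horizontal_fields_def by blast

lemma horizontal_smooth: "W \<in> horizontal_fields M \<Longrightarrow> smooth_field W"
  by (erule horizontal_fieldE) (simp add: section_anchor_smooth)

definition grad :: "('a \<Rightarrow> real) \<Rightarrow> 'a vfield" where "grad f q = \<xi> q (lift f q)"

lemma grad_horizontal: "f \<in> C_infinity A \<Longrightarrow> grad f \<in> horizontal_fields M"
  unfolding horizontal_fields_def grad_def[abs_def] using lift_section by blast

lemma grad_inner: "w \<in> F q \<Longrightarrow> sr_inner M q (grad f q) (\<xi> q w) = \<xi> q w f"
  unfolding grad_def by (simp add: sr_inner_minimal[OF lift_minimal] lift(2))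

text \<open>Uniqueness: a competitor \<open>Z\<close> is tested with itself and with \<open>grad f\<close>, which shows that its minimal
  lift is at distance zero from \<open>lift f\<close>.\<close>

lemma horizontal_gradient_eq:
  fixes f :: "'a \<Rightarrow> real"
  assumes f: "f \<in> C_infinity A" shows "horizontal_gradient M f = grad f"
  unfolding horizontal_gradient_def
proof (rule the_equality, intro conjI ballI allI grad_horizontal[OF f])
  fix W q assume "W \<in> horizontal_fields M"
  then obtain s where s: "s \<in> bundle_sections M" "W = (\<lambda>q. \<xi> q (s q))" by (rule horizontal_fieldE)
  show "sr_inner M q (grad f q) (W q) = W q f" unfolding s(2) by (rule grad_inner[OF section_in_fiber[OF s(1)]])
next
  fix Z assume Z: "Z \<in> horizontal_fields M \<and> (\<forall>W\<in>horizontal_fields M. \<forall>q. sr_inner M q (Z q) (W q) = W q f)"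
  then obtain s where s: "s \<in> bundle_sections M" "Z = (\<lambda>q. \<xi> q (s q))" using horizontal_fieldE by blast
  show "Z = grad f"
  proof
    fix q
    obtain u where u: "minimal q u" "\<xi> q u = \<xi> q (s q)" by (rule minimal_lift[OF section_in_fiber[OF s(1)]])
    have Zq: "Z q = \<xi> q u" using u(2) s(2) by simp
    have uF: "u \<in> F q" using u by (simp add: minimal_def)
    let ?l = "lift f q"
    have lF: "?l \<in> F q" by (rule lift)
    have 1: "ip q u u = ip q ?l u"
    proof -
      have "ip q u u = sr_inner M q (Z q) (Z q)" unfolding Zq by (rule sr_inner_minimal[OF u(1) uF, symmetric])
      also have "\<dots> = Z q f" using Z by blast
      also have "\<dots> = ip q ?l u" unfolding Zq by (rule lift(2)[OF uF, symmetric])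
      finally show ?thesis .
    qed
    have 2: "ip q u ?l = ip q ?l ?l"
    proof -
      have "ip q u ?l = sr_inner M q (Z q) (grad f q)" unfolding Zq grad_def by (rule sr_inner_minimal[OF u(1) lF, symmetric])
      also have "\<dots> = grad f q f" using Z grad_horizontal[OF f] by blast
      also have "\<dots> = ip q ?l ?l" unfolding grad_def by (rule lift(2)[OF lF, symmetric])
      finally show ?thesis .
    qed
    have "ip q (u - ?l) (u - ?l) = 0"
      unfolding ip_square_diff[OF uF lF] using 1 2 ip(1)[OF uF lF] by simp
    moreover have "ip q (u - ?l) (u - ?l) > 0" if "u - ?l \<noteq> 0"
      by (rule ip(4)[OF subspace_diff[OF fiber_subspace uF lF] that])
    ultimately have "u - ?l = 0" by (metis less_irrefl)
    then have "u = ?l" by simp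
    then show "Z q = grad f q" unfolding Zq grad_def by simp
  qed
qed

lemma divergence_props:
  assumes X: "smooth_field X"
  shows "divergence M \<omega> X \<in> C_infinity A"
    "\<And>f. f \<in> C_infinity_c A \<Longrightarrow> (\<integral>q. f q * divergence M \<omega> X q \<partial>\<omega>) = - (\<integral>q. X q f \<partial>\<omega>)"
    "\<And>V \<phi> q. (V, \<phi>) \<in> A \<Longrightarrow> q \<in> V \<Longrightarrow> divergence M \<omega> X q = local_div V \<phi> X (\<phi> q)"
proof -
  have *: "divergence M \<omega> X \<in> C_infinity A \<and>
    (\<forall>f\<in>C_infinity_c A. (\<integral>q. f q * divergence M \<omega> X q \<partial>\<omega>) = - (\<integral>q. X q f \<partial>\<omega>)) \<and>
    (\<forall>V \<phi> q. (V, \<phi>) \<in> A \<longrightarrow> q \<in> V \<longrightarrow> divergence M \<omega> X q = local_div V \<phi> X (\<phi> q))"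
  proof (rule divergence_exists[OF X])
    fix h assume h: "h \<in> C_infinity A"
      "\<And>f. f \<in> C_infinity_c A \<Longrightarrow> (\<integral>q. f q * h q \<partial>\<omega>) = - (\<integral>q. X q f \<partial>\<omega>)"
      "\<And>V \<phi> q. (V, \<phi>) \<in> A \<Longrightarrow> q \<in> V \<Longrightarrow> h q = local_div V \<phi> X (\<phi> q)"
    have "divergence M \<omega> X = h"
      unfolding divergence_def
    proof (rule the_equality, intro conjI ballI h)
      fix k assume k: "k \<in> C_infinity A \<and> (\<forall>f\<in>C_infinity_c A. (\<integral>q. f q * k q \<partial>\<omega>) = - (\<integral>q. X q f \<partial>\<omega>))"
      show "k = h"
      proof (rule divergence_unique[OF _ h(1)])
        show "(\<integral>q. f q * k q \<partial>\<omega>) = (\<integral>q. f q * h q \<partial>\<omega>)" if "f \<in> C_infinity_c A" for f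
          using k that h(2)[OF that] by simp
      qed (use k in simp)
    qed
    with h show ?thesis by (simp only: simp_thms) blast
  qed
  show "divergence M \<omega> X \<in> C_infinity A" using * by (rule conjunct1)
  show "(\<integral>q. f q * divergence M \<omega> X q \<partial>\<omega>) = - (\<integral>q. X q f \<partial>\<omega>)" if "f \<in> C_infinity_c A" for f
    using * that by (elim conjE) (erule bspec)
  show "divergence M \<omega> X q = local_div V \<phi> X (\<phi> q)" if "(V, \<phi>) \<in> A" "q \<in> V" for V \<phi> q
    using * that by (elim conjE) simp
qed

end

context sub_riemannian_space
begin

section \<open>The energy density\<close>

text \<open>The divergence is determined on an open set by integrals against functions supported in it.\<close>

lemma divergence_support:
  assumes X: "smooth_field X" and K: "closed K" "\<And>q f. q \<notin> K \<Longrightarrow> X q f = 0" and q: "q \<notin> K"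
  shows "divergence M \<omega> X q = 0"
proof (rule fundamental_lemma[where N="- K" and k="\<lambda>_. 0" and h="divergence M \<omega> X"])
  show o: "open (- K)" using K(1) by (rule open_Compl)
  show "smooth_fun_on A (- K) (divergence M \<omega> X)"
    by (rule C_infinity_smooth_fun_on[OF divergence_props(1)[OF X]])
  show "smooth_fun_on A (- K) (\<lambda>_. 0 :: real)" by (rule smooth_fun_on_const[OF o])
  fix g :: "'a \<Rightarrow> real" assume g: "g \<in> C_infinity A" "support_in g (- K)"
  obtain L where L: "compact L" "L \<subseteq> - K" "\<forall>q. q \<notin> L \<longrightarrow> g q = 0" using g(2) unfolding support_in_def by blast
  have "X p g = 0" for p
  proof (cases "p \<in> K")
    case True
    show ?thesis
      by (rule tangent_local[OF smooth_fieldD(1)[OF X] g(1) open_Compl[OF compact_imp_closed[OF L(1)]]]) (use L True in auto)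
  qed (rule K(2))
  then have "(\<integral>q. g q * divergence M \<omega> X q \<partial>\<omega>) = 0"
    using divergence_props(2)[OF X, of g] g(1) support_in_mono[OF g(2) subset_UNIV]
    by (simp add: C_infinity_c_iff)
  then show "(\<integral>q. g q * divergence M \<omega> X q \<partial>\<omega>) = (\<integral>q. g q * 0 \<partial>\<omega>)" by simp
qed (use q in simp)

text \<open>The carre du champ \<open>g(\<nabla>f, \<nabla>k)\<close>, computed in the fibre.\<close>

definition Gam :: "('a \<Rightarrow> real) \<Rightarrow> ('a \<Rightarrow> real) \<Rightarrow> 'a \<Rightarrow> real" where
  "Gam f k q = ip q (lift f q) (lift k q)"

lemma Gam_grad: "Gam f k q = grad f q k"
  unfolding Gam_def grad_def using ip(1)[OF lift(1) lift(1)] lift(2)[OF lift(1)] by simp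

lemma Gam_sym: "Gam f k q = Gam k f q"
  unfolding Gam_def by (rule ip(1)[OF lift(1) lift(1)])

lemma Gam_nonneg: "0 \<le> Gam f f q"
  unfolding Gam_def by (rule ip_nonneg[OF lift(1)])

lemma grad_field: "f \<in> C_infinity A \<Longrightarrow> smooth_field (grad f)"
  by (rule horizontal_smooth[OF grad_horizontal])

lemma grad_tangent: "grad f q \<in> tangent_space A q"
  unfolding grad_def by (rule anchor(1)[OF lift(1)])

lemma Gam_C_infinity:
  fixes f k :: "'a \<Rightarrow> real"
  assumes "f \<in> C_infinity A" "k \<in> C_infinity A" shows "Gam f k \<in> C_infinity A"
  using smooth_fieldD(2)[OF grad_field[OF assms(1)] assms(2)] by (simp only: Gam_grad[abs_def])

lemma Gam_local:
  fixes f k :: "'a \<Rightarrow> real"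
  assumes f: "f \<in> C_infinity A" and W: "open W" "q \<in> W" "\<And>p. p \<in> W \<Longrightarrow> f p = 0"
  shows "Gam f k q = 0"
proof -
  have "Gam k f q = 0" unfolding Gam_grad by (rule tangent_local[OF grad_tangent f W])
  then show ?thesis using Gam_sym[of f k q] by simp
qed

lemma Gam_support:
  fixes f k :: "'a \<Rightarrow> real"
  assumes f: "f \<in> C_infinity A" and s: "support_in f N" shows "support_in (Gam f k) N"
proof -
  obtain K where K: "compact K" "K \<subseteq> N" "\<forall>q. q \<notin> K \<longrightarrow> f q = 0" using s unfolding support_in_def by blast
  have "Gam f k q = 0" if "q \<notin> K" for q
    by (rule Gam_local[OF f open_Compl[OF compact_imp_closed[OF K(1)]]]) (use K(3) that in auto)
  then show ?thesis unfolding support_in_def using K(1,2) by blast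
qed

lemma lift_linear:
  assumes "f \<in> C_infinity A" "k \<in> C_infinity A"
  shows "lift (\<lambda>p. f p + k p) q = lift f q + lift k q" "lift (\<lambda>p. c * f p) q = c *\<^sub>R lift f q"
proof -
  show "lift (\<lambda>p. f p + k p) q = lift f q + lift k q"
  proof (rule lift_unique)
    show "lift f q + lift k q \<in> F q" by (rule subspace_add[OF fiber_subspace lift(1) lift(1)])
    show "ip q (lift f q + lift k q) u = \<xi> q u (\<lambda>p. f p + k p)" if u: "u \<in> F q" for u
      unfolding ip(2)[OF lift(1) lift(1) u] lift(2)[OF u] by (rule tangentD(1)[OF anchor(1)[OF u] assms, symmetric])
  qed
  show "lift (\<lambda>p. c * f p) q = c *\<^sub>R lift f q"
  proof (rule lift_unique)
    show "c *\<^sub>R lift f q \<in> F q" by (rule subspace_scale[OF fiber_subspace lift(1)])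
    show "ip q (c *\<^sub>R lift f q) u = \<xi> q u (\<lambda>p. c * f p)" if u: "u \<in> F q" for u
      unfolding ip(3)[OF lift(1) u] lift(2)[OF u] by (rule tangentD(2)[OF anchor(1)[OF u] assms(1), symmetric])
  qed
qed

lemma lift_diff:
  assumes "f \<in> C_infinity A" "k \<in> C_infinity A"
  shows "lift (\<lambda>p. f p - k p) q = lift f q - lift k q"
proof -
  have "lift (\<lambda>p. f p - k p) q = lift (\<lambda>p. f p + (-1) * k p) q"
    by (rule arg_cong[where f="\<lambda>g. lift g q"]) (rule ext, simp)
  also have "\<dots> = lift f q + lift (\<lambda>p. (-1) * k p) q"
    by (rule lift_linear(1)[OF assms(1) C_infinity_cmult[OF assms(2)]])
  also have "lift (\<lambda>p. (-1) * k p) q = (-1) *\<^sub>R lift k q" by (rule lift_linear(2)[OF assms(2,2)])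
  finally show ?thesis by simp
qed

lemma Gam_add:
  assumes "f \<in> C_infinity A" "k \<in> C_infinity A"
  shows "Gam (\<lambda>p. f p + k p) (\<lambda>p. f p + k p) q = Gam f f q + 2 * Gam f k q + Gam k k q"
    "Gam (\<lambda>p. f p - k p) (\<lambda>p. f p - k p) q = Gam f f q - 2 * Gam f k q + Gam k k q"
  unfolding Gam_def lift_linear(1)[OF assms] lift_diff[OF assms]
  by (rule ip_square_add[OF lift(1) lift(1)], rule ip_square_diff[OF lift(1) lift(1)])

lemma Gam_add_le:
  assumes "f \<in> C_infinity A" "k \<in> C_infinity A"
  shows "Gam (\<lambda>p. f p + k p) (\<lambda>p. f p + k p) q \<le> 2 * Gam f f q + 2 * Gam k k q"
  using Gam_nonneg[of "\<lambda>p. f p - k p" q] unfolding Gam_add[OF assms] by linarith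

lemma Gam_integrable:
  fixes f k :: "'a \<Rightarrow> real"
  assumes "f \<in> C_infinity A" "k \<in> C_infinity A" "support_in f UNIV"
  shows "integrable \<omega> (Gam f k)"
  by (rule C_infinity_c_integrable[OF Gam_C_infinity[OF assms(1,2)] Gam_support[OF assms(1,3)]])

abbreviation "Lap f \<equiv> divergence M \<omega> (grad f)"

lemma Lap_support:
  fixes f :: "'a \<Rightarrow> real"
  assumes f: "f \<in> C_infinity A" and K: "compact K" "\<And>q. q \<notin> K \<Longrightarrow> f q = 0" and q: "q \<notin> K"
  shows "Lap f q = 0"
proof (rule divergence_support[OF grad_field[OF f] compact_imp_closed[OF K(1)] _ q])
  fix p g assume p: "p \<notin> K"
  have "Gam f g p = 0"
    by (rule Gam_local[OF f open_Compl[OF compact_imp_closed[OF K(1)]]]) (use K(2) p in auto)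
  then show "grad f p g = 0" by (simp add: Gam_grad)
qed

section \<open>Approximation of weak solutions with bounded energy\<close>

text \<open>The properties of \<open>\<kappa> v\<close> that survive the passage from one chart to the manifold: limit of smooth
  functions of bounded energy, in the sense of pairings with smooth functions. It is stable
  under sums, unlike a statement about a particular mollification.\<close>

definition approximable :: "('a \<Rightarrow> real) \<Rightarrow> bool" where
  "approximable g \<longleftrightarrow> (\<forall>h\<in>C_infinity A. integrable \<omega> (\<lambda>q. g q * h q)) \<and>
    (\<exists>u E. \<forall>n::nat. u n \<in> C_infinity A \<and> support_in (u n) UNIV \<and> (\<integral>q. Gam (u n) (u n) q \<partial>\<omega>) \<le> E \<and>
       (\<forall>h\<in>C_infinity A. (\<lambda>n. \<integral>q. u n q * h q \<partial>\<omega>) \<longlonglongrightarrow> (\<integral>q. g q * h q \<partial>\<omega>)))"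

lemma approximable_add:
  assumes f: "approximable f" and g: "approximable g"
  shows "approximable (\<lambda>q. f q + g q)"
proof -
  have fi: "integrable \<omega> (\<lambda>q. f q * h q)" if "h \<in> C_infinity A" for h
    using f that unfolding approximable_def by blast
  have gi: "integrable \<omega> (\<lambda>q. g q * h q)" if "h \<in> C_infinity A" for h
    using g that unfolding approximable_def by blast
  obtain u E where u: "\<forall>n::nat. u n \<in> C_infinity A \<and> support_in (u n) UNIV \<and> (\<integral>q. Gam (u n) (u n) q \<partial>\<omega>) \<le> E \<and>
       (\<forall>h\<in>C_infinity A. (\<lambda>n. \<integral>q. u n q * h q \<partial>\<omega>) \<longlonglongrightarrow> (\<integral>q. f q * h q \<partial>\<omega>))"
    using f unfolding approximable_def by (elim conjE exE)
  obtain w D where w: "\<forall>n::nat. w n \<in> C_infinity A \<and> support_in (w n) UNIV \<and> (\<integral>q. Gam (w n) (w n) q \<partial>\<omega>) \<le> D \<and>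
       (\<forall>h\<in>C_infinity A. (\<lambda>n. \<integral>q. w n q * h q \<partial>\<omega>) \<longlonglongrightarrow> (\<integral>q. g q * h q \<partial>\<omega>))"
    using g unfolding approximable_def by (elim conjE exE)
  have uC: "u n \<in> C_infinity A" "support_in (u n) UNIV" "(\<integral>q. Gam (u n) (u n) q \<partial>\<omega>) \<le> E" for n
    using spec[OF u, of n] by simp_all
  have wC: "w n \<in> C_infinity A" "support_in (w n) UNIV" "(\<integral>q. Gam (w n) (w n) q \<partial>\<omega>) \<le> D" for n
    using spec[OF w, of n] by simp_all
  have ui: "integrable \<omega> (\<lambda>q. u n q * h q)" and wi: "integrable \<omega> (\<lambda>q. w n q * h q)" if "h \<in> C_infinity A" for n h
    by (rule C_infinity_c_integrable[OF C_infinity_mult[OF uC(1) that] support_in_mult[OF uC(2)]],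
        rule C_infinity_c_integrable[OF C_infinity_mult[OF wC(1) that] support_in_mult[OF wC(2)]])
  have "(\<integral>q. Gam (\<lambda>q. u n q + w n q) (\<lambda>q. u n q + w n q) q \<partial>\<omega>) \<le> 2 * E + 2 * D" for n
  proof -
    have i1: "integrable \<omega> (\<lambda>q. 2 * Gam (u n) (u n) q)" "integrable \<omega> (\<lambda>q. 2 * Gam (w n) (w n) q)"
      by (intro integrable_mult_right Gam_integrable uC wC)+
    have "(\<integral>q. Gam (\<lambda>q. u n q + w n q) (\<lambda>q. u n q + w n q) q \<partial>\<omega>)
      \<le> (\<integral>q. 2 * Gam (u n) (u n) q + 2 * Gam (w n) (w n) q \<partial>\<omega>)"
    proof (rule integral_mono)
      show "integrable \<omega> (Gam (\<lambda>q. u n q + w n q) (\<lambda>q. u n q + w n q))"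
        by (intro Gam_integrable C_infinity_add support_in_add uC wC)
      show "integrable \<omega> (\<lambda>q. 2 * Gam (u n) (u n) q + 2 * Gam (w n) (w n) q)"
        by (rule Bochner_Integration.integrable_add[OF i1])
    qed (rule Gam_add_le[OF uC(1) wC(1)])
    also have "\<dots> = 2 * (\<integral>q. Gam (u n) (u n) q \<partial>\<omega>) + 2 * (\<integral>q. Gam (w n) (w n) q \<partial>\<omega>)"
      by (simp only: Bochner_Integration.integral_add[OF i1] integral_mult_right_zero)
    also have "\<dots> \<le> 2 * E + 2 * D" using uC(3)[of n] wC(3)[of n] by linarith
    finally show ?thesis .
  qed
  moreover have "(\<lambda>n. \<integral>q. (u n q + w n q) * h q \<partial>\<omega>) \<longlonglongrightarrow> (\<integral>q. (f q + g q) * h q \<partial>\<omega>)" if h: "h \<in> C_infinity A" for h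
  proof -
    have "(\<lambda>n. (\<integral>q. u n q * h q \<partial>\<omega>) + (\<integral>q. w n q * h q \<partial>\<omega>)) \<longlonglongrightarrow> (\<integral>q. f q * h q \<partial>\<omega>) + (\<integral>q. g q * h q \<partial>\<omega>)"
      using u w h by (intro tendsto_add) blast+
    then show ?thesis by (simp only: distrib_right Bochner_Integration.integral_add[OF ui[OF h] wi[OF h]]
        Bochner_Integration.integral_add[OF fi[OF h] gi[OF h]])
  qed
  ultimately have "\<forall>n. (\<lambda>q. u n q + w n q) \<in> C_infinity A \<and> support_in (\<lambda>q. u n q + w n q) UNIV \<and>
      (\<integral>q. Gam (\<lambda>q. u n q + w n q) (\<lambda>q. u n q + w n q) q \<partial>\<omega>) \<le> 2 * E + 2 * D \<and>
       (\<forall>h\<in>C_infinity A. (\<lambda>n. \<integral>q. (u n q + w n q) * h q \<partial>\<omega>) \<longlonglongrightarrow> (\<integral>q. (f q + g q) * h q \<partial>\<omega>))"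
    by (intro allI conjI C_infinity_add support_in_add uC wC ballI)
  moreover have "integrable \<omega> (\<lambda>q. (f q + g q) * h q)" if "h \<in> C_infinity A" for h
    unfolding distrib_right by (rule Bochner_Integration.integrable_add[OF fi[OF that] gi[OF that]])
  ultimately show ?thesis
    unfolding approximable_def
    by (intro conjI ballI exI[of _ "\<lambda>n q. u n q + w n q"] exI[of _ "2 * E + 2 * D"])
qed

lemma approximable_zero: "approximable (\<lambda>_. 0)"
proof -
  have z: "(\<lambda>_. 0) \<in> C_infinity A" by (rule C_infinity_const)
  have "Gam (\<lambda>_. 0) (\<lambda>_. 0) q = 0" for q by (rule Gam_local[OF z open_UNIV]) auto
  then have "(\<integral>q. Gam (\<lambda>_. 0) (\<lambda>_. 0) q \<partial>\<omega>) = 0" by (simp only: integral_zero)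
  then show ?thesis
    unfolding approximable_def
    by (intro conjI ballI exI[of _ "\<lambda>n q. 0"] exI[of _ 0]) (simp_all add: z support_in_zero)
qed

lemma approximable_sum:
  "(\<And>i. i < (n::nat) \<Longrightarrow> approximable (f i)) \<Longrightarrow> approximable (\<lambda>q. \<Sum>i<n. f i q)"
proof (induction n)
  case (Suc n)
  have "approximable (\<lambda>q. (\<Sum>i<n. f i q) + f n q)"
    by (rule approximable_add[OF Suc.IH Suc.prems]) (simp_all add: Suc.prems)
  then show ?case by simp
qed (simp add: approximable_zero)

lemma compact_bounds:
  fixes \<rho> :: "'e \<Rightarrow> real"
  assumes "compact K" "continuous_on K \<rho>" "\<And>x. x \<in> K \<Longrightarrow> \<rho> x > 0"
  obtains c C where "c > 0" "C > 0" "\<forall>x\<in>K. c \<le> \<rho> x \<and> \<rho> x \<le> C"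
proof (cases "K = {}")
  case True
  then show ?thesis by (intro that[of 1 1]) auto
next
  case False
  obtain x where x: "x \<in> K" "\<forall>y\<in>K. \<rho> x \<le> \<rho> y" using continuous_attains_inf[OF assms(1) False assms(2)] by blast
  obtain y where y: "y \<in> K" "\<forall>z\<in>K. \<rho> z \<le> \<rho> y" using continuous_attains_sup[OF assms(1) False assms(2)] by blast
  show ?thesis by (rule that[of "\<rho> x" "\<rho> y"]) (use x y assms(3) in auto)
qed

text \<open>In a chart the cut-off coordinates \<open>crd a\<close> play the role of the coordinates near the support
  of \<open>\<kappa>\<close>, and the matrix \<open>mat\<close> of their energy densities, weighted by the density of \<open>\<omega>\<close>, represents
  energy and Laplacian. It is a Gram matrix times a nonnegative function, hence semidefinite, so
  that the local energy estimate applies to the mollifications of \<open>\<kappa> v\<close>, which are pulled back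
  to the manifold.\<close>

lemma weak_solution_approximable_local:
  assumes c: "(V, \<phi>) \<in> A" and \<kappa>: "\<kappa> \<in> C_infinity A" "support_in \<kappa> V"
    and v: "v \<in> borel_measurable borel" "integrable \<omega> (\<lambda>q. (v q)\<^sup>2)"
    and w: "w \<in> borel_measurable borel" "integrable \<omega> (\<lambda>q. (w q)\<^sup>2)"
    and eq: "\<And>f. f \<in> C_infinity_c A \<Longrightarrow> (\<integral>q. Lap f q * v q \<partial>\<omega>) = (\<integral>q. f q * w q \<partial>\<omega>)"
  shows "approximable (\<lambda>q. \<kappa> q * v q)"
proof -
  let ?O = "\<phi> ` V" and ?\<rho> = "rho V \<phi>" and ?\<psi> = "inv_into V \<phi>"
  have oV: "open V" and oO: "open ?O" by (rule chart_props[OF c])+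
  define kap where "kap = push V \<phi> \<kappa>"
  have kap: "test_fun kap" unfolding kap_def by (rule push_test_fun[OF c C_infinity_smooth_fun_on[OF \<kappa>(1)] \<kappa>(2)])
  obtain K where K: "compact K" "K \<subseteq> ?O" "\<forall>x. x \<notin> K \<longrightarrow> kap x = 0"
    unfolding kap_def by (rule push_support[OF c \<kappa>(2)])
  \<comment> \<open>nested neighbourhoods of the support of the cut-off: \<open>K \<subseteq> K1 \<subseteq> U \<subseteq> K2 \<subseteq> \<phi> ` V\<close>\<close>
  obtain e where e: "e > 0" "(\<Union>x\<in>K. ball x e) \<subseteq> ?O"
    using compact_subset_open_imp_ball_epsilon_subset[OF K(1) oO K(2)] by metis
  define d where "d = e / 4"
  have d: "d > 0" using e by (simp add: d_def)
  define thick where "thick = (\<lambda>s. {x + y |x y. x \<in> K \<and> y \<in> cball (0::'e) s})"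
  have thick_compact: "compact (thick s)" for s
    unfolding thick_def by (rule compact_sums[OF K(1) compact_cball])
  have thickI: "z \<in> thick s" if "x \<in> K" "norm (z - x) \<le> s" for z x s
    unfolding thick_def using that by (intro CollectI exI[of _ x] exI[of _ "z - x"]) simp
  have thickE: "\<exists>x\<in>K. norm (z - x) \<le> s" if z: "z \<in> thick s" for z s
  proof -
    obtain x y where "z = x + y" "x \<in> K" "norm y \<le> s" using z unfolding thick_def mem_Collect_eq mem_cball_0 by blast
    then show ?thesis by (intro bexI[of _ x]) simp_all
  qed
  define K1 K2 where "K1 = thick d" and "K2 = thick (2 * d)"
  define U where "U = (\<Union>x\<in>K. ball x (2 * d))"
  have oU: "open U" unfolding U_def by blast
  have KU: "K1 \<subseteq> U" unfolding K1_def U_def using thickE d by (force simp: dist_norm norm_minus_commute)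
  have KK1: "K \<subseteq> K1" unfolding K1_def using thickI d by force
  have UK2: "U \<subseteq> K2" unfolding K2_def U_def by (force simp: dist_norm norm_minus_commute intro: thickI)
  have K2O: "K2 \<subseteq> ?O"
  proof
    fix z assume "z \<in> K2"
    then obtain x where "x \<in> K" "norm (z - x) \<le> 2 * d" unfolding K2_def using thickE by blast
    then have "z \<in> ball x e" using e(1) by (simp add: dist_norm norm_minus_commute d_def)
    then show "z \<in> ?O" using e(2) \<open>x \<in> K\<close> by blast
  qed
  have cK1: "compact K1" and cK2: "compact K2" unfolding K1_def K2_def by (rule thick_compact)+
  have UO: "U \<subseteq> ?O" using UK2 K2O by blast
  have K1O: "K1 \<subseteq> ?O" using KU UO by blast
  obtain m c' where mc: "\<forall>i<m. c' i \<in> C_infinity A" "\<forall>i<m. \<exists>N. N = V \<and> support_in (c' i) N"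
    "\<forall>q\<in>?\<psi> ` K2. (\<Sum>i<(m::nat). c' i q) = 1"
  proof (rule partition_of_unity[of "?\<psi> ` K2" "\<lambda>N. N = V"])
    show "compact (?\<psi> ` K2)" by (rule compact_chart_preimage(1)[OF c cK2 K2O])
    show "\<exists>N. N = V \<and> open N \<and> q \<in> N" if "q \<in> ?\<psi> ` K2" for q
      using compact_chart_preimage(2)[OF c cK2 K2O] that oV by blast
  qed
  define \<eta> where "\<eta> = (\<lambda>q. \<Sum>i<m. c' i q)"
  have \<eta>: "\<eta> \<in> C_infinity A" "support_in \<eta> V"
    unfolding \<eta>_def by (rule C_infinity_sum, use mc in simp, rule support_in_sum, use mc in simp)
  define W where "W = V \<inter> \<phi> -` U"
  have oW: "open W" unfolding W_def by (rule chart_open_preimage[OF c oU])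
  have \<psi>W: "?\<psi> x \<in> W" "?\<psi> x \<in> V" "\<phi> (?\<psi> x) = x" if "x \<in> U" for x
  proof -
    have xO: "x \<in> ?O" using that UO by blast
    then show "?\<psi> x \<in> V" "\<phi> (?\<psi> x) = x" by (rule inv_into_into, rule f_inv_into_f)
    then show "?\<psi> x \<in> W" using that by (simp add: W_def)
  qed
  have \<eta>1: "\<eta> q = 1" if "q \<in> W" for q
  proof -
    have "\<phi> q \<in> K2" "?\<psi> (\<phi> q) = q" using that UK2 chart_inv[OF c] by (auto simp: W_def)
    then have "q \<in> ?\<psi> ` K2" by (metis imageI)
    then show ?thesis unfolding \<eta>_def by (rule bspec[OF mc(3)])
  qed
  define crd where "crd = (\<lambda>a p. \<eta> p * (\<phi> p \<bullet> a))"
  have crd: "crd a \<in> C_infinity A" for a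
    unfolding crd_def by (rule cutoff_coordinate_C_infinity[OF c \<eta>, of "\<lambda>x. x \<bullet> a"]) (auto intro!: smooth_on_inner smooth_on_ident)
  define G where "G = (\<lambda>a b q. \<eta> q * \<eta> q * Gam (crd a) (crd b) q)"
  have G: "G a b \<in> C_infinity A" "support_in (G a b) V" for a b
    unfolding G_def
    by (intro C_infinity_mult \<eta> Gam_C_infinity crd, rule support_in_mult[OF support_in_mult[OF \<eta>(2)]])
  define mat where "mat = (\<lambda>a b x. push V \<phi> (G a b) x * ?\<rho> x)"
  have mat: "test_fun (mat a b)" for a b
    unfolding mat_def by (rule push_rho_test_fun[OF c G rho(1)[OF c]])
  have mat_sym: "mat a b x = mat b a x" for a b x
    unfolding mat_def push_def G_def by (simp add: Gam_sym[of "crd a"])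
  have mat_U: "mat a b x = ?\<rho> x * Gam (crd a) (crd b) (?\<psi> x)" if "x \<in> U" for a b x
    using that UO \<eta>1[OF \<psi>W(1)[OF that]] by (auto simp: mat_def push_def G_def)
  have mat_pos: "0 \<le> quad mat x p p" for x p
  proof (cases "x \<in> ?O")
    case True
    let ?q = "?\<psi> x"
    let ?l = "\<Sum>a\<in>Basis. p a *\<^sub>R lift (crd a) ?q"
    have sF: "(\<Sum>a\<in>B. p a *\<^sub>R lift (crd a) ?q) \<in> F ?q" for B
      by (intro subspace_sum[OF fiber_subspace] subspace_scale[OF fiber_subspace] lift(1))
    have l1: "ip ?q (\<Sum>a\<in>B. p a *\<^sub>R lift (crd a) ?q) u = (\<Sum>a\<in>B. p a * ip ?q (lift (crd a) ?q) u)"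
      if "u \<in> F ?q" "finite B" for u B
      using that(2)
    proof (induction B)
      case empty
      show ?case using ip(3)[OF that(1,1), of 0] by simp
    next
      case (insert a B)
      then show ?case
        by (simp add: ip(2)[OF subspace_scale[OF fiber_subspace lift(1)] sF that(1)] ip(3)[OF lift(1) that(1)])
    qed
    have "ip ?q ?l ?l = (\<Sum>a\<in>Basis. p a * ip ?q (lift (crd a) ?q) ?l)" by (rule l1[OF sF finite_Basis])
    also have "\<dots> = (\<Sum>a\<in>Basis. p a * (\<Sum>b\<in>Basis. p b * Gam (crd a) (crd b) ?q))"
      by (intro sum.cong refl arg_cong[where f="(*) _"])
        (simp only: ip(1)[OF lift(1) sF] l1[OF lift(1) finite_Basis] Gam_def ip(1)[OF lift(1) lift(1)])
    finally have "quad mat x p p = (\<eta> ?q * \<eta> ?q * ?\<rho> x) * ip ?q ?l ?l"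
      using True by (simp add: quad_def mat_def push_def G_def sum_distrib_left mult_ac)
    moreover have "0 \<le> \<eta> ?q * \<eta> ?q * ?\<rho> x" using rho(2)[OF c True] by simp
    ultimately show ?thesis using ip_nonneg[OF sF] by simp
  next
    case False
    then show ?thesis by (simp add: quad_def mat_def push_def)
  qed

  \<comment> \<open>in coordinates the gradient, the energy density and the Laplacian are given by \<open>mat\<close>\<close>
  have comp: "?\<rho> x * (field_comp V \<phi> (grad f) x \<bullet> a) = (\<Sum>b\<in>Basis. mat a b x * dirderiv b (push V \<phi> f) x)"
    if f: "f \<in> C_infinity A" "support_in f V" and x: "x \<in> U" for f a x
  proof -
    let ?q = "?\<psi> x"
    note qW = \<psi>W[OF x]
    have "field_comp V \<phi> (grad f) x \<bullet> a = grad f ?q (crd a)"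
      unfolding field_comp_def crd_def
      by (rule tcomp_inner[OF c qW(2) grad_tangent \<eta> oW qW(1) \<eta>1, symmetric])
    also have "\<dots> = grad (crd a) ?q f" by (simp only: Gam_grad[symmetric] Gam_sym)
    also have "\<dots> = (\<Sum>b\<in>Basis. (tcomp V \<phi> ?q (grad (crd a) ?q) \<bullet> b) * dirderiv b (push V \<phi> f) x)"
      using push_derivative[OF c grad_tangent qW(2) f] qW(3) by simp
    also have "\<dots> = (\<Sum>b\<in>Basis. Gam (crd a) (crd b) ?q * dirderiv b (push V \<phi> f) x)"
    proof (intro sum.cong refl arg_cong[where f="\<lambda>t. t * _"])
      fix b
      have "tcomp V \<phi> ?q (grad (crd a) ?q) \<bullet> b = grad (crd a) ?q (crd b)"
        unfolding crd_def by (rule tcomp_inner[OF c qW(2) grad_tangent \<eta> oW qW(1) \<eta>1, symmetric])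
      then show "tcomp V \<phi> ?q (grad (crd a) ?q) \<bullet> b = Gam (crd a) (crd b) ?q" by (simp only: Gam_grad)
    qed
    finally have "field_comp V \<phi> (grad f) x \<bullet> a = (\<Sum>b\<in>Basis. Gam (crd a) (crd b) ?q * dirderiv b (push V \<phi> f) x)" .
    then show ?thesis by (simp add: mat_U[OF x] sum_distrib_left mult_ac)
  qed
  have energy_U: "?\<rho> x * Gam f f (?\<psi> x) = energy mat (push V \<phi> f) x"
    if f: "f \<in> C_infinity A" "support_in f V" and x: "x \<in> U" for f x
  proof -
    let ?q = "?\<psi> x"
    note qW = \<psi>W[OF x]
    have "Gam f f ?q = (\<Sum>a\<in>Basis. (field_comp V \<phi> (grad f) x \<bullet> a) * dirderiv a (push V \<phi> f) x)"
      unfolding Gam_grad field_comp_def using push_derivative[OF c grad_tangent qW(2) f] qW(3) by simp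
    then have "?\<rho> x * Gam f f ?q = (\<Sum>a\<in>Basis. (?\<rho> x * (field_comp V \<phi> (grad f) x \<bullet> a)) * dirderiv a (push V \<phi> f) x)"
      by (simp add: sum_distrib_left mult_ac)
    also have "\<dots> = (\<Sum>a\<in>Basis. \<Sum>b\<in>Basis. mat a b x * dirderiv a (push V \<phi> f) x * dirderiv b (push V \<phi> f) x)"
      by (intro sum.cong refl) (simp add: comp[OF f x] sum_distrib_left sum_distrib_right mult_ac)
    finally show ?thesis by (simp only: energy_def quad_def)
  qed
  have Lap_U: "?\<rho> x * Lap f (?\<psi> x) = div_form_op mat (push V \<phi> f) x"
    if f: "f \<in> C_infinity A" "support_in f V" and x: "x \<in> U" for f x
  proof -
    let ?q = "?\<psi> x"
    note qW = \<psi>W[OF x]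
    have tf: "test_fun (push V \<phi> f)" by (rule push_test_fun[OF c C_infinity_smooth_fun_on[OF f(1)] f(2)])
    have tm: "test_fun (\<lambda>x. mat a b x * dirderiv b (push V \<phi> f) x)" for a b
      by (intro test_fun_mult' mat test_fun_dirderiv tf)
    have "Lap f ?q = local_div V \<phi> (grad f) x"
      using divergence_props(3)[OF grad_field[OF f(1)] c qW(2)] qW(3) by simp
    moreover have "?\<rho> x > 0" by (rule rho(2)[OF c]) (use x UO in blast)
    ultimately have "?\<rho> x * Lap f ?q = (\<Sum>a\<in>Basis. dirderiv a (\<lambda>x. ?\<rho> x * (field_comp V \<phi> (grad f) x \<bullet> a)) x)"
      by (simp add: local_div_def)
    also have "\<dots> = (\<Sum>a\<in>Basis. \<Sum>b\<in>Basis. dirderiv a (\<lambda>x. mat a b x * dirderiv b (push V \<phi> f) x) x)"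
    proof (rule sum.cong[OF refl])
      fix a :: 'e
      have "((\<lambda>x. \<Sum>b\<in>Basis. mat a b x * dirderiv b (push V \<phi> f) x) has_derivative
        (\<lambda>h. \<Sum>b\<in>Basis. frechet_derivative (\<lambda>x. mat a b x * dirderiv b (push V \<phi> f) x) (at x) h)) (at x)"
        by (intro has_derivative_sum test_fun_has_derivative tm)
      then have "((\<lambda>x. ?\<rho> x * (field_comp V \<phi> (grad f) x \<bullet> a)) has_derivative
        (\<lambda>h. \<Sum>b\<in>Basis. frechet_derivative (\<lambda>x. mat a b x * dirderiv b (push V \<phi> f) x) (at x) h)) (at x)"
        by (rule has_derivative_transform_within_open[OF _ oU x]) (rule comp[OF f, symmetric])
      from fun_cong[OF frechet_derivative_at[OF this], of a, symmetric]
      show "dirderiv a (\<lambda>x. ?\<rho> x * (field_comp V \<phi> (grad f) x \<bullet> a)) x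
        = (\<Sum>b\<in>Basis. dirderiv a (\<lambda>x. mat a b x * dirderiv b (push V \<phi> f) x) x)" .
    qed
    finally show ?thesis by (simp only: div_form_op_def)
  qed

  \<comment> \<open>functions with compact support in the chart go back and forth between the chart and the manifold\<close>
  have pull1: "pull V \<phi> f \<in> C_infinity A" "support_in (pull V \<phi> f) V" "push V \<phi> (pull V \<phi> f) = f"
    "\<And>q. q \<notin> ?\<psi> ` L \<Longrightarrow> pull V \<phi> f q = 0" "compact (?\<psi> ` L)"
    if f: "test_fun f" and L: "compact L" "L \<subseteq> ?O" "\<forall>x. x \<notin> L \<longrightarrow> f x = 0" for f L
  proof -
    have s: "smooth_on ?O f" by (rule smooth_on_subset[of UNIV]) (use f in \<open>simp_all add: test_fun_def\<close>)
    have z: "f x = 0" if "x \<in> ?O" "x \<notin> L" for x using L(3) that by blast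
    show "pull V \<phi> f \<in> C_infinity A" "support_in (pull V \<phi> f) V"
      by (rule pull_C_infinity[OF c s L(1,2) z], assumption+)+
    show "push V \<phi> (pull V \<phi> f) = f"
    proof
      fix x show "push V \<phi> (pull V \<phi> f) x = f x"
      proof (cases "x \<in> ?O")
        case True
        then show ?thesis using inv_into_into[of x \<phi> V] f_inv_into_f[of x \<phi> V] by (simp add: push_def pull_def)
      next
        case False
        then have "x \<notin> L" using L(2) by blast
        then show ?thesis using L(3) False by (simp add: push_def)
      qed
    qed
    show "compact (?\<psi> ` L)" by (rule compact_chart_preimage(1)[OF c L(1,2)])
    show "pull V \<phi> f q = 0" if q: "q \<notin> ?\<psi> ` L" for q
    proof (cases "q \<in> V")
      case True
      have "\<phi> q \<notin> L"
      proof
        assume "\<phi> q \<in> L"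
        then have "?\<psi> (\<phi> q) \<in> ?\<psi> ` L" by (rule imageI)
        then show False using q chart_inv[OF c True] by simp
      qed
      then show ?thesis using True L(3) by (simp add: pull_def)
    qed (simp add: pull_def)
  qed

  define uu where "uu = (\<lambda>x. indicator K x * push V \<phi> v x)"
  define FF where "FF = (\<lambda>x. indicator K x * push V \<phi> w x * ?\<rho> x)"
  have KO': "continuous_on K ?\<rho>"
    by (rule continuous_on_subset[OF smooth_on_continuous_on[OF rho(1)[OF c]] K(2)])
  obtain r0 R0 where r0: "r0 > 0" "R0 > 0" "\<forall>x\<in>K. r0 \<le> ?\<rho> x \<and> ?\<rho> x \<le> R0"
    by (rule compact_bounds[OF K(1) KO']) (use rho(2)[OF c] K(2) in blast)
  have Km[measurable]: "K \<in> sets borel" using compact_imp_closed[OF K(1)] by simp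
  have \<psi>Km: "?\<psi> ` K \<in> sets borel"
    using compact_imp_closed[OF compact_chart_preimage(1)[OF c K(1,2)]] by simp
  have \<psi>KV: "?\<psi> ` K \<subseteq> V" by (rule compact_chart_preimage(2)[OF c K(1,2)])
  have ind: "indicator (?\<psi> ` K) (?\<psi> x) = (indicator K x :: real)" if "x \<in> ?O" for x
  proof -
    have "?\<psi> x \<in> ?\<psi> ` K \<longleftrightarrow> x \<in> K"
    proof
      assume "?\<psi> x \<in> ?\<psi> ` K"
      then obtain y where y: "y \<in> K" "?\<psi> x = ?\<psi> y" by blast
      have "x = y" using f_inv_into_f[OF that] f_inv_into_f[of y \<phi> V] y K(2) by (metis subsetD)
      then show "x \<in> K" using y by simp
    qed blast
    then show ?thesis by (simp add: indicator_def)
  qed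
  have sq: "push V \<phi> g \<in> borel_measurable borel \<and> integrable lborel (\<lambda>x. indicator K x * (push V \<phi> g x)\<^sup>2 * ?\<rho> x)"
    if g: "g \<in> borel_measurable borel" "integrable \<omega> (\<lambda>q. (g q)\<^sup>2)" for g
  proof -
    let ?g = "\<lambda>q. indicator (?\<psi> ` K) q * (g q)\<^sup>2 :: real"
    have gm: "?g \<in> borel_measurable borel" using g(1) \<psi>Km by measurable
    have "integrable \<omega> ?g"
    proof (rule Bochner_Integration.integrable_bound[OF g(2)])
      show "?g \<in> borel_measurable \<omega>" using gm by (simp add: measurable_\<omega>)
    qed (simp add: indicator_def)
    moreover have z: "\<forall>q. q \<notin> V \<longrightarrow> ?g q = 0" using \<psi>KV by (auto simp: indicator_def)
    ultimately have "integrable lborel (\<lambda>x. push V \<phi> ?g x * ?\<rho> x)" using chart_integral(1)[OF c gm z] by simp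
    moreover have "push V \<phi> ?g x * ?\<rho> x = indicator K x * (push V \<phi> g x)\<^sup>2 * ?\<rho> x" for x
      by (cases "x \<in> ?O") (simp_all add: push_def ind)
    ultimately have i: "integrable lborel (\<lambda>x. indicator K x * (push V \<phi> g x)\<^sup>2 * ?\<rho> x)" by simp
    let ?h = "\<lambda>q. indicator V q * g q"
    have hm: "?h \<in> borel_measurable borel" by (intro borel_measurable_times borel_measurable_indicator g(1)) (simp add: oV)
    have "push V \<phi> ?h \<in> borel_measurable borel" by (rule chart_integral(3)[OF c hm]) simp
    moreover have "push V \<phi> ?h = push V \<phi> g"
      by (rule ext) (simp add: push_def inv_into_into)
    ultimately show ?thesis using i by simp
  qed
  have bK: "bounded K" by (rule compact_imp_bounded[OF K(1)])
  have uu: "compact_L2 uu"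
    unfolding compact_L2_def
  proof (intro conjI)
    note [measurable] = sq[OF v, THEN conjunct1]
    show "uu \<in> borel_measurable borel" unfolding uu_def by measurable
    show "integrable lborel (\<lambda>x. (uu x)\<^sup>2)"
    proof (rule Bochner_Integration.integrable_bound)
      show "integrable lborel (\<lambda>x. inverse r0 * (indicator K x * (push V \<phi> v x)\<^sup>2 * ?\<rho> x))"
        using sq[OF v] by simp
      show "(\<lambda>x. (uu x)\<^sup>2) \<in> borel_measurable lborel" unfolding uu_def by measurable
      have "norm ((uu x)\<^sup>2) \<le> norm (inverse r0 * (indicator K x * (push V \<phi> v x)\<^sup>2 * ?\<rho> x))" for x
      proof (cases "x \<in> K")
        case True
        then have "1 \<le> inverse r0 * ?\<rho> x" using r0 by (simp add: field_simps)
        then have "(push V \<phi> v x)\<^sup>2 * 1 \<le> (push V \<phi> v x)\<^sup>2 * (inverse r0 * ?\<rho> x)" by (rule mult_left_mono) simp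
        also have "\<dots> \<le> norm (inverse r0 * (indicator K x * (push V \<phi> v x)\<^sup>2 * ?\<rho> x))"
          using True by (simp add: mult_ac)
        finally show ?thesis using True by (simp add: uu_def)
      qed (simp add: uu_def)
      then show "AE x in lborel. norm ((uu x)\<^sup>2) \<le> norm (inverse r0 * (indicator K x * (push V \<phi> v x)\<^sup>2 * ?\<rho> x))" by simp
    qed
    show "bounded {x. uu x \<noteq> 0}" by (rule bounded_subset[OF bK]) (auto simp: uu_def indicator_def)
  qed
  have FF: "compact_L2 FF"
    unfolding compact_L2_def
  proof (intro conjI)
    note [measurable] = sq[OF w, THEN conjunct1]
    have [measurable]: "(\<lambda>x. indicator K x * ?\<rho> x) \<in> borel_measurable borel"
      using borel_measurable_continuous_on_indicator[OF Km KO'] by simp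
    have FFe: "FF = (\<lambda>x. push V \<phi> w x * (indicator K x * ?\<rho> x))" by (rule ext) (simp add: FF_def)
    show "FF \<in> borel_measurable borel" unfolding FFe by measurable
    show "integrable lborel (\<lambda>x. (FF x)\<^sup>2)"
    proof (rule Bochner_Integration.integrable_bound)
      show "integrable lborel (\<lambda>x. R0 * (indicator K x * (push V \<phi> w x)\<^sup>2 * ?\<rho> x))"
        using sq[OF w] by simp
      show "(\<lambda>x. (FF x)\<^sup>2) \<in> borel_measurable lborel" unfolding FFe by measurable
      have "norm ((FF x)\<^sup>2) \<le> norm (R0 * (indicator K x * (push V \<phi> w x)\<^sup>2 * ?\<rho> x))" for x
      proof (cases "x \<in> K")
        case True
        then have r: "0 \<le> ?\<rho> x" "?\<rho> x \<le> R0" using r0 by fastforce+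
        have "((push V \<phi> w x)\<^sup>2 * ?\<rho> x) * ?\<rho> x \<le> ((push V \<phi> w x)\<^sup>2 * ?\<rho> x) * R0"
          by (rule mult_left_mono) (use r in auto)
        then show ?thesis using True r r0(2) by (simp add: FF_def power_mult_distrib power2_eq_square mult_ac abs_mult)
      qed (simp add: FF_def)
      then show "AE x in lborel. norm ((FF x)\<^sup>2) \<le> norm (R0 * (indicator K x * (push V \<phi> w x)\<^sup>2 * ?\<rho> x))" by simp
    qed
    show "bounded {x. FF x \<noteq> 0}" by (rule bounded_subset[OF bK]) (auto simp: FF_def indicator_def)
  qed
  have oK: "open (- K)" using compact_imp_closed[OF K(1)] by (rule open_Compl)
  have equation: "(\<integral>x. uu x * div_form_op mat (\<lambda>x. kap x * \<psi> x) x \<partial>lborel) = (\<integral>x. FF x * (kap x * \<psi> x) \<partial>lborel)"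
    if \<psi>: "test_fun \<psi>" for \<psi>
  proof -
    define f where "f = (\<lambda>x. kap x * \<psi> x)"
    have f: "test_fun f" unfolding f_def by (rule test_fun_mult'[OF kap \<psi>])
    have fz: "\<forall>x. x \<notin> K \<longrightarrow> f x = 0" using K(3) by (simp add: f_def)
    note p = pull1[OF f K(1,2) fz]
    let ?f = "pull V \<phi> f"
    have fc: "?f \<in> C_infinity_c A"
      using p(1) support_in_mono[OF p(2) subset_UNIV] by (simp add: C_infinity_c_iff)
    have Lz: "Lap ?f q = 0" if "q \<notin> ?\<psi> ` K" for q by (rule Lap_support[OF p(1) p(5) p(4) that])
    have LC: "Lap ?f \<in> borel_measurable borel"
      using C_infinity_measurable[OF divergence_props(1)[OF grad_field[OF p(1)]]] by (simp add: measurable_\<omega>)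
    have fm: "?f \<in> borel_measurable borel" using C_infinity_measurable[OF p(1)] by (simp add: measurable_\<omega>)
    have m1: "(\<lambda>q. Lap ?f q * v q) \<in> borel_measurable borel" "(\<lambda>q. ?f q * w q) \<in> borel_measurable borel"
      using LC fm v(1) w(1) by (auto intro: borel_measurable_times)
    have z1: "\<forall>q. q \<notin> V \<longrightarrow> Lap ?f q * v q = 0" using Lz \<psi>KV by (metis mult_zero_left subsetD)
    have z2: "\<forall>q. q \<notin> V \<longrightarrow> ?f q * w q = 0" by (simp add: pull_def)
    have "(\<integral>x. uu x * div_form_op mat f x \<partial>lborel) = (\<integral>x. push V \<phi> (\<lambda>q. Lap ?f q * v q) x * ?\<rho> x \<partial>lborel)"
    proof (rule Bochner_Integration.integral_cong[OF refl])
      fix x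
      show "uu x * div_form_op mat f x = push V \<phi> (\<lambda>q. Lap ?f q * v q) x * ?\<rho> x"
      proof (cases "x \<in> K")
        case True
        then have xU: "x \<in> U" using KK1 KU by blast
        then show ?thesis using True Lap_U[OF p(1,2) xU] UO unfolding p(3) by (auto simp: uu_def push_def mult_ac)
      next
        case False
        have "push V \<phi> (\<lambda>q. Lap ?f q * v q) x = 0"
        proof (cases "x \<in> ?O")
          case True
          have "?\<psi> x \<notin> ?\<psi> ` K" using ind[OF True] False by (auto simp: indicator_def split: if_splits)
          then show ?thesis using Lz by (simp add: push_def)
        qed (simp add: push_def)
        then show ?thesis using False by (simp add: uu_def)
      qed
    qed
    also have "\<dots> = (\<integral>q. Lap ?f q * v q \<partial>\<omega>)" by (rule chart_integral(2)[OF c m1(1) z1, symmetric])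
    also have "\<dots> = (\<integral>q. ?f q * w q \<partial>\<omega>)" by (rule eq[OF fc])
    also have "\<dots> = (\<integral>x. push V \<phi> (\<lambda>q. ?f q * w q) x * ?\<rho> x \<partial>lborel)" by (rule chart_integral(2)[OF c m1(2) z2])
    also have "\<dots> = (\<integral>x. FF x * f x \<partial>lborel)"
    proof (rule Bochner_Integration.integral_cong[OF refl])
      fix x
      have "push V \<phi> (\<lambda>q. ?f q * w q) x = push V \<phi> ?f x * push V \<phi> w x" by (simp add: push_def)
      then have "push V \<phi> (\<lambda>q. ?f q * w q) x = f x * push V \<phi> w x" unfolding p(3) .
      then show "push V \<phi> (\<lambda>q. ?f q * w q) x * ?\<rho> x = FF x * f x"
        using fz by (cases "x \<in> K") (simp_all add: FF_def)
    qed
    finally show ?thesis by (simp only: f_def)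
  qed

  obtain Cm where Cm: "\<And>r. r > 0 \<Longrightarrow> \<exists>j :: 'e \<Rightarrow> real. mollifier r j \<and> mollifier_bound Cm r j"
    unfolding mollifier_bound_def using mollifier_exists by metis
  obtain E where E: "\<And>r j. 0 < r \<Longrightarrow> mollifier r j \<Longrightarrow> mollifier_bound Cm r j \<Longrightarrow>
    (\<integral>x. energy mat (conv j (\<lambda>x. kap x * uu x)) x \<partial>lborel) \<le> E"
    using local_energy_bound[OF mat mat_sym mat_pos kap uu FF equation, where C=Cm] by metis
  define vv where "vv = (\<lambda>x. kap x * uu x)"
  have vv: "compact_L2 vv" unfolding vv_def by (rule compact_L2_mult[OF uu kap])
  have vvi: "integrable lborel vv" by (rule compact_L2_integrable[OF vv])
  have vvz: "vv x = 0" if "x \<notin> K" for x using that by (simp add: vv_def uu_def)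
  define rr where "rr = (\<lambda>n::nat. d / real (Suc n))"
  have rr: "rr n > 0" "rr n \<le> d" for n
    using d by (auto simp: rr_def divide_le_eq_1 field_simps)
  have rr0: "rr \<longlonglongrightarrow> 0"
    unfolding rr_def using tendsto_mult[OF tendsto_const[of d] LIMSEQ_Suc[OF lim_1_over_n]] by simp
  have "\<forall>n. \<exists>j :: 'e \<Rightarrow> real. mollifier (rr n) j \<and> mollifier_bound Cm (rr n) j" using Cm rr(1) by blast
  from choice[OF this] obtain j :: "nat \<Rightarrow> 'e \<Rightarrow> real"
    where "\<forall>n. mollifier (rr n) (j n) \<and> mollifier_bound Cm (rr n) (j n)" by (elim exE)
  then have j: "mollifier (rr n) (j n)" "mollifier_bound Cm (rr n) (j n)" for n by simp_all
  define g where "g = (\<lambda>n. conv (j n) vv)"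
  have tj: "test_fun (j n)" for n using j(1)[of n] by (simp add: mollifier_def)
  have g: "test_fun (g n)" for n unfolding g_def by (rule test_fun_conv[OF tj vv])
  have gz: "\<forall>x. x \<notin> K1 \<longrightarrow> g n x = 0" for n
  proof (intro allI impI)
    fix x assume x: "x \<notin> K1"
    show "g n x = 0"
      unfolding g_def
    proof (rule conv_eq_0)
      show "j n x = 0" if "rr n \<le> norm x" for x using j(1)[of n] that by (simp add: mollifier_def)
      fix y assume "vv y \<noteq> 0"
      then have "y \<in> K" using vvz by blast
      then show "rr n \<le> norm (x - y)" using thickI[of y x d] x rr(2)[of n] unfolding K1_def by linarith
    qed
  qed
  note p = pull1[OF g cK1 K1O gz]
  let ?u = "\<lambda>n. pull V \<phi> (g n)"
  have oK1: "open (- K1)" using compact_imp_closed[OF cK1] by (rule open_Compl)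
  have en: "(\<integral>q. Gam (?u n) (?u n) q \<partial>\<omega>) \<le> E" for n
  proof -
    have sG: "support_in (Gam (?u n) (?u n)) V" by (rule Gam_support[OF p(1,2)])
    have "(\<integral>q. Gam (?u n) (?u n) q \<partial>\<omega>) = (\<integral>x. push V \<phi> (Gam (?u n) (?u n)) x * ?\<rho> x \<partial>lborel)"
      by (rule chart_integral_smooth(2)[OF c Gam_C_infinity[OF p(1) p(1)] sG])
    also have "\<dots> = (\<integral>x. energy mat (g n) x \<partial>lborel)"
    proof (rule Bochner_Integration.integral_cong[OF refl])
      fix x
      show "push V \<phi> (Gam (?u n) (?u n)) x * ?\<rho> x = energy mat (g n) x"
      proof (cases "x \<in> U")
        case True
        then show ?thesis using energy_U[OF p(1,2) True] UO unfolding p(3) by (auto simp: push_def mult.commute)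
      next
        case False
        then have xK1: "x \<in> - K1" using KU by blast
        have "dirderiv b (g n) x = 0" for b by (rule dirderiv_eq_0[OF oK1 _ xK1]) (use gz in simp)
        then have "energy mat (g n) x = 0" by (simp add: energy_def quad_def)
        moreover have "push V \<phi> (Gam (?u n) (?u n)) x = 0"
        proof (cases "x \<in> ?O")
          case True
          have "Gam (?u n) (?u n) (?\<psi> x) = 0"
          proof (rule Gam_local[OF p(1)])
            show "open (V \<inter> \<phi> -` (- K1))" by (rule chart_open_preimage[OF c oK1])
            show "?\<psi> x \<in> V \<inter> \<phi> -` (- K1)"
              using inv_into_into[OF True] f_inv_into_f[OF True] xK1 by simp
            show "?u n q = 0" if "q \<in> V \<inter> \<phi> -` (- K1)" for q using that gz by (simp add: pull_def)
          qed
          then show ?thesis by (simp add: push_def)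
        qed (simp add: push_def)
        ultimately show ?thesis by simp
      qed
    qed
    also have "\<dots> \<le> E" unfolding g_def vv_def by (rule E[OF rr(1) j])
    finally show ?thesis .
  qed
  have lim: "(\<lambda>n. \<integral>q. ?u n q * h q \<partial>\<omega>) \<longlonglongrightarrow> (\<integral>q. \<kappa> q * v q * h q \<partial>\<omega>)"
    and int: "integrable \<omega> (\<lambda>q. \<kappa> q * v q * h q)" if h: "h \<in> C_infinity A" for h
  proof -
    define H where "H = (\<lambda>x. push V \<phi> (\<lambda>q. \<eta> q * h q) x * ?\<rho> x)"
    have H: "test_fun H"
      unfolding H_def by (rule push_rho_test_fun[OF c C_infinity_mult[OF \<eta>(1) h] support_in_mult[OF \<eta>(2)] rho(1)[OF c]])
    have HU: "H x = h (?\<psi> x) * ?\<rho> x" if "x \<in> U" for x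
      using that UO \<eta>1[OF \<psi>W(1)[OF that]] by (auto simp: H_def push_def)
    have e1: "(\<integral>q. ?u n q * h q \<partial>\<omega>) = (\<integral>x. g n x * H x \<partial>lborel)" for n
    proof -
      have "(\<integral>q. ?u n q * h q \<partial>\<omega>) = (\<integral>x. push V \<phi> (\<lambda>q. ?u n q * h q) x * ?\<rho> x \<partial>lborel)"
        by (rule chart_integral_smooth(2)[OF c C_infinity_mult[OF p(1) h] support_in_mult[OF p(2)]])
      also have "\<dots> = (\<integral>x. g n x * H x \<partial>lborel)"
      proof (rule Bochner_Integration.integral_cong[OF refl])
        fix x
        have "push V \<phi> (\<lambda>q. ?u n q * h q) x = push V \<phi> (?u n) x * push V \<phi> h x" by (simp add: push_def)
        then have "push V \<phi> (\<lambda>q. ?u n q * h q) x = g n x * push V \<phi> h x" unfolding p(3) .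
        then show "push V \<phi> (\<lambda>q. ?u n q * h q) x * ?\<rho> x = g n x * H x"
        proof (cases "x \<in> K1")
          case True
          then have "x \<in> U" "x \<in> ?O" using KU UO by blast+
          then show ?thesis using \<open>push V \<phi> (\<lambda>q. ?u n q * h q) x = g n x * push V \<phi> h x\<close> HU by (simp add: push_def[of _ _ h])
        qed (simp add: gz)
      qed
      finally show ?thesis .
    qed
    have km: "\<kappa> \<in> borel_measurable borel" and hm: "h \<in> borel_measurable borel"
      using C_infinity_measurable[OF \<kappa>(1)] C_infinity_measurable[OF h] by (simp_all add: measurable_\<omega>)
    have m: "(\<lambda>q. \<kappa> q * v q * h q) \<in> borel_measurable borel" using km hm v(1) by (intro borel_measurable_times)
    have z: "\<forall>q. q \<notin> V \<longrightarrow> \<kappa> q * v q * h q = 0" using support_in_eq_0[OF \<kappa>(2)] by simp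
    have e2: "push V \<phi> (\<lambda>q. \<kappa> q * v q * h q) x * ?\<rho> x = vv x * H x" for x
    proof (cases "x \<in> K")
      case True
      then have "x \<in> U" "x \<in> ?O" using KK1 KU UO by blast+
      then show ?thesis using True HU by (simp add: push_def vv_def uu_def kap_def)
    next
      case False
      have "push V \<phi> (\<lambda>q. \<kappa> q * v q * h q) x = kap x * push V \<phi> v x * push V \<phi> h x" by (simp add: push_def kap_def)
      then show ?thesis using False K(3) vvz by simp
    qed
    show "integrable \<omega> (\<lambda>q. \<kappa> q * v q * h q)"
      unfolding chart_integral(1)[OF c m z] e2 by (rule compact_L2_mult_integrable[OF vv H])
    have e3: "(\<integral>q. \<kappa> q * v q * h q \<partial>\<omega>) = (\<integral>x. vv x * H x \<partial>lborel)"
      unfolding chart_integral(2)[OF c m z] e2 ..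
    obtain L where L: "L \<ge> 0" "\<And>x y. \<bar>H x - H y\<bar> \<le> L * norm (x - y)" using test_fun_Lipschitz[OF H] by metis
    have "\<bar>(\<integral>x. g n x * H x \<partial>lborel) - (\<integral>x. vv x * H x \<partial>lborel)\<bar> \<le> L * rr n * (\<integral>x. \<bar>vv x\<bar> \<partial>lborel)" for n
      unfolding g_def by (rule mollifier_pairing[OF j(1) rr(1) vvi H L(2,1)])
    note b = this
    have lim0: "(\<lambda>n. L * rr n * (\<integral>x. \<bar>vv x\<bar> \<partial>lborel)) \<longlonglongrightarrow> 0"
      using tendsto_mult[OF tendsto_mult[OF tendsto_const[of L] rr0] tendsto_const[of "\<integral>x. \<bar>vv x\<bar> \<partial>lborel"]] by simp
    have "(\<lambda>n. (\<integral>x. g n x * H x \<partial>lborel) - (\<integral>x. vv x * H x \<partial>lborel)) \<longlonglongrightarrow> 0"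
      by (rule Lim_null_comparison[OF always_eventually[OF allI] lim0]) (simp only: real_norm_def b)
    then show "(\<lambda>n. \<integral>q. ?u n q * h q \<partial>\<omega>) \<longlonglongrightarrow> (\<integral>q. \<kappa> q * v q * h q \<partial>\<omega>)"
      unfolding e1 e3 by (rule LIM_zero_cancel)
  qed
  show ?thesis
    unfolding approximable_def
    by (intro conjI ballI int exI[of _ ?u] exI[of _ E] allI p(1) support_in_mono[OF p(2) subset_UNIV] en lim)
qed

lemma weak_solution_approximable:
  assumes v: "v \<in> borel_measurable borel" "integrable \<omega> (\<lambda>q. (v q)\<^sup>2)"
    and w: "w \<in> borel_measurable borel" "integrable \<omega> (\<lambda>q. (w q)\<^sup>2)"
    and eq: "\<And>f. f \<in> C_infinity_c A \<Longrightarrow> (\<integral>q. Lap f q * v q \<partial>\<omega>) = (\<integral>q. f q * w q \<partial>\<omega>)"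
    and K: "compact K"
  obtains g where "approximable g" "\<forall>q\<in>K. g q = v q"
proof -
  have cover: "\<exists>N. (\<exists>\<phi>. (N, \<phi>) \<in> A) \<and> open N \<and> q \<in> N" for q
  proof -
    obtain V \<phi> where "(V, \<phi>) \<in> A" "q \<in> V" by (rule chart_at)
    then show ?thesis using chart_props(1) by blast
  qed
  obtain n c where nc: "\<forall>i<n. c i \<in> C_infinity A"
    "\<forall>i<n. \<exists>N. (\<exists>\<phi>. (N, \<phi>) \<in> A) \<and> support_in (c i) N" "\<forall>q\<in>K. (\<Sum>i<(n::nat). c i q) = 1"
    by (rule partition_of_unity[OF K, of "\<lambda>N. \<exists>\<phi>. (N, \<phi>) \<in> A"]) (rule cover)
  show thesis
  proof (rule that[of "\<lambda>q. \<Sum>i<n. c i q * v q"])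
    show "approximable (\<lambda>q. \<Sum>i<n. c i q * v q)"
    proof (rule approximable_sum)
      fix i assume i: "i < n"
      then obtain V \<phi> where "(V, \<phi>) \<in> A" "support_in (c i) V" using nc(2) by blast
      then show "approximable (\<lambda>q. c i q * v q)"
        using nc(1) i by (intro weak_solution_approximable_local[OF _ _ _ v w eq]) simp_all
    qed
    show "\<forall>q\<in>K. (\<Sum>i<n. c i q * v q) = v q" using nc(3) by (simp add: sum_distrib_right[symmetric])
  qed
qed

end

section \<open>Weak gradients as limits\<close>

inductive_set midpoint_hull :: "('b \<Rightarrow> real) set \<Rightarrow> ('b \<Rightarrow> real) set" for S where
  base: "f \<in> S \<Longrightarrow> f \<in> midpoint_hull S"
| mid: "f \<in> midpoint_hull S \<Longrightarrow> h \<in> midpoint_hull S \<Longrightarrow> (\<lambda>x. (1/2) * (f x + h x)) \<in> midpoint_hull S"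

lemma midpoint_hull_mono: "S \<subseteq> T \<Longrightarrow> midpoint_hull S \<subseteq> midpoint_hull T"
proof
  fix f assume "S \<subseteq> T" "f \<in> midpoint_hull S"
  from this(2,1) show "f \<in> midpoint_hull T"
    by induction (use midpoint_hull.base midpoint_hull.mid in blast)+
qed

lemma Fatou_bound:
  fixes F :: "nat \<Rightarrow> 'b \<Rightarrow> real"
  assumes F: "\<And>k. integrable \<mu> (F k)" "\<And>k q. 0 \<le> F k q" "\<And>k. (\<integral>q. F k q \<partial>\<mu>) \<le> B"
    and f: "f \<in> borel_measurable \<mu>" "\<And>q. 0 \<le> f q" "AE q in \<mu>. (\<lambda>k. F k q) \<longlonglongrightarrow> f q"
  shows "integrable \<mu> f" "(\<integral>q. f q \<partial>\<mu>) \<le> B"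
proof -
  have [measurable]: "F k \<in> borel_measurable \<mu>" for k using F(1) by (rule borel_measurable_integrable)
  have "0 \<le> (\<integral>q. F 0 q \<partial>\<mu>)" by (rule Bochner_Integration.integral_nonneg) (rule F(2))
  then have B: "0 \<le> B" using F(3)[of 0] by linarith
  have "(\<integral>\<^sup>+q. f q \<partial>\<mu>) = (\<integral>\<^sup>+q. liminf (\<lambda>k. ennreal (F k q)) \<partial>\<mu>)"
  proof (rule nn_integral_cong_AE, rule AE_mp[OF f(3)], intro AE_I2 impI)
    fix q assume "(\<lambda>k. F k q) \<longlonglongrightarrow> f q"
    then have "(\<lambda>k. ennreal (F k q)) \<longlonglongrightarrow> ennreal (f q)" by (rule tendsto_ennrealI)
    then show "ennreal (f q) = liminf (\<lambda>k. ennreal (F k q))"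
      using lim_imp_Liminf[OF trivial_limit_sequentially] by metis
  qed
  also have "\<dots> \<le> liminf (\<lambda>k. \<integral>\<^sup>+q. ennreal (F k q) \<partial>\<mu>)" by (rule nn_integral_liminf) simp
  also have "\<dots> \<le> ennreal B"
  proof (rule Liminf_le[OF trivial_limit_sequentially always_eventually], rule allI)
    fix k
    have "(\<integral>\<^sup>+q. ennreal (F k q) \<partial>\<mu>) = ennreal (\<integral>q. F k q \<partial>\<mu>)"
      by (rule nn_integral_eq_integral[OF F(1)]) (simp add: F(2))
    then show "(\<integral>\<^sup>+q. ennreal (F k q) \<partial>\<mu>) \<le> ennreal B" using F(3) by (simp add: ennreal_leI)
  qed
  finally have le: "(\<integral>\<^sup>+q. f q \<partial>\<mu>) \<le> ennreal B" .
  show i: "integrable \<mu> f"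
    by (rule integrableI_nonneg[OF f(1)]) (use f(2) le order_le_less_trans[OF le ennreal_less_top] in simp_all)
  have "ennreal (\<integral>q. f q \<partial>\<mu>) = (\<integral>\<^sup>+q. f q \<partial>\<mu>)"
    by (rule nn_integral_eq_integral[OF i, symmetric]) (simp add: f(2))
  with le have "ennreal (\<integral>q. f q \<partial>\<mu>) \<le> ennreal B" by (simp only:)
  then show "(\<integral>q. f q \<partial>\<mu>) \<le> B" using B by (simp only: ennreal_le_iff)
qed

text \<open>The weights turn square summability into summability of the increments:
  \<open>2 d \<le> (2 ^ k d)\<^sup>2 + (1 / 4) ^ k\<close>.\<close>

lemma summable_weighted_Cauchy:
  fixes r :: "nat \<Rightarrow> 'b::banach"
  assumes s: "summable (\<lambda>k. 4 ^ k * (norm (r (Suc k) - r k))\<^sup>2)"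
  obtains a where "r \<longlonglongrightarrow> a"
proof -
  have "summable (\<lambda>k. norm (r (Suc k) - r k))"
  proof (rule summable_comparison_test')
    show "summable (\<lambda>k. 4 ^ k * (norm (r (Suc k) - r k))\<^sup>2 + (1/4) ^ k)"
      by (intro summable_add s summable_geometric) simp
    fix k :: nat
    let ?x = "norm (r (Suc k) - r k)"
    have p: "(4::real) ^ k = 2 ^ k * 2 ^ k" by (simp add: power_mult_distrib[symmetric])
    have "2 * (2 ^ k * ?x) * (1/2) ^ k \<le> (2 ^ k * ?x)\<^sup>2 + ((1/2) ^ k)\<^sup>2" by (rule sum_squares_bound)
    moreover have "2 * (2 ^ k * ?x) * (1/2) ^ k = 2 * ?x" by (simp add: power_one_over)
    moreover have "(2 ^ k * ?x)\<^sup>2 = 4 ^ k * ?x\<^sup>2" by (simp add: p power2_eq_square)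
    moreover have "((1/2::real) ^ k)\<^sup>2 = (1/4) ^ k"
      by (simp add: power2_eq_square power_mult_distrib[symmetric])
    moreover have "0 \<le> ?x" by simp
    ultimately have "?x \<le> 4 ^ k * ?x\<^sup>2 + (1/4) ^ k" by linarith
    then show "norm ?x \<le> 4 ^ k * ?x\<^sup>2 + (1/4) ^ k" by simp
  qed
  then have "summable (\<lambda>k. r (Suc k) - r k)" by (rule summable_norm_cancel)
  then have "(\<lambda>n. \<Sum>k<n. r (Suc k) - r k) \<longlonglongrightarrow> (\<Sum>k. r (Suc k) - r k)" by (rule summable_LIMSEQ)
  then have "(\<lambda>n. (r n - r 0) + r 0) \<longlonglongrightarrow> (\<Sum>k. r (Suc k) - r k) + r 0"
    unfolding sum_lessThan_telescope by (rule tendsto_add[OF _ tendsto_const])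
  then show thesis using that by simp
qed

lemma complex_integral:
  assumes "integrable \<mu> a" "integrable \<mu> b"
  shows "integrable \<mu> (\<lambda>q. Complex (a q) (b q))"
    "(\<integral>q. Complex (a q) (b q) \<partial>\<mu>) = Complex (\<integral>q. a q \<partial>\<mu>) (\<integral>q. b q \<partial>\<mu>)"
proof -
  have i: "integrable \<mu> (\<lambda>q. complex_of_real (a q))" "integrable \<mu> (\<lambda>q. \<i> * complex_of_real (b q))"
    by (intro integrable_mult_right integrable_of_real assms)+
  show "integrable \<mu> (\<lambda>q. Complex (a q) (b q))"
    unfolding Complex_eq by (rule Bochner_Integration.integrable_add[OF i])
  show "(\<integral>q. Complex (a q) (b q) \<partial>\<mu>) = Complex (\<integral>q. a q \<partial>\<mu>) (\<integral>q. b q \<partial>\<mu>)"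
    unfolding Complex_eq Bochner_Integration.integral_add[OF i] integral_mult_right_zero integral_complex_of_real ..
qed

lemma integrable_mult_L2:
  fixes a :: "'b \<Rightarrow> real" and b :: "'b \<Rightarrow> real"
  assumes a: "a \<in> borel_measurable \<mu>" "integrable \<mu> (\<lambda>q. (a q)\<^sup>2)"
    and b: "b \<in> borel_measurable \<mu>" "integrable \<mu> (\<lambda>q. (b q)\<^sup>2)"
  shows "integrable \<mu> (\<lambda>q. a q * b q)"
proof (rule Bochner_Integration.integrable_bound)
  show "integrable \<mu> (\<lambda>q. (a q)\<^sup>2 + (b q)\<^sup>2)" by (rule Bochner_Integration.integrable_add[OF a(2) b(2)])
  show "(\<lambda>q. a q * b q) \<in> borel_measurable \<mu>" by (rule borel_measurable_times[OF a(1) b(1)])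
  have "\<bar>x * y\<bar> \<le> x\<^sup>2 + y\<^sup>2" for x y :: real
    using sum_squares_bound[of "\<bar>x\<bar>" "\<bar>y\<bar>"] mult_nonneg_nonneg[OF abs_ge_zero[of x] abs_ge_zero[of y]]
    unfolding abs_mult power2_abs mult.assoc by linarith
  then show "AE q in \<mu>. norm (a q * b q) \<le> norm ((a q)\<^sup>2 + (b q)\<^sup>2)" by simp
qed

context sub_riemannian_space
begin

lemma ip_0: assumes u: "u \<in> F q" shows "ip q 0 u = 0" "ip q u 0 = 0"
  using ip(3)[OF u u, of 0] ip_right(2)[OF u u, of 0] by simp_all

lemma minimal_in_fiber: "minimal q u \<Longrightarrow> u \<in> F q"
  by (simp add: minimal_def)

lemma minimal_0: "minimal q 0"
  using minimal_diff[OF lift_minimal lift_minimal, of q "\<lambda>_. 0" "\<lambda>_. 0"] by simp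

lemma ip_diff_left: "u \<in> F q \<Longrightarrow> v \<in> F q \<Longrightarrow> w \<in> F q \<Longrightarrow> ip q (u - v) w = ip q u w - ip q v w"
  using ip(2)[of u q "(-1) *\<^sub>R v" w] ip(3)[of v q w "-1"] subspace_scale[OF fiber_subspace, of v q "-1"] by simp

text \<open>The factor \<open>t\<close> distributes a small distance and a bounded test section; it will be \<open>2\<^sup>k\<close>.\<close>

lemma ip_weighted_bound:
  assumes a: "a \<in> F q" and w: "w \<in> F q" and t: "t > 0"
  shows "\<bar>ip q a w\<bar> \<le> t * ip q a a + inverse t * ip q w w"
proof -
  have tF: "t *\<^sub>R a \<in> F q" by (rule subspace_scale[OF fiber_subspace a])
  have e: "ip q (t *\<^sub>R a) (t *\<^sub>R a) = t * (t * ip q a a)" "ip q (t *\<^sub>R a) w = t * ip q a w"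
    by (simp_all only: ip(3)[OF a tF] ip_right(2)[OF a a] ip(3)[OF a w])
  have "0 \<le> t * (t * ip q a a) + 2 * (t * ip q a w) + ip q w w"
    using ip_nonneg[OF subspace_add[OF fiber_subspace tF w]] unfolding ip_square_add[OF tF w] e .
  moreover have "0 \<le> t * (t * ip q a a) - 2 * (t * ip q a w) + ip q w w"
    using ip_nonneg[OF subspace_diff[OF fiber_subspace tF w]] unfolding ip_square_diff[OF tF w] e .
  ultimately have "2 * (t * \<bar>ip q a w\<bar>) \<le> t * (t * ip q a a) + ip q w w" by (simp add: abs_if)
  moreover have "0 \<le> t * \<bar>ip q a w\<bar>" using t by simp
  ultimately have "t * \<bar>ip q a w\<bar> \<le> t * (t * ip q a a) + ip q w w" by linarith
  then have "inverse t * (t * \<bar>ip q a w\<bar>) \<le> inverse t * (t * (t * ip q a a) + ip q w w)"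
    using t by (intro mult_left_mono) simp_all
  then show ?thesis using t by (simp add: distrib_left mult.assoc[symmetric])
qed

text \<open>The fibre is isometric to a Euclidean space, where the increments are summable. Minimality is
  an orthogonality condition and survives the limit.\<close>

lemma minimal_limit:
  assumes m: "\<And>k. minimal q (u k)"
    and s: "summable (\<lambda>k. 4 ^ k * ip q (u (Suc k) - u k) (u (Suc k) - u k))"
  shows "\<exists>l. minimal q l \<and> (\<forall>w\<in>F q. (\<lambda>k. ip q (u k) w) \<longlonglongrightarrow> ip q l w) \<and>
    (\<lambda>k. ip q (u k) (u k)) \<longlonglongrightarrow> ip q l l \<and>
    (\<forall>n. (\<lambda>k. ip q (u k - u n) (u k - u n)) \<longlonglongrightarrow> ip q (l - u n) (l - u n))"
proof -
  obtain E :: "'r \<Rightarrow> 'u" where E: "linear E" "range E = F q" "\<forall>r s. ip q (E r) (E s) = r \<bullet> s" by (rule fiber_isometry)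
  have "\<exists>r. u k = E r" for k using minimal_in_fiber[OF m[of k]] E(2) by blast
  then obtain r where r: "\<And>k. u k = E (r k)" by metis
  have ur: "u = (\<lambda>k. E (r k))" by (rule ext) (rule r)
  have d: "E x - E y = E (x - y)" for x y using linear_diff[OF E(1)] by simp
  have "summable (\<lambda>k. 4 ^ k * (norm (r (Suc k) - r k))\<^sup>2)"
    using s unfolding ur d E(3)[rule_format] by (simp only: power2_norm_eq_inner)
  then obtain a where a: "r \<longlonglongrightarrow> a" by (rule summable_weighted_Cauchy)
  have w: "(\<lambda>k. ip q (u k) w) \<longlonglongrightarrow> ip q (E a) w" if w: "w \<in> F q" for w
  proof -
    obtain y where y: "w = E y" using w E(2) by blast
    show ?thesis unfolding ur y E(3)[rule_format] by (intro tendsto_intros a)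
  qed
  show ?thesis
  proof (intro exI[of _ "E a"] conjI allI ballI w)
    show "minimal q (E a)"
      unfolding minimal_def
    proof (intro conjI ballI impI)
      show "E a \<in> F q" using E(2) by blast
      fix k assume k: "k \<in> F q" "\<forall>f. \<xi> q k f = 0"
      have "ip q (u n) k = 0" for n using m[of n] k by (simp add: minimal_def)
      then have "(\<lambda>n. 0) \<longlonglongrightarrow> ip q (E a) k" using w[OF k(1)] by simp
      then show "ip q (E a) k = 0" using LIMSEQ_unique[OF tendsto_const] by metis
    qed
    show "(\<lambda>k. ip q (u k) (u k)) \<longlonglongrightarrow> ip q (E a) (E a)"
      unfolding ur E(3)[rule_format] by (intro tendsto_intros a)
    show "(\<lambda>k. ip q (u k - u n) (u k - u n)) \<longlonglongrightarrow> ip q (E a - u n) (E a - u n)" for n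
      unfolding ur d E(3)[rule_format] by (intro tendsto_intros a)
  qed
qed

definition test_function :: "('a \<Rightarrow> real) \<Rightarrow> bool" where
  "test_function f \<longleftrightarrow> f \<in> C_infinity A \<and> support_in f UNIV"

definition total_energy :: "('a \<Rightarrow> real) \<Rightarrow> real" where
  "total_energy f = (\<integral>q. Gam f f q \<partial>\<omega>)"

lemma test_function_mean:
  assumes "test_function f" "test_function h" shows "test_function (\<lambda>x. (1/2) * (f x + h x))"
proof -
  have "support_in (\<lambda>x. (f x + h x) * (1/2)) UNIV"
    using assms by (intro support_in_mult support_in_add) (simp_all add: test_function_def)
  then have "support_in (\<lambda>x. (1/2) * (f x + h x)) UNIV" by (simp add: mult.commute)
  then show ?thesis using assms by (simp only: test_function_def C_infinity_cmult C_infinity_add simp_thms)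
qed

lemma parallelogram:
  assumes "test_function f" "test_function h"
  shows "total_energy (\<lambda>x. f x - h x)
    = 2 * total_energy f + 2 * total_energy h - 4 * total_energy (\<lambda>x. (1/2) * (f x + h x))"
proof -
  have f: "f \<in> C_infinity A" "support_in f UNIV" and h: "h \<in> C_infinity A" "support_in h UNIV"
    using assms by (simp_all add: test_function_def)
  have fh: "(\<lambda>x. f x + h x) \<in> C_infinity A" by (rule C_infinity_add[OF f(1) h(1)])
  have half: "Gam (\<lambda>x. (1/2) * (f x + h x)) (\<lambda>x. (1/2) * (f x + h x)) q
    = (1/4) * (Gam f f q + 2 * Gam f h q + Gam h h q)" for q
  proof -
    have "Gam (\<lambda>x. (1/2) * (f x + h x)) (\<lambda>x. (1/2) * (f x + h x)) q
      = (1/2) * ((1/2) * Gam (\<lambda>x. f x + h x) (\<lambda>x. f x + h x) q)"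
      unfolding Gam_def lift_linear(2)[OF fh fh]
      by (simp only: ip(3)[OF lift(1) subspace_scale[OF fiber_subspace lift(1)]] ip_right(2)[OF lift(1) lift(1)])
    then show ?thesis unfolding Gam_add(1)[OF f(1) h(1)] by simp
  qed
  have i: "integrable \<omega> (Gam f f)" "integrable \<omega> (Gam f h)" "integrable \<omega> (Gam h h)"
    by (intro Gam_integrable f h)+
  note int_simps = Bochner_Integration.integral_add Bochner_Integration.integral_diff integral_mult_right_zero
    Bochner_Integration.integrable_add Bochner_Integration.integrable_diff integrable_mult_right i
  have I1: "(\<integral>q. Gam f f q - 2 * Gam f h q + Gam h h q \<partial>\<omega>)
    = (\<integral>q. Gam f f q \<partial>\<omega>) - 2 * (\<integral>q. Gam f h q \<partial>\<omega>) + (\<integral>q. Gam h h q \<partial>\<omega>)"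
    by (simp only: int_simps)
  have I2: "(\<integral>q. (1/4) * (Gam f f q + 2 * Gam f h q + Gam h h q) \<partial>\<omega>)
    = (1/4) * ((\<integral>q. Gam f f q \<partial>\<omega>) + 2 * (\<integral>q. Gam f h q \<partial>\<omega>) + (\<integral>q. Gam h h q \<partial>\<omega>))"
    by (simp only: int_simps)
  show ?thesis
    unfolding total_energy_def half Gam_add(2)[OF f(1) h(1)] I1 I2 by (simp add: field_simps)
qed

lemma total_energy_nonneg: "0 \<le> total_energy f"
  unfolding total_energy_def by (rule Bochner_Integration.integral_nonneg) (rule Gam_nonneg)

text \<open>Let \<open>d n\<close> be the infimum of the energy over the midpoint hull of the tail from \<open>n\<close> on. These
  infima increase to a limit \<open>D\<close>. Two elements of a late hull with energy close to \<open>D\<close> have a midpoint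
  of energy at least \<open>d n\<close>, so by the parallelogram identity their difference has small energy.
  Midpoints suffice here, which keeps the convex combinations free of weights; their pairings
  converge to the same limit as those of the original sequence.\<close>

lemma energy_Cauchy_sequence:
  assumes g: "approximable g"
  obtains h E where "\<And>k. test_function (h k)" "\<And>k. total_energy (h k) \<le> E"
    "\<And>\<phi>. \<phi> \<in> C_infinity A \<Longrightarrow> (\<lambda>k. \<integral>q. h k q * \<phi> q \<partial>\<omega>) \<longlonglongrightarrow> (\<integral>q. g q * \<phi> q \<partial>\<omega>)"
    "\<And>k l. k \<le> l \<Longrightarrow> total_energy (\<lambda>x. h l x - h k x) \<le> (1/8) ^ k"
proof -
  obtain u E where u: "\<forall>n::nat. u n \<in> C_infinity A \<and> support_in (u n) UNIV \<and> (\<integral>q. Gam (u n) (u n) q \<partial>\<omega>) \<le> E \<and>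
       (\<forall>h\<in>C_infinity A. (\<lambda>n. \<integral>q. u n q * h q \<partial>\<omega>) \<longlonglongrightarrow> (\<integral>q. g q * h q \<partial>\<omega>))"
    using g unfolding approximable_def by (elim conjE exE)
  have ut: "test_function (u n)" and uE: "total_energy (u n) \<le> E" for n
    using spec[OF u, of n] by (simp_all add: test_function_def total_energy_def)
  define K where "K = (\<lambda>n. midpoint_hull (u ` {n..}))"
  have Kt: "test_function f \<and> total_energy f \<le> E" if "f \<in> K n" for f n
    using that unfolding K_def
  proof induction
    case (base f)
    then show ?case using ut uE by blast
  next
    case (mid f h)
    then show ?case
      using test_function_mean[of f h] parallelogram[of f h] total_energy_nonneg[of "\<lambda>x. f x - h x"] by simp
  qed
  have Kmid: "(\<lambda>x. (1/2) * (f x + h x)) \<in> K n" if "f \<in> K n" "h \<in> K n" for f h n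
    using that unfolding K_def by (rule midpoint_hull.mid)
  have uK: "u n \<in> K n" for n unfolding K_def by (rule midpoint_hull.base) simp
  have Kmono: "K n \<subseteq> K m" if "m \<le> n" for m n
    unfolding K_def using that by (intro midpoint_hull_mono image_mono) auto
  define d where "d = (\<lambda>n. Inf (total_energy ` K n))"
  have bdd: "bdd_below (total_energy ` K n)" for n
    by (rule bdd_belowI[of _ 0]) (use total_energy_nonneg in auto)
  have dle: "d n \<le> total_energy f" if "f \<in> K n" for n f
    unfolding d_def by (rule cInf_lower[OF imageI[OF that] bdd])
  have "incseq d"
    unfolding d_def by (intro incseq_SucI cInf_superset_mono bdd image_mono Kmono) (use uK in auto)
  moreover have "\<forall>n. d n \<le> E" using dle[OF uK] uE order_trans by blast
  ultimately obtain D where D: "d \<longlonglongrightarrow> D" "\<forall>i. d i \<le> D" by (rule incseq_convergent)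
  define \<delta> :: "nat \<Rightarrow> real" where "\<delta> = (\<lambda>k. (1/8) ^ k / 8)"
  have \<delta>: "\<delta> k > 0" for k by (simp add: \<delta>_def)
  have \<delta>m: "\<delta> l \<le> \<delta> k" if "k \<le> l" for k l
    unfolding \<delta>_def using power_decreasing[OF that, of "1/8::real"] by simp
  have "\<exists>n. \<forall>m\<ge>n. D - d m < \<delta> k" for k
  proof -
    have "\<forall>\<^sub>F m in sequentially. D - \<delta> k < d m" using D(1) by (rule order_tendstoD) (simp add: \<delta>)
    then obtain N where "\<forall>m\<ge>N. D - \<delta> k < d m" unfolding eventually_sequentially by blast
    then show ?thesis by (intro exI[of _ N]) (auto simp: algebra_simps)
  qed
  then obtain n where n: "\<forall>k. \<forall>m\<ge>n k. D - d m < \<delta> k" by metis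
  define m where "m = (\<lambda>k. k + (\<Sum>i\<le>k. n i))"
  have mk: "k \<le> m k" "n k \<le> m k" for k
    unfolding m_def using member_le_sum[of k "{..k}" n] by simp_all
  have mm: "m k \<le> m l" if "k \<le> l" for k l
    unfolding m_def by (intro add_mono that sum_mono2) (use that in auto)
  have "\<exists>f\<in>K (m k). total_energy f < d (m k) + \<delta> k" for k
  proof -
    have "Inf (total_energy ` K (m k)) < d (m k) + \<delta> k" using \<delta>[of k] by (simp add: d_def)
    then have "\<exists>x\<in>total_energy ` K (m k). x < d (m k) + \<delta> k"
      by (rule cInf_lessD[rotated]) (use uK in blast)
    then show ?thesis by blast
  qed
  then obtain h where h: "\<forall>k. h k \<in> K (m k) \<and> total_energy (h k) < d (m k) + \<delta> k" by metis
  have hK: "h k \<in> K (m k)" and hE: "total_energy (h k) < D + \<delta> k" for k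
    using h D(2) by (blast, metis add_le_cancel_right less_le_trans)
  show thesis
  proof (rule that[of h E])
    show "test_function (h k)" "total_energy (h k) \<le> E" for k using Kt[OF hK] by simp_all
    show "total_energy (\<lambda>x. h l x - h k x) \<le> (1/8) ^ k" if kl: "k \<le> l" for k l
    proof -
      have "h l \<in> K (m k)" using Kmono[OF mm[OF kl]] hK by blast
      then have "d (m k) \<le> total_energy (\<lambda>x. (1/2) * (h l x + h k x))" by (intro dle Kmid hK)
      moreover have "D - d (m k) < \<delta> k" using n mk(2) by blast
      ultimately have "total_energy (\<lambda>x. h l x - h k x) \<le> 8 * \<delta> k"
        using parallelogram[of "h l" "h k"] Kt[OF hK, of l] Kt[OF hK, of k] hE[of k] hE[of l] \<delta>m[OF kl] by simp
      then show ?thesis by (simp add: \<delta>_def)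
    qed
    fix \<phi> :: "'a \<Rightarrow> real" assume \<phi>: "\<phi> \<in> C_infinity A"
    let ?c = "\<integral>q. g q * \<phi> q \<partial>\<omega>"
    show "(\<lambda>k. \<integral>q. h k q * \<phi> q \<partial>\<omega>) \<longlonglongrightarrow> ?c"
    proof (rule LIMSEQ_I)
      fix \<epsilon> :: real assume \<epsilon>: "\<epsilon> > 0"
      have "(\<lambda>n. \<integral>q. u n q * \<phi> q \<partial>\<omega>) \<longlonglongrightarrow> ?c" using u \<phi> by blast
      from LIMSEQ_D[OF this \<epsilon>] obtain N where N: "\<forall>n\<ge>N. norm ((\<integral>q. u n q * \<phi> q \<partial>\<omega>) - ?c) < \<epsilon>" by blast
      have *: "\<bar>(\<integral>q. f q * \<phi> q \<partial>\<omega>) - ?c\<bar> < \<epsilon> \<and> test_function f" if "f \<in> K j" "N \<le> j" for f j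
        using that unfolding K_def
      proof induction
        case (base f)
        then show ?case using N ut by auto
      next
        case (mid f h)
        have i: "integrable \<omega> (\<lambda>q. k q * \<phi> q)" if "test_function k" for k
          using that by (intro C_infinity_c_integrable C_infinity_mult \<phi> support_in_mult) (simp_all add: test_function_def)
        have fh: "test_function f" "test_function h" using mid by simp_all
        have "(\<integral>q. (1/2) * (f q + h q) * \<phi> q \<partial>\<omega>) = (1/2) * ((\<integral>q. f q * \<phi> q \<partial>\<omega>) + (\<integral>q. h q * \<phi> q \<partial>\<omega>))"
          by (simp only: mult.assoc distrib_right integral_mult_right_zero Bochner_Integration.integral_add[OF i[OF fh(1)] i[OF fh(2)]])
        moreover have "\<bar>(\<integral>q. f q * \<phi> q \<partial>\<omega>) - ?c\<bar> < \<epsilon>" "\<bar>(\<integral>q. h q * \<phi> q \<partial>\<omega>) - ?c\<bar> < \<epsilon>"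
          using mid by simp_all
        moreover have "\<bar>(1/2) * (a + b) - c\<bar> < \<epsilon>" if "\<bar>a - c\<bar> < \<epsilon>" "\<bar>b - c\<bar> < \<epsilon>" for a b c :: real
        proof -
          have "(1/2) * (a + b) - c = ((a - c) + (b - c)) / 2" by (simp add: field_simps)
          then have "\<bar>(1/2) * (a + b) - c\<bar> = \<bar>(a - c) + (b - c)\<bar> / 2" by (simp only: abs_divide abs_numeral)
          also have "\<dots> \<le> (\<bar>a - c\<bar> + \<bar>b - c\<bar>) / 2" by (intro divide_right_mono abs_triangle_ineq) simp
          also have "\<dots> < \<epsilon>" using that by (simp add: field_simps)
          finally show ?thesis .
        qed
        ultimately have "\<bar>(\<integral>q. (1/2) * (f q + h q) * \<phi> q \<partial>\<omega>) - ?c\<bar> < \<epsilon>" by (simp only: simp_thms)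
        then show ?case using test_function_mean[OF fh] by simp
      qed
      have "norm ((\<integral>q. h k q * \<phi> q \<partial>\<omega>) - ?c) < \<epsilon>" if "k \<ge> N" for k
        using *[OF hK] mk(1)[of k] that by simp
      then show "\<exists>no. \<forall>n\<ge>no. norm ((\<integral>q. h n q * \<phi> q \<partial>\<omega>) - ?c) < \<epsilon>" by blast
    qed
  qed
qed

lemma section_ip_smooth:
  assumes s: "s \<in> bundle_sections M" shows "(\<lambda>q. ip q (s q) (s q)) \<in> C_infinity A"
  unfolding C_infinity_iff
proof (rule smooth_fun_on_local)
  fix q
  obtain V \<tau> where t: "(V, \<tau>) \<in> trivs M" "q \<in> V" by (rule triv_at)
  have "\<forall>(V, \<tau>)\<in>trivs M. smooth_fun_on A V (\<lambda>q. \<tau> q (s q))" using s unfolding bundle_sections_def by blast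
  from bspec[OF this t(1)] have st: "smooth_fun_on A V (\<lambda>q. \<tau> q (s q))" by simp
  from ip_smooth_gen[OF t(1) st st] have "smooth_fun_on A V (\<lambda>q. ip q (s q) (s q))"
    by (rule smooth_fun_on_cong[OF triv(1)[OF t(1)], rotated]) (simp add: untriv(3)[OF t(1)] section_in_fiber[OF s])
  then show "\<exists>T. open T \<and> q \<in> T \<and> smooth_fun_on A T (\<lambda>q. ip q (s q) (s q))"
    by (intro exI[of _ V] conjI triv(1)[OF t(1)] t(2))
qed

end

context sub_riemannian_space
begin

lemma compact_cutoff:
  assumes K: "compact K"
  obtains \<chi>' where "\<chi>' \<in> C_infinity A" "support_in \<chi>' UNIV" "\<forall>q\<in>K. \<chi>' q = (1::real)"
proof -
  obtain n :: nat and c where c: "\<forall>i<n. c i \<in> C_infinity A"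
    "\<forall>i<n. \<exists>N. N = UNIV \<and> support_in (c i) N" "\<forall>q\<in>K. (\<Sum>i<n. c i q) = 1"
    by (rule partition_of_unity[OF K, of "\<lambda>N. N = UNIV"]) auto
  show thesis
    by (rule that[of "\<lambda>q. \<Sum>i<n. c i q"]) (use c in \<open>auto intro!: C_infinity_sum support_in_sum\<close>)
qed

lemma field_closure: "q \<notin> closure {q. W q \<noteq> (\<lambda>f. 0)} \<Longrightarrow> W q f = (0::real)"
  using closure_subset[of "{q. W q \<noteq> (\<lambda>f. 0)}"] by (metis (mono_tags, lifting) mem_Collect_eq subsetD)

text \<open>The increments of the Cauchy sequence have energy at most \<open>8\<^sup>-\<^sup>k\<close>, so even with weights \<open>4\<^sup>k\<close> their
  energy densities are summable almost everywhere and \<open>minimal_limit\<close> yields a limit of the lifts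
  at almost every point. Fatou's lemma bounds its distance to the \<open>k\<close>-th lift in the mean, again
  by \<open>8\<^sup>-\<^sup>k\<close>, and this passes the divergence identity to the limit.\<close>

lemma weak_gradient_exists:
  assumes g: "approximable g"
  obtains l :: "'a \<Rightarrow> 'u" where "\<And>q. minimal q (l q)"
    "\<And>f. f \<in> C_infinity A \<Longrightarrow> (\<lambda>q. \<xi> q (l q) f) \<in> borel_measurable \<omega>"
    "integrable \<omega> (\<lambda>q. ip q (l q) (l q))"
    "\<And>s. s \<in> bundle_sections M \<Longrightarrow> compact (closure {q. \<xi> q (s q) \<noteq> (\<lambda>f. 0)}) \<Longrightarrow>
       integrable \<omega> (\<lambda>q. ip q (l q) (s q)) \<and>
       (\<integral>q. ip q (l q) (s q) \<partial>\<omega>) = - (\<integral>q. g q * divergence M \<omega> (\<lambda>q. \<xi> q (s q)) q \<partial>\<omega>)"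
proof (rule energy_Cauchy_sequence[OF g])
  fix h E
  assume ht: "\<And>k. test_function (h k)" and hE: "\<And>k. total_energy (h k) \<le> E"
    and hlim: "\<And>\<phi>. \<phi> \<in> C_infinity A \<Longrightarrow> (\<lambda>k. \<integral>q. h k q * \<phi> q \<partial>\<omega>) \<longlonglongrightarrow> (\<integral>q. g q * \<phi> q \<partial>\<omega>)"
    and hC: "\<And>k l. k \<le> l \<Longrightarrow> total_energy (\<lambda>x. h l x - h k x) \<le> (1/8) ^ k"
  have hs: "h k \<in> C_infinity A" "support_in (h k) UNIV" for k using ht[of k] by (simp_all add: test_function_def)
  define D where "D = (\<lambda>k n q. ip q (lift (h k) q - lift (h n) q) (lift (h k) q - lift (h n) q))"
  have dF: "lift (h k) q - lift (h n) q \<in> F q" for k n q by (rule subspace_diff[OF fiber_subspace lift(1) lift(1)])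
  have D: "D k n = Gam (\<lambda>x. h k x - h n x) (\<lambda>x. h k x - h n x)" for k n
    by (rule ext) (simp only: D_def Gam_def lift_diff[OF hs(1) hs(1)])
  have Dnn: "0 \<le> D k n q" for k n q unfolding D_def by (rule ip_nonneg[OF dF])
  have Di: "integrable \<omega> (D k n)" for k n
  proof -
    have 1: "D k n = (\<lambda>q. Gam (h k) (h k) q - 2 * Gam (h k) (h n) q + Gam (h n) (h n) q)"
      by (rule ext) (simp only: D Gam_add(2)[OF hs(1) hs(1)])
    have i: "integrable \<omega> (Gam (h k) (h k))" "integrable \<omega> (Gam (h k) (h n))" "integrable \<omega> (Gam (h n) (h n))"
      by (intro Gam_integrable hs)+
    show ?thesis unfolding 1
      by (intro Bochner_Integration.integrable_add Bochner_Integration.integrable_diff integrable_mult_right i)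
  qed
  have Dint: "(\<integral>q. D k n q \<partial>\<omega>) \<le> (1/8) ^ n" if "n \<le> k" for k n
    using hC[OF that] by (simp only: D total_energy_def)
  note [measurable] = borel_measurable_integrable[OF Di]
  define S where "S = (\<lambda>q. \<Sum>k. ennreal (4 ^ k * D (Suc k) k q))"
  have [measurable]: "S \<in> borel_measurable \<omega>" unfolding S_def by measurable
  have "(\<integral>\<^sup>+q. S q \<partial>\<omega>) = (\<Sum>k. \<integral>\<^sup>+q. ennreal (4 ^ k * D (Suc k) k q) \<partial>\<omega>)"
    unfolding S_def by (rule nn_integral_suminf) measurable
  also have "\<dots> \<le> (\<Sum>k. ennreal ((1/2) ^ k))"
  proof (rule suminf_le[OF _ summableI summableI])
    fix k
    have "(\<integral>\<^sup>+q. ennreal (4 ^ k * D (Suc k) k q) \<partial>\<omega>) = ennreal (\<integral>q. 4 ^ k * D (Suc k) k q \<partial>\<omega>)"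
      by (rule nn_integral_eq_integral[OF integrable_mult_right[OF Di]]) (simp add: Dnn)
    also have "\<dots> \<le> ennreal ((1/2) ^ k)"
    proof (rule ennreal_leI)
      have "(\<integral>q. 4 ^ k * D (Suc k) k q \<partial>\<omega>) = 4 ^ k * (\<integral>q. D (Suc k) k q \<partial>\<omega>)"
        by (rule integral_mult_right_zero)
      also have "\<dots> \<le> 4 ^ k * (1/8) ^ k" by (rule mult_left_mono[OF Dint]) simp_all
      also have "\<dots> = (1/2) ^ k" by (simp add: power_mult_distrib[symmetric])
      finally show "(\<integral>q. 4 ^ k * D (Suc k) k q \<partial>\<omega>) \<le> (1/2) ^ k" .
    qed
    finally show "(\<integral>\<^sup>+q. ennreal (4 ^ k * D (Suc k) k q) \<partial>\<omega>) \<le> ennreal ((1/2) ^ k)" .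
  qed
  also have "\<dots> = ennreal (\<Sum>k. (1/2) ^ k)" by (rule suminf_ennreal2) (simp_all add: summable_geometric)
  finally have "(\<integral>\<^sup>+q. S q \<partial>\<omega>) < top" by (rule order_le_less_trans) simp
  then have ae: "AE q in \<omega>. S q \<noteq> \<infinity>" by (intro nn_integral_PInf_AE) auto
  define Gd where "Gd = {q \<in> space \<omega>. S q \<noteq> \<infinity>}"
  have Gdm[measurable]: "Gd \<in> sets \<omega>" unfolding Gd_def by measurable
  have aeG: "AE q in \<omega>. q \<in> Gd" using ae AE_space by eventually_elim (simp add: Gd_def)
  define R where "R = (\<lambda>q l. minimal q l \<and> (q \<notin> Gd \<longrightarrow> l = 0) \<and> (q \<in> Gd \<longrightarrow>
    (\<forall>w\<in>F q. (\<lambda>k. ip q (lift (h k) q) w) \<longlonglongrightarrow> ip q l w) \<and>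
    (\<lambda>k. ip q (lift (h k) q) (lift (h k) q)) \<longlonglongrightarrow> ip q l l \<and>
    (\<forall>n. (\<lambda>k. D k n q) \<longlonglongrightarrow> ip q (l - lift (h n) q) (l - lift (h n) q))))"
  have "\<exists>l. R q l" for q
  proof (cases "q \<in> Gd")
    case True
    then have "(\<Sum>k. ennreal (4 ^ k * D (Suc k) k q)) \<noteq> top" by (simp add: Gd_def S_def)
    then have "summable (\<lambda>k. 4 ^ k * D (Suc k) k q)" by (rule summable_suminf_not_top[rotated]) (simp add: Dnn)
    then have "summable (\<lambda>k. 4 ^ k * ip q (lift (h (Suc k)) q - lift (h k) q) (lift (h (Suc k)) q - lift (h k) q))"
      by (simp only: D_def)
    from minimal_limit[OF lift_minimal this] show ?thesis using True unfolding R_def D_def by blast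
  next
    case False
    then show ?thesis unfolding R_def using minimal_0 by blast
  qed
  then obtain l where "\<forall>q. R q (l q)" using choice[of R] by blast
  note l = this[unfolded R_def]
  have lm: "minimal q (l q)" and lF: "l q \<in> F q" for q using l minimal_in_fiber by blast+
  have l0: "l q = 0" if "q \<notin> Gd" for q using l that by blast
  have lw: "(\<lambda>k. ip q (lift (h k) q) w) \<longlonglongrightarrow> ip q (l q) w" if "q \<in> Gd" "w \<in> F q" for q w using l that by blast
  have ll: "(\<lambda>k. Gam (h k) (h k) q) \<longlonglongrightarrow> ip q (l q) (l q)" if "q \<in> Gd" for q using l that unfolding Gam_def by blast
  have lD: "(\<lambda>k. D k n q) \<longlonglongrightarrow> ip q (l q - lift (h n) q) (l q - lift (h n) q)" if "q \<in> Gd" for q n using l that by blast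
  have ldF: "l q - lift (h n) q \<in> F q" for q n by (rule subspace_diff[OF fiber_subspace lF lift(1)])

  \<comment> \<open>pairings with smooth sections are measurable as limits\<close>
  have pair: "(\<lambda>q. ip q (l q) (t q)) \<in> borel_measurable \<omega>"
    if t: "\<And>q. t q \<in> F q" "\<And>k. (\<lambda>q. ip q (lift (h k) q) (t q)) \<in> borel_measurable \<omega>" for t
  proof (rule borel_measurable_LIMSEQ_real)
    show "(\<lambda>q. indicator Gd q * ip q (lift (h k) q) (t q)) \<in> borel_measurable \<omega>" for k
      by (intro borel_measurable_times borel_measurable_indicator Gdm t(2))
    show "(\<lambda>k. indicator Gd q * ip q (lift (h k) q) (t q)) \<longlonglongrightarrow> ip q (l q) (t q)" for q
      by (cases "q \<in> Gd") (simp_all add: lw t(1) l0 ip_0)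
  qed
  have lmeas: "(\<lambda>q. ip q (l q) (l q)) \<in> borel_measurable \<omega>"
  proof (rule borel_measurable_LIMSEQ_real)
    show "(\<lambda>q. indicator Gd q * Gam (h k) (h k) q) \<in> borel_measurable \<omega>" for k
      by (intro borel_measurable_times borel_measurable_indicator Gdm C_infinity_measurable Gam_C_infinity hs)
    show "(\<lambda>k. indicator Gd q * Gam (h k) (h k) q) \<longlonglongrightarrow> ip q (l q) (l q)" for q
      by (cases "q \<in> Gd") (simp_all add: ll l0 ip_0[OF subspace_0[OF fiber_subspace]])
  qed
  have dexp: "ip q (l q - lift (h n) q) (l q - lift (h n) q)
    = ip q (l q) (l q) - 2 * ip q (l q) (lift (h n) q) + Gam (h n) (h n) q" for n q
    unfolding Gam_def by (rule ip_square_diff[OF lF lift(1)])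
  have dmeas: "(\<lambda>q. ip q (l q - lift (h n) q) (l q - lift (h n) q)) \<in> borel_measurable \<omega>" for n
    unfolding dexp
  proof (intro borel_measurable_add borel_measurable_diff borel_measurable_times borel_measurable_const lmeas pair)
    show "(\<lambda>q. ip q (lift (h k) q) (lift (h n) q)) \<in> borel_measurable \<omega>" for k
      using C_infinity_measurable[OF Gam_C_infinity[OF hs(1) hs(1)]] by (simp only: Gam_def[abs_def])
    show "Gam (h n) (h n) \<in> borel_measurable \<omega>" by (intro C_infinity_measurable Gam_C_infinity hs)
  qed (rule lift(1))
  have li: "integrable \<omega> (\<lambda>q. ip q (l q) (l q))"
  proof (rule Fatou_bound(1))
    show "integrable \<omega> (Gam (h k) (h k))" for k by (intro Gam_integrable hs)
    show "0 \<le> Gam (h k) (h k) q" for k q by (rule Gam_nonneg)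
    show "(\<integral>q. Gam (h k) (h k) q \<partial>\<omega>) \<le> E" for k using hE by (simp only: total_energy_def)
    show "AE q in \<omega>. (\<lambda>k. Gam (h k) (h k) q) \<longlonglongrightarrow> ip q (l q) (l q)" using aeG by eventually_elim (rule ll)
  qed (rule lmeas, rule ip_nonneg[OF lF])
  have dist: "integrable \<omega> (\<lambda>q. ip q (l q - lift (h n) q) (l q - lift (h n) q)) \<and>
    (\<integral>q. ip q (l q - lift (h n) q) (l q - lift (h n) q) \<partial>\<omega>) \<le> (1/8) ^ n" for n
  proof -
    have 1: "integrable \<omega> (D (k + n) n)" "0 \<le> D (k + n) n q" "(\<integral>q. D (k + n) n q \<partial>\<omega>) \<le> (1/8) ^ n" for k q
      by (rule Di, rule Dnn, rule Dint) simp
    have 2: "AE q in \<omega>. (\<lambda>k. D (k + n) n q) \<longlonglongrightarrow> ip q (l q - lift (h n) q) (l q - lift (h n) q)"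
      using aeG by eventually_elim (rule LIMSEQ_ignore_initial_segment[OF lD])
    show ?thesis
      using Fatou_bound[where F="\<lambda>k. D (k + n) n", OF 1 dmeas ip_nonneg[OF ldF] 2] by (rule conjI)
  qed

  show thesis
  proof (rule that[OF lm])
    show "integrable \<omega> (\<lambda>q. ip q (l q) (l q))" by (rule li)
    show "(\<lambda>q. \<xi> q (l q) f) \<in> borel_measurable \<omega>" if f: "f \<in> C_infinity A" for f
    proof -
      have "(\<lambda>q. ip q (l q) (lift f q)) \<in> borel_measurable \<omega>"
      proof (rule pair[OF lift(1)])
        show "(\<lambda>q. ip q (lift (h k) q) (lift f q)) \<in> borel_measurable \<omega>" for k
          using C_infinity_measurable[OF Gam_C_infinity[OF hs(1) f]] by (simp only: Gam_def[abs_def])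
      qed
      moreover have "ip q (l q) (lift f q) = \<xi> q (l q) f" for q
        using ip(1)[OF lF lift(1)] lift(2)[OF lF] by simp
      ultimately show ?thesis by simp
    qed
    fix s assume s: "s \<in> bundle_sections M" and cK: "compact (closure {q. \<xi> q (s q) \<noteq> (\<lambda>f. 0)})"
    define W where "W = (\<lambda>q. \<xi> q (s q))"
    define K where "K = closure {q. W q \<noteq> (\<lambda>f. 0)}"
    have K: "compact K" using cK by (simp add: K_def W_def)
    have sF: "s q \<in> F q" for q by (rule section_in_fiber[OF s])
    have W: "smooth_field W" unfolding W_def by (rule section_anchor_smooth[OF s])
    have WK: "\<xi> q (s q) f = 0" if "q \<notin> K" for q f
      using field_closure[of q W f] that by (simp add: K_def W_def)
    obtain \<chi>' where c: "\<chi>' \<in> C_infinity A" "support_in \<chi>' UNIV" "\<forall>q\<in>K. \<chi>' q = 1" by (rule compact_cutoff[OF K])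
    define \<sigma> where "\<sigma> = (\<lambda>q. \<chi>' q * (\<chi>' q * ip q (s q) (s q)))"
    have \<sigma>i: "integrable \<omega> \<sigma>" unfolding \<sigma>_def
      by (intro C_infinity_c_integrable C_infinity_mult c section_ip_smooth[OF s] support_in_mult[OF c(2)])
    have \<sigma>nn: "0 \<le> \<sigma> q" for q
      unfolding \<sigma>_def mult.assoc[symmetric] by (rule mult_nonneg_nonneg[OF zero_le_square ip_nonneg[OF sF]])
    \<comment> \<open>a minimal vector does not see the kernel of the anchor, so its pairing with \<open>s\<close> lives on \<open>K\<close>\<close>
    have bound: "\<bar>ip q a (s q)\<bar> \<le> t * ip q a a + inverse t * \<sigma> q" if a: "minimal q a" and t: "t > 0" for q a t
    proof (cases "q \<in> K")
      case True
      then show ?thesis using ip_weighted_bound[OF minimal_in_fiber[OF a] sF t] c(3) by (simp add: \<sigma>_def)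
    next
      case False
      then have "ip q a (s q) = 0" using a sF WK by (simp add: minimal_def)
      then show ?thesis using t \<sigma>nn ip_nonneg[OF minimal_in_fiber[OF a]] by simp
    qed
    have hW: "ip q (lift (h k) q) (s q) = W q (h k)" for k q unfolding W_def by (rule lift(2)[OF sF])
    have hWi: "integrable \<omega> (\<lambda>q. W q (h k))" for k
      by (rule C_infinity_c_integrable[OF smooth_fieldD(2)[OF W hs(1)] field_support[OF smooth_fieldD(1)[OF W] hs]])
    have lsm: "(\<lambda>q. ip q (l q) (s q)) \<in> borel_measurable \<omega>"
      by (rule pair[OF sF]) (simp only: hW borel_measurable_integrable[OF hWi])
    have lsi: "integrable \<omega> (\<lambda>q. ip q (l q) (s q))"
    proof (rule Bochner_Integration.integrable_bound[OF _ lsm])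
      show "integrable \<omega> (\<lambda>q. 1 * ip q (l q) (l q) + inverse 1 * \<sigma> q)"
        by (intro Bochner_Integration.integrable_add integrable_mult_right li \<sigma>i)
      show "AE q in \<omega>. norm (ip q (l q) (s q)) \<le> norm (1 * ip q (l q) (l q) + inverse 1 * \<sigma> q)"
        using order_trans[OF bound[OF lm zero_less_one] abs_ge_self] by (intro AE_I2) simp
    qed
    define dv where "dv = divergence M \<omega> W"
    have dv: "dv \<in> C_infinity A" unfolding dv_def by (rule divergence_props(1)[OF W])
    have hdiv: "(\<integral>q. W q (h k) \<partial>\<omega>) = - (\<integral>q. h k q * dv q \<partial>\<omega>)" for k
      using divergence_props(2)[OF W, of "h k"] hs by (simp add: C_infinity_c_iff dv_def)
    have b: "\<bar>(\<integral>q. W q (h k) \<partial>\<omega>) - (\<integral>q. ip q (l q) (s q) \<partial>\<omega>)\<bar> \<le> (1/4) ^ k + (1/2) ^ k * (\<integral>q. \<sigma> q \<partial>\<omega>)" for k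
    proof -
      let ?d = "\<lambda>q. ip q (l q - lift (h k) q) (l q - lift (h k) q)"
      have "(\<integral>q. W q (h k) \<partial>\<omega>) - (\<integral>q. ip q (l q) (s q) \<partial>\<omega>) = (\<integral>q. W q (h k) - ip q (l q) (s q) \<partial>\<omega>)"
        by (rule Bochner_Integration.integral_diff[OF hWi lsi, symmetric])
      then have "\<bar>(\<integral>q. W q (h k) \<partial>\<omega>) - (\<integral>q. ip q (l q) (s q) \<partial>\<omega>)\<bar> \<le> (\<integral>q. \<bar>W q (h k) - ip q (l q) (s q)\<bar> \<partial>\<omega>)"
        using integral_abs_bound[of \<omega> "\<lambda>q. W q (h k) - ip q (l q) (s q)"] by simp
      also have "\<dots> \<le> (\<integral>q. 2 ^ k * ?d q + inverse (2 ^ k) * \<sigma> q \<partial>\<omega>)"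
      proof (rule integral_mono)
        show "integrable \<omega> (\<lambda>q. \<bar>W q (h k) - ip q (l q) (s q)\<bar>)"
          by (intro integrable_abs Bochner_Integration.integrable_diff hWi lsi)
        show "integrable \<omega> (\<lambda>q. 2 ^ k * ?d q + inverse (2 ^ k) * \<sigma> q)"
          using dist[of k] by (intro Bochner_Integration.integrable_add integrable_mult_right \<sigma>i) (rule conjunct1)
        fix q
        have "\<bar>W q (h k) - ip q (l q) (s q)\<bar> = \<bar>ip q (l q - lift (h k) q) (s q)\<bar>"
          unfolding ip_diff_left[OF lF lift(1) sF] hW by (rule abs_minus_commute)
        also have "\<dots> \<le> 2 ^ k * ?d q + inverse (2 ^ k) * \<sigma> q"
          by (rule bound[OF minimal_diff[OF lm lift_minimal]]) simp
        finally show "\<bar>W q (h k) - ip q (l q) (s q)\<bar> \<le> 2 ^ k * ?d q + inverse (2 ^ k) * \<sigma> q" .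
      qed
      also have "\<dots> = 2 ^ k * (\<integral>q. ?d q \<partial>\<omega>) + inverse (2 ^ k) * (\<integral>q. \<sigma> q \<partial>\<omega>)"
        using conjunct1[OF dist[of k]] \<sigma>i by (simp only: Bochner_Integration.integral_add integrable_mult_right integral_mult_right_zero)
      also have "\<dots> \<le> 2 ^ k * (1/8) ^ k + inverse (2 ^ k) * (\<integral>q. \<sigma> q \<partial>\<omega>)"
        by (intro add_right_mono mult_left_mono conjunct2[OF dist]) simp
      also have "\<dots> = (1/4) ^ k + (1/2) ^ k * (\<integral>q. \<sigma> q \<partial>\<omega>)"
      proof -
        have "(2::real) ^ k * (1/8) ^ k = (2 * (1/8)) ^ k" by (simp only: power_mult_distrib)
        then show ?thesis by (simp add: power_one_over inverse_eq_divide)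
      qed
      finally show ?thesis .
    qed
    have "(\<lambda>k. (1/4) ^ k + (1/2) ^ k * (\<integral>q. \<sigma> q \<partial>\<omega>)) \<longlonglongrightarrow> 0 + 0 * (\<integral>q. \<sigma> q \<partial>\<omega>)"
      by (intro tendsto_add tendsto_mult tendsto_const LIMSEQ_power_zero) simp_all
    then have lim0: "(\<lambda>k. (1/4) ^ k + (1/2) ^ k * (\<integral>q. \<sigma> q \<partial>\<omega>)) \<longlonglongrightarrow> 0" by simp
    have "(\<lambda>k. (\<integral>q. W q (h k) \<partial>\<omega>) - (\<integral>q. ip q (l q) (s q) \<partial>\<omega>)) \<longlonglongrightarrow> 0"
      by (rule Lim_null_comparison[OF always_eventually[OF allI] lim0]) (simp only: real_norm_def b)
    then have "(\<lambda>k. - (\<integral>q. h k q * dv q \<partial>\<omega>)) \<longlonglongrightarrow> (\<integral>q. ip q (l q) (s q) \<partial>\<omega>)"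
      unfolding hdiv by (rule LIM_zero_cancel)
    moreover have "(\<lambda>k. - (\<integral>q. h k q * dv q \<partial>\<omega>)) \<longlonglongrightarrow> - (\<integral>q. g q * dv q \<partial>\<omega>)"
      by (rule tendsto_minus[OF hlim[OF dv]])
    ultimately have "(\<integral>q. ip q (l q) (s q) \<partial>\<omega>) = - (\<integral>q. g q * dv q \<partial>\<omega>)" by (rule LIMSEQ_unique)
    then show "integrable \<omega> (\<lambda>q. ip q (l q) (s q)) \<and>
       (\<integral>q. ip q (l q) (s q) \<partial>\<omega>) = - (\<integral>q. g q * divergence M \<omega> (\<lambda>q. \<xi> q (s q)) q \<partial>\<omega>)"
      using lsi by (simp add: dv_def W_def)
  qed
qed

text \<open>On a relatively compact set the weak gradient of \<open>g\<close> serves for \<open>v\<close>: a test field supported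
  in the set has its divergence supported there, where \<open>g\<close> and \<open>v\<close> agree.\<close>

lemma weak_solution_gradient:
  assumes v: "v \<in> borel_measurable borel" "integrable \<omega> (\<lambda>q. (v q)\<^sup>2)"
    and w: "w \<in> borel_measurable borel" "integrable \<omega> (\<lambda>q. (w q)\<^sup>2)"
    and eq: "\<And>f. f \<in> C_infinity_c A \<Longrightarrow> (\<integral>q. Lap f q * v q \<partial>\<omega>) = (\<integral>q. f q * w q \<partial>\<omega>)"
    and \<Omega>: "open \<Omega>" "compact (closure \<Omega>)"
  obtains l :: "'a \<Rightarrow> 'u" where "\<And>q. minimal q (l q)"
    "\<And>f. f \<in> C_infinity A \<Longrightarrow> (\<lambda>q. \<xi> q (l q) f) \<in> borel_measurable (restrict_space \<omega> \<Omega>)"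
    "integrable (restrict_space \<omega> \<Omega>) (\<lambda>q. ip q (l q) (l q))"
    "\<And>s. s \<in> bundle_sections M \<Longrightarrow> compact (closure {q. \<xi> q (s q) \<noteq> (\<lambda>f. 0)}) \<Longrightarrow>
       closure {q. \<xi> q (s q) \<noteq> (\<lambda>f. 0)} \<subseteq> \<Omega> \<Longrightarrow>
       integrable (restrict_space \<omega> \<Omega>) (\<lambda>q. ip q (l q) (s q)) \<and>
       integrable (restrict_space \<omega> \<Omega>) (\<lambda>q. v q * divergence M \<omega> (\<lambda>q. \<xi> q (s q)) q) \<and>
       (\<integral>q. ip q (l q) (s q) \<partial>restrict_space \<omega> \<Omega>)
         = - (\<integral>q. v q * divergence M \<omega> (\<lambda>q. \<xi> q (s q)) q \<partial>restrict_space \<omega> \<Omega>)"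
proof -
  have m: "\<Omega> \<in> sets \<omega>" "\<Omega> \<inter> space \<omega> \<in> sets \<omega>" using \<Omega>(1) by (simp_all add: sets_\<omega>)
  have res: "integrable (restrict_space \<omega> \<Omega>) f" if "integrable \<omega> f" for f :: "'a \<Rightarrow> real"
    unfolding integrable_restrict_space[OF m(2)] by (rule integrable_mult_indicator[OF m(1) that])
  obtain g where g: "approximable g" "\<forall>q\<in>closure \<Omega>. g q = v q"
    by (rule weak_solution_approximable[OF v w eq \<Omega>(2)])
  show thesis
  proof (rule weak_gradient_exists[OF g(1)])
    fix l assume l: "\<And>q. minimal q (l q)" "\<And>f. f \<in> C_infinity A \<Longrightarrow> (\<lambda>q. \<xi> q (l q) f) \<in> borel_measurable \<omega>"
      "integrable \<omega> (\<lambda>q. ip q (l q) (l q))"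
      and ls: "\<And>s. s \<in> bundle_sections M \<Longrightarrow> compact (closure {q. \<xi> q (s q) \<noteq> (\<lambda>f. 0)}) \<Longrightarrow>
       integrable \<omega> (\<lambda>q. ip q (l q) (s q)) \<and>
       (\<integral>q. ip q (l q) (s q) \<partial>\<omega>) = - (\<integral>q. g q * divergence M \<omega> (\<lambda>q. \<xi> q (s q)) q \<partial>\<omega>)"
    show thesis
    proof (rule that[OF l(1)])
      show "(\<lambda>q. \<xi> q (l q) f) \<in> borel_measurable (restrict_space \<omega> \<Omega>)" if "f \<in> C_infinity A" for f
        by (rule measurable_restrict_space1[OF l(2)[OF that]])
      show "integrable (restrict_space \<omega> \<Omega>) (\<lambda>q. ip q (l q) (l q))" by (rule res[OF l(3)])
      fix s assume s: "s \<in> bundle_sections M" and K: "compact (closure {q. \<xi> q (s q) \<noteq> (\<lambda>f. 0)})"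
        and K\<Omega>: "closure {q. \<xi> q (s q) \<noteq> (\<lambda>f. 0)} \<subseteq> \<Omega>"
      let ?W = "\<lambda>q. \<xi> q (s q)" and ?K = "closure {q. \<xi> q (s q) \<noteq> (\<lambda>f. 0)}"
      define dv where "dv = divergence M \<omega> ?W"
      note W = section_anchor_smooth[OF s]
      have WK: "\<xi> q (s q) f = 0" if "q \<notin> ?K" for q f by (rule field_closure[OF that])
      have dvK: "dv q = 0" if "q \<notin> ?K" for q
        unfolding dv_def by (rule divergence_support[OF W closed_closure WK that])
      have dv: "dv \<in> C_infinity A" unfolding dv_def by (rule divergence_props(1)[OF W])
      have dvs: "support_in dv UNIV" unfolding support_in_def using K dvK by blast
      have lsK: "ip q (l q) (s q) = 0" if "q \<notin> ?K" for q
        using l(1)[of q] section_in_fiber[OF s] WK[OF that] by (simp add: minimal_def)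
      have gdv: "g q * dv q = indicator \<Omega> q *\<^sub>R (v q * dv q)" for q
        using g(2) closure_subset[of \<Omega>] dvK[of q] K\<Omega> by (cases "q \<in> \<Omega>") auto
      have lsO: "ip q (l q) (s q) = indicator \<Omega> q *\<^sub>R ip q (l q) (s q)" for q
        using lsK[of q] K\<Omega> by (cases "q \<in> \<Omega>") auto
      have "integrable \<omega> (\<lambda>q. v q * dv q)"
      proof (rule integrable_mult_L2)
        show "v \<in> borel_measurable \<omega>" using v(1) by (simp add: measurable_\<omega>)
        show "dv \<in> borel_measurable \<omega>" by (rule C_infinity_measurable[OF dv])
        show "integrable \<omega> (\<lambda>q. (dv q)\<^sup>2)"
          unfolding power2_eq_square by (intro C_infinity_c_integrable C_infinity_mult dv support_in_mult dvs)
      qed (rule v(2))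
      moreover have "(\<integral>q. ip q (l q) (s q) \<partial>restrict_space \<omega> \<Omega>) = - (\<integral>q. v q * dv q \<partial>restrict_space \<omega> \<Omega>)"
        using conjunct2[OF ls[OF s K]]
        unfolding integral_restrict_space[OF m(2)] lsO[symmetric] gdv[symmetric] by (simp only: dv_def)
      ultimately show "integrable (restrict_space \<omega> \<Omega>) (\<lambda>q. ip q (l q) (s q)) \<and>
       integrable (restrict_space \<omega> \<Omega>) (\<lambda>q. v q * divergence M \<omega> ?W q) \<and>
       (\<integral>q. ip q (l q) (s q) \<partial>restrict_space \<omega> \<Omega>)
         = - (\<integral>q. v q * divergence M \<omega> ?W q \<partial>restrict_space \<omega> \<Omega>)"
        using res conjunct1[OF ls[OF s K]] unfolding dv_def by blast
    qed
  qed
qed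

end

section \<open>The domain of the adjoint\<close>

context sub_riemannian_space
begin

lemma L2_Re_Im:
  assumes u: "u \<in> L2 \<mu>"
  shows "(\<lambda>q. Re (u q)) \<in> borel_measurable \<mu>" "(\<lambda>q. Im (u q)) \<in> borel_measurable \<mu>"
    "integrable \<mu> (\<lambda>q. (Re (u q))\<^sup>2)" "integrable \<mu> (\<lambda>q. (Im (u q))\<^sup>2)"
proof -
  have um: "u \<in> borel_measurable \<mu>" and ui: "integrable \<mu> (\<lambda>q. (cmod (u q))\<^sup>2)" using u by (simp_all add: L2_def)
  show m: "(\<lambda>q. Re (u q)) \<in> borel_measurable \<mu>" "(\<lambda>q. Im (u q)) \<in> borel_measurable \<mu>"
    using um borel_measurable_complex_iff[of u \<mu>] by simp_all
  show "integrable \<mu> (\<lambda>q. (Re (u q))\<^sup>2)"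
    by (rule Bochner_Integration.integrable_bound[OF ui borel_measurable_power[OF m(1)]]) (simp add: cmod_power2)
  show "integrable \<mu> (\<lambda>q. (Im (u q))\<^sup>2)"
    by (rule Bochner_Integration.integrable_bound[OF ui borel_measurable_power[OF m(2)]]) (simp add: cmod_power2)
qed

lemma sub_laplacian_real:
  fixes f :: "'a \<Rightarrow> real"
  assumes f: "f \<in> C_infinity A"
  shows "sub_laplacian M \<omega> (\<lambda>q. complex_of_real (f q)) q = complex_of_real (Lap f q)"
proof -
  have z: "(\<lambda>_. 0 :: real) \<in> C_infinity A" by (rule C_infinity_const)
  have "Lap (\<lambda>_. 0) q = 0" by (rule Lap_support[OF z compact_empty]) simp_all
  then show ?thesis
    unfolding sub_laplacian_def Re_complex_of_real Im_complex_of_real horizontal_gradient_eq[OF f] horizontal_gradient_eq[OF z]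
    by (simp add: complex_of_real_def)
qed

lemma complex_test_function:
  fixes f :: "'a \<Rightarrow> real"
  assumes "f \<in> C_infinity_c A" shows "(\<lambda>q. complex_of_real (f q)) \<in> C_infinity_c A"
  using assms smooth_fun_on_bounded_linear[OF open_UNIV bounded_linear_of_real, of f]
  by (simp add: C_infinity_c_def C_infinity_iff)

text \<open>The sub-Laplacian is a real operator, so real test functions separate real and imaginary
  part of the equation.\<close>

lemma adjoint_domain_real_equations:
  fixes f :: "'a \<Rightarrow> real"
  assumes v: "v \<in> L2 \<omega>" and w: "w \<in> L2 \<omega>"
    and eq: "\<forall>u\<in>C_infinity_c A. L2_inner \<omega> (\<lambda>q. - sub_laplacian M \<omega> u q) v = L2_inner \<omega> u w"
    and f: "f \<in> C_infinity_c A"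
  shows "(\<integral>q. Lap f q * Re (v q) \<partial>\<omega>) = (\<integral>q. f q * - Re (w q) \<partial>\<omega>)"
    "(\<integral>q. Lap f q * Im (v q) \<partial>\<omega>) = (\<integral>q. f q * - Im (w q) \<partial>\<omega>)"
proof -
  have fs: "f \<in> C_infinity A" "support_in f UNIV" using f by (simp_all add: C_infinity_c_iff)
  obtain K where K: "compact K" "\<forall>q. q \<notin> K \<longrightarrow> f q = 0" using fs(2) unfolding support_in_def by blast
  have "Lap f q = 0" if "q \<notin> K" for q by (rule Lap_support[OF fs(1) K(1) _ that]) (use K(2) in simp)
  then have Ls: "Lap f \<in> C_infinity A" "support_in (Lap f) UNIV"
    using K(1) divergence_props(1)[OF grad_field[OF fs(1)]] unfolding support_in_def by blast+
  have int: "integrable \<omega> (\<lambda>q. a q * b q)"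
    if a: "a \<in> C_infinity A" "support_in a UNIV" and b: "b \<in> borel_measurable \<omega>" "integrable \<omega> (\<lambda>q. (b q)\<^sup>2)"
    for a b :: "'a \<Rightarrow> real"
  proof (rule integrable_mult_L2[OF C_infinity_measurable[OF a(1)] _ b])
    show "integrable \<omega> (\<lambda>q. (a q)\<^sup>2)"
      unfolding power2_eq_square by (intro C_infinity_c_integrable C_infinity_mult a support_in_mult[OF a(2)])
  qed
  note vi = int[OF Ls L2_Re_Im(1,3)[OF v]] int[OF Ls L2_Re_Im(2,4)[OF v]]
  note wi = int[OF fs L2_Re_Im(1,3)[OF w]] int[OF fs L2_Re_Im(2,4)[OF w]]
  have e1: "- sub_laplacian M \<omega> (\<lambda>q. complex_of_real (f q)) q * cnj (v q)
    = Complex (- (Lap f q * Re (v q))) (Lap f q * Im (v q))" for q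
    unfolding sub_laplacian_real[OF fs(1)] by (rule complex_eqI) simp_all
  have e2: "complex_of_real (f q) * cnj (w q) = Complex (f q * Re (w q)) (- (f q * Im (w q)))" for q
    by (rule complex_eqI) simp_all
  have "(\<integral>q. - sub_laplacian M \<omega> (\<lambda>q. complex_of_real (f q)) q * cnj (v q) \<partial>\<omega>)
    = (\<integral>q. complex_of_real (f q) * cnj (w q) \<partial>\<omega>)"
    using bspec[OF eq complex_test_function[OF f]] by (simp only: L2_inner_def)
  then have "(\<integral>q. - (Lap f q * Re (v q)) \<partial>\<omega>) = (\<integral>q. f q * Re (w q) \<partial>\<omega>) \<and>
    (\<integral>q. Lap f q * Im (v q) \<partial>\<omega>) = (\<integral>q. - (f q * Im (w q)) \<partial>\<omega>)"
    unfolding e1 e2 complex_integral(2)[OF Bochner_Integration.integrable_minus[OF vi(1)] vi(2)]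
      complex_integral(2)[OF wi(1) Bochner_Integration.integrable_minus[OF wi(2)]] by simp
  then show "(\<integral>q. Lap f q * Re (v q) \<partial>\<omega>) = (\<integral>q. f q * - Re (w q) \<partial>\<omega>)"
    "(\<integral>q. Lap f q * Im (v q) \<partial>\<omega>) = (\<integral>q. f q * - Im (w q) \<partial>\<omega>)"
    by simp_all
qed

lemma adjoint_domain_W1:
  assumes v: "v \<in> adjoint_domain \<omega> (C_infinity_c A) (\<lambda>u q. - sub_laplacian M \<omega> u q)"
    and \<Omega>: "open \<Omega>" "compact (closure \<Omega>)"
  shows "v \<in> W1 M \<omega> \<Omega>"
proof -
  let ?\<mu> = "restrict_space \<omega> \<Omega>"
  obtain w where vw: "v \<in> L2 \<omega>" "w \<in> L2 \<omega>"
    and eq: "\<forall>u\<in>C_infinity_c A. L2_inner \<omega> (\<lambda>q. - sub_laplacian M \<omega> u q) v = L2_inner \<omega> u w"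
    using v unfolding adjoint_domain_def by blast
  have eqs: "\<forall>f\<in>C_infinity_c A. (\<integral>q. Lap f q * Re (v q) \<partial>\<omega>) = (\<integral>q. f q * - Re (w q) \<partial>\<omega>)"
    "\<forall>f\<in>C_infinity_c A. (\<integral>q. Lap f q * Im (v q) \<partial>\<omega>) = (\<integral>q. f q * - Im (w q) \<partial>\<omega>)"
    by (rule ballI, rule adjoint_domain_real_equations[OF vw eq], assumption)+
  note vm = L2_Re_Im(1,2)[OF vw(1), unfolded measurable_\<omega>]
  have wm: "(\<lambda>q. - Re (w q)) \<in> borel_measurable borel" "(\<lambda>q. - Im (w q)) \<in> borel_measurable borel"
    using L2_Re_Im(1,2)[OF vw(2), unfolded measurable_\<omega>] by simp_all
  have wi: "integrable \<omega> (\<lambda>q. (- Re (w q))\<^sup>2)" "integrable \<omega> (\<lambda>q. (- Im (w q))\<^sup>2)"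
    using L2_Re_Im(3,4)[OF vw(2)] by simp_all
  define weak where "weak = (\<lambda>(l :: 'a \<Rightarrow> 'u) x. (\<forall>q. minimal q (l q)) \<and>
    (\<forall>f. f \<in> C_infinity A \<longrightarrow> (\<lambda>q. \<xi> q (l q) f) \<in> borel_measurable ?\<mu>) \<and>
    integrable ?\<mu> (\<lambda>q. ip q (l q) (l q)) \<and>
    (\<forall>s. s \<in> bundle_sections M \<longrightarrow> compact (closure {q. \<xi> q (s q) \<noteq> (\<lambda>f. 0)}) \<longrightarrow>
       closure {q. \<xi> q (s q) \<noteq> (\<lambda>f. 0)} \<subseteq> \<Omega> \<longrightarrow>
       integrable ?\<mu> (\<lambda>q. ip q (l q) (s q)) \<and>
       integrable ?\<mu> (\<lambda>q. x q * divergence M \<omega> (\<lambda>q. \<xi> q (s q)) q) \<and>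
       (\<integral>q. ip q (l q) (s q) \<partial>?\<mu>) = - (\<integral>q. x q * divergence M \<omega> (\<lambda>q. \<xi> q (s q)) q \<partial>?\<mu>)))"
  have ex: "\<exists>l. weak l x"
    if x: "x \<in> borel_measurable borel" "integrable \<omega> (\<lambda>q. (x q)\<^sup>2)"
      and y: "y \<in> borel_measurable borel" "integrable \<omega> (\<lambda>q. (y q)\<^sup>2)"
      and xy: "\<forall>f\<in>C_infinity_c A. (\<integral>q. Lap f q * x q \<partial>\<omega>) = (\<integral>q. f q * y q \<partial>\<omega>)" for x y
  proof (rule weak_solution_gradient[OF x y bspec[OF xy] \<Omega>])
    fix l
    assume l: "\<And>q. minimal q (l q)"
      "\<And>f. f \<in> C_infinity A \<Longrightarrow> (\<lambda>q. \<xi> q (l q) f) \<in> borel_measurable ?\<mu>"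
      "integrable ?\<mu> (\<lambda>q. ip q (l q) (l q))"
      and ls: "\<And>s. s \<in> bundle_sections M \<Longrightarrow> compact (closure {q. \<xi> q (s q) \<noteq> (\<lambda>f. 0)}) \<Longrightarrow>
         closure {q. \<xi> q (s q) \<noteq> (\<lambda>f. 0)} \<subseteq> \<Omega> \<Longrightarrow>
         integrable ?\<mu> (\<lambda>q. ip q (l q) (s q)) \<and>
         integrable ?\<mu> (\<lambda>q. x q * divergence M \<omega> (\<lambda>q. \<xi> q (s q)) q) \<and>
         (\<integral>q. ip q (l q) (s q) \<partial>?\<mu>) = - (\<integral>q. x q * divergence M \<omega> (\<lambda>q. \<xi> q (s q)) q \<partial>?\<mu>)"
    have "weak l x"
      unfolding weak_def
    proof (rule conjI[OF allI[OF l(1)]], rule conjI[OF _ conjI[OF l(3)]])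
      show "\<forall>f. f \<in> C_infinity A \<longrightarrow> (\<lambda>q. \<xi> q (l q) f) \<in> borel_measurable ?\<mu>"
        by (rule allI, rule impI, rule l(2))
    qed (rule allI, rule impI, rule impI, rule impI, rule ls)
    then show ?thesis by (rule exI[of "\<lambda>l. weak l x" l])
  qed
  obtain lr where r: "weak lr (\<lambda>q. Re (v q))"
    using ex[OF vm(1) L2_Re_Im(3)[OF vw(1)] wm(1) wi(1) eqs(1)] by (elim exE)
  obtain li where i: "weak li (\<lambda>q. Im (v q))"
    using ex[OF vm(2) L2_Re_Im(4)[OF vw(1)] wm(2) wi(2) eqs(2)] by (elim exE)
  have wD: "minimal q (l q)" "f \<in> C_infinity A \<Longrightarrow> (\<lambda>q. \<xi> q (l q) f) \<in> borel_measurable ?\<mu>"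
    "integrable ?\<mu> (\<lambda>q. ip q (l q) (l q))" if w: "weak l x" for l x q f
    by (rule spec[OF conjunct1[OF w[unfolded weak_def]]],
        rule spec[OF conjunct1[OF conjunct2[OF w[unfolded weak_def]]], THEN mp], assumption,
        rule conjunct1[OF conjunct2[OF conjunct2[OF w[unfolded weak_def]]]])
  have min: "minimal q (lr q)" "minimal q (li q)" for q by (rule wD(1)[OF r], rule wD(1)[OF i])
  have F: "lr q \<in> F q" "li q \<in> F q" for q by (rule minimal_in_fiber[OF min(1)], rule minimal_in_fiber[OF min(2)])
  define Z where "Z = (\<lambda>q f. Complex (\<xi> q (lr q) f) (\<xi> q (li q) f))"
  have ZRe: "(\<lambda>f. Re (Z q f)) = \<xi> q (lr q)" and ZIm: "(\<lambda>f. Im (Z q f)) = \<xi> q (li q)" for q by (simp_all add: Z_def)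
  have "v \<in> L2 ?\<mu>"
  proof -
    have m: "\<Omega> \<in> sets \<omega>" "\<Omega> \<inter> space \<omega> \<in> sets \<omega>" using \<Omega>(1) by (simp_all add: sets_\<omega>)
    have "integrable \<omega> (\<lambda>q. (cmod (v q))\<^sup>2)" "v \<in> borel_measurable \<omega>" using vw(1) by (simp_all add: L2_def)
    then show ?thesis
      using integrable_mult_indicator[OF m(1), of "\<lambda>q. (cmod (v q))\<^sup>2"] measurable_restrict_space1[of v \<omega> borel \<Omega>]
      unfolding L2_def integrable_restrict_space[OF m(2)] by blast
  qed
  moreover have "Z \<in> L2_sections M \<omega> \<Omega>"
    unfolding L2_sections_def mem_Collect_eq
  proof (intro conjI ballI)
    show "Z q \<in> distribution_complex_at M q" for q
      unfolding distribution_complex_at_def distribution_at_def mem_Collect_eq ZRe ZIm using F by blast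
    show "(\<lambda>q. Z q f) \<in> borel_measurable ?\<mu>" if "f \<in> C_infinity A" for f
      unfolding borel_measurable_complex_iff Z_def complex.sel by (intro conjI wD(2)[OF r that] wD(2)[OF i that])
    have "sr_inner_complex M q (Z q) (Z q) = complex_of_real (ip q (lr q) (lr q) + ip q (li q) (li q))" for q
      unfolding sr_inner_complex_def ZRe ZIm
      by (simp only: sr_inner_minimal[OF min(1)] sr_inner_minimal[OF min(2)] F ip(1)[OF F(2) F(1)] complex_of_real_def diff_self)
    moreover have "integrable ?\<mu> (\<lambda>q. complex_of_real (ip q (lr q) (lr q) + ip q (li q) (li q)))"
      by (intro integrable_of_real Bochner_Integration.integrable_add wD(3)[OF r] wD(3)[OF i])
    ultimately show "integrable ?\<mu> (\<lambda>q. sr_inner_complex M q (Z q) (Z q))" by simp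
  qed
  moreover have "weak_horizontal_gradient M \<omega> \<Omega> v Z"
    unfolding weak_horizontal_gradient_def
  proof (intro ballI impI)
    fix W assume W: "W \<in> horizontal_fields M"
      and K: "compact (closure {q. W q \<noteq> (\<lambda>f. 0)}) \<and> closure {q. W q \<noteq> (\<lambda>f. 0)} \<subseteq> \<Omega>"
    obtain s where s: "s \<in> bundle_sections M" and Ws: "W = (\<lambda>q. \<xi> q (s q))" by (rule horizontal_fieldE[OF W])
    have sF: "s q \<in> F q" for q by (rule section_in_fiber[OF s])
    have P: "integrable ?\<mu> (\<lambda>q. ip q (l q) (s q)) \<and>
       integrable ?\<mu> (\<lambda>q. x q * divergence M \<omega> W q) \<and>
       (\<integral>q. ip q (l q) (s q) \<partial>?\<mu>) = - (\<integral>q. x q * divergence M \<omega> W q \<partial>?\<mu>)"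
      if "weak l x" for l x
      unfolding Ws
      by (rule conjunct2[OF conjunct2[OF conjunct2[OF that[unfolded weak_def]]], rule_format,
            OF s conjunct1[OF K[unfolded Ws]] conjunct2[OF K[unfolded Ws]]])
    have z: "(\<lambda>f. 0) = \<xi> q 0" for q by (rule ext) (simp add: anchor_0)
    have e1: "sr_inner_complex M q (Z q) (\<lambda>f. complex_of_real (W q f)) = Complex (ip q (lr q) (s q)) (ip q (li q) (s q))" for q
      unfolding sr_inner_complex_def ZRe ZIm Re_complex_of_real Im_complex_of_real z[of q] Ws
      by (simp only: sr_inner_minimal[OF min(1)] sr_inner_minimal[OF min(2)] sF subspace_0[OF fiber_subspace]
          ip_0(2)[OF F(1)] ip_0(2)[OF F(2)] add_0_right diff_0_right)
    have e2: "v q * complex_of_real (divergence M \<omega> W q)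
      = Complex (Re (v q) * divergence M \<omega> W q) (Im (v q) * divergence M \<omega> W q)" for q
      by (rule complex_eqI) simp_all
    show "(\<integral>q. sr_inner_complex M q (Z q) (\<lambda>f. complex_of_real (W q f)) \<partial>?\<mu>)
      = - (\<integral>q. v q * complex_of_real (divergence M \<omega> W q) \<partial>?\<mu>)"
    proof -
      note Pr = P[OF r] and Pi = P[OF i]
      have "(\<integral>q. sr_inner_complex M q (Z q) (\<lambda>f. complex_of_real (W q f)) \<partial>?\<mu>)
        = Complex (\<integral>q. ip q (lr q) (s q) \<partial>?\<mu>) (\<integral>q. ip q (li q) (s q) \<partial>?\<mu>)"
        unfolding e1 by (rule complex_integral(2)[OF conjunct1[OF Pr] conjunct1[OF Pi]])
      moreover have "(\<integral>q. v q * complex_of_real (divergence M \<omega> W q) \<partial>?\<mu>)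
        = Complex (\<integral>q. Re (v q) * divergence M \<omega> W q \<partial>?\<mu>) (\<integral>q. Im (v q) * divergence M \<omega> W q \<partial>?\<mu>)"
        unfolding e2
        by (rule complex_integral(2)[OF conjunct1[OF conjunct2[OF Pr]] conjunct1[OF conjunct2[OF Pi]]])
      ultimately show ?thesis
        unfolding conjunct2[OF conjunct2[OF Pr]] conjunct2[OF conjunct2[OF Pi]] by (simp add: complex_eq_iff)
    qed
  qed
  ultimately show ?thesis unfolding W1_def by blast
qed

end

theorem lemma4p2:
  fixes M :: "('a::{second_countable_topology, t2_space}, 'e::euclidean_space,
               'u::real_vector, 'r::euclidean_space) sub_riemannian"
    and \<omega> :: "'a measure"
  assumes "sub_riemannian_manifold M"
    and "smooth_measure M \<omega>"
  shows "adjoint_domain \<omega> (C_infinity_c (charts M)) (\<lambda>u q. - sub_laplacian M \<omega> u q) \<subseteq> W1_loc M \<omega>"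
proof -
  interpret sub_riemannian_space M \<omega> by unfold_locales (rule assms)+
  show ?thesis using adjoint_domain_W1 unfolding W1_loc_def by blast
qed

end
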